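(* Let $C\subset\mathbb{P}^3$ be the Cayley cubic surface \[X_2X_3X_4+X_1X_3X_4+X_1X_2X_4+X_1X_2X_3=0,\] and let $U$ be the complement in $C$ of the nine lines contained in $C$, namely the six lines $X_i=X_j=0$ ($1\le i<j\le 4$) and the three lines $X_i+X_j=X_k+X_l=0$ ($\{i,j,k,l\}=\{1,2,3,4\}$). For $B\ge 1$ let \[N(B)=\#\{\mathbf{x}=(x_1,x_2,x_3,x_4)\in\mathbb{Z}^4:\ \mathbf{x}\in U,\ \max_i|x_i|\le B,\ \gcd(x_1,x_2,x_3,x_4)=1\}.\] Then there are absolute constants $c_1,c_2>0$ such that for all sufficiently large $B$, \[c_1B(\log B)^6\le N(B)\le c_2B(\log B)^6.\]
   Context: A vector $\mathbf{x}\in\mathbb{Z}^4$ is said to lie in $U$ if it is nonzero, satisfies $x_2x_3x_4+x_1x_3x_4+x_1x_2x_4+x_1x_2x_3=0$, and the corresponding projective point does not lie on any of the nine lines listed. *)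

theory Defs
  imports "HOL-Analysis.Analysis"
begin

text \<open>
  A projective subvariety of $P^3$ is represented by the integer points of its affine cone
  (the zero vector is removed in \<open>in_U\<close>). Coordinates are indexed by the four-element
  type \<open>4\<close>, in which the numerals \<open>1\<close>, \<open>2\<close>, \<open>3\<close>, \<open>4\<close> are the four distinct elements
  (as \<open>4 = 0\<close> there, the order of the type is not the order of the labels).
\<close>

definition cayley_cubic :: "(int ^ 4) set" where
  "cayley_cubic =
     {x. x$2 * x$3 * x$4 + x$1 * x$3 * x$4 + x$1 * x$2 * x$4 + x$1 * x$2 * x$3 = 0}"

definition coord_line :: "4 \<Rightarrow> 4 \<Rightarrow> (int ^ 4) set" where
  "coord_line i j = {x. x$i = 0 \<and> x$j = 0}"

definition pair_line :: "4 \<Rightarrow> 4 \<Rightarrow> 4 \<Rightarrow> 4 \<Rightarrow> (int ^ 4) set" where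
  "pair_line i j k l = {x. x$i + x$j = 0 \<and> x$k + x$l = 0}"

definition cayley_lines :: "(int ^ 4) set set" where
  "cayley_lines =
     {coord_line 1 2, coord_line 1 3, coord_line 1 4,
      coord_line 2 3, coord_line 2 4, coord_line 3 4,
      pair_line 1 2 3 4, pair_line 1 3 2 4, pair_line 1 4 2 3}"

definition in_U :: "int ^ 4 \<Rightarrow> bool" where
  "in_U x \<longleftrightarrow> x \<noteq> 0 \<and> x \<in> cayley_cubic \<and> (\<forall>L\<in>cayley_lines. x \<notin> L)"

definition counted_points :: "real \<Rightarrow> (int ^ 4) set" where
  "counted_points B =
     {x. in_U x \<and> real_of_int (MAX i. \<bar>x$i\<bar>) \<le> B \<and> (GCD i. x$i) = 1}"

definition N :: "real \<Rightarrow> nat" where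
  "N B = card (counted_points B)"

lemma finite_counted_points: "finite (counted_points B)"
proof (rule finite_subset)
  show "counted_points B \<subseteq> {x. \<forall>i. x$i \<in> {-\<lfloor>B\<rfloor>..\<lfloor>B\<rfloor>}}"
  proof
    fix x assume "x \<in> counted_points B"
    then have B: "(MAX i. \<bar>x$i\<bar>) \<le> \<lfloor>B\<rfloor>"
      by (simp add: counted_points_def le_floor_iff)
    have "\<bar>x$i\<bar> \<le> \<lfloor>B\<rfloor>" for i
      using B by (meson Max_ge UNIV_I finite_code finite_imageI imageI order_trans)
    then show "x \<in> {x. \<forall>i. x$i \<in> {-\<lfloor>B\<rfloor>..\<lfloor>B\<rfloor>}}"
      by (simp add: abs_le_iff minus_le_iff)
  qed
  have "{x::int^4. \<forall>i. x$i \<in> {-\<lfloor>B\<rfloor>..\<lfloor>B\<rfloor>}} \<subseteq>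
        vec_lambda ` (UNIV \<rightarrow>\<^sub>E {-\<lfloor>B\<rfloor>..\<lfloor>B\<rfloor>})"
  proof
    fix x :: "int^4" assume "x \<in> {x. \<forall>i. x$i \<in> {-\<lfloor>B\<rfloor>..\<lfloor>B\<rfloor>}}"
    then have "x = vec_lambda (vec_nth x)" "vec_nth x \<in> UNIV \<rightarrow>\<^sub>E {-\<lfloor>B\<rfloor>..\<lfloor>B\<rfloor>}"
      by auto
    then show "x \<in> vec_lambda ` (UNIV \<rightarrow>\<^sub>E {-\<lfloor>B\<rfloor>..\<lfloor>B\<rfloor>})" by blast
  qed
  then show "finite {x::int^4. \<forall>i. x$i \<in> {-\<lfloor>B\<rfloor>..\<lfloor>B\<rfloor>}}"
    by (rule finite_subset) (intro finite_imageI finite_PiE, auto)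
qed

lemma cayley_lines_subset: "L \<in> cayley_lines \<Longrightarrow> L \<subseteq> cayley_cubic"
  by (auto simp: cayley_lines_def coord_line_def pair_line_def cayley_cubic_def
        add_eq_0_iff algebra_simps)

end

theory Submission
  imports Defs "HOL-Number_Theory.Number_Theory" "HOL-Computational_Algebra.Nth_Powers"
begin

text \<open>
  On \<open>U\<close> no coordinate vanishes, so the inverses of the coordinates sum to zero, and the points correspond to the primitive
  points \<open>w\<close> of the plane \<open>w\<^sub>1 + w\<^sub>2 + w\<^sub>3 + w\<^sub>4 = 0\<close> up to sign. As \<open>w\<close> is primitive, \<open>w\<^sub>i\<close> is the product of the gcds
  \<open>d\<^sub>i\<^sub>j = gcd (w\<^sub>i, w\<^sub>j)\<close> and a factor \<open>u\<^sub>i\<close>, and the coordinates of the point are monomials in these ten variables.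

  For the upper bound all variables are restricted to dyadic boxes. The key is that \<open>w\<^sub>i + w\<^sub>j\<close> is divisible by \<open>d\<^sub>i\<^sub>j * d\<^sub>k\<^sub>l\<close>; let
  \<open>z\<close> be the quotient. If one of the \<open>d\<^sub>i\<^sub>j\<close> is large compared with the others, the two expressions for \<open>z\<close> can be counted one after
  the other as lattice points in the plane. Otherwise one fixes the \<open>u\<^sub>i\<close>, the quotient \<open>z\<close> of \<open>w\<^sub>1 + w\<^sub>4\<close>, and a root \<open>r\<close> of
  \<open>r\<^sup>2 * u\<^sub>1 * u\<^sub>2 = u\<^sub>3 * u\<^sub>4\<close> modulo \<open>z\<close>, and the \<open>d\<^sub>i\<^sub>j\<close> lie on lattices of determinant \<open>z\<close>. On average over the
  \<open>u\<^sub>i\<close> and \<open>z\<close> the number of roots is bounded, up to two logarithms that are made up for by a saving in the size of the \<open>u\<^sub>i\<close>.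
  There are six free exponents, and each contributes a factor \<open>log B\<close>.

  For the lower bound the \<open>d\<^sub>i\<^sub>j\<close> run over the integers up to a small power of \<open>B\<close> that are \<open>1\<close> modulo a large factorial \<open>M\<close>. For
  fixed \<open>d\<^sub>i\<^sub>j\<close> the \<open>u\<^sub>i\<close> run over progressions of units modulo \<open>M\<close>, so that no small prime obstructs coprimality, and
  on average over the \<open>d\<^sub>i\<^sub>j\<close> a union bound over the large primes discards only a small proportion of the tuples.
\<close>

text \<open>Let W be the size of the two largest coordinates of w, V that of the third and Pd the
  product of the sizes of the d_ij. The bound wanted for a box is its volume W V^2 / Pd, and the
  obstacle is the additive constant in every lattice point count. For a single pair (i, j) it
  produces a term 1 / D^2, with D the size of d_ij, which is harmless only for large D. If D12, D34,
  D13 and D24 are all too small for this, then by geometric means the lattices containing (d12, d34)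
  and (d13, d24) have enough points to absorb the constant. Unequal coordinates cost powers of W /
  V, and these can be afforded: the height controls W^2 V / Pd, which exceeds the volume by W / V.
  With W = k^9 V every argument loses at most k^8, so one factor 1 / k remains and the sum over the
  ratio W / V is geometric. In the lower bound a union bound over all primes would discard
  everything. Over primes p > m a loss proportional to 1 / p^2 sums to at most a constant over m;
  this is why the primes up to m are removed by congruences modulo m!, and why each bad event has to
  require two divisibilities by p.\<close>

section \<open>Fibre counting and lattice points in plane boxes\<close>

lemma card_le_sum_fibres:
  fixes g :: "'b \<Rightarrow> real"
  assumes "finite S" "finite A" "f ` S \<subseteq> A"
    and "\<And>a. a \<in> A \<Longrightarrow> real (card {x\<in>S. f x = a}) \<le> g a"
  shows "real (card S) \<le> (\<Sum>a\<in>A. g a)"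
proof -
  have "S = (\<Union>a\<in>A. {x\<in>S. f x = a})" using assms(3) by auto
  then have "card S \<le> (\<Sum>a\<in>A. card {x\<in>S. f x = a})"
    using card_UN_le[OF assms(2), of "\<lambda>a. {x\<in>S. f x = a}"] by simp
  then have "real (card S) \<le> (\<Sum>a\<in>A. real (card {x\<in>S. f x = a}))"
    by (metis of_nat_le_iff of_nat_sum)
  also have "\<dots> \<le> (\<Sum>a\<in>A. g a)" by (rule sum_mono) (rule assms(4))
  finally show ?thesis .
qed

lemma card_le_mult_fibres:
  fixes k :: real
  assumes "finite S" "f ` S \<subseteq> A" "finite A" "real (card A) \<le> n" "0 \<le> k"
    and "\<And>a. a \<in> A \<Longrightarrow> real (card {x\<in>S. f x = a}) \<le> k"
  shows "real (card S) \<le> n * k"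
proof -
  have "real (card S) \<le> (\<Sum>a\<in>A. k)"
    using assms by (intro card_le_sum_fibres[where f = f]) auto
  also have "\<dots> = real (card A) * k" by simp
  also have "\<dots> \<le> n * k" using assms by (intro mult_right_mono) auto
  finally show ?thesis .
qed

lemma card_int_atLeastAtMost_le:
  fixes a b :: real
  assumes "a \<le> b"
  shows "real (card {\<lfloor>a\<rfloor>..\<lfloor>b\<rfloor>}) \<le> b - a + 2"
proof -
  have "\<lfloor>a\<rfloor> \<le> \<lfloor>b\<rfloor>" using assms by (rule floor_mono)
  then have "real (card {\<lfloor>a\<rfloor>..\<lfloor>b\<rfloor>}) = of_int (\<lfloor>b\<rfloor> - \<lfloor>a\<rfloor> + 1)" by simp
  also have "\<dots> \<le> b - a + 2" by simp linarith
  finally show ?thesis .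
qed

lemma card_nonzero_int_le:
  fixes Q :: real
  assumes "S \<subseteq> {n::int. n \<noteq> 0 \<and> \<bar>real_of_int n\<bar> \<le> Q}" "0 \<le> Q"
  shows "finite S" "real (card S) \<le> 2 * Q"
proof -
  have sub: "S \<subseteq> {1..\<lfloor>Q\<rfloor>} \<union> {-\<lfloor>Q\<rfloor>..-1}"
  proof
    fix n assume "n \<in> S"
    then have "n \<noteq> 0" "real_of_int \<bar>n\<bar> \<le> Q" using assms by auto
    then have "n \<noteq> 0" "\<bar>n\<bar> \<le> \<lfloor>Q\<rfloor>" by (auto simp: le_floor_iff)
    then show "n \<in> {1..\<lfloor>Q\<rfloor>} \<union> {-\<lfloor>Q\<rfloor>..-1}" by auto
  qed
  then show "finite S" by (rule finite_subset) auto
  have "card S \<le> card ({1..\<lfloor>Q\<rfloor>} \<union> {-\<lfloor>Q\<rfloor>..-1})" by (rule card_mono[OF _ sub]) auto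
  also have "\<dots> \<le> card {1..\<lfloor>Q\<rfloor>} + card {-\<lfloor>Q\<rfloor>..-1}" by (rule card_Un_le)
  also have "\<dots> = 2 * nat \<lfloor>Q\<rfloor>" by simp
  finally have "real (card S) \<le> 2 * real (nat \<lfloor>Q\<rfloor>)" by linarith
  also have "\<dots> \<le> 2 * Q" using assms(2) by simp
  finally show "real (card S) \<le> 2 * Q" .
qed

lemma card_residue_class_le:
  fixes S :: "int set" and z :: int and U :: real
  assumes "z > 0" "0 \<le> U" "\<And>u. u \<in> S \<Longrightarrow> \<bar>real_of_int u\<bar> \<le> U"
    and "\<And>u v. u \<in> S \<Longrightarrow> v \<in> S \<Longrightarrow> z dvd u - v"
  shows "finite S" "real (card S) \<le> 2 * U / z + 2"
proof -
  let ?f = "\<lambda>u::int. \<lfloor>real_of_int u / z\<rfloor>"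
  have inj: "inj_on ?f S"
  proof (rule inj_onI)
    fix u v assume uv: "u \<in> S" "v \<in> S" "?f u = ?f v"
    have "u div z = v div z" using uv(3) by (simp add: floor_divide_of_int_eq)
    moreover have "u mod z = v mod z" using assms(4)[OF uv(1,2)] by (simp add: mod_eq_dvd_iff)
    ultimately show "u = v" by (metis mult_div_mod_eq)
  qed
  have im: "?f ` S \<subseteq> {\<lfloor>-U/z\<rfloor>..\<lfloor>U/z\<rfloor>}"
  proof
    fix y assume "y \<in> ?f ` S"
    then obtain u where u: "u \<in> S" "y = ?f u" by auto
    have "-U \<le> u" "u \<le> U" using assms(3)[OF u(1)] by auto
    then have "-U/z \<le> u/z" "u/z \<le> U/z" using assms(1) by (auto intro!: divide_right_mono simp: minus_divide_left simp del: divide_minus_left)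
    then show "y \<in> {\<lfloor>-U/z\<rfloor>..\<lfloor>U/z\<rfloor>}" using u(2) floor_mono by auto
  qed
  show "finite S" using inj im by (meson finite_atLeastAtMost_int finite_imageD finite_subset)
  have "card S = card (?f ` S)" using inj by (simp add: card_image)
  also have "\<dots> \<le> card {\<lfloor>-U/z\<rfloor>..\<lfloor>U/z\<rfloor>}" by (rule card_mono[OF _ im]) auto
  finally have "real (card S) \<le> real (card {\<lfloor>-U/z\<rfloor>..\<lfloor>U/z\<rfloor>})" by simp
  also have "\<dots> \<le> U/z - (-U/z) + 2" by (rule card_int_atLeastAtMost_le) (use assms in \<open>simp add: field_simps\<close>)
  finally show "real (card S) \<le> 2 * U / z + 2" by simp
qed

text \<open>The slopes y / x and y' / x' differ by the cross product over x x', hence by at least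
  \<delta> = m / F^2 unless the points agree up to sign. All slopes lie in an interval of length 2 G
  / F, and pieces of length \<delta> separate them. The sign of x tells a point from its
  negative.\<close>

lemma card_slopes_half:
  fixes S :: "(int \<times> int) set" and F G m :: real
  assumes fin: "finite S" and pos: "F > 0" "G > 0" "m > 0"
    and box: "\<And>x y. (x, y) \<in> S \<Longrightarrow> \<bar>real_of_int x\<bar> \<le> F \<and> \<bar>real_of_int y\<bar> * F \<le> \<bar>real_of_int x\<bar> * G \<and> x \<noteq> 0"
    and cross: "\<And>x y x' y'. (x, y) \<in> S \<Longrightarrow> (x', y') \<in> S \<Longrightarrow>
        ((x', y') = (x, y) \<or> (x', y') = (-x, -y)) \<or> m \<le> \<bar>real_of_int (x * y' - y * x')\<bar>"
  shows "real (card S) \<le> 4 + 4 * F * G / m"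
proof -
  define \<delta> where "\<delta> = m / F\<^sup>2"
  have \<delta>: "\<delta> > 0" using pos by (simp add: \<delta>_def)
  define f :: "int \<times> int \<Rightarrow> bool \<times> int" where "f = (\<lambda>(x, y). (x > 0, \<lfloor>(real_of_int y / x) / \<delta>\<rfloor>))"
  have inj: "inj_on f S"
  proof (rule inj_onI)
    fix p q assume pq: "p \<in> S" "q \<in> S" "f p = f q"
    obtain x y where p: "p = (x, y)" by (cases p)
    obtain x' y' where q: "q = (x', y')" by (cases q)
    have b: "\<bar>real_of_int x\<bar> \<le> F" "x \<noteq> 0" "\<bar>real_of_int x'\<bar> \<le> F" "x' \<noteq> 0"
      using box pq p q by blast+
    have "\<bar>(real_of_int y / x) / \<delta> - (real_of_int y' / x') / \<delta>\<bar> < 1"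
      using pq(3) unfolding p q f_def by simp linarith
    then have "\<bar>(real_of_int y / x - real_of_int y' / x') / \<delta>\<bar> < 1"
      by (simp only: diff_divide_distrib)
    then have lt: "\<bar>real_of_int y / x - real_of_int y' / x'\<bar> < \<delta>"
      using \<delta> by (simp only: abs_divide abs_of_pos pos_divide_less_eq mult_1)
    have eq: "real_of_int y / x - real_of_int y' / x' = - (real_of_int (x * y' - y * x')) / (x * x')"
      using b by (simp add: field_simps)
    have "\<bar>real_of_int (x * y' - y * x')\<bar> = \<bar>real_of_int y / x - real_of_int y' / x'\<bar> * (\<bar>real_of_int x\<bar> * \<bar>real_of_int x'\<bar>)"
      unfolding eq using b by (simp add: abs_mult)
    also have "\<dots> < \<delta> * (\<bar>real_of_int x\<bar> * \<bar>real_of_int x'\<bar>)" using lt b by (intro mult_strict_right_mono) auto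
    also have "\<dots> \<le> \<delta> * (F * F)" using b \<delta> pos by (intro mult_left_mono mult_mono) auto
    also have "\<dots> = m" using pos by (simp add: \<delta>_def power2_eq_square)
    finally have "\<bar>real_of_int (x * y' - y * x')\<bar> < m" .
    then have "(x', y') = (x, y) \<or> (x', y') = (-x, -y)"
      using cross[of x y x' y'] pq p q by auto
    moreover have "x > 0 \<longleftrightarrow> x' > 0" using pq(3) unfolding p q f_def by simp
    ultimately show "p = q" using b p q by auto
  qed
  have im: "f ` S \<subseteq> UNIV \<times> {\<lfloor>-(G/F)/\<delta>\<rfloor>..\<lfloor>(G/F)/\<delta>\<rfloor>}"
  proof
    fix w assume "w \<in> f ` S"
    then obtain x y where xy: "(x, y) \<in> S" "w = f (x, y)" by auto
    have b: "\<bar>real_of_int x\<bar> \<le> F" "\<bar>real_of_int y\<bar> * F \<le> \<bar>real_of_int x\<bar> * G" "x \<noteq> 0"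
      using box[OF xy(1)] by auto
    have "\<bar>real_of_int y / x\<bar> \<le> G / F" using b pos by (simp add: abs_divide field_simps)
    then have "-(G/F) \<le> real_of_int y / x" "real_of_int y / x \<le> G / F" by linarith+
    then have "-(G/F)/\<delta> \<le> (real_of_int y / x)/\<delta>" "(real_of_int y / x)/\<delta> \<le> G / F/\<delta>"
      using \<delta> by (meson divide_right_mono less_imp_le)+
    then show "w \<in> UNIV \<times> {\<lfloor>-(G/F)/\<delta>\<rfloor>..\<lfloor>(G/F)/\<delta>\<rfloor>}"
      unfolding xy(2) f_def using floor_mono by auto
  qed
  have "card S = card (f ` S)" using inj by (simp add: card_image)
  also have "\<dots> \<le> card ((UNIV::bool set) \<times> {\<lfloor>-(G/F)/\<delta>\<rfloor>..\<lfloor>(G/F)/\<delta>\<rfloor>})"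
    by (rule card_mono[OF _ im]) auto
  also have "\<dots> = 2 * card {\<lfloor>-(G/F)/\<delta>\<rfloor>..\<lfloor>(G/F)/\<delta>\<rfloor>}" by (simp add: card_cartesian_product)
  finally have "real (card S) \<le> 2 * real (card {\<lfloor>-(G/F)/\<delta>\<rfloor>..\<lfloor>(G/F)/\<delta>\<rfloor>})" by linarith
  also have "\<dots> \<le> 2 * ((G/F)/\<delta> - (-(G/F)/\<delta>) + 2)"
    by (intro mult_left_mono card_int_atLeastAtMost_le) (use \<delta> pos in \<open>auto simp: field_simps\<close>)
  also have "\<dots> = 4 + 4 * F * G / m" using pos by (simp add: \<delta>_def field_simps power2_eq_square)
  finally show ?thesis .
qed

text \<open>Distinct directions in a box have slopes separated by the least nonzero cross product.\<close>

lemma card_slopes: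
  fixes S :: "(int \<times> int) set" and F G m :: real
  assumes fin: "finite S" and pos: "F > 0" "G > 0" "m > 0"
    and box: "\<And>x y. (x, y) \<in> S \<Longrightarrow> \<bar>real_of_int x\<bar> \<le> F \<and> \<bar>real_of_int y\<bar> \<le> G"
    and cross: "\<And>x y x' y'. (x, y) \<in> S \<Longrightarrow> (x', y') \<in> S \<Longrightarrow>
        ((x', y') = (x, y) \<or> (x', y') = (-x, -y)) \<or> m \<le> \<bar>real_of_int (x * y' - y * x')\<bar>"
  shows "real (card S) \<le> 9 + 8 * F * G / m"
proof -
  \<comment> \<open>A nonzero point goes to the coordinate that is larger relative to the box, so
    that the slope taken with respect to it is bounded. \<open>S2\<close> becomes an instance of the
    same lemma after swapping coordinates.\<close>
  define S1 where "S1 = {(x, y) \<in> S. \<bar>real_of_int y\<bar> * F \<le> \<bar>real_of_int x\<bar> * G \<and> x \<noteq> 0}"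
  define S2 where "S2 = {(x, y) \<in> S. \<bar>real_of_int x\<bar> * G \<le> \<bar>real_of_int y\<bar> * F \<and> y \<noteq> 0}"
  have sub: "S \<subseteq> S1 \<union> S2 \<union> {(0,0)}"
  proof
    fix p assume p: "p \<in> S"
    obtain x y where xy: "p = (x, y)" by (cases p)
    show "p \<in> S1 \<union> S2 \<union> {(0,0)}"
    proof (cases "\<bar>real_of_int y\<bar> * F \<le> \<bar>real_of_int x\<bar> * G")
      case True
      then have "x = 0 \<Longrightarrow> y = 0" using pos by (auto simp: mult_le_0_iff)
      then show ?thesis using True p xy S1_def by auto
    next
      case False
      then have "y \<noteq> 0" using pos by (auto simp: not_le mult_less_0_iff)
      then show ?thesis using False p xy S2_def by auto
    qed
  qed
  have fin12: "finite S1" "finite S2" using fin S1_def S2_def by (auto intro: finite_subset[OF _ fin])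
  have c1: "real (card S1) \<le> 4 + 4 * F * G / m"
    by (rule card_slopes_half[OF fin12(1) pos]) (use box cross S1_def in auto)
  have "real (card (prod.swap ` S2)) \<le> 4 + 4 * G * F / m"
  proof (rule card_slopes_half[OF _ pos(2,1,3)])
    show "finite (prod.swap ` S2)" using fin12 by simp
    fix x y assume xy: "(x, y) \<in> prod.swap ` S2"
    then have yx: "(y, x) \<in> S2" by auto
    then show "\<bar>real_of_int x\<bar> \<le> G \<and> \<bar>real_of_int y\<bar> * G \<le> \<bar>real_of_int x\<bar> * F \<and> x \<noteq> 0"
      using box S2_def by auto
    fix x' y' assume "(x', y') \<in> prod.swap ` S2"
    then have yx': "(y', x') \<in> S2" by auto
    have "\<bar>real_of_int (y * x' - x * y')\<bar> = \<bar>real_of_int (x * y' - y * x')\<bar>"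
      by (simp add: abs_minus_commute)
    then show "((x', y') = (x, y) \<or> (x', y') = (-x, -y)) \<or> m \<le> \<bar>real_of_int (x * y' - y * x')\<bar>"
      using cross[of y x y' x'] yx yx' S2_def by auto
  qed
  moreover have "card (prod.swap ` S2) = card S2" by (rule card_image) auto
  ultimately have c2: "real (card S2) \<le> 4 + 4 * G * F / m" by simp
  have "card S \<le> card (S1 \<union> S2 \<union> {(0,0)})" by (rule card_mono[OF _ sub]) (use fin12 in auto)
  also have "\<dots> \<le> card S1 + card S2 + 1"
    using card_Un_le[of "S1 \<union> S2" "{(0,0)}"] card_Un_le[of S1 S2] by simp
  finally have "real (card S) \<le> real (card S1) + real (card S2) + 1" by linarith
  then show ?thesis using c1 c2 by (simp add: mult.commute mult.left_commute)
qed

text \<open>A Bezout combination of v equal to 1, applied to w, gives the factor t with w = t v;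
  then t divides every coordinate of w and must be a unit.\<close>

lemma primitive_parallel_int3:
  fixes v1 v2 v3 w1 w2 w3 :: int
  assumes "gcd v1 (gcd v2 v3) = 1" "gcd w1 (gcd w2 w3) = 1"
    and "v1 * w2 = v2 * w1" "v1 * w3 = v3 * w1" "v2 * w3 = v3 * w2"
  shows "(w1, w2, w3) = (v1, v2, v3) \<or> (w1, w2, w3) = (-v1, -v2, -v3)"
proof -
  obtain b c where bc: "b * v2 + c * v3 = gcd v2 v3" using bezout_int by blast
  obtain a e where "a * v1 + e * gcd v2 v3 = 1" using bezout_int assms(1) by metis
  then have "a * v1 + e * (b * v2 + c * v3) = 1" unfolding bc .
  then have one: "a * v1 + e * b * v2 + e * c * v3 = 1" by (simp only: distrib_left mult.assoc add.assoc)
  define t where "t = a * w1 + e * b * w2 + e * c * w3"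
  have "w1 = (a * v1 + e * b * v2 + e * c * v3) * w1" using one by simp
  also have "\<dots> = a * v1 * w1 + e * b * (v2 * w1) + e * c * (v3 * w1)" by (simp add: algebra_simps)
  also have "\<dots> = v1 * t" unfolding assms(3)[symmetric] assms(4)[symmetric] t_def by (simp add: algebra_simps)
  finally have 1: "w1 = v1 * t" .
  have "w2 = (a * v1 + e * b * v2 + e * c * v3) * w2" using one by simp
  also have "\<dots> = a * (v1 * w2) + e * b * v2 * w2 + e * c * (v3 * w2)" by (simp add: algebra_simps)
  also have "\<dots> = v2 * t" unfolding assms(3) assms(5)[symmetric] t_def by (simp add: algebra_simps)
  finally have 2: "w2 = v2 * t" .
  have "w3 = (a * v1 + e * b * v2 + e * c * v3) * w3" using one by simp
  also have "\<dots> = a * (v1 * w3) + e * b * (v2 * w3) + e * c * v3 * w3" by (simp add: algebra_simps)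
  also have "\<dots> = v3 * t" unfolding assms(4) assms(5) t_def by (simp add: algebra_simps)
  finally have 3: "w3 = v3 * t" .
  have "t dvd gcd w1 (gcd w2 w3)" using 1 2 3 by simp
  then have "t = 1 \<or> t = -1" using assms(2) by (simp add: zdvd1_eq abs_eq_iff')
  then show ?thesis using 1 2 3 by auto
qed

text \<open>The cross product of two solutions is proportional to (c1, c2, c3). Its first coordinate
  D is therefore a multiple of c1 / gcd (c1, c2, c3), and D = 0 only for parallel, hence equal or
  opposite, primitive solutions. The slopes of the projections to (y, z) are thus well
  separated.\<close>

lemma card_primitive_plane_le:
  fixes S :: "(int \<times> int \<times> int) set" and F G :: real and c1 c2 c3 :: int
  assumes fin: "finite S" and pos: "F > 0" "G > 0" "c1 \<noteq> 0"
    and S: "\<And>x y z. (x, y, z) \<in> S \<Longrightarrow> c1 * x + c2 * y + c3 * z = 0 \<and> gcd x (gcd y z) = 1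
        \<and> \<bar>real_of_int y\<bar> \<le> F \<and> \<bar>real_of_int z\<bar> \<le> G"
  shows "real (card S) \<le> 9 + 8 * F * G * gcd c1 (gcd c2 c3) / \<bar>c1\<bar>"
proof -
  define g where "g = gcd c1 (gcd c2 c3)"
  have g: "g > 0" using pos(3) by (simp add: g_def)
  let ?pr = "snd :: int \<times> int \<times> int \<Rightarrow> int \<times> int"
  have inj: "inj_on ?pr S"
  proof (rule inj_onI)
    fix p q assume pq: "p \<in> S" "q \<in> S" "snd p = snd q"
    obtain x y z where p: "p = (x, y, z)" by (cases p) auto
    obtain x' where q: "q = (x', y, z)" using pq(3) p by (cases q) auto
    have "c1 * x + c2 * y + c3 * z = 0" "c1 * x' + c2 * y + c3 * z = 0" using S pq p q by blast+
    then have "c1 * x = c1 * x'" by linarith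
    then show "p = q" using pos(3) p q by simp
  qed
  have "real (card (?pr ` S)) \<le> 9 + 8 * F * G / (\<bar>real_of_int c1\<bar> / g)"
  proof (rule card_slopes)
    show "finite (?pr ` S)" using fin by simp
    show "0 < \<bar>real_of_int c1\<bar> / real_of_int g" using pos g by simp
    fix x y assume "(x, y) \<in> ?pr ` S"
    then obtain t where t: "(t, x, y) \<in> S" by (metis imageE prod.collapse)
    then show "\<bar>real_of_int x\<bar> \<le> F \<and> \<bar>real_of_int y\<bar> \<le> G" using S by blast
    fix x' y' assume "(x', y') \<in> ?pr ` S"
    then obtain t' where t': "(t', x', y') \<in> S" by (metis imageE prod.collapse)
    have e: "c1 * t + c2 * x + c3 * y = 0" "c1 * t' + c2 * x' + c3 * y' = 0"
      using S t t' by blast+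
    define D where "D = x * y' - y * x'"
    have e': "c1 * t = - (c2 * x + c3 * y)" "c1 * t' = - (c2 * x' + c3 * y')" using e by linarith+
    have "c1 * (y * t' - t * y') = y * (c1 * t') - y' * (c1 * t)" by (simp add: algebra_simps)
    also have "\<dots> = c2 * D" unfolding e' D_def by (simp add: algebra_simps)
    finally have d2: "c1 * (y * t' - t * y') = c2 * D" .
    have "c1 * (t * x' - x * t') = x' * (c1 * t) - x * (c1 * t')" by (simp add: algebra_simps)
    also have "\<dots> = c3 * D" unfolding e' D_def by (simp add: algebra_simps)
    finally have d3: "c1 * (t * x' - x * t') = c3 * D" .
    show "((x', y') = (x, y) \<or> (x', y') = (-x, -y)) \<or> \<bar>real_of_int c1\<bar> / g \<le> \<bar>real_of_int (x * y' - y * x')\<bar>"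
    proof (cases "D = 0")
      case True
      then have "y * t' = t * y'" "t * x' = x * t'" "x * y' = y * x'" using d2 d3 pos(3) D_def by auto
      then have "(t', x', y') = (t, x, y) \<or> (t', x', y') = (-t, -x, -y)"
        using S[OF t] S[OF t'] by (intro primitive_parallel_int3) (auto simp: mult.commute)
      then show ?thesis by auto
    next
      case False
      have "c1 dvd c1 * D" "c1 dvd c2 * D" "c1 dvd c3 * D" using d2 d3 by (metis dvd_triv_left)+
      obtain b e where be: "b * c2 + e * c3 = gcd c2 c3" using bezout_int by blast
      obtain a k where ak: "a * c1 + k * gcd c2 c3 = g" using bezout_int g_def by metis
      have "g * D = a * (c1 * D) + k * b * (c2 * D) + k * e * (c3 * D)"
        unfolding ak[symmetric] be[symmetric] by (simp add: algebra_simps)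
      then have "c1 dvd g * D" using \<open>c1 dvd c1 * D\<close> \<open>c1 dvd c2 * D\<close> \<open>c1 dvd c3 * D\<close> by simp
      then have "\<bar>c1\<bar> \<le> \<bar>g * D\<bar>" using False g by (intro dvd_imp_le_int) auto
      then have "\<bar>c1\<bar> \<le> g * \<bar>D\<bar>" using g by (simp add: abs_mult)
      then have "\<bar>real_of_int c1\<bar> \<le> g * \<bar>real_of_int D\<bar>" by (metis of_int_abs of_int_le_iff of_int_mult)
      then have "\<bar>real_of_int c1\<bar> / g \<le> \<bar>real_of_int D\<bar>" using g by (simp add: field_simps)
      then show ?thesis unfolding D_def by simp
    qed
  qed (use pos in auto)
  then show ?thesis using inj g pos by (simp add: card_image g_def)
qed

section \<open>The two equations attached to one pair of indices\<close>

definition nz_ints :: "real \<Rightarrow> int set" where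
  "nz_ints Q = {n. n \<noteq> 0 \<and> \<bar>real_of_int n\<bar> \<le> Q}"

lemma finite_nz_ints [simp]: "finite (nz_ints Q)"
proof (cases "0 \<le> Q")
  case True
  then show ?thesis using card_nonzero_int_le(1)[of "nz_ints Q" Q] by (simp add: nz_ints_def)
next
  case False
  then have "nz_ints Q = {}" by (auto simp: nz_ints_def)
  then show ?thesis by simp
qed

lemma card_nz_ints_le: "0 \<le> Q \<Longrightarrow> real (card (nz_ints Q)) \<le> 2 * Q"
  using card_nonzero_int_le(2)[of "nz_ints Q" Q] by (simp add: nz_ints_def)

lemma card_Times_le:
  fixes a b :: real
  assumes "real (card A) \<le> a" "real (card B) \<le> b"
  shows "real (card (A \<times> B)) \<le> a * b"
proof -
  have "0 \<le> a" using assms(1) of_nat_0_le_iff[of "card A"] by linarith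
  then show ?thesis unfolding card_cartesian_product of_nat_mult using assms by (intro mult_mono) auto
qed

text \<open>With q, x2, x3, y2, y3 fixed, the equation is a plane in (x1, p, y1) whose coefficients
  have gcd 1 by coprimality. The last hypothesis makes the main term 8 P Y1 / (X2 X3) dominate the
  constant 9 up to \<sigma>. The factor 139264 is 8192 * (9 + 8), where 8192 comes from the number
  of fixed tuples.\<close>

lemma card_edge_first:
  fixes A :: "(int \<times> int \<times> int \<times> int \<times> int \<times> int \<times> int \<times> int) set"
    and P Q X1 X2 X3 Y1 Y2 Y3 \<sigma> :: real
  assumes fin: "finite A" and pos: "P > 0" "Q > 0" "X1 > 0" "X2 > 0" "X3 > 0" "Y1 > 0" "Y2 > 0" "Y3 > 0" "\<sigma> \<ge> 1"
    and A: "\<And>p q x1 x2 x3 y1 y2 y3. (p, q, x1, x2, x3, y1, y2, y3) \<in> A \<Longrightarrow>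
        p * q = x1 * x2 * x3 + y1 * y2 * y3 \<and> coprime (x1 * x2 * x3) (y1 * y2 * y3) \<and>
        p \<in> nz_ints P \<and> q \<in> nz_ints Q \<and> x1 \<in> nz_ints (16 * X1) \<and> x2 \<in> nz_ints (16 * X2) \<and> x3 \<in> nz_ints (16 * X3) \<and>
        X2 \<le> \<bar>real_of_int x2\<bar> \<and> X3 \<le> \<bar>real_of_int x3\<bar> \<and>
        y1 \<in> nz_ints Y1 \<and> y2 \<in> nz_ints Y2 \<and> y3 \<in> nz_ints Y3"
    and le: "X2 * X3 \<le> \<sigma> * P * Y1"
  shows "real (card A) \<le> 139264 * \<sigma> * P * Q * (Y1 * Y2 * Y3)"
proof -
  let ?f = "\<lambda>(p::int, q::int, x1::int, x2::int, x3::int, y1::int, y2::int, y3::int). (q, x2, x3, y2, y3)"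
  let ?g = "\<lambda>(p::int, q::int, x1::int, x2::int, x3::int, y1::int, y2::int, y3::int). (x1, p, y1)"
  let ?T = "nz_ints Q \<times> nz_ints (16 * X2) \<times> nz_ints (16 * X3) \<times> nz_ints Y2 \<times> nz_ints Y3"
  have cT: "real (card ?T) \<le> (2 * Q) * ((2 * (16 * X2)) * ((2 * (16 * X3)) * ((2 * Y2) * (2 * Y3))))"
    by (intro card_Times_le card_nz_ints_le) (use pos in auto)
  have "real (card A) \<le> ((2 * Q) * ((2 * (16 * X2)) * ((2 * (16 * X3)) * ((2 * Y2) * (2 * Y3))))) * (9 + 8 * P * Y1 / (X2 * X3))"
  proof (rule card_le_mult_fibres[OF fin _ _ cT, where f = ?f])
    show "?f ` A \<subseteq> ?T" using A by auto
    show "finite ?T" by simp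
    show "0 \<le> 9 + 8 * P * Y1 / (X2 * X3)" using pos by simp
    fix a assume "a \<in> ?T"
    obtain q x2 x3 y2 y3 where a: "a = (q, x2, x3, y2, y3)" by (cases a) auto
    let ?B = "{w \<in> A. ?f w = a}"
    show "real (card ?B) \<le> 9 + 8 * P * Y1 / (X2 * X3)"
    proof (cases "?B = {}")
      case True
      show ?thesis unfolding True using pos by simp
    next
      case False
      then obtain p' x1' y1' where w: "(p', q, x1', x2, x3, y1', y2, y3) \<in> A" using a by auto
      have nz: "x2 * x3 \<noteq> 0" "X2 \<le> \<bar>real_of_int x2\<bar>" "X3 \<le> \<bar>real_of_int x3\<bar>"
        using A[OF w] by (auto simp: nz_ints_def)
      have "coprime (x1' * (x2 * x3)) (y1' * (y2 * y3))" using A[OF w] by (simp add: mult.assoc)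
      then have "coprime (x2 * x3) (y2 * y3)" by simp
      then have g1: "gcd (x2 * x3) (gcd (-q) (y2 * y3)) = 1"
        by (metis coprime_iff_gcd_eq_1 gcd.left_commute gcd_1_int)
      have inj: "inj_on ?g ?B" using a by (auto simp: inj_on_def)
      have "real (card (?g ` ?B)) \<le> 9 + 8 * P * Y1 * gcd (x2 * x3) (gcd (-q) (y2 * y3)) / \<bar>x2 * x3\<bar>"
      proof (rule card_primitive_plane_le)
        show "finite (?g ` ?B)" using fin by simp
        fix x y z assume "(x, y, z) \<in> ?g ` ?B"
        then have m: "(y, q, x, x2, x3, z, y2, y3) \<in> A" using a by auto
        have e: "y * q = x * x2 * x3 + z * y2 * y3" using A[OF m] by auto
        have "coprime (x * (x2 * x3)) (z * (y2 * y3))" using A[OF m] by (simp add: mult.assoc)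
        then have "coprime x z" by simp
        then have "gcd x (gcd y z) = 1" by (metis coprime_iff_gcd_eq_1 gcd.left_commute gcd_1_int)
        moreover have "x2 * x3 * x + - q * y + y2 * y3 * z = 0" using e by (simp add: algebra_simps)
        ultimately show "x2 * x3 * x + - q * y + y2 * y3 * z = 0 \<and> gcd x (gcd y z) = 1 \<and>
            \<bar>real_of_int y\<bar> \<le> P \<and> \<bar>real_of_int z\<bar> \<le> Y1" using A[OF m] by (auto simp: nz_ints_def)
      qed (use pos nz in auto)
      also have "\<dots> = 9 + 8 * P * Y1 / \<bar>real_of_int (x2 * x3)\<bar>" unfolding g1 by simp
      also have "\<dots> \<le> 9 + 8 * P * Y1 / (X2 * X3)"
      proof -
        have "X2 * X3 \<le> \<bar>real_of_int x2\<bar> * \<bar>real_of_int x3\<bar>" using nz pos by (intro mult_mono) auto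
        moreover have "\<bar>real_of_int (x2 * x3)\<bar> > 0" using nz by simp
        ultimately show ?thesis using pos by (intro add_left_mono divide_left_mono mult_pos_pos) (auto simp: abs_mult)
      qed
      finally show ?thesis using inj by (simp add: card_image)
    qed
  qed
  also have "\<dots> = 8192 * (9 * (X2 * X3) * (Q * Y2 * Y3) + 8 * (P * Q * (Y1 * Y2 * Y3)))"
    using pos by (simp add: field_simps)
  also have "\<dots> \<le> 8192 * (9 * (\<sigma> * P * Y1) * (Q * Y2 * Y3) + 8 * (\<sigma> * (P * Q * (Y1 * Y2 * Y3))))"
  proof (intro mult_left_mono add_mono mult_right_mono)
    have "0 \<le> P * Q * (Y1 * Y2 * Y3)" using pos by (intro mult_nonneg_nonneg) auto
    then show "P * Q * (Y1 * Y2 * Y3) \<le> \<sigma> * (P * Q * (Y1 * Y2 * Y3))"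
      using pos mult_right_mono[of 1 \<sigma> "P * Q * (Y1 * Y2 * Y3)"] by simp
  qed (use pos le in auto)
  also have "\<dots> = 139264 * \<sigma> * P * Q * (Y1 * Y2 * Y3)" by (simp add: algebra_simps)
  finally show ?thesis .
qed

text \<open>The inequality needed in \<open>card_edge_first\<close> may be tried for three choices
  of the solved variables. If all three failed, multiplying them would give (X1 X2 X3)^2 >
  \<sigma>^3 P^2 Q Y1 Y2 Y3, against the hypothesis and P \<ge> 1. The other two choices are
  permutations of the variables.\<close>

lemma card_edge_first':
  fixes A :: "(int \<times> int \<times> int \<times> int \<times> int \<times> int \<times> int \<times> int) set"
    and P Q X1 X2 X3 Y1 Y2 Y3 \<sigma> :: real
  assumes fin: "finite A" and pos: "P \<ge> 1" "Q > 0" "X1 > 0" "X2 > 0" "X3 > 0" "Y1 > 0" "Y2 > 0" "Y3 > 0" "\<sigma> \<ge> 1"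
    and A: "\<And>p q x1 x2 x3 y1 y2 y3. (p, q, x1, x2, x3, y1, y2, y3) \<in> A \<Longrightarrow>
        p * q = x1 * x2 * x3 + y1 * y2 * y3 \<and> coprime (x1 * x2 * x3) (y1 * y2 * y3) \<and>
        p \<in> nz_ints P \<and> q \<in> nz_ints Q \<and> x1 \<in> nz_ints (16 * X1) \<and> x2 \<in> nz_ints (16 * X2) \<and> x3 \<in> nz_ints (16 * X3) \<and>
        X1 \<le> \<bar>real_of_int x1\<bar> \<and> X2 \<le> \<bar>real_of_int x2\<bar> \<and> X3 \<le> \<bar>real_of_int x3\<bar> \<and>
        y1 \<in> nz_ints Y1 \<and> y2 \<in> nz_ints Y2 \<and> y3 \<in> nz_ints Y3"
    and le: "(X1 * X2 * X3)\<^sup>2 \<le> \<sigma> ^ 3 * P * Q * (Y1 * Y2 * Y3)"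
  shows "real (card A) \<le> 139264 * \<sigma> * P * Q * (Y1 * Y2 * Y3)"
proof -
  have "X2 * X3 \<le> \<sigma> * P * Y1 \<or> X1 * X3 \<le> \<sigma> * Q * Y2 \<or> X1 * X2 \<le> \<sigma> * P * Y3"
  proof (rule ccontr)
    assume "\<not> ?thesis"
    then have lt: "\<sigma> * P * Y1 < X2 * X3" "\<sigma> * Q * Y2 < X1 * X3" "\<sigma> * P * Y3 < X1 * X2" by auto
    have "(\<sigma> * P * Y1) * (\<sigma> * Q * Y2) * (\<sigma> * P * Y3) < (X2 * X3) * (X1 * X3) * (X1 * X2)"
      by (intro mult_strict_mono[OF mult_strict_mono[OF lt(1,2)] lt(3)]) (use pos in auto)
    also have "\<dots> = (X1 * X2 * X3)\<^sup>2" by (simp add: power2_eq_square)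
    also note le
    also have "\<sigma> ^ 3 * P * Q * (Y1 * Y2 * Y3) \<le> P * (\<sigma> ^ 3 * P * Q * (Y1 * Y2 * Y3))"
      using pos mult_right_mono[of 1 P "\<sigma> ^ 3 * P * Q * (Y1 * Y2 * Y3)"] by simp
    also have "\<dots> = (\<sigma> * P * Y1) * (\<sigma> * Q * Y2) * (\<sigma> * P * Y3)" by (simp add: power3_eq_cube)
    finally show False by simp
  qed
  then consider "X2 * X3 \<le> \<sigma> * P * Y1" | "X1 * X3 \<le> \<sigma> * Q * Y2" | "X1 * X2 \<le> \<sigma> * P * Y3" by blast
  then show ?thesis
  proof cases
    case 1
    show ?thesis by (rule card_edge_first[where ?X1.0 = X1, OF fin _ _ _ _ _ _ _ _ _ _ 1]) (use pos A in auto)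
  next
    case 2
    let ?h = "\<lambda>(p::int, q::int, x1::int, x2::int, x3::int, y1::int, y2::int, y3::int). (q, p, x2, x1, x3, y2, y1, y3)"
    have "real (card (?h ` A)) \<le> 139264 * \<sigma> * Q * P * (Y2 * Y1 * Y3)"
    proof (rule card_edge_first[where ?X1.0 = X2 and ?X2.0 = X1 and ?X3.0 = X3])
      fix p q x1 x2 x3 y1 y2 y3 assume "(p, q, x1, x2, x3, y1, y2, y3) \<in> ?h ` A"
      then have m: "(q, p, x2, x1, x3, y2, y1, y3) \<in> A" by auto
      show "p * q = x1 * x2 * x3 + y1 * y2 * y3 \<and> coprime (x1 * x2 * x3) (y1 * y2 * y3) \<and>
        p \<in> nz_ints Q \<and> q \<in> nz_ints P \<and> x1 \<in> nz_ints (16 * X2) \<and> x2 \<in> nz_ints (16 * X1) \<and> x3 \<in> nz_ints (16 * X3) \<and>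
        X1 \<le> \<bar>real_of_int x2\<bar> \<and> X3 \<le> \<bar>real_of_int x3\<bar> \<and>
        y1 \<in> nz_ints Y2 \<and> y2 \<in> nz_ints Y1 \<and> y3 \<in> nz_ints Y3" using A[OF m] by (simp add: mult.commute)
    qed (use pos fin 2 in auto)
    moreover have "inj_on ?h A" by (auto simp: inj_on_def)
    ultimately show ?thesis by (simp add: card_image mult_ac)
  next
    case 3
    let ?h = "\<lambda>(p::int, q::int, x1::int, x2::int, x3::int, y1::int, y2::int, y3::int). (p, q, x3, x1, x2, y3, y1, y2)"
    have "real (card (?h ` A)) \<le> 139264 * \<sigma> * P * Q * (Y3 * Y1 * Y2)"
    proof (rule card_edge_first[where ?X1.0 = X3 and ?X2.0 = X1 and ?X3.0 = X2])
      fix p q x1 x2 x3 y1 y2 y3 assume "(p, q, x1, x2, x3, y1, y2, y3) \<in> ?h ` A"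
      then have m: "(p, q, x2, x3, x1, y2, y3, y1) \<in> A" by auto
      show "p * q = x1 * x2 * x3 + y1 * y2 * y3 \<and> coprime (x1 * x2 * x3) (y1 * y2 * y3) \<and>
        p \<in> nz_ints P \<and> q \<in> nz_ints Q \<and> x1 \<in> nz_ints (16 * X3) \<and> x2 \<in> nz_ints (16 * X1) \<and> x3 \<in> nz_ints (16 * X2) \<and>
        X1 \<le> \<bar>real_of_int x2\<bar> \<and> X2 \<le> \<bar>real_of_int x3\<bar> \<and>
        y1 \<in> nz_ints Y3 \<and> y2 \<in> nz_ints Y1 \<and> y3 \<in> nz_ints Y2" using A[OF m] by (simp add: ac_simps)
    qed (use pos fin 3 in auto)
    moreover have "inj_on ?h A" by (auto simp: inj_on_def)
    ultimately show ?thesis by (simp add: card_image mult_ac)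
  qed
qed

text \<open>The two equations are the two expressions for \<open>w\<^sub>i + w\<^sub>j = - (w\<^sub>k + w\<^sub>l)\<close> after cancelling gcds; \<open>q\<close> is their
  common factor.\<close>

lemma card_edge:
  fixes S :: "(int \<times> int \<times> int \<times> int \<times> int \<times> int \<times> int \<times> int \<times> int \<times> int \<times> int) set"
    and P Q X1 X2 X3 Y1 Y2 Y3 F T m \<sigma> :: real
  assumes fin: "finite S" and pos: "P \<ge> 1" "Q > 0" "X1 > 0" "X2 > 0" "X3 > 0" "Y1 > 0" "Y2 > 0" "Y3 > 0" "\<sigma> \<ge> 1"
      "F > 0" "T > 0" "m > 0"
    and S: "\<And>p q x1 x2 x3 y1 y2 y3 f s t. (p, q, x1, x2, x3, y1, y2, y3, f, s, t) \<in> S \<Longrightarrow>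
        p * q = x1 * x2 * x3 + y1 * y2 * y3 \<and> coprime (x1 * x2 * x3) (y1 * y2 * y3) \<and>
        f * q + x1 * y1 * s + x2 * y2 * t = 0 \<and> coprime (x1 * y1) (x2 * y2) \<and> coprime s t \<and>
        p \<in> nz_ints P \<and> q \<in> nz_ints Q \<and> x1 \<in> nz_ints (16 * X1) \<and> x2 \<in> nz_ints (16 * X2) \<and> x3 \<in> nz_ints (16 * X3) \<and>
        X1 \<le> \<bar>real_of_int x1\<bar> \<and> X2 \<le> \<bar>real_of_int x2\<bar> \<and> X3 \<le> \<bar>real_of_int x3\<bar> \<and>
        y1 \<in> nz_ints Y1 \<and> y2 \<in> nz_ints Y2 \<and> y3 \<in> nz_ints Y3 \<and>
        \<bar>real_of_int f\<bar> \<le> F \<and> \<bar>real_of_int t\<bar> \<le> T \<and> m \<le> \<bar>real_of_int (x1 * y1)\<bar>"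
    and le: "(X1 * X2 * X3)\<^sup>2 \<le> \<sigma> ^ 3 * P * Q * (Y1 * Y2 * Y3)"
  shows "real (card S) \<le> 1253376 * \<sigma> * P * Q * (Y1 * Y2 * Y3) * (1 + F * T / m)"
proof -
  let ?f = "\<lambda>(p::int, q::int, x1::int, x2::int, x3::int, y1::int, y2::int, y3::int, f::int, s::int, t::int). (p, q, x1, x2, x3, y1, y2, y3)"
  let ?g = "\<lambda>(p::int, q::int, x1::int, x2::int, x3::int, y1::int, y2::int, y3::int, f::int, s::int, t::int). (s, f, t)"
  have cA: "real (card (?f ` S)) \<le> 139264 * \<sigma> * P * Q * (Y1 * Y2 * Y3)"
  proof (rule card_edge_first'[OF _ pos(1-9) _ le])
    show "finite (?f ` S)" using fin by simp
  qed (auto dest!: S)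
  \<comment> \<open>The image under \<open>?f\<close> is counted by the first equation alone. Over
    each of its points the second equation is a plane in (s, f, t) with coefficients x1 y1, q, x2 y2
    of gcd 1, so a second lattice count gives 9 + 8 F T / m.\<close>
  have "real (card S) \<le> (139264 * \<sigma> * P * Q * (Y1 * Y2 * Y3)) * (9 + 8 * F * T / m)"
  proof (rule card_le_mult_fibres[OF fin _ _ cA, where f = ?f])
    show "?f ` S \<subseteq> ?f ` S" "finite (?f ` S)" using fin by auto
    show "0 \<le> 9 + 8 * F * T / m" using pos by simp
    fix a assume "a \<in> ?f ` S"
    then obtain p q x1 x2 x3 y1 y2 y3 f0 s0 t0 where a: "a = (p, q, x1, x2, x3, y1, y2, y3)"
      and w: "(p, q, x1, x2, x3, y1, y2, y3, f0, s0, t0) \<in> S" by auto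
    let ?B = "{w \<in> S. ?f w = a}"
    have "coprime (x1 * y1) (x2 * y2)" using S[OF w] by simp
    then have g1: "gcd (x1 * y1) (gcd q (x2 * y2)) = 1"
      by (metis coprime_iff_gcd_eq_1 gcd.left_commute gcd_1_int)
    have inj: "inj_on ?g ?B" using a by (auto simp: inj_on_def)
    have "real (card (?g ` ?B)) \<le> 9 + 8 * F * T * gcd (x1 * y1) (gcd q (x2 * y2)) / \<bar>x1 * y1\<bar>"
    proof (rule card_primitive_plane_le)
      show "finite (?g ` ?B)" using fin by simp
      show "x1 * y1 \<noteq> 0" using S[OF w] by (auto simp: nz_ints_def)
      fix x y z assume "(x, y, z) \<in> ?g ` ?B"
      then have m: "(p, q, x1, x2, x3, y1, y2, y3, y, x, z) \<in> S" using a by auto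
      have "gcd x (gcd y z) = 1" using S[OF m] by (metis coprime_iff_gcd_eq_1 gcd.left_commute gcd_1_int)
      moreover have "x1 * y1 * x + q * y + x2 * y2 * z = 0" using S[OF m] by (simp add: algebra_simps)
      ultimately show "x1 * y1 * x + q * y + x2 * y2 * z = 0 \<and> gcd x (gcd y z) = 1 \<and>
            \<bar>real_of_int y\<bar> \<le> F \<and> \<bar>real_of_int z\<bar> \<le> T" using S[OF m] by auto
    qed (use pos in auto)
    also have "\<dots> = 9 + 8 * F * T / \<bar>real_of_int (x1 * y1)\<bar>" unfolding g1 by simp
    also have "\<dots> \<le> 9 + 8 * F * T / m"
    proof -
      have "m \<le> \<bar>real_of_int (x1 * y1)\<bar>" using S[OF w] by blast
      then show ?thesis using pos by (intro add_left_mono divide_left_mono mult_pos_pos) auto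
    qed
    finally show "real (card ?B) \<le> 9 + 8 * F * T / m" using inj by (simp add: card_image)
  qed
  also have "\<dots> \<le> (139264 * \<sigma> * P * Q * (Y1 * Y2 * Y3)) * (9 * (1 + F * T / m))"
    using pos by (intro mult_left_mono) (auto simp: field_simps)
  finally show ?thesis by (simp add: algebra_simps)
qed

section \<open>Weighted sums over integers and divisor functions\<close>

text \<open>With x = n / (n + 1) the induction step amounts to 2 x^(1 - \<theta>) \<le> 1 + x. For
  \<theta> \<le> 1/2 this follows from x^(1 - \<theta>) \<le> sqrt x and the inequality of
  arithmetic and geometric means.\<close>

lemma sum_powr_neg_le:
  fixes \<theta> :: real
  assumes "\<theta> \<le> 1/2"
  shows "(\<Sum>m=1..n. real m powr (-\<theta>)) \<le> 2 * real n powr (1 - \<theta>)"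
proof (induction n)
  case 0
  then show ?case by simp
next
  case (Suc n)
  define x where "x = real n / real (Suc n)"
  have x: "0 \<le> x" "x \<le> 1" by (auto simp: x_def)
  have "x powr (1 - \<theta>) \<le> x powr (1/2)"
  proof (cases "x = 0")
    case False
    then show ?thesis using x assms by (intro powr_mono') auto
  qed simp
  also have "\<dots> = sqrt (x * 1)" using x by (simp add: powr_half_sqrt)
  also have "\<dots> \<le> (x + 1) / 2" using x by (intro arith_geo_mean_sqrt) auto
  finally have 1: "x powr (1 - \<theta>) \<le> (x + 1) / 2" .
  define S where "S = real (Suc n) powr (1 - \<theta>)"
  have S: "S \<ge> 0" by (simp add: S_def)
  have "real n = x * real (Suc n)" by (simp add: x_def)
  then have "real n powr (1 - \<theta>) = x powr (1 - \<theta>) * S"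
    unfolding S_def by (metis powr_mult x(1) of_nat_0_le_iff)
  also have "\<dots> \<le> (x + 1) / 2 * S" using 1 S by (intro mult_right_mono) auto
  finally have 2: "2 * real n powr (1 - \<theta>) \<le> S * x + S" by (simp add: algebra_simps)
  have "real (Suc n) powr (-\<theta>) = S / real (Suc n)"
    using powr_add[of "real (Suc n)" 1 "-\<theta>"] by (simp add: S_def)
  also have "\<dots> = S - S * x" by (simp add: x_def field_simps)
  finally have 3: "real (Suc n) powr (-\<theta>) = S - S * x" .
  have "(\<Sum>m=1..Suc n. real m powr (-\<theta>)) = (\<Sum>m=1..n. real m powr (-\<theta>)) + real (Suc n) powr (-\<theta>)"
    by simp
  also have "\<dots> \<le> 2 * real n powr (1 - \<theta>) + real (Suc n) powr (-\<theta>)" using Suc by simp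
  also have "\<dots> \<le> 2 * S" using 2 3 by simp
  finally show ?case by (simp add: S_def)
qed

lemma nz_ints_eq: 
  assumes "0 \<le> X"
  shows "nz_ints X = int ` {1..nat \<lfloor>X\<rfloor>} \<union> (\<lambda>m. - int m) ` {1..nat \<lfloor>X\<rfloor>}"
proof -
  have a: "x \<in> int ` {1..nat \<lfloor>X\<rfloor>} \<union> (\<lambda>m. - int m) ` {1..nat \<lfloor>X\<rfloor>}" if "x \<noteq> 0" "\<bar>real_of_int x\<bar> \<le> X" for x
  proof -
    have "nat \<bar>x\<bar> \<in> {1..nat \<lfloor>X\<rfloor>}" using that by (simp add: le_floor_iff nat_mono)
    moreover have "x = int (nat \<bar>x\<bar>) \<or> x = - int (nat \<bar>x\<bar>)" by auto
    ultimately show ?thesis by blast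
  qed
  have b: "\<bar>real_of_int x\<bar> \<le> X \<and> x \<noteq> 0" if x: "x \<in> int ` {1..nat \<lfloor>X\<rfloor>} \<union> (\<lambda>m. - int m) ` {1..nat \<lfloor>X\<rfloor>}" for x
  proof -
    obtain m where "m \<in> {1..nat \<lfloor>X\<rfloor>}" "x = int m \<or> x = - int m" using x by blast
    then have m: "1 \<le> m" "m \<le> nat \<lfloor>X\<rfloor>" "x = int m \<or> x = - int m" by simp_all
    have "int m \<le> \<lfloor>X\<rfloor>" using m assms by (simp add: le_nat_iff)
    then have "real m \<le> X" by (simp add: le_floor_iff)
    then show ?thesis using m by auto
  qed
  show ?thesis
  proof (rule equalityI; rule subsetI)
    fix x assume "x \<in> nz_ints X"
    then show "x \<in> int ` {1..nat \<lfloor>X\<rfloor>} \<union> (\<lambda>m. - int m) ` {1..nat \<lfloor>X\<rfloor>}"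
      unfolding nz_ints_def mem_Collect_eq by (elim conjE) (rule a)
  next
    fix x assume "x \<in> int ` {1..nat \<lfloor>X\<rfloor>} \<union> (\<lambda>m. - int m) ` {1..nat \<lfloor>X\<rfloor>}"
    from b[OF this] show "x \<in> nz_ints X" by (simp add: nz_ints_def)
  qed
qed

lemma sum_nz_ints_powr_le:
  fixes \<theta> X :: real
  assumes "\<theta> \<le> 1/2" "0 \<le> X"
  shows "(\<Sum>n\<in>nz_ints X. \<bar>real_of_int n\<bar> powr (-\<theta>)) \<le> 4 * X powr (1 - \<theta>)"
proof -
  let ?M = "nat \<lfloor>X\<rfloor>"
  have "(\<Sum>n\<in>nz_ints X. \<bar>real_of_int n\<bar> powr (-\<theta>))
      \<le> (\<Sum>n\<in>int ` {1..?M}. \<bar>real_of_int n\<bar> powr (-\<theta>)) + (\<Sum>n\<in>(\<lambda>m. - int m) ` {1..?M}. \<bar>real_of_int n\<bar> powr (-\<theta>))"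
    unfolding nz_ints_eq[OF assms(2)] by (subst sum.union_inter[symmetric]) (auto intro!: sum_nonneg)
  also have "\<dots> = 2 * (\<Sum>m=1..?M. real m powr (-\<theta>))"
    by (simp add: sum.reindex inj_on_def)
  also have "\<dots> \<le> 2 * (2 * real ?M powr (1 - \<theta>))" by (intro mult_left_mono sum_powr_neg_le assms) auto
  also have "\<dots> \<le> 4 * X powr (1 - \<theta>)"
    using assms by (simp add: powr_mono2)
  finally show ?thesis .
qed

text \<open>Substituting n = d m saves exactly the factor d for every \<theta>: d^(-\<theta>) comes
  from the weight and d^(\<theta> - 1) from the shorter range.\<close>

lemma sum_nz_ints_dvd_powr_le:
  fixes \<theta> X :: real and d :: int
  assumes "\<theta> \<le> 1/2" "0 \<le> X" "d > 0"
  shows "(\<Sum>n\<in>{n\<in>nz_ints X. d dvd n}. \<bar>real_of_int n\<bar> powr (-\<theta>)) \<le> 4 * X powr (1 - \<theta>) / d"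
proof -
  have eq: "{n\<in>nz_ints X. d dvd n} = (\<lambda>m. d * m) ` nz_ints (X / d)"
  proof (intro equalityI subsetI)
    fix n assume "n \<in> {n\<in>nz_ints X. d dvd n}"
    then obtain m where m: "n = d * m" "n \<noteq> 0" "\<bar>real_of_int n\<bar> \<le> X" by (auto simp: nz_ints_def)
    then have "\<bar>real_of_int m\<bar> \<le> X / d" using assms(3) by (simp add: abs_mult field_simps)
    then show "n \<in> (\<lambda>m. d * m) ` nz_ints (X / d)" using m by (auto simp: nz_ints_def)
  next
    fix n assume "n \<in> (\<lambda>m. d * m) ` nz_ints (X / d)"
    then show "n \<in> {n\<in>nz_ints X. d dvd n}" using assms(3) by (auto simp: nz_ints_def abs_mult field_simps)
  qed
  have "(\<Sum>n\<in>{n\<in>nz_ints X. d dvd n}. \<bar>real_of_int n\<bar> powr (-\<theta>))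
      = (\<Sum>m\<in>nz_ints (X / d). \<bar>real_of_int (d * m)\<bar> powr (-\<theta>))"
    unfolding eq using assms(3) by (subst sum.reindex) (auto simp: inj_on_def)
  also have "\<dots> = (\<Sum>m\<in>nz_ints (X / d). real_of_int d powr (-\<theta>) * \<bar>real_of_int m\<bar> powr (-\<theta>))"
    using assms(3) by (intro sum.cong) (auto simp: abs_mult powr_mult)
  also have "\<dots> = real_of_int d powr (-\<theta>) * (\<Sum>m\<in>nz_ints (X / d). \<bar>real_of_int m\<bar> powr (-\<theta>))"
    by (simp add: sum_distrib_left)
  also have "\<dots> \<le> real_of_int d powr (-\<theta>) * (4 * (X / d) powr (1 - \<theta>))"
    using assms by (intro mult_left_mono sum_nz_ints_powr_le) auto
  also have "\<dots> = 4 * X powr (1 - \<theta>) * (real_of_int d powr (-\<theta>) / real_of_int d powr (1 - \<theta>))"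
    using assms by (simp add: powr_divide)
  also have "real_of_int d powr (-\<theta>) / real_of_int d powr (1 - \<theta>) = real_of_int d powr (-1)"
    by (simp add: powr_diff[symmetric])
  also have "\<dots> = 1 / d" using assms(3) by (simp add: powr_minus_divide)
  finally show ?thesis by simp
qed

lemma sum_powr_three_halves_le:
  "(\<Sum>e=1..n. real e powr (-(3/2))) \<le> 3"
proof -
  \<comment> \<open>The subtracted term 2 / sqrt (n + 1) makes the induction telescope, as in the
    comparison with an integral.\<close>
  have "(\<Sum>e=1..Suc n. real e powr (-(3/2))) \<le> 3 - 2 / sqrt (real (Suc n))" for n
  proof (induction n)
    case 0
    then show ?case by simp
  next
    case (Suc n)
    define s where "s = sqrt (real (Suc n))"
    define t where "t = sqrt (real (Suc (Suc n)))"
    have st: "0 < s" "s \<le> t" "t\<^sup>2 = s\<^sup>2 + 1" "0 < t" by (auto simp: s_def t_def)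
    have "real (Suc (Suc n)) powr (-(3/2)) = 1 / (t * t\<^sup>2)"
    proof -
      have "real (Suc (Suc n)) powr (3/2) = real (Suc (Suc n)) powr (1 + 1/2)" by simp
      also have "\<dots> = t\<^sup>2 * t" by (subst powr_add) (simp add: t_def powr_half_sqrt)
      finally show ?thesis by (simp add: powr_minus_divide mult.commute)
    qed
    also have "\<dots> \<le> 2 / s - 2 / t"
    proof -
      have "(t - s) * (t + s) = 1" using st by (simp add: power2_eq_square algebra_simps)
      moreover have "(t - s) * (t + s) \<le> (t - s) * (2 * t)" using st by (intro mult_left_mono) auto
      ultimately have "1 \<le> 2 * t * (t - s)" by (simp add: algebra_simps)
      then have "s * 1 \<le> t * (2 * t * (t - s))" using st by (intro mult_mono) auto
      then have "s / (s * t * t\<^sup>2) \<le> t * (2 * t * (t - s)) / (s * t * t\<^sup>2)" using st by (intro divide_right_mono) auto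
      also have "\<dots> = 2 / s - 2 / t" using st(1,4) by (simp add: divide_simps power2_eq_square)
      finally show ?thesis using st(1) by simp
    qed
    finally have "real (Suc (Suc n)) powr (-(3/2)) \<le> 2 / s - 2 / t" .
    then show ?case using Suc by (simp add: s_def t_def)
  qed
  note * = this
  show ?thesis
  proof (cases n)
    case (Suc k)
    have "0 \<le> 2 / sqrt (real (Suc k))" by simp
    then show ?thesis unfolding Suc using *[of k] by linarith
  qed simp
qed

text \<open>Divisors are taken as naturals so that associates count once. For n \<noteq> 0 the
  number 0 is not among them and \<open>card (dvs n)\<close> is the divisor function.\<close>

definition dvs :: "int \<Rightarrow> nat set" where
  "dvs n = {e. int e dvd n}"

lemma finite_dvs [simp]:
  assumes "n \<noteq> 0"
  shows "finite (dvs n)"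
proof (rule finite_subset)
  show "dvs n \<subseteq> {..nat \<bar>n\<bar>}"
  proof
    fix e assume "e \<in> dvs n"
    then have "int e dvd n" by (simp add: dvs_def)
    then have "\<bar>int e\<bar> \<le> \<bar>n\<bar>" by (rule dvd_imp_le_int[OF assms])
    then show "e \<in> {..nat \<bar>n\<bar>}" by simp
  qed
qed simp

lemma dvs_pos:
  assumes "n \<noteq> 0" "e \<in> dvs n"
  shows "e > 0"
proof (rule Nat.gr0I)
  assume "e = 0"
  then have "0 dvd n" using assms(2) by (simp add: dvs_def)
  then show False using assms(1) by simp
qed

lemma card_dvs_mono: "m dvd n \<Longrightarrow> n \<noteq> 0 \<Longrightarrow> card (dvs m) \<le> card (dvs n)"
proof (rule card_mono)
  assume "m dvd n" "n \<noteq> 0"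
  show "dvs m \<subseteq> dvs n"
  proof
    fix e assume "e \<in> dvs m"
    then have "int e dvd m" by (simp add: dvs_def)
    then have "int e dvd n" using \<open>m dvd n\<close> by (rule dvd_trans)
    then show "e \<in> dvs n" by (simp add: dvs_def)
  qed
qed simp

text \<open>A divisor of a product splits into a divisor of each factor, even without
  coprimality.\<close>

lemma card_dvs_mult_le:
  assumes "m \<noteq> 0" "n \<noteq> 0"
  shows "card (dvs (m * n)) \<le> card (dvs m) * card (dvs n)"
proof -
  have "dvs (m * n) \<subseteq> (\<lambda>(a, b). a * b) ` (dvs m \<times> dvs n)"
  proof
    fix e assume "e \<in> dvs (m * n)"
    then have "int e dvd m * n" by (simp add: dvs_def)
    then obtain a b where ab: "int e = a * b" "a dvd m" "b dvd n" using division_decomp by blast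
    have "e = nat \<bar>a\<bar> * nat \<bar>b\<bar>" using ab(1) by (metis abs_of_nat nat_abs_mult_distrib nat_int)
    moreover have "nat \<bar>a\<bar> \<in> dvs m" "nat \<bar>b\<bar> \<in> dvs n" using ab by (auto simp: dvs_def)
    ultimately show "e \<in> (\<lambda>(a, b). a * b) ` (dvs m \<times> dvs n)" by auto
  qed
  then have "card (dvs (m * n)) \<le> card ((\<lambda>(a, b). a * b) ` (dvs m \<times> dvs n))"
    using assms by (intro card_mono) auto
  also have "\<dots> \<le> card (dvs m \<times> dvs n)" using assms by (intro card_image_le) auto
  finally show ?thesis by (simp add: card_cartesian_product)
qed

text \<open>Of two complementary divisors one is at most sqrt n.\<close>

lemma card_dvs_le_sqrt:
  assumes "n > 0"
  shows "real (card (dvs n)) \<le> 2 * sqrt n"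
proof -
  let ?s = "nat \<lfloor>sqrt (real_of_int n)\<rfloor>"
  have sub: "dvs n \<subseteq> {1..?s} \<union> (\<lambda>e. nat n div e) ` {1..?s}"
  proof
    fix e assume e: "e \<in> dvs n"
    have e0: "e > 0" using dvs_pos[of n e] assms e by simp
    have "int e dvd int (nat n)" using e assms by (simp add: dvs_def)
    then have "e dvd nat n" by (simp only: of_nat_dvd_iff)
    then obtain f where f: "nat n = e * f" by blast
    have f0: "f > 0" using f assms by (intro Nat.gr0I) auto
    have nf: "real_of_int n = real e * real f" using f assms by (metis of_nat_mult of_nat_nat less_imp_le of_int_of_nat_eq)
    show "e \<in> {1..?s} \<union> (\<lambda>e. nat n div e) ` {1..?s}"
    proof (cases "real e \<le> sqrt (real_of_int n)")
      case True
      then have "e \<le> ?s" by (simp add: le_nat_floor)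
      then show ?thesis using e0 by auto
    next
      case False
      have "real f \<le> sqrt (real_of_int n)"
      proof (rule ccontr)
        assume "\<not> ?thesis"
        then have "sqrt n * sqrt n < real e * real f" using False assms e0 by (intro mult_strict_mono) auto
        then show False using nf assms by simp
      qed
      then have "f \<le> ?s" by (simp add: le_nat_floor)
      moreover have "e = nat n div f" using f f0 by simp
      ultimately show ?thesis using f0 by auto
    qed
  qed
  have "card (dvs n) \<le> card ({1..?s} \<union> (\<lambda>e. nat n div e) ` {1..?s})" by (rule card_mono[OF _ sub]) auto
  also have "\<dots> \<le> card {1..?s} + card ((\<lambda>e. nat n div e) ` {1..?s})" by (rule card_Un_le)
  also have "\<dots> \<le> ?s + ?s" using card_image_le[of "{1..?s}" "\<lambda>e. nat n div e"] by simp
  finally have "real (card (dvs n)) \<le> 2 * real ?s" by linarith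
  also have "\<dots> \<le> 2 * sqrt n" using assms by simp
  finally show ?thesis .
qed

text \<open>Take the least k > 0 with e dividing k^2. If e divides b^2, then e also divides gcd (b,
  k)^2, so by minimality gcd (b, k) = k.\<close>

lemma square_divisor_root:
  fixes e :: nat
  assumes "e > 0"
  shows "\<exists>k::int. k > 0 \<and> real e \<le> (real_of_int k)\<^sup>2 \<and> (\<forall>b. int e dvd b\<^sup>2 \<longrightarrow> k dvd b)"
proof -
  define k where "k = (LEAST k. k > 0 \<and> int e dvd (int k)\<^sup>2)"
  have k: "k > 0 \<and> int e dvd (int k)\<^sup>2" unfolding k_def by (rule LeastI[of _ e]) (use assms in auto)
  have "int k dvd b" if b: "int e dvd b\<^sup>2" for b
  proof -
    have "int e dvd gcd (b\<^sup>2) ((int k)\<^sup>2)" using b k by (intro gcd_greatest) auto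
    also have "\<dots> = (gcd b (int k))\<^sup>2" by simp
    finally have "int e dvd (int (nat (gcd b (int k))))\<^sup>2" by simp
    moreover have "nat (gcd b (int k)) > 0" using k by simp
    ultimately have "k \<le> nat (gcd b (int k))" unfolding k_def by (intro Least_le) auto
    moreover have "gcd b (int k) \<le> int k" using k by (intro zdvd_imp_le) auto
    ultimately have "gcd b (int k) = int k" by (simp add: le_nat_iff)
    then show ?thesis by (metis gcd_dvd1)
  qed
  moreover have "int e \<le> (int k)\<^sup>2" using k by (intro zdvd_imp_le) auto
  then have "real e \<le> (real_of_int (int k))\<^sup>2" by (metis of_int_le_iff of_int_of_nat_eq of_int_power)
  ultimately show ?thesis using k by (intro exI[of _ "int k"]) auto
qed

text \<open>Write the divisor function as a sum over common divisors e of u and b^2. The condition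
  on u saves a factor e. The condition on b^2 forces a divisor of b of size at least sqrt e and
  saves sqrt e. The sum of e^(-3/2) converges, so the divisor function is bounded on average; 48 = 4
  * 4 * 3.\<close>

lemma sum_dvs_gcd_square_le:
  fixes U B :: real
  assumes "0 \<le> U" "0 \<le> B"
  shows "(\<Sum>(u, b)\<in>nz_ints U \<times> nz_ints B. card (dvs (gcd u (b\<^sup>2))) * (\<bar>real_of_int u\<bar> powr (-(1/4)) * \<bar>real_of_int b\<bar> powr (-(1/2))))
     \<le> 48 * (U powr (3/4) * B powr (1/2))"
proof -
  let ?E = "{1..nat \<lfloor>U\<rfloor>}"
  let ?wu = "\<lambda>u. \<bar>real_of_int u\<bar> powr (-(1/4))"
  let ?wb = "\<lambda>b. \<bar>real_of_int b\<bar> powr (-(1/2))"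
  have 1: "real (card (dvs (gcd u (b\<^sup>2)))) = (\<Sum>e\<in>?E. (if int e dvd u then 1 else 0) * (if int e dvd b\<^sup>2 then 1 else 0))"
    if u: "u \<in> nz_ints U" for u b
  proof -
    have "dvs (gcd u (b\<^sup>2)) = {e\<in>?E. int e dvd u \<and> int e dvd b\<^sup>2}"
    proof (intro equalityI subsetI)
      fix e assume e: "e \<in> dvs (gcd u (b\<^sup>2))"
      then have eu: "int e dvd u" "int e dvd b\<^sup>2" by (auto simp: dvs_def)
      have "u \<noteq> 0" using u by (simp add: nz_ints_def)
      then have "\<bar>int e\<bar> \<le> \<bar>u\<bar>" using eu(1) by (intro dvd_imp_le_int)
      then have "int e \<le> \<bar>u\<bar>" by simp
      then have "real e \<le> \<bar>real_of_int u\<bar>" by linarith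
      then have "real e \<le> U" using u by (simp add: nz_ints_def)
      then have "e \<le> nat \<lfloor>U\<rfloor>" by (simp add: le_nat_floor)
      moreover have "e > 0" using eu(1) \<open>u \<noteq> 0\<close> by (intro Nat.gr0I) auto
      ultimately show "e \<in> {e\<in>?E. int e dvd u \<and> int e dvd b\<^sup>2}" using eu by auto
    qed (auto simp: dvs_def)
    then have "real (card (dvs (gcd u (b\<^sup>2)))) = (\<Sum>e\<in>?E. if int e dvd u \<and> int e dvd b\<^sup>2 then 1 else 0)"
      by (simp add: sum.inter_filter[symmetric])
    also have "\<dots> = (\<Sum>e\<in>?E. (if int e dvd u then 1 else 0) * (if int e dvd b\<^sup>2 then 1 else 0))"
      by (intro sum.cong) auto
    finally show ?thesis .
  qed
  have "(\<Sum>(u, b)\<in>nz_ints U \<times> nz_ints B. card (dvs (gcd u (b\<^sup>2))) * (?wu u * ?wb b))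
      = (\<Sum>u\<in>nz_ints U. \<Sum>b\<in>nz_ints B. \<Sum>e\<in>?E. ((if int e dvd u then ?wu u else 0) * (if int e dvd b\<^sup>2 then ?wb b else 0)))"
    unfolding sum.cartesian_product[symmetric]
  proof (intro sum.cong refl)
    fix u b assume "u \<in> nz_ints U"
    show "real (card (dvs (gcd u (b\<^sup>2)))) * (?wu u * ?wb b)
        = (\<Sum>e\<in>?E. ((if int e dvd u then ?wu u else 0) * (if int e dvd b\<^sup>2 then ?wb b else 0)))"
      unfolding 1[OF \<open>u \<in> nz_ints U\<close>] sum_distrib_right by (intro sum.cong refl) auto
  qed
  also have "\<dots> = (\<Sum>u\<in>nz_ints U. \<Sum>e\<in>?E. \<Sum>b\<in>nz_ints B. ((if int e dvd u then ?wu u else 0) * (if int e dvd b\<^sup>2 then ?wb b else 0)))"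
    by (intro sum.cong refl sum.swap)
  also have "\<dots> = (\<Sum>e\<in>?E. \<Sum>u\<in>nz_ints U. \<Sum>b\<in>nz_ints B. ((if int e dvd u then ?wu u else 0) * (if int e dvd b\<^sup>2 then ?wb b else 0)))"
    by (rule sum.swap)
  also have "\<dots> = (\<Sum>e\<in>?E. (\<Sum>u\<in>nz_ints U. if int e dvd u then ?wu u else 0) * (\<Sum>b\<in>nz_ints B. if int e dvd b\<^sup>2 then ?wb b else 0))"
    by (simp only: sum_product)
  also have "\<dots> \<le> (\<Sum>e\<in>?E. 16 * (U powr (3/4) * B powr (1/2)) * real e powr (-(3/2)))"
  proof (rule sum_mono)
    fix e assume "e \<in> ?E"
    then have e: "e > 0" by simp
    obtain k :: int where k: "k > 0" "real e \<le> (real_of_int k)\<^sup>2" "\<And>b. int e dvd b\<^sup>2 \<Longrightarrow> k dvd b"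
      using square_divisor_root[OF e] by auto
    have "(\<Sum>u\<in>nz_ints U. if int e dvd u then ?wu u else 0) = (\<Sum>u\<in>{n\<in>nz_ints U. int e dvd n}. ?wu u)"
      by (simp add: sum.inter_filter)
    also have "\<dots> \<le> 4 * U powr (1 - 1/4) / real_of_int (int e)"
      by (rule sum_nz_ints_dvd_powr_le) (use assms e in auto)
    finally have A: "(\<Sum>u\<in>nz_ints U. if int e dvd u then ?wu u else 0) \<le> 4 * U powr (3/4) / e" by simp
    have "(\<Sum>b\<in>nz_ints B. if int e dvd b\<^sup>2 then ?wb b else 0) \<le> (\<Sum>b\<in>nz_ints B. if k dvd b then ?wb b else 0)"
      by (rule sum_mono) (use k(3) in auto)
    also have "\<dots> = (\<Sum>b\<in>{n\<in>nz_ints B. k dvd n}. ?wb b)" by (simp add: sum.inter_filter)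
    also have "\<dots> \<le> 4 * B powr (1 - 1/2) / k"
      by (rule sum_nz_ints_dvd_powr_le) (use assms k in auto)
    also have "\<dots> \<le> 4 * B powr (1/2) / sqrt e"
    proof -
      have "sqrt e \<le> k" using k by (intro real_le_lsqrt) auto
      then show ?thesis using e by (simp add: frac_le)
    qed
    finally have C: "(\<Sum>b\<in>nz_ints B. if int e dvd b\<^sup>2 then ?wb b else 0) \<le> 4 * B powr (1/2) / sqrt e" .
    have "(\<Sum>u\<in>nz_ints U. if int e dvd u then ?wu u else 0) * (\<Sum>b\<in>nz_ints B. if int e dvd b\<^sup>2 then ?wb b else 0)
        \<le> (4 * U powr (3/4) / e) * (4 * B powr (1/2) / sqrt e)"
      by (intro mult_mono A C) (auto intro!: sum_nonneg)
    also have "\<dots> = 16 * (U powr (3/4) * B powr (1/2)) * (1 / (real e * sqrt e))" by simp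
    also have "1 / (real e * sqrt e) = real e powr (-(3/2))"
    proof -
      have "real e powr (3/2) = real e powr (1 + 1/2)" by simp
      also have "\<dots> = real e * sqrt e" by (subst powr_add) (simp add: powr_half_sqrt)
      finally show ?thesis by (simp add: powr_minus_divide)
    qed
    finally show "(\<Sum>u\<in>nz_ints U. if int e dvd u then ?wu u else 0) * (\<Sum>b\<in>nz_ints B. if int e dvd b\<^sup>2 then ?wb b else 0)
        \<le> 16 * (U powr (3/4) * B powr (1/2)) * real e powr (-(3/2))" .
  qed
  also have "\<dots> = 16 * (U powr (3/4) * B powr (1/2)) * (\<Sum>e\<in>?E. real e powr (-(3/2)))"
    by (simp add: sum_distrib_left)
  also have "\<dots> \<le> 16 * (U powr (3/4) * B powr (1/2)) * 3"
    by (intro mult_left_mono sum_powr_three_halves_le) auto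
  finally show ?thesis by simp
qed

text \<open>Bound gcd (n, y) by the sum of all e dividing both n and y. The weight e cancels the
  factor 1 / e saved by restricting y to multiples of e, so every divisor of n contributes
  equally.\<close>

lemma sum_gcd_powr_le:
  fixes n :: int and Y :: real
  assumes "n \<noteq> 0" "0 \<le> Y"
  shows "(\<Sum>y\<in>nz_ints Y. real_of_int (gcd n y) * \<bar>real_of_int y\<bar> powr (-(1/2))) \<le> 4 * Y powr (1/2) * card (dvs n)"
proof -
  let ?w = "\<lambda>b. \<bar>real_of_int b\<bar> powr (-(1/2))"
  have "(\<Sum>y\<in>nz_ints Y. real_of_int (gcd n y) * ?w y) \<le> (\<Sum>y\<in>nz_ints Y. \<Sum>e\<in>dvs n. if int e dvd y then real e * ?w y else 0)"
  proof (rule sum_mono)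
    fix y assume "y \<in> nz_ints Y"
    let ?g = "nat (gcd n y)"
    have g: "?g \<in> dvs n" "int ?g dvd y" by (auto simp: dvs_def)
    have "real_of_int (gcd n y) * ?w y = (if int ?g dvd y then real ?g * ?w y else 0)" by simp
    also have "\<dots> \<le> (\<Sum>e\<in>dvs n. if int e dvd y then real e * ?w y else 0)"
      by (rule member_le_sum[OF g(1)]) (use assms in auto)
    finally show "real_of_int (gcd n y) * ?w y \<le> (\<Sum>e\<in>dvs n. if int e dvd y then real e * ?w y else 0)" .
  qed
  also have "\<dots> = (\<Sum>e\<in>dvs n. real e * (\<Sum>y\<in>{y\<in>nz_ints Y. int e dvd y}. ?w y))"
  proof (subst sum.swap, intro sum.cong refl)
    fix e
    have "(\<Sum>y\<in>nz_ints Y. if int e dvd y then real e * ?w y else 0) = (\<Sum>y\<in>{y\<in>nz_ints Y. int e dvd y}. real e * ?w y)"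
      by (rule sum.inter_filter[symmetric]) simp
    then show "(\<Sum>y\<in>nz_ints Y. if int e dvd y then real e * ?w y else 0) = real e * (\<Sum>y\<in>{y\<in>nz_ints Y. int e dvd y}. ?w y)"
      by (simp only: sum_distrib_left)
  qed
  also have "\<dots> \<le> (\<Sum>e\<in>dvs n. 4 * Y powr (1/2))"
  proof (rule sum_mono)
    fix e assume "e \<in> dvs n"
    then have e: "e > 0" by (rule dvs_pos[OF assms(1)])
    have "(\<Sum>y\<in>{y\<in>nz_ints Y. int e dvd y}. ?w y) \<le> 4 * Y powr (1 - 1/2) / real_of_int (int e)"
      by (rule sum_nz_ints_dvd_powr_le) (use assms e in auto)
    then have "real e * (\<Sum>y\<in>{y\<in>nz_ints Y. int e dvd y}. ?w y) \<le> real e * (4 * Y powr (1 - 1/2) / e)"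
      by (intro mult_left_mono) auto
    then show "real e * (\<Sum>y\<in>{y\<in>nz_ints Y. int e dvd y}. ?w y) \<le> 4 * Y powr (1/2)" using e by simp
  qed
  finally show ?thesis by (simp add: mult.commute)
qed

section \<open>Integer points on u1 u2 a^2 - u3 u4 b^2 = z y\<close>

text \<open>Any of the three coefficients may serve as the divisor in
  \<open>card_primitive_plane_le\<close>. Mixing the three bounds with exponents 1/4, 1/4, 1/2
  leaves, for coefficients u2 a^2, u4 b^2 and y, negative powers of at most 1/2 in every variable,
  and these can be summed by \<open>sum_powr_neg_le\<close>.\<close>

lemma card_primitive_plane_geom:
  fixes S :: "(int \<times> int \<times> int) set" and E F G :: real and c1 c2 c3 :: int
  assumes fin: "finite S" and pos: "E > 0" "F > 0" "G > 0" and c: "c1 \<noteq> 0" "c2 \<noteq> 0" "c3 \<noteq> 0"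
    and S: "\<And>x y z. (x, y, z) \<in> S \<Longrightarrow> c1 * x + c2 * y + c3 * z = 0 \<and> gcd x (gcd y z) = 1
        \<and> \<bar>real_of_int x\<bar> \<le> E \<and> \<bar>real_of_int y\<bar> \<le> F \<and> \<bar>real_of_int z\<bar> \<le> G"
  shows "real (card S) \<le> 9 + 8 * real_of_int (gcd c1 (gcd c2 c3)) * (E * F * G) *
      ((\<bar>real_of_int c1\<bar> * E) powr (-(1/4)) * (\<bar>real_of_int c2\<bar> * F) powr (-(1/4)) * (\<bar>real_of_int c3\<bar> * G) powr (-(1/2)))"
proof -
  define g where "g = real_of_int (gcd c1 (gcd c2 c3))"
  have g: "g > 0" using c by (simp add: g_def)
  have 1: "real (card S) \<le> 9 + 8 * F * G * g / \<bar>c1\<bar>"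
    unfolding g_def by (rule card_primitive_plane_le[OF fin pos(2,3) c(1)]) (use S in blast)
  let ?p = "\<lambda>(x::int, y::int, z::int). (y, x, z)"
  let ?q = "\<lambda>(x::int, y::int, z::int). (z, x, y)"
  have "real (card (?p ` S)) \<le> 9 + 8 * E * G * gcd c2 (gcd c1 c3) / \<bar>c2\<bar>"
  proof (rule card_primitive_plane_le[OF _ pos(1,3) c(2)])
    fix x y z assume "(x, y, z) \<in> ?p ` S"
    then have m: "(y, x, z) \<in> S" by auto
    have "gcd x (gcd y z) = gcd y (gcd x z)" by (simp add: gcd.left_commute)
    then show "c2 * x + c1 * y + c3 * z = 0 \<and> gcd x (gcd y z) = 1 \<and> \<bar>real_of_int y\<bar> \<le> E \<and> \<bar>real_of_int z\<bar> \<le> G"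
      using S[OF m] by (simp add: add.commute add.left_commute)
  qed (use fin in auto)
  moreover have "card (?p ` S) = card S" by (rule card_image) (auto simp: inj_on_def)
  ultimately have 2: "real (card S) \<le> 9 + 8 * E * G * g / \<bar>c2\<bar>" by (simp add: g_def gcd.left_commute)
  have "real (card (?q ` S)) \<le> 9 + 8 * E * F * gcd c3 (gcd c1 c2) / \<bar>c3\<bar>"
  proof (rule card_primitive_plane_le[OF _ pos(1,2) c(3)])
    fix x y z assume "(x, y, z) \<in> ?q ` S"
    then have m: "(y, z, x) \<in> S" by auto
    have "gcd x (gcd y z) = gcd y (gcd z x)" by (simp add: ac_simps)
    then show "c3 * x + c1 * y + c2 * z = 0 \<and> gcd x (gcd y z) = 1 \<and> \<bar>real_of_int y\<bar> \<le> E \<and> \<bar>real_of_int z\<bar> \<le> F"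
      using S[OF m] by (simp add: add.commute add.left_commute)
  qed (use fin in auto)
  moreover have "card (?q ` S) = card S" by (rule card_image) (auto simp: inj_on_def)
  moreover have "gcd c3 (gcd c1 c2) = gcd c1 (gcd c2 c3)" by (simp add: ac_simps)
  ultimately have 3: "real (card S) \<le> 9 + 8 * E * F * g / \<bar>c3\<bar>" by (simp only: g_def)
  \<comment> \<open>Normalised so that the three bounds read t \<le> 1 / (|c_i| times the size of
    the i-th unknown); their weighted geometric mean is then immediate.\<close>
  define t where "t = (real (card S) - 9) / (8 * g * (E * F * G))"
  have D: "8 * g * (E * F * G) > 0" using g pos by simp
  then have D0: "8 * g * (E * F * G) \<noteq> 0" by linarith
  have t: "real (card S) = 9 + 8 * g * (E * F * G) * t"
    unfolding t_def by (simp only: times_divide_eq_right nonzero_mult_div_cancel_left[OF D0])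
  have "1 / (\<bar>real_of_int c1\<bar> * E) * (8 * g * (E * F * G)) = 8 * F * G * g / \<bar>c1\<bar>" using pos by simp
  then have t1: "t \<le> 1 / (\<bar>real_of_int c1\<bar> * E)" using 1 unfolding t_def pos_divide_le_eq[OF D] by linarith
  have "1 / (\<bar>real_of_int c2\<bar> * F) * (8 * g * (E * F * G)) = 8 * E * G * g / \<bar>c2\<bar>" using pos by simp
  then have t2: "t \<le> 1 / (\<bar>real_of_int c2\<bar> * F)" using 2 unfolding t_def pos_divide_le_eq[OF D] by linarith
  have "1 / (\<bar>real_of_int c3\<bar> * G) * (8 * g * (E * F * G)) = 8 * E * F * g / \<bar>c3\<bar>" using pos by simp
  then have t3: "t \<le> 1 / (\<bar>real_of_int c3\<bar> * G)" using 3 unfolding t_def pos_divide_le_eq[OF D] by linarith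
  have inv: "(1 / x) powr e = x powr (- e)" if "x > 0" for x e :: real
    using that by (simp add: powr_divide powr_minus_divide)
  have "t \<le> (\<bar>real_of_int c1\<bar> * E) powr (-(1/4)) * (\<bar>real_of_int c2\<bar> * F) powr (-(1/4)) * (\<bar>real_of_int c3\<bar> * G) powr (-(1/2))"
  proof (cases "t \<le> 0")
    case True
    then show ?thesis by (meson order_trans mult_nonneg_nonneg powr_ge_zero)
  next
    case False
    then have "t = t powr (1/4) * t powr (1/4) * t powr (1/2)" by (simp flip: powr_add)
    also have "\<dots> \<le> (1 / (\<bar>real_of_int c1\<bar> * E)) powr (1/4) * (1 / (\<bar>real_of_int c2\<bar> * F)) powr (1/4) * (1 / (\<bar>real_of_int c3\<bar> * G)) powr (1/2)"
      using False t1 t2 t3 by (intro mult_mono powr_mono2) auto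
    finally have *: "t \<le> (1 / (\<bar>real_of_int c1\<bar> * E)) powr (1/4) * (1 / (\<bar>real_of_int c2\<bar> * F)) powr (1/4) * (1 / (\<bar>real_of_int c3\<bar> * G)) powr (1/2)" .
    have p: "0 < \<bar>real_of_int c1\<bar> * E" "0 < \<bar>real_of_int c2\<bar> * F" "0 < \<bar>real_of_int c3\<bar> * G" using c pos by simp_all
    from * show ?thesis unfolding inv[OF p(1)] inv[OF p(2)] inv[OF p(3)] .
  qed
  then show ?thesis unfolding t g_def[symmetric] using D by (intro add_left_mono mult_left_mono) auto
qed

text \<open>Split the gcd as x y with x dividing u and y dividing a^2. Then x is prime to v and must
  divide b^2, while y is prime to b^2 and must divide v. The bound decouples (u, b) from (v, a), so
  that the later sum factors.\<close>

lemma card_dvs_conic_gcd_le: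
  fixes u v a b :: int
  assumes "coprime u v" "coprime a b" "u \<noteq> 0" "v \<noteq> 0" "a \<noteq> 0" "b \<noteq> 0"
  shows "card (dvs (gcd (u * a\<^sup>2) (v * b\<^sup>2))) \<le> card (dvs (gcd u (b\<^sup>2))) * card (dvs (gcd v (a\<^sup>2)))"
proof -
  let ?G = "gcd (u * a\<^sup>2) (v * b\<^sup>2)"
  have ab: "coprime (a\<^sup>2) (b\<^sup>2)" using assms(2) by simp
  obtain x y where xy: "?G = x * y" "x dvd u" "y dvd a\<^sup>2" using division_decomp[of ?G u "a\<^sup>2"] by auto
  have "x dvd v * b\<^sup>2" using xy(1) by (metis dvd_trans dvd_triv_left gcd_dvd2)
  moreover have "coprime x v" using xy(2) assms(1) by (meson coprime_divisors dvd_refl)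
  ultimately have "x dvd b\<^sup>2" by (simp add: coprime_dvd_mult_right_iff)
  moreover have "y dvd v * b\<^sup>2" using xy(1) by (metis dvd_trans dvd_triv_right gcd_dvd2)
  moreover have "coprime y (b\<^sup>2)" using xy(3) ab by (meson coprime_divisors dvd_refl)
  ultimately have "x dvd gcd u (b\<^sup>2)" "y dvd gcd v (a\<^sup>2)" using xy by (simp_all add: coprime_dvd_mult_left_iff)
  then have "?G dvd gcd u (b\<^sup>2) * gcd v (a\<^sup>2)" unfolding xy(1) by (rule mult_dvd_mono)
  then have "card (dvs ?G) \<le> card (dvs (gcd u (b\<^sup>2) * gcd v (a\<^sup>2)))"
    using assms by (intro card_dvs_mono) auto
  also have "\<dots> \<le> card (dvs (gcd u (b\<^sup>2))) * card (dvs (gcd v (a\<^sup>2)))"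
    using assms by (intro card_dvs_mult_le) auto
  finally show ?thesis .
qed

lemma sum_Times_mult:
  fixes F :: "'a \<Rightarrow> real" and H :: "'b \<Rightarrow> real"
  shows "(\<Sum>p\<in>A \<times> B. F (fst p) * H (snd p)) = sum F A * sum H B"
  by (simp add: sum_product sum.cartesian_product split_beta)

lemma powr_quarter_mult_square:
  fixes p x U :: real
  assumes "0 \<le> p" "0 \<le> x" "0 \<le> U"
  shows "(p * (x * x) * U) powr (-(1/4)) = p powr (-(1/4)) * x powr (-(1/2)) * U powr (-(1/4))"
  using assms by (simp add: powr_mult flip: powr_add)

text \<open>For fixed u2, u4, a, b, y the equation is linear in (u1, u3, z), and its solutions are
  primitive because u1 and u3 are coprime. The constant 9 gives the first term. The gcd of the
  coefficients is removed first by summing over y and then by the averages of divisor functions over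
  (u2, b) and (u4, a).\<close>

lemma card_conic_le:
  fixes A :: "(int \<times> int \<times> int \<times> int \<times> int \<times> int \<times> int \<times> int) set"
    and U1 U2 U3 U4 P Q Z Y :: real
  assumes fin: "finite A" and pos: "U1 > 0" "U2 > 0" "U3 > 0" "U4 > 0" "P > 0" "Q > 0" "Z > 0" "Y > 0"
    and A: "\<And>u1 u2 u3 u4 a b z y. (u1, u2, u3, u4, a, b, z, y) \<in> A \<Longrightarrow>
      u1 * u2 * a\<^sup>2 - u3 * u4 * b\<^sup>2 = z * y \<and> coprime u1 u3 \<and> coprime u2 u4 \<and> coprime a b \<and>
      u1 \<in> nz_ints U1 \<and> u2 \<in> nz_ints U2 \<and> u3 \<in> nz_ints U3 \<and> u4 \<in> nz_ints U4 \<and>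
      a \<in> nz_ints P \<and> b \<in> nz_ints Q \<and> z \<in> nz_ints Z \<and> y \<in> nz_ints Y"
  shows "real (card A) \<le> 288 * (U2 * U4 * P * Q * Y) + 73728 * ((U1 * U2 * U3 * U4) powr (3/4) * (Z * P * Q * Y) powr (1/2))"
proof -
  let ?f = "\<lambda>(u1::int, u2::int, u3::int, u4::int, a::int, b::int, z::int, y::int). (((u2, b), (u4, a)), y)"
  let ?g = "\<lambda>(u1::int, u2::int, u3::int, u4::int, a::int, b::int, z::int, y::int). (u1, u3, z)"
  let ?N = "(nz_ints U2 \<times> nz_ints Q) \<times> (nz_ints U4 \<times> nz_ints P)"
  \<comment> \<open>The pairs are grouped as (u2, b) and (u4, a) so that the sum factors. The
    coprimality conditions are kept in \<open>T\<close> until \<open>card_dvs_conic_gcd_le\<close>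
    has been applied; then the sum is extended to all of \<open>?N\<close>.\<close>
  define T where "T = {((u2, b), (u4, a)) \<in> ?N. coprime u2 u4 \<and> coprime a b}"
  have T: "T \<subseteq> ?N" by (auto simp: T_def)
  then have finT: "finite T" by (rule finite_subset) simp
  define K where "K = 8 * (U1 * U3 * Z) * (U1 powr (-(1/4)) * U3 powr (-(1/4)) * Z powr (-(1/2)))"
  have K0: "K \<ge> 0" using pos by (simp add: K_def)
  define w1 :: "int \<times> int \<Rightarrow> real" where "w1 = (\<lambda>(u, b). \<bar>real_of_int u\<bar> powr (-(1/4)) * \<bar>real_of_int b\<bar> powr (-(1/2)))"
  have w1: "w1 p \<ge> 0" for p by (cases p) (simp add: w1_def)
  let ?w = "\<lambda>y. \<bar>real_of_int y\<bar> powr (-(1/2))"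
  define G where "G = (\<lambda>((u2, b), (u4, a)). gcd (u2 * a\<^sup>2) (u4 * b\<^sup>2) :: int)"
  define h where "h = (\<lambda>(p, y). 9 + K * (w1 (fst p) * w1 (snd p)) * (real_of_int (gcd (G p) y) * ?w y))"
  have "real (card A) \<le> (\<Sum>t\<in>T \<times> nz_ints Y. h t)"
  proof (rule card_le_sum_fibres[OF fin, where f = ?f])
    show "finite (T \<times> nz_ints Y)" using finT by simp
    show "?f ` A \<subseteq> T \<times> nz_ints Y" using A by (auto simp: T_def)
    fix t assume "t \<in> T \<times> nz_ints Y"
    then obtain u2 b u4 a y where t: "t = (((u2, b), (u4, a)), y)" and u2: "u2 \<in> nz_ints U2" and b: "b \<in> nz_ints Q"
      and u4: "u4 \<in> nz_ints U4" and a: "a \<in> nz_ints P" and y: "y \<in> nz_ints Y"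
      by (auto simp: T_def)
    let ?B = "{w \<in> A. ?f w = t}"
    have inj: "inj_on ?g ?B" using t by (auto simp: inj_on_def)
    have nz: "u2 \<noteq> 0" "b \<noteq> 0" "u4 \<noteq> 0" "a \<noteq> 0" "y \<noteq> 0" using u2 b u4 a y by (auto simp: nz_ints_def)
    have "real (card (?g ` ?B)) \<le> 9 + 8 * real_of_int (gcd (u2 * a\<^sup>2) (gcd (- (u4 * b\<^sup>2)) (-y))) * (U1 * U3 * Z) *
      ((\<bar>real_of_int (u2 * a\<^sup>2)\<bar> * U1) powr (-(1/4)) * (\<bar>real_of_int (- (u4 * b\<^sup>2))\<bar> * U3) powr (-(1/4)) * (\<bar>real_of_int (-y)\<bar> * Z) powr (-(1/2)))"
    proof (rule card_primitive_plane_geom)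
      show "finite (?g ` ?B)" using fin by simp
      fix x1 x2 x3 assume "(x1, x2, x3) \<in> ?g ` ?B"
      then have m: "(x1, u2, x2, u4, a, b, x3, y) \<in> A" using t by auto
      have "coprime x1 x2" using A[OF m] by blast
      then have "gcd (gcd x1 x2) x3 = 1" by (simp only: coprime_imp_gcd_eq_1) simp
      then have "gcd x1 (gcd x2 x3) = 1" by (simp only: gcd.assoc)
      moreover have "u2 * a\<^sup>2 * x1 + - (u4 * b\<^sup>2) * x2 + -y * x3 = 0" using A[OF m] by (simp add: algebra_simps)
      ultimately show "u2 * a\<^sup>2 * x1 + - (u4 * b\<^sup>2) * x2 + -y * x3 = 0 \<and> gcd x1 (gcd x2 x3) = 1 \<and>
        \<bar>real_of_int x1\<bar> \<le> U1 \<and> \<bar>real_of_int x2\<bar> \<le> U3 \<and> \<bar>real_of_int x3\<bar> \<le> Z"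
        using A[OF m] by (auto simp: nz_ints_def)
    qed (use pos nz in auto)
    also have "gcd (u2 * a\<^sup>2) (gcd (- (u4 * b\<^sup>2)) (-y)) = gcd (gcd (u2 * a\<^sup>2) (u4 * b\<^sup>2)) y"
      by (simp add: gcd.assoc)
    also have "(\<bar>real_of_int (u2 * a\<^sup>2)\<bar> * U1) powr (-(1/4)) = \<bar>real_of_int u2\<bar> powr (-(1/4)) * \<bar>real_of_int a\<bar> powr (-(1/2)) * U1 powr (-(1/4))"
    proof -
      have "\<bar>real_of_int (u2 * a\<^sup>2)\<bar> * U1 = \<bar>real_of_int u2\<bar> * (\<bar>real_of_int a\<bar> * \<bar>real_of_int a\<bar>) * U1"
        unfolding of_int_minus abs_minus_cancel of_int_mult of_int_power abs_mult power_abs[symmetric] power2_eq_square ..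
      then show ?thesis using pos by (simp only: powr_quarter_mult_square abs_ge_zero less_imp_le)
    qed
    also have "(\<bar>real_of_int (- (u4 * b\<^sup>2))\<bar> * U3) powr (-(1/4)) = \<bar>real_of_int u4\<bar> powr (-(1/4)) * \<bar>real_of_int b\<bar> powr (-(1/2)) * U3 powr (-(1/4))"
    proof -
      have "\<bar>real_of_int (- (u4 * b\<^sup>2))\<bar> * U3 = \<bar>real_of_int u4\<bar> * (\<bar>real_of_int b\<bar> * \<bar>real_of_int b\<bar>) * U3"
        unfolding of_int_minus abs_minus_cancel of_int_mult of_int_power abs_mult power_abs[symmetric] power2_eq_square ..
      then show ?thesis using pos by (simp only: powr_quarter_mult_square abs_ge_zero less_imp_le)
    qed
    also have "(\<bar>real_of_int (-y)\<bar> * Z) powr (-(1/2)) = ?w y * Z powr (-(1/2))" using pos by (simp add: powr_mult)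
    finally have "real (card (?g ` ?B)) \<le> h t" by (simp add: h_def t K_def w1_def G_def mult_ac)
    then show "real (card ?B) \<le> h t" using inj by (simp add: card_image)
  qed
  also have "\<dots> = (\<Sum>p\<in>T. \<Sum>y\<in>nz_ints Y. h (p, y))" by (simp add: sum.cartesian_product)
  also have "\<dots> = (\<Sum>p\<in>T. 9 * real (card (nz_ints Y)) + K * (w1 (fst p) * w1 (snd p)) * (\<Sum>y\<in>nz_ints Y. real_of_int (gcd (G p) y) * ?w y))"
    by (simp add: h_def sum.distrib sum_distrib_left)
  also have "\<dots> \<le> (\<Sum>p\<in>T. 9 * (2 * Y) + 4 * Y powr (1/2) * K * ((card (dvs (gcd (fst (fst p)) ((snd (fst p))\<^sup>2))) * w1 (fst p)) * (card (dvs (gcd (fst (snd p)) ((snd (snd p))\<^sup>2))) * w1 (snd p))))"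
  proof (rule sum_mono, rule add_mono)
    fix p assume p: "p \<in> T"
    show "9 * real (card (nz_ints Y)) \<le> 9 * (2 * Y)" using card_nz_ints_le[of Y] pos by simp
    obtain u2 b u4 a where pe: "p = ((u2, b), (u4, a))" by (metis prod.collapse)
    have c: "coprime u2 u4" "coprime a b" "u2 \<noteq> 0" "b \<noteq> 0" "u4 \<noteq> 0" "a \<noteq> 0" using p pe by (auto simp: T_def nz_ints_def)
    have Gp: "G p = gcd (u2 * a\<^sup>2) (u4 * b\<^sup>2)" by (simp add: G_def pe)
    have "(\<Sum>y\<in>nz_ints Y. real_of_int (gcd (G p) y) * ?w y) \<le> 4 * Y powr (1/2) * card (dvs (G p))"
      by (rule sum_gcd_powr_le) (use c pos Gp in auto)
    also have "\<dots> \<le> 4 * Y powr (1/2) * (real (card (dvs (gcd u2 (b\<^sup>2)))) * real (card (dvs (gcd u4 (a\<^sup>2)))))"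
      using card_dvs_conic_gcd_le[OF c(1,2,3,5,6,4)] unfolding Gp
      by (intro mult_left_mono) (auto simp flip: of_nat_mult)
    finally have "K * (w1 (fst p) * w1 (snd p)) * (\<Sum>y\<in>nz_ints Y. real_of_int (gcd (G p) y) * ?w y)
        \<le> K * (w1 (fst p) * w1 (snd p)) * (4 * Y powr (1/2) * (real (card (dvs (gcd u2 (b\<^sup>2)))) * real (card (dvs (gcd u4 (a\<^sup>2))))))"
      using K0 w1 by (intro mult_left_mono) auto
    then show "K * (w1 (fst p) * w1 (snd p)) * (\<Sum>y\<in>nz_ints Y. real_of_int (gcd (G p) y) * ?w y)
        \<le> 4 * Y powr (1/2) * K * ((card (dvs (gcd (fst (fst p)) ((snd (fst p))\<^sup>2))) * w1 (fst p)) * (card (dvs (gcd (fst (snd p)) ((snd (snd p))\<^sup>2))) * w1 (snd p)))"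
      by (simp add: pe mult_ac)
  qed
  also have "\<dots> \<le> (\<Sum>p\<in>?N. 9 * (2 * Y) + 4 * Y powr (1/2) * K * ((card (dvs (gcd (fst (fst p)) ((snd (fst p))\<^sup>2))) * w1 (fst p)) * (card (dvs (gcd (fst (snd p)) ((snd (snd p))\<^sup>2))) * w1 (snd p))))"
    using pos K0 w1 by (intro sum_mono2 T) auto
  also have "\<dots> = 18 * Y * real (card ?N) + 4 * Y powr (1/2) * K *
      ((\<Sum>q\<in>nz_ints U2 \<times> nz_ints Q. card (dvs (gcd (fst q) ((snd q)\<^sup>2))) * w1 q) * (\<Sum>q\<in>nz_ints U4 \<times> nz_ints P. card (dvs (gcd (fst q) ((snd q)\<^sup>2))) * w1 q))"
    using sum_Times_mult[of "\<lambda>q. real (card (dvs (gcd (fst q) ((snd q)\<^sup>2)))) * w1 q" "\<lambda>q. real (card (dvs (gcd (fst q) ((snd q)\<^sup>2)))) * w1 q"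
        "nz_ints U2 \<times> nz_ints Q" "nz_ints U4 \<times> nz_ints P"]
    by (simp only: sum.distrib sum_distrib_left[symmetric] sum_constant) simp
  also have "\<dots> \<le> 18 * Y * ((2 * U2 * (2 * Q)) * (2 * U4 * (2 * P))) + 4 * Y powr (1/2) * K *
      ((48 * (U2 powr (3/4) * Q powr (1/2))) * (48 * (U4 powr (3/4) * P powr (1/2))))"
  proof (intro add_mono mult_left_mono mult_mono)
    show "real (card ?N) \<le> (2 * U2 * (2 * Q)) * (2 * U4 * (2 * P))"
      by (intro card_Times_le card_nz_ints_le) (use pos in auto)
    show "(\<Sum>q\<in>nz_ints U2 \<times> nz_ints Q. card (dvs (gcd (fst q) ((snd q)\<^sup>2))) * w1 q) \<le> 48 * (U2 powr (3/4) * Q powr (1/2))"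
      using sum_dvs_gcd_square_le[of U2 Q] pos by (simp add: w1_def split_beta)
    show "(\<Sum>q\<in>nz_ints U4 \<times> nz_ints P. card (dvs (gcd (fst q) ((snd q)\<^sup>2))) * w1 q) \<le> 48 * (U4 powr (3/4) * P powr (1/2))"
      using sum_dvs_gcd_square_le[of U4 P] pos by (simp add: w1_def split_beta)
  qed (use pos K0 w1 in \<open>auto intro!: sum_nonneg\<close>)
  also have "\<dots> = 288 * (U2 * U4 * P * Q * Y) + 9216 * K * (U2 powr (3/4) * U4 powr (3/4) * (P powr (1/2) * Q powr (1/2) * Y powr (1/2)))"
    by simp
  also have "K = 8 * (U1 powr (3/4) * U3 powr (3/4) * Z powr (1/2))"
  proof -
    have r: "x * x powr (-(1/4)) = x powr (3/4)" "x * x powr (-(1/2)) = x powr (1/2)" if "x > 0" for x :: real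
      using that powr_add[of x 1 "-(1/4)"] powr_add[of x 1 "-(1/2)"] by simp_all
    have "K = 8 * ((U1 * U1 powr (-(1/4))) * (U3 * U3 powr (-(1/4))) * (Z * Z powr (-(1/2))))"
      by (simp add: K_def mult_ac)
    then show ?thesis using pos by (simp only: r)
  qed
  finally show ?thesis using pos by (simp add: powr_mult mult_ac)
qed

section \<open>Short vectors of the lattice a = r b modulo z\<close>

text \<open>Thue's pigeonhole argument: the box [0, A] x [0, z / A] contains more than z integer
  points, so two of them agree modulo the lattice. Both sides of the box are shorter than z, so
  neither coordinate of the difference can vanish alone; for this r must be prime to z.\<close>

lemma short_lattice_vector:
  fixes z r :: int and A :: real
  assumes "1 < A" "A < z" "coprime r z"
  shows "\<exists>a b. a \<noteq> 0 \<and> b \<noteq> 0 \<and> z dvd a - r * b \<and> \<bar>real_of_int a\<bar> \<le> A \<and> \<bar>real_of_int b\<bar> \<le> z / A"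
proof -
  have zr: "real_of_int z > 0" using assms by linarith
  then have z: "z > 0" by simp
  define I where "I = {0..\<lfloor>A\<rfloor>} \<times> {0..\<lfloor>z / A\<rfloor>}"
  define f where "f = (\<lambda>(i, j). (i - r * j) mod z)"
  have fl: "0 \<le> \<lfloor>A\<rfloor>" "0 \<le> \<lfloor>z / A\<rfloor>" using assms zr by simp_all
  have "A * (z / A) < (real_of_int \<lfloor>A\<rfloor> + 1) * (real_of_int \<lfloor>z / A\<rfloor> + 1)"
    using assms zr by (intro mult_strict_mono divide_nonneg_pos) linarith+
  then have "real_of_int z < real_of_int ((\<lfloor>A\<rfloor> + 1) * (\<lfloor>z / A\<rfloor> + 1))" using assms by simp
  then have lt: "z < (\<lfloor>A\<rfloor> + 1) * (\<lfloor>z / A\<rfloor> + 1)" by (simp only: of_int_less_iff)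
  have "card (f ` I) \<le> card {0..<z}" using z by (intro card_mono) (auto simp: f_def)
  also have "\<dots> = nat z" by simp
  also have "\<dots> < nat ((\<lfloor>A\<rfloor> + 1) * (\<lfloor>z / A\<rfloor> + 1))" using lt z by simp
  also have "\<dots> = card I" using fl by (simp add: I_def card_cartesian_product nat_mult_distrib)
  finally have "\<not> inj_on f I" by (rule pigeonhole)
  then obtain i j i' j' where ij: "(i, j) \<in> I" "(i', j') \<in> I" "f (i, j) = f (i', j')" "(i, j) \<noteq> (i', j')"
    by (auto simp: inj_on_def)
  define a where "a = i - i'"
  define b where "b = j - j'"
  have "z dvd (i - r * j) - (i' - r * j')" using ij(3) by (simp add: f_def mod_eq_dvd_iff)
  also have "(i - r * j) - (i' - r * j') = a - r * b" by (simp add: a_def b_def algebra_simps)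
  finally have d: "z dvd a - r * b" .
  have ai: "\<bar>a\<bar> \<le> \<lfloor>A\<rfloor>" "\<bar>b\<bar> \<le> \<lfloor>z / A\<rfloor>" using ij(1,2) by (auto simp: I_def a_def b_def)
  then have ar: "\<bar>real_of_int a\<bar> \<le> A" "\<bar>real_of_int b\<bar> \<le> z / A" by (simp_all add: le_floor_iff)
  have zA: "z / A < z" using assms zr by (simp add: field_simps)
  have az: "\<bar>a\<bar> < z" "\<bar>b\<bar> < z" using ar assms zA by linarith+
  have small: "x = 0" if "z dvd x" "\<bar>x\<bar> < z" for x
    using that dvd_imp_le_int[of x z] by fastforce
  have "b \<noteq> 0"
  proof
    assume "b = 0"
    then have "a = 0" using d az small[of a] by simp
    then show False using \<open>b = 0\<close> ij(4) by (simp add: a_def b_def)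
  qed
  moreover have "a \<noteq> 0"
  proof
    assume "a = 0"
    then have "z dvd r * b" using d by simp
    then have "z dvd b" using assms(3) by (simp add: coprime_dvd_mult_right_iff coprime_commute)
    then show False using small[of b] az \<open>b \<noteq> 0\<close> by simp
  qed
  ultimately show ?thesis using d ar by blast
qed

text \<open>Divide a short vector by the gcd k of its coordinates. Only the part h of k shared with
  z is lost from the modulus, while the vector shrinks by k \<ge> h. This gain offsets the smaller
  modulus z'.\<close>

lemma short_primitive_vector:
  fixes z r :: int and A :: real
  assumes "1 < A" "A < z" "coprime r z"
  shows "\<exists>a b h z'. a \<noteq> 0 \<and> b \<noteq> 0 \<and> coprime a b \<and> h > 0 \<and> z' > 0 \<and> z = h * z' \<and> z' dvd a - r * b \<and>
     \<bar>real_of_int a\<bar> * h \<le> A \<and> \<bar>real_of_int b\<bar> * h \<le> z / A"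
proof -
  obtain a b where ab: "a \<noteq> 0" "b \<noteq> 0" "z dvd a - r * b" "\<bar>real_of_int a\<bar> \<le> A" "\<bar>real_of_int b\<bar> \<le> z / A"
    using short_lattice_vector[OF assms] by blast
  have "real_of_int z > 0" using assms by linarith
  then have z: "z > 0" by simp
  define k where "k = gcd a b"
  have k: "k > 0" using ab by (simp add: k_def)
  obtain a0 b0 where a0: "a = a0 * k" "b = b0 * k" "coprime a0 b0"
    using gcd_coprime_exists[of a b] ab unfolding k_def by auto
  define h where "h = gcd k z"
  obtain k0 z' where kz: "k = k0 * h" "z = z' * h" "coprime k0 z'"
    using gcd_coprime_exists[of k z] k unfolding h_def by auto
  have h: "h > 0" using k by (simp add: h_def)
  have z': "z' > 0" using kz(2) z h by (simp add: zero_less_mult_iff)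
  have "a - r * b = h * (k0 * (a0 - r * b0))" using a0 kz(1) by (simp add: algebra_simps)
  then have "h * z' dvd h * (k0 * (a0 - r * b0))" using ab(3) kz(2) by (simp add: mult.commute)
  then have "z' dvd k0 * (a0 - r * b0)" using h by simp
  then have d: "z' dvd a0 - r * b0" using kz(3) by (simp add: coprime_dvd_mult_right_iff coprime_commute)
  have "h dvd k" by (simp add: h_def)
  then have hk: "h \<le> k" using k by (rule zdvd_imp_le)
  have "\<bar>real_of_int a0\<bar> * h \<le> \<bar>real_of_int a0\<bar> * k" using hk by (intro mult_left_mono) auto
  also have "\<dots> = \<bar>real_of_int a\<bar>" using k by (simp add: a0 abs_mult)
  also note ab(4)
  finally have A: "\<bar>real_of_int a0\<bar> * h \<le> A" .
  have "\<bar>real_of_int b0\<bar> * h \<le> \<bar>real_of_int b0\<bar> * k" using hk by (intro mult_left_mono) auto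
  also have "\<dots> = \<bar>real_of_int b\<bar>" using k by (simp add: a0 abs_mult)
  also note ab(5)
  finally have B: "\<bar>real_of_int b0\<bar> * h \<le> z / A" .
  have "a0 \<noteq> 0" "b0 \<noteq> 0" using ab a0 by auto
  then show ?thesis using a0(3) h z' kz(2) d A B by (intro exI[of _ a0] exI[of _ b0] exI[of _ h] exI[of _ z']) (simp add: mult.commute)
qed

text \<open>For two roots \<open>r\<close> and \<open>s\<close> put \<open>k = z / gcd (s - r, z)\<close>: then \<open>k\<close> divides \<open>h\<close> and \<open>s + r\<close>, and \<open>k\<close> determines \<open>s\<close> modulo
  \<open>z\<close> up to a factor 2.\<close>

lemma card_root_lifts_le:
  fixes R :: "int set" and z h z' :: int
  assumes "h > 0" "z' > 0" "z = h * z'" and R: "R \<subseteq> {0..<z}"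
    and cop: "\<And>r. r \<in> R \<Longrightarrow> coprime r z"
    and cong: "\<And>r s. r \<in> R \<Longrightarrow> s \<in> R \<Longrightarrow> z' dvd s - r \<and> z dvd s\<^sup>2 - r\<^sup>2"
  shows "card R \<le> 2 * card (dvs h)"
proof (cases "R = {}")
  case False
  then obtain r where r: "r \<in> R" by blast
  have z: "z > 0" using assms by simp
  \<comment> \<open>Congruence modulo z is determined only up to a factor 2, and the second
    component supplies the missing bit: in which half of [0, z) the root lies.\<close>
  define f where "f = (\<lambda>s. (nat (z div gcd (s - r) z), 2 * s \<ge> z))"
  have main: "z div gcd (s - r) z dvd s + r \<and> z div gcd (s - r) z dvd h \<and> gcd (s - r) z > 0
      \<and> z = gcd (s - r) z * (z div gcd (s - r) z)" if s: "s \<in> R" for s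
  proof -
    let ?g = "gcd (s - r) z"
    have g: "?g > 0" using z by simp
    obtain x k where xk: "s - r = x * ?g" "z = k * ?g" "coprime x k"
      using gcd_coprime_exists[of "s - r" z] g by auto
    have k: "z div ?g = k" using xk(2) g by (metis nonzero_mult_div_cancel_right less_irrefl)
    have "s\<^sup>2 - r\<^sup>2 = (x * ?g) * (s + r)" unfolding xk(1)[symmetric] by (simp add: algebra_simps power2_eq_square)
    then have "k * ?g dvd ?g * (x * (s + r))" using cong[OF r s] xk(2) by (metis mult.assoc mult.commute)
    then have "?g * k dvd ?g * (x * (s + r))" by (simp only: mult.commute)
    then have "k dvd x * (s + r)" using g by (metis dvd_mult_cancel_left less_irrefl)
    then have "k dvd s + r" using xk(3) by (simp add: coprime_dvd_mult_right_iff coprime_commute)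
    moreover have "k dvd h"
    proof -
      have "z' dvd ?g" using cong[OF r s] assms(3) by simp
      then obtain m where m: "?g = z' * m" by blast
      have "h * z' = k * m * z'" using xk(2) m assms(3) by (simp add: ac_simps)
      then have "h = k * m" using assms(2) by simp
      then show ?thesis by simp
    qed
    ultimately show ?thesis using k g xk(2) by (simp add: mult.commute)
  qed
  have inj: "inj_on f R"
  proof (rule inj_onI)
    fix s t assume st: "s \<in> R" "t \<in> R" "f s = f t"
    let ?g = "gcd (s - r) z" and ?g' = "gcd (t - r) z"
    let ?k = "z div ?g" and ?k' = "z div ?g'"
    have "?k \<ge> 0" "?k' \<ge> 0" using z by (simp_all add: pos_imp_zdiv_nonneg_iff)
    moreover have "nat ?k = nat ?k'" using st(3) by (simp add: f_def)
    ultimately have kk: "?k = ?k'" by (simp only: eq_nat_nat_iff)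
    have k0: "?k \<noteq> 0" using main[OF st(1)] z by (metis less_irrefl mult_zero_right)
    have "?g * ?k = ?g' * ?k" using main[OF st(1)] main[OF st(2)] kk by metis
    then have gg: "?g = ?g'" using k0 by (simp only: mult_cancel_right) simp
    define g where "g = ?g"
    define k where "k = ?k"
    have zg: "z = g * k" using main[OF st(1)] by (simp add: g_def k_def)
    have gt: "?g dvd t - r" unfolding gg by (rule gcd_dvd1)
    have "g dvd (s - r) - (t - r)" unfolding g_def by (rule dvd_diff[OF gcd_dvd1 gt])
    then have d1: "g dvd s - t" by simp
    have kt: "k dvd t + r" using main[OF st(2)] kk by (simp add: k_def)
    have "k dvd s + r" using main[OF st(1)] by (simp add: k_def)
    then have "k dvd (s + r) - (t + r)" using kt by (rule dvd_diff)
    then have d2: "k dvd s - t" by simp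
    have ks: "k dvd s + r" using main[OF st(1)] by (simp add: k_def)
    have gs: "g dvd s - r" unfolding g_def by (rule gcd_dvd1)
    \<comment> \<open>A common divisor of g and k divides both s + r and s - r, hence 2 r; being
      prime to r it divides 2. Since z = g k, divisibility of s - t by g and by k is therefore
      divisibility by z up to this factor.\<close>
    have "gcd g k dvd (s + r) - (s - r)"
      by (rule dvd_diff[OF dvd_trans[OF gcd_dvd2 ks] dvd_trans[OF gcd_dvd1 gs]])
    then have "gcd g k dvd 2 * r" by (simp add: algebra_simps)
    moreover have "coprime (gcd g k) r"
    proof -
      have "gcd g k dvd z" unfolding zg by (simp add: dvd_mult2)
      then show ?thesis using cop[OF r] by (meson coprime_commute coprime_divisors dvd_refl)
    qed
    ultimately have g2: "gcd g k dvd 2" by (simp add: coprime_dvd_mult_left_iff)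
    have "lcm g k dvd s - t" using d1 d2 by simp
    then have "gcd g k * lcm g k dvd 2 * (s - t)" using g2 by (intro mult_dvd_mono)
    moreover have "gcd g k * lcm g k = \<bar>z\<bar>" unfolding zg by (simp only: abs_mult prod_gcd_lcm_int)
    ultimately have zd: "z dvd 2 * (s - t)" by simp
    have "0 \<le> s" "s < z" "0 \<le> t" "t < z" using R st by auto
    moreover have "(2 * s \<ge> z) = (2 * t \<ge> z)" using st(3) by (simp add: f_def)
    ultimately have "\<bar>2 * (s - t)\<bar> < z" by (cases "z \<le> 2 * s") auto
    then have "2 * (s - t) = 0" using zd dvd_imp_le_int[of "2 * (s - t)" z] by fastforce
    then show "s = t" by simp
  qed
  have "f ` R \<subseteq> dvs h \<times> UNIV"
  proof
    fix x assume "x \<in> f ` R"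
    then obtain s where s: "s \<in> R" "x = f s" by blast
    have "z div gcd (s - r) z \<ge> 0" using z by (simp add: pos_imp_zdiv_nonneg_iff)
    then show "x \<in> dvs h \<times> UNIV" using main[OF s(1)] s(2) by (simp add: f_def dvs_def)
  qed
  then have "card (f ` R) \<le> card (dvs h \<times> (UNIV :: bool set))"
    using assms(1) by (intro card_mono) auto
  then show ?thesis using inj by (simp add: card_image card_cartesian_product mult.commute)
qed simp

lemma card_square_ints_le:
  fixes U :: real
  assumes "0 \<le> U"
  shows "real (card {u \<in> nz_ints U. \<exists>s. \<bar>u\<bar> = s\<^sup>2}) \<le> 2 * sqrt U"
proof -
  have "{u \<in> nz_ints U. \<exists>s. \<bar>u\<bar> = s\<^sup>2} \<subseteq> (\<lambda>s. sgn s * s\<^sup>2) ` nz_ints (sqrt U)"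
  proof
    fix u assume "u \<in> {u \<in> nz_ints U. \<exists>s. \<bar>u\<bar> = s\<^sup>2}"
    then obtain s where u: "u \<noteq> 0" "\<bar>real_of_int u\<bar> \<le> U" "\<bar>u\<bar> = s\<^sup>2" by (auto simp: nz_ints_def)
    have "(real_of_int \<bar>s\<bar>)\<^sup>2 = \<bar>real_of_int u\<bar>" using u(3) by (metis of_int_abs of_int_power power2_abs)
    then have "real_of_int \<bar>s\<bar> \<le> sqrt U" using u(2) by (intro real_le_rsqrt) simp
    moreover have s0: "s \<noteq> 0" using u by auto
    ultimately have "sgn u * \<bar>s\<bar> \<in> nz_ints (sqrt U)" using u by (simp add: nz_ints_def abs_mult sgn_if)
    moreover have "u = sgn (sgn u * \<bar>s\<bar>) * (sgn u * \<bar>s\<bar>)\<^sup>2"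
    proof -
      have "u > 0 \<Longrightarrow> u = s\<^sup>2" "\<not> u > 0 \<Longrightarrow> u = - (s\<^sup>2)" using u(3) by linarith+
      moreover have "(sgn s)\<^sup>2 = 1" using s0 by (simp add: sgn_if)
      ultimately show ?thesis using u(1) s0 by (cases "u > 0") (simp_all add: sgn_mult)
    qed
    ultimately show "u \<in> (\<lambda>s. sgn s * s\<^sup>2) ` nz_ints (sqrt U)" by blast
  qed
  then have "card {u \<in> nz_ints U. \<exists>s. \<bar>u\<bar> = s\<^sup>2} \<le> card ((\<lambda>s. sgn s * s\<^sup>2) ` nz_ints (sqrt U))"
    by (intro card_mono) auto
  also have "\<dots> \<le> card (nz_ints (sqrt U))" by (rule card_image_le) simp
  finally have "real (card {u \<in> nz_ints U. \<exists>s. \<bar>u\<bar> = s\<^sup>2}) \<le> real (card (nz_ints (sqrt U)))" by simp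
  also have "\<dots> \<le> 2 * sqrt U" using assms by (intro card_nz_ints_le) simp
  finally show ?thesis .
qed

lemma coprime_mult_square_int:
  fixes u v b :: int
  assumes "coprime u v" "\<bar>u * v\<bar> = b\<^sup>2"
  shows "\<exists>s. \<bar>u\<bar> = s\<^sup>2" "\<exists>s. \<bar>v\<bar> = s\<^sup>2"
proof -
  have "(\<exists>s. \<bar>u\<bar> = s\<^sup>2) \<and> (\<exists>s. \<bar>v\<bar> = s\<^sup>2)"
  proof (cases "u = 0 \<or> v = 0")
    case True
    then have "(\<bar>u\<bar> = 0\<^sup>2 \<and> \<bar>v\<bar> = 1\<^sup>2) \<or> (\<bar>u\<bar> = 1\<^sup>2 \<and> \<bar>v\<bar> = 0\<^sup>2)" using assms(1) by auto
    then show ?thesis by blast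
  next
    case False
  have c: "coprime (nat \<bar>u\<bar>) (nat \<bar>v\<bar>)" using assms(1) by (simp add: coprime_int_iff[symmetric])
  have "nat \<bar>u\<bar> * nat \<bar>v\<bar> = (nat \<bar>b\<bar>)\<^sup>2"
    using assms(2) by (metis abs_mult abs_ge_zero nat_mult_distrib nat_power_eq power2_abs)
  then have p: "is_nth_power 2 (nat \<bar>u\<bar> * nat \<bar>v\<bar>)" by (auto simp: is_nth_power_def)
  have "is_nth_power 2 (nat \<bar>u\<bar>)" "is_nth_power 2 (nat \<bar>v\<bar>)"
    using is_nth_power_mult_coprime_natD[OF c p] False by auto
  then obtain s t where "nat \<bar>u\<bar> = s\<^sup>2" "nat \<bar>v\<bar> = t\<^sup>2" by (auto simp: is_nth_power_def)
  then have "\<bar>u\<bar> = (int s)\<^sup>2" "\<bar>v\<bar> = (int t)\<^sup>2" by (metis abs_ge_zero int_nat_eq of_nat_power)+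
  then show ?thesis by blast
  qed
  then show "\<exists>s. \<bar>u\<bar> = s\<^sup>2" "\<exists>s. \<bar>v\<bar> = s\<^sup>2" by blast+
qed

text \<open>Coprimality gives mutual divisibility of u and b^2, and of v and a^2. This settles the
  degenerate case in which the quadratic form vanishes at the short vector.\<close>

lemma coprime_square_eq_int:
  fixes u v a b :: int
  assumes "coprime u v" "coprime a b" "u * a\<^sup>2 = v * b\<^sup>2"
  shows "\<bar>u\<bar> = b\<^sup>2" "\<bar>v\<bar> = a\<^sup>2"
proof -
  have ab: "coprime (a\<^sup>2) (b\<^sup>2)" using assms(2) by simp
  have "u dvd v * b\<^sup>2" "b\<^sup>2 dvd u * a\<^sup>2" "v dvd u * a\<^sup>2" "a\<^sup>2 dvd v * b\<^sup>2" using assms(3) by (metis dvd_triv_left dvd_triv_right)+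
  then have "u dvd b\<^sup>2" "b\<^sup>2 dvd u" "v dvd a\<^sup>2" "a\<^sup>2 dvd v"
    using assms(1) ab by (simp_all add: coprime_dvd_mult_right_iff coprime_dvd_mult_left_iff coprime_commute)
  then show "\<bar>u\<bar> = b\<^sup>2" "\<bar>v\<bar> = a\<^sup>2" by (metis abs_dvd_iff abs_ge_zero dvd_abs_iff zdvd_antisym_nonneg zero_le_power2)+
qed

section \<open>The number of roots on average\<close>

text \<open>The summand is the sum of 1 / (d e) over d e = h, and these pairs inject into the square
  of {1..n}. This is the origin of the two extra logarithms in the bound for the roots.\<close>

lemma sum_card_dvs_div_le:
  "(\<Sum>h=1..n. real (card (dvs (int h))) / real h) \<le> (harm n :: real)\<^sup>2"
proof -
  have "(\<Sum>h=1..n. real (card (dvs (int h))) / real h) = (\<Sum>h=1..n. \<Sum>d\<in>dvs (int h). 1 / real h)" by simp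
  also have "\<dots> = (\<Sum>(h, d)\<in>Sigma {1..n} (\<lambda>h. dvs (int h)). 1 / real h)"
    by (rule sum.Sigma) auto
  also have "\<dots> = (\<Sum>x\<in>Sigma {1..n} (\<lambda>h. dvs (int h)). (\<lambda>(d, e). 1 / real d * (1 / real e)) ((\<lambda>(h, d). (d, h div d)) x))"
  proof (intro sum.cong refl)
    fix x assume "x \<in> Sigma {1..n} (\<lambda>h. dvs (int h))"
    then obtain h d where x: "x = (h, d)" "d dvd h" by (auto simp: dvs_def)
    have "real h = real d * real (h div d)" using x(2) by (metis dvd_mult_div_cancel of_nat_mult)
    then show "(case x of (h, d) \<Rightarrow> 1 / real h) = (\<lambda>(d, e). 1 / real d * (1 / real e)) ((\<lambda>(h, d). (d, h div d)) x)"
      by (simp add: x(1))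
  qed
  also have "\<dots> = (\<Sum>y\<in>(\<lambda>(h, d). (d, h div d)) ` Sigma {1..n} (\<lambda>h. dvs (int h)). (\<lambda>(d, e). 1 / real d * (1 / real e)) y)"
  proof (subst sum.reindex)
    show "inj_on (\<lambda>(h, d). (d, h div d)) (Sigma {1..n} (\<lambda>h. dvs (int h)))"
    proof (rule inj_onI)
      fix x y assume xy: "x \<in> Sigma {1..n} (\<lambda>h. dvs (int h))" "y \<in> Sigma {1..n} (\<lambda>h. dvs (int h))"
        "(\<lambda>(h, d). (d, h div d)) x = (\<lambda>(h, d). (d, h div d)) y"
      obtain h d where x: "x = (h, d)" "d dvd h" using xy(1) by (auto simp: dvs_def)
      obtain k e where y: "y = (k, e)" "e dvd k" using xy(2) by (auto simp: dvs_def)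
      have "d = e" "h div d = k div e" using xy(3) x y by auto
      then have "h = k" using x(2) y(2) by (metis dvd_mult_div_cancel)
      then show "x = y" using x y \<open>d = e\<close> by simp
    qed
  qed (simp add: o_def)
  also have "\<dots> \<le> (\<Sum>y\<in>{1..n} \<times> {1..n}. (\<lambda>(d, e). 1 / real d * (1 / real e)) y)"
  proof (rule sum_mono2)
    show "(\<lambda>(h, d). (d, h div d)) ` Sigma {1..n} (\<lambda>h. dvs (int h)) \<subseteq> {1..n} \<times> {1..n}"
    proof
      fix y assume "y \<in> (\<lambda>(h, d). (d, h div d)) ` Sigma {1..n} (\<lambda>h. dvs (int h))"
      then obtain h d where h: "1 \<le> h" "h \<le> n" "d dvd h" "y = (d, h div d)" by (auto simp: dvs_def)
      have "d > 0" "d \<le> h" using h by (auto intro: Nat.gr0I dvd_imp_le)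
      moreover have "h div d > 0" using \<open>d > 0\<close> \<open>d \<le> h\<close> by (simp add: div_greater_zero_iff)
      moreover have "h div d \<le> n" using h(2) div_le_dividend le_trans by blast
      ultimately show "y \<in> {1..n} \<times> {1..n}" using h by simp
    qed
  qed auto
  also have "\<dots> = (\<Sum>d=1..n. 1 / real d) * (\<Sum>e=1..n. 1 / real e)"
    by (simp add: sum_product sum.cartesian_product)
  also have "\<dots> = (harm n)\<^sup>2" by (simp add: harm_def power2_eq_square inverse_eq_divide)
  finally show ?thesis .
qed

text \<open>The ratio 32 between the bounds for z is what dyadic boxes leave: d14 d23 z lies between
  W / 2 and 4 W, and d14 d23 varies by a factor 4. The root r is represented in [0, z).\<close>

definition root_tuples :: "real \<Rightarrow> real \<Rightarrow> real \<Rightarrow> real \<Rightarrow> real \<Rightarrow> (int \<times> int \<times> int \<times> int \<times> int \<times> int) set" where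
  "root_tuples U1 U2 U3 U4 Z = {(u1, u2, u3, u4, z, r).
     u1 \<in> nz_ints U1 \<and> u2 \<in> nz_ints U2 \<and> u3 \<in> nz_ints U3 \<and> u4 \<in> nz_ints U4 \<and>
     coprime u1 u2 \<and> coprime u3 u4 \<and> coprime (u1 * u2) (u3 * u4) \<and> coprime z (u1 * u2 * (u3 * u4)) \<and>
     Z \<le> real_of_int z \<and> real_of_int z \<le> 32 * Z \<and> 0 \<le> r \<and> r < z \<and> z dvd r\<^sup>2 * (u1 * u2) - u3 * u4}"

lemma root_tuples_coprime_root:
  assumes "(u1, u2, u3, u4, z, r) \<in> root_tuples U1 U2 U3 U4 Z"
  shows "coprime r z"
proof (rule coprimeI)
  fix d assume d: "d dvd r" "d dvd z"
  have z: "z dvd r\<^sup>2 * (u1 * u2) - u3 * u4" "coprime z (u1 * u2 * (u3 * u4))" using assms by (auto simp: root_tuples_def)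
  have "d dvd r\<^sup>2 * (u1 * u2) - u3 * u4" using d z(1) dvd_trans by blast
  moreover have "d dvd r\<^sup>2 * (u1 * u2)" using d(1) by (simp add: dvd_mult2 power2_eq_square)
  ultimately have "d dvd u3 * u4" by (simp add: dvd_diff_right_iff)
  then show "is_unit d" using z(2) d(2) by (meson coprime_common_divisor dvd_mult)
qed

lemma finite_root_tuples [simp]: "finite (root_tuples U1 U2 U3 U4 Z)"
proof (rule finite_subset)
  show "root_tuples U1 U2 U3 U4 Z \<subseteq> nz_ints U1 \<times> nz_ints U2 \<times> nz_ints U3 \<times> nz_ints U4 \<times> {0..\<lfloor>32 * Z\<rfloor>} \<times> {0..\<lfloor>32 * Z\<rfloor>}"
    by (auto simp: root_tuples_def le_floor_iff)
qed simp

lemma finite_section: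
  assumes "finite X"
  shows "finite {w. (h, w) \<in> X}"
proof (rule finite_subset)
  show "{w. (h, w) \<in> X} \<subseteq> snd ` X" by force
qed (use assms in simp)

text \<open>Each root is replaced by a short vector (a, b) of its lattice with a reduced modulus z'
  = z / h. The form u1 u2 a^2 - u3 u4 b^2 is then divisible by z' with a small quotient y, so the
  tuples are points counted by \<open>card_conic_le\<close>, or belong to the degenerate case y = 0.
  The roots with the same vector number at most twice the divisor function of h, and the result is
  summed over h.\<close>

lemma card_root_tuples_core:
  fixes U1 U2 U3 U4 Z :: real
  assumes U: "1 \<le> U2" "U2 \<le> U1" "1 \<le> U4" "U4 \<le> U3" and Z: "U1 < Z" "U3 < Z"
  shows "real (card (root_tuples U1 U2 U3 U4 Z)) \<le>
     166440960 * (Z * (U1 * U2 * U3 * U4)) + 8192 * (Z * sqrt (U1 * U2 * U3 * U4)) * (harm (nat \<lfloor>32 * Z\<rfloor>))\<^sup>2"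
proof -
  let ?T = "root_tuples U1 U2 U3 U4 Z"
  define p where "p = sqrt (U1 * U2)"
  define q where "q = sqrt (U3 * U4)"
  have pos: "U1 > 0" "U2 > 0" "U3 > 0" "U4 > 0" "Z > 0" using assms by linarith+
  have p2: "p * p = U1 * U2" and q2: "q * q = U3 * U4" using pos by (simp_all add: p_def q_def)
  have pq: "p > 0" "q > 0" using pos by (simp_all add: p_def q_def)
  have ge1: "1 \<le> p" "1 \<le> q" using U mult_mono[of 1 U1 1 U2] mult_mono[of 1 U3 1 U4] by (simp_all add: p_def q_def)
  have pZ: "p < Z" 
  proof -
    have "U1 * U2 < Z * Z" using Z U pos by (intro mult_strict_mono') auto
    then show ?thesis unfolding p_def using pos real_sqrt_less_iff[of "U1 * U2" "Z * Z"] by simp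
  qed
  have qZ: "q < Z" 
  proof -
    have "U3 * U4 < Z * Z" using Z U pos by (intro mult_strict_mono') auto
    then show ?thesis unfolding q_def using pos real_sqrt_less_iff[of "U3 * U4" "Z * Z"] by simp
  qed
  have U2p: "U2 \<le> p" unfolding p_def by (rule real_le_rsqrt) (use U pos in \<open>simp add: power2_eq_square\<close>)
  have U4q: "U4 \<le> q" unfolding q_def by (rule real_le_rsqrt) (use U pos in \<open>simp add: power2_eq_square\<close>)
  \<comment> \<open>This choice balances the two terms of the form: p^2 A^2 and q^2 (Z / A)^2 both
    equal Z p q.\<close>
  define A where "A = sqrt (Z * q / p)"
  have A2: "A * A = Z * q / p" using pos pq by (simp add: A_def)
  have A1: "1 < A"
  proof -
    have "p * 1 < Z * q" using pZ ge1 pos by (intro mult_less_le_imp_less) auto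
    then have "1 < Z * q / p" using pq by simp
    then show ?thesis by (simp add: A_def)
  qed
  have AZ: "A < Z"
  proof -
    have "Z * q / p \<le> Z * q / 1" using pos pq ge1 by (intro divide_left_mono) auto
    also have "\<dots> < Z * Z" using qZ pos by simp
    finally have "sqrt (Z * q / p) < sqrt (Z * Z)" by (simp only: real_sqrt_less_iff)
    then show ?thesis using pos by (simp add: A_def)
  qed
  have Apos: "A > 0" using A1 by simp
  define Pr where "Pr = (\<lambda>(u1::int, u2::int, u3::int, u4::int, z::int, r::int) (a::int, b::int, h::int, z'::int). a \<noteq> 0 \<and> b \<noteq> 0 \<and> coprime a b \<and> h > 0 \<and> z' > 0 \<and> z = h * z' \<and> z' dvd a - r * b \<and>
     \<bar>real_of_int a\<bar> * h \<le> A \<and> \<bar>real_of_int b\<bar> * h \<le> z / A)"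
  have "\<forall>t\<in>?T. \<exists>s. Pr t s"
  proof
    fix t assume t: "t \<in> ?T"
    obtain u1 u2 u3 u4 z r where te: "t = (u1, u2, u3, u4, z, r)" by (cases t) auto
    have c: "coprime r z" using root_tuples_coprime_root t te by blast
    have "Z \<le> z" using t te by (simp add: root_tuples_def)
    then have "A < real_of_int z" using AZ by linarith
    from short_primitive_vector[OF A1 this c] show "\<exists>s. Pr t s" unfolding te Pr_def by auto
  qed
  then obtain \<phi> where \<phi>: "\<And>t. t \<in> ?T \<Longrightarrow> Pr t (\<phi> t)" by (metis (no_types))
  \<comment> \<open>The root r and the modulus z are forgotten. The value of z returns as h z', so a
    fibre of \<open>F\<close> consists of different roots for the same modulus.\<close>
  define F where "F = (\<lambda>t. case t of (u1::int, u2::int, u3::int, u4::int, z::int, r::int) \<Rightarrow> case \<phi> t of (a, b, h, z') \<Rightarrow> (h, (u1, u2, u3, u4, a, b, z')))"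
  define n where "n = nat \<lfloor>32 * Z\<rfloor>"
  define W where "W = (\<lambda>h. {w. (h, w) \<in> F ` ?T})"
  have FE: "\<exists>z r. (u1, u2, u3, u4, z, r) \<in> ?T \<and> Pr (u1, u2, u3, u4, z, r) (a, b, h, z') \<and> F (u1, u2, u3, u4, z, r) = (h, (u1, u2, u3, u4, a, b, z'))"
    if FT: "(h, (u1, u2, u3, u4, a, b, z')) \<in> F ` ?T" for h u1 u2 u3 u4 a b z'
  proof -
    obtain t where t: "t \<in> ?T" "F t = (h, (u1, u2, u3, u4, a, b, z'))" using FT by (metis imageE)
    obtain v1 v2 v3 v4 z r where te: "t = (v1, v2, v3, v4, z, r)" by (cases t) auto
    obtain a' b' h' z'' where ph: "\<phi> t = (a', b', h', z'')" by (cases "\<phi> t") auto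
    have "v1 = u1" "v2 = u2" "v3 = u3" "v4 = u4" "a' = a" "b' = b" "h' = h" "z'' = z'"
      using t(2) ph unfolding F_def te by auto
    then show ?thesis using t \<phi>[OF t(1)] ph te by auto
  qed
  have Hrange: "h \<in> int ` {1..n}" if hw: "(h, w) \<in> F ` ?T" for h w
  proof -
    obtain u1 u2 u3 u4 a b z' where w: "w = (u1, u2, u3, u4, a, b, z')" by (cases w) auto
    obtain z r where t: "(u1, u2, u3, u4, z, r) \<in> ?T" "Pr (u1, u2, u3, u4, z, r) (a, b, h, z')"
      using FE hw w by blast
    have z: "z = h * z'" "h > 0" "z' > 0" "real_of_int z \<le> 32 * Z" using t by (auto simp: Pr_def root_tuples_def)
    have "h \<le> z" using z by simp
    then have "h \<le> \<lfloor>32 * Z\<rfloor>" using z(4) by (simp add: le_floor_iff)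
    then have "nat h \<in> {1..n}" using z(2) by (simp add: n_def nat_mono)
    moreover have "h = int (nat h)" using z by simp
    ultimately show ?thesis by blast
  qed
  have finF: "finite (F ` ?T)" by simp
  have finW: "finite (W h)" for h
    unfolding W_def by (rule finite_section[OF finF])
  \<comment> \<open>In a fibre z' divides a - r b for all r, and z' is prime to b because a and b
    are coprime. The roots therefore agree modulo z', and \<open>card_root_lifts_le\<close>
    applies.\<close>
  have "real (card ?T) \<le> (\<Sum>x\<in>F ` ?T. 2 * real (card (dvs (fst x))))"
  proof (rule card_le_sum_fibres[OF finite_root_tuples finF order_refl])
    fix x assume x: "x \<in> F ` ?T"
    obtain h u1 u2 u3 u4 a b z' where xe: "x = (h, (u1, u2, u3, u4, a, b, z'))" by (cases x) auto
    let ?B = "{t \<in> ?T. F t = x}"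
    let ?r = "\<lambda>(u1::int, u2::int, u3::int, u4::int, z::int, r::int). r"
    have B: "\<exists>r. t = (u1, u2, u3, u4, h * z', r) \<and> t \<in> ?T \<and> Pr t (a, b, h, z')" if t: "t \<in> ?B" for t
    proof -
      obtain v1 v2 v3 v4 z r where te: "t = (v1, v2, v3, v4, z, r)" by (cases t) auto
      obtain a' b' h' z'' where ph: "\<phi> t = (a', b', h', z'')" by (cases "\<phi> t") auto
      have e: "v1 = u1" "v2 = u2" "v3 = u3" "v4 = u4" "a' = a" "b' = b" "h' = h" "z'' = z'"
        using t ph unfolding F_def te xe by auto
      have "t \<in> ?T" using t by simp
      then have P: "Pr t (a, b, h, z')" using \<phi>[of t] ph e by simp
      then have "z = h * z'" unfolding te Pr_def by simp
      then show ?thesis using te e P \<open>t \<in> ?T\<close> by blast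
    qed
    obtain z0 r0 where t0: "(u1, u2, u3, u4, z0, r0) \<in> ?T" "Pr (u1, u2, u3, u4, z0, r0) (a, b, h, z')"
      using FE x unfolding xe by blast
    have hz: "h > 0" "z' > 0" using t0(2) by (simp_all add: Pr_def)
    have "card (?r ` ?B) \<le> 2 * card (dvs h)"
    proof (rule card_root_lifts_le[OF hz refl])
      show "?r ` ?B \<subseteq> {0..<h * z'}"
      proof
        fix r assume "r \<in> ?r ` ?B"
        then obtain t where t: "t \<in> ?B" "r = ?r t" by blast
        obtain s where s: "t = (u1, u2, u3, u4, h * z', s)" "t \<in> ?T" using B[OF t(1)] by blast
        then show "r \<in> {0..<h * z'}" using t(2) by (simp add: root_tuples_def)
      qed
      fix r assume "r \<in> ?r ` ?B"
      then obtain t where t: "t \<in> ?B" "r = ?r t" by blast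
      then have r: "(u1, u2, u3, u4, h * z', r) \<in> ?T" "Pr (u1, u2, u3, u4, h * z', r) (a, b, h, z')" using B[OF t(1)] by auto
      show "coprime r (h * z')" using root_tuples_coprime_root[OF r(1)] .
      fix s assume "s \<in> ?r ` ?B"
      then obtain t' where t': "t' \<in> ?B" "s = ?r t'" by blast
      then have s: "(u1, u2, u3, u4, h * z', s) \<in> ?T" "Pr (u1, u2, u3, u4, h * z', s) (a, b, h, z')" using B[OF t'(1)] by auto
      have d: "z' dvd a - r * b" "z' dvd a - s * b" "coprime a b" using r(2) s(2) by (simp_all add: Pr_def)
      have cb: "coprime z' b"
      proof (rule coprimeI)
        fix c assume c: "c dvd z'" "c dvd b"
        have "c dvd a - r * b" using c(1) d(1) by (rule dvd_trans)
        moreover have "c dvd r * b" using c(2) by simp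
        ultimately have "c dvd a" by (simp add: dvd_diff_left_iff)
        then show "is_unit c" using d(3) c(2) by (meson coprime_common_divisor)
      qed
      have "z' dvd (a - r * b) - (a - s * b)" using d(1,2) by (rule dvd_diff)
      also have "\<dots> = (s - r) * b" by (simp add: algebra_simps)
      finally have 1: "z' dvd s - r" using cb by (simp add: coprime_dvd_mult_left_iff)
      have e: "h * z' dvd r\<^sup>2 * (u1 * u2) - u3 * u4" "h * z' dvd s\<^sup>2 * (u1 * u2) - u3 * u4" "coprime (h * z') (u1 * u2 * (u3 * u4))"
        using r(1) s(1) by (simp_all add: root_tuples_def)
      have "h * z' dvd (s\<^sup>2 * (u1 * u2) - u3 * u4) - (r\<^sup>2 * (u1 * u2) - u3 * u4)" using e(2,1) by (rule dvd_diff)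
      also have "\<dots> = (s\<^sup>2 - r\<^sup>2) * (u1 * u2)" by (simp add: algebra_simps)
      finally have "h * z' dvd (s\<^sup>2 - r\<^sup>2) * (u1 * u2)" .
      moreover have "coprime (h * z') (u1 * u2)" using e(3) coprime_mult_right_iff by blast
      ultimately have "h * z' dvd s\<^sup>2 - r\<^sup>2" using coprime_dvd_mult_left_iff by blast
      then show "z' dvd s - r \<and> h * z' dvd s\<^sup>2 - r\<^sup>2" using 1 by blast
    qed
    moreover have "inj_on ?r ?B"
    proof (rule inj_onI)
      fix t t' assume "t \<in> ?B" "t' \<in> ?B" "?r t = ?r t'"
      then show "t = t'" using B[of t] B[of t'] by auto
    qed
    ultimately have "card ?B \<le> 2 * card (dvs h)" by (simp only: card_image)
    then show "real (card ?B) \<le> 2 * real (card (dvs (fst x)))" unfolding xe fst_conv by linarith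
  qed
  also have "F ` ?T = (SIGMA h:int ` {1..n}. W h)"
  proof (intro equalityI subsetI)
    fix x assume x: "x \<in> F ` ?T"
    obtain h w where xe: "x = (h, w)" by (cases x)
    show "x \<in> (SIGMA h:int ` {1..n}. W h)" using Hrange[of h w] x unfolding xe W_def by blast
  next
    fix x assume "x \<in> (SIGMA h:int ` {1..n}. W h)"
    then show "x \<in> F ` ?T" unfolding W_def by blast
  qed
  also have "(\<Sum>x\<in>(SIGMA h:int ` {1..n}. W h). 2 * real (card (dvs (fst x)))) = (\<Sum>h\<in>int ` {1..n}. \<Sum>w\<in>W h. 2 * real (card (dvs h)))"
    by (subst sum.Sigma) (simp_all add: finW split_beta)
  also have "\<dots> = (\<Sum>h=1..n. 2 * real (card (dvs (int h))) * real (card (W (int h))))"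
    by (subst sum.reindex) (simp_all add: inj_on_def mult.commute)
  also have "\<dots> \<le> (\<Sum>h=1..n. (55480320 * (Z * (p * q)\<^sup>2)) * real h powr (-(3/2)) + (8192 * (Z * (p * q))) * (real (card (dvs (int h))) / real h))"
  proof (rule sum_mono)
    fix h assume "h \<in> {1..n}"
    then have h: "real h > 0" "h > 0" by auto
    \<comment> \<open>\<open>W1\<close> holds the vectors with nonzero quotient y, \<open>W2\<close>
      the degenerate ones.\<close>
    define W1 where "W1 = {(u1, u2, u3, u4, a, b, z') \<in> W (int h). u1 * u2 * a\<^sup>2 \<noteq> u3 * u4 * b\<^sup>2}"
    define W2 where "W2 = {(u1, u2, u3, u4, a, b, z') \<in> W (int h). u1 * u2 * a\<^sup>2 = u3 * u4 * b\<^sup>2}"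
    have Wfacts: "\<exists>z r. (u1, u2, u3, u4, z, r) \<in> ?T \<and> z = int h * z' \<and> coprime a b \<and> a \<noteq> 0 \<and> b \<noteq> 0 \<and> z' > 0 \<and> z' dvd a - r * b \<and>
       \<bar>real_of_int a\<bar> \<le> A / h \<and> \<bar>real_of_int b\<bar> \<le> z' / A \<and> Z / h \<le> z' \<and> z' \<le> 32 * Z / h"
      if w: "(u1, u2, u3, u4, a, b, z') \<in> W (int h)" for u1 u2 u3 u4 a b z'
    proof -
      obtain z r where t: "(u1, u2, u3, u4, z, r) \<in> ?T" "Pr (u1, u2, u3, u4, z, r) (a, b, int h, z')"
        using FE w unfolding W_def by blast
      have PP: "a \<noteq> 0 \<and> b \<noteq> 0 \<and> coprime a b \<and> int h > 0 \<and> z' > 0 \<and> z = int h * z' \<and> z' dvd a - r * b \<and>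
          \<bar>real_of_int a\<bar> * h \<le> A \<and> \<bar>real_of_int b\<bar> * h \<le> z / A"
        using t(2) unfolding Pr_def prod.case of_int_of_nat_eq .
      have P: "a \<noteq> 0" "b \<noteq> 0" "coprime a b" "z' > 0" "z = int h * z'" "z' dvd a - r * b" "\<bar>real_of_int a\<bar> * h \<le> A" "\<bar>real_of_int b\<bar> * h \<le> z / A"
        using PP by blast+
      have zz: "Z \<le> z" "z \<le> 32 * Z" using t(1) by (simp_all add: root_tuples_def)
      have "\<bar>real_of_int b\<bar> * h \<le> (z' / A) * h" using P(8) unfolding P(5) by (simp add: mult.commute)
      then have "\<bar>real_of_int b\<bar> \<le> z' / A" using h(1) by (rule mult_right_le_imp_le)
      moreover have "\<bar>real_of_int a\<bar> \<le> A / h" using P(7) h by (simp add: field_simps)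
      moreover have "Z / h \<le> z'" "z' \<le> 32 * Z / h" using zz h unfolding P(5) by (simp_all add: field_simps)
      ultimately show ?thesis using t(1) P by blast
    qed
    \<comment> \<open>33 = 1 + 32: after dividing by z', the a-term of the form contributes p q / h
      and the b-term 32 p q / h.\<close>
    let ?Y = "33 * (p * q) / h"
    have c1: "real (card W1) \<le> 13870080 * (Z * (p * q)\<^sup>2) / (real h)\<^sup>2"
    proof -
      let ?e = "\<lambda>(u1::int, u2::int, u3::int, u4::int, a::int, b::int, z'::int). (u1, u2, u3, u4, a, b, z', (u1 * u2 * a\<^sup>2 - u3 * u4 * b\<^sup>2) div z')"
      have "real (card (?e ` W1)) \<le> 288 * (U2 * U4 * (A / h) * (32 * Z / h / A) * ?Y) + 73728 * ((U1 * U2 * U3 * U4) powr (3/4) * ((32 * Z / h) * (A / h) * (32 * Z / h / A) * ?Y) powr (1/2))"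
      proof (rule card_conic_le)
        show "finite (?e ` W1)" using finW[of "int h"] by (auto simp: W1_def intro: finite_subset)
        fix u1 u2 u3 u4 a b z' y assume "(u1, u2, u3, u4, a, b, z', y) \<in> ?e ` W1"
        then have w: "(u1, u2, u3, u4, a, b, z') \<in> W (int h)" "u1 * u2 * a\<^sup>2 \<noteq> u3 * u4 * b\<^sup>2" "y = (u1 * u2 * a\<^sup>2 - u3 * u4 * b\<^sup>2) div z'"
          by (auto simp: W1_def)
        obtain z r where t: "(u1, u2, u3, u4, z, r) \<in> ?T" "z = int h * z'" "coprime a b" "a \<noteq> 0" "b \<noteq> 0" "z' > 0" "z' dvd a - r * b"
          "\<bar>real_of_int a\<bar> \<le> A / h" "\<bar>real_of_int b\<bar> \<le> z' / A" "Z / h \<le> z'" "z' \<le> 32 * Z / h" using Wfacts[OF w(1)] by blast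
        have T: "u1 \<in> nz_ints U1" "u2 \<in> nz_ints U2" "u3 \<in> nz_ints U3" "u4 \<in> nz_ints U4" "coprime (u1 * u2) (u3 * u4)"
          "z dvd r\<^sup>2 * (u1 * u2) - u3 * u4" using t(1) by (simp_all add: root_tuples_def)
        \<comment> \<open>Modulo z' the vector satisfies a = r b, so the form is b^2 times the
          expression that the root r annihilates.\<close>
        have "u1 * u2 * a\<^sup>2 - u3 * u4 * b\<^sup>2 = (a - r * b) * (u1 * u2 * (a + r * b)) + b\<^sup>2 * (r\<^sup>2 * (u1 * u2) - u3 * u4)"
          by (simp add: algebra_simps power2_eq_square)
        moreover have "z' dvd r\<^sup>2 * (u1 * u2) - u3 * u4" using T(6) t(2) dvd_mult_right by blast
        ultimately have "z' dvd u1 * u2 * a\<^sup>2 - u3 * u4 * b\<^sup>2" using t(7) by simp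
        then have y: "u1 * u2 * a\<^sup>2 - u3 * u4 * b\<^sup>2 = z' * y" using w(3) by simp
        have y0: "y \<noteq> 0" using w(2) y by auto
        have cop: "coprime u1 u3" "coprime u2 u4" using T(5) by (meson coprime_mult_left_iff coprime_mult_right_iff)+
        have ub: "\<bar>real_of_int u1\<bar> \<le> U1" "\<bar>real_of_int u2\<bar> \<le> U2" "\<bar>real_of_int u3\<bar> \<le> U3" "\<bar>real_of_int u4\<bar> \<le> U4"
          using T by (simp_all add: nz_ints_def)
        have zr: "real_of_int z' > 0" using t(6) by simp
        have "real_of_int z' * \<bar>real_of_int y\<bar> = \<bar>real_of_int (u1 * u2 * a\<^sup>2 - u3 * u4 * b\<^sup>2)\<bar>"
          unfolding y using zr by (simp add: abs_mult)
        also have "\<dots> \<le> \<bar>real_of_int (u1 * u2 * a\<^sup>2)\<bar> + \<bar>real_of_int (u3 * u4 * b\<^sup>2)\<bar>"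
          by (simp only: of_int_diff abs_triangle_ineq4)
        also have "\<dots> = \<bar>real_of_int u1\<bar> * \<bar>real_of_int u2\<bar> * (\<bar>real_of_int a\<bar> * \<bar>real_of_int a\<bar>) + \<bar>real_of_int u3\<bar> * \<bar>real_of_int u4\<bar> * (\<bar>real_of_int b\<bar> * \<bar>real_of_int b\<bar>)"
          by (simp only: power2_eq_square of_int_mult abs_mult)
        also have "\<dots> \<le> U1 * U2 * (A / h * (A / h)) + U3 * U4 * (z' / A * (z' / A))"
          using ub t(8,9) pos zr Apos h by (intro add_mono mult_mono) auto
        also have "\<dots> = (p * p) * (Z * q / p) / h / h + q * q * z' * z' / (Z * q / p)"
          unfolding p2[symmetric] q2[symmetric] A2[symmetric] by simp
        also have "\<dots> = p * q * (Z / h) / h + q * p * z' * (z' / Z)"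
          using pq pos by (simp add: mult_ac)
        also have "\<dots> \<le> p * q * z' / h + q * p * z' * (32 / h)"
        proof (intro add_mono divide_right_mono mult_left_mono)
          show "z' / Z \<le> 32 / h" using t(11) pos by (simp add: field_simps)
        qed (use t(10) pq zr h in auto)
        also have "\<dots> = z' * ?Y" by (simp add: field_simps)
        finally have "\<bar>real_of_int y\<bar> \<le> ?Y" using zr by (simp only: mult_le_cancel_left_pos)
        moreover have "z' / A \<le> 32 * Z / h / A" using t(11) Apos by (intro divide_right_mono) auto
        ultimately show "u1 * u2 * a\<^sup>2 - u3 * u4 * b\<^sup>2 = z' * y \<and> coprime u1 u3 \<and> coprime u2 u4 \<and> coprime a b \<and>
          u1 \<in> nz_ints U1 \<and> u2 \<in> nz_ints U2 \<and> u3 \<in> nz_ints U3 \<and> u4 \<in> nz_ints U4 \<and>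
          a \<in> nz_ints (A / h) \<and> b \<in> nz_ints (32 * Z / h / A) \<and> z' \<in> nz_ints (32 * Z / h) \<and> y \<in> nz_ints ?Y"
          using y cop T t y0 by (auto simp: nz_ints_def)
      qed (use pos pq Apos h in auto)
      also have "card (?e ` W1) = card W1" by (rule card_image) (auto simp: inj_on_def)
      also have "288 * (U2 * U4 * (A / h) * (32 * Z / h / A) * ?Y) \<le> 304128 * (Z * (p * q)\<^sup>2) / (real h)\<^sup>2"
      proof -
        have "288 * (U2 * U4 * (A / h) * (32 * Z / h / A) * ?Y) = 304128 * (U2 * U4) * (Z * (p * q)) / (real h * real h) / h"
          using Apos by simp
        also have "\<dots> \<le> 304128 * (U2 * U4) * (Z * (p * q)) / (real h * real h) / 1"
          using h pos pq by (intro divide_left_mono) auto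
        \<comment> \<open>The ordering of the sizes enters here: the smaller factors satisfy U2
          \<le> p and U4 \<le> q.\<close>
        also have "\<dots> \<le> 304128 * (p * q) * (Z * (p * q)) / (real h * real h) / 1"
          using h pos pq U2p U4q by (intro divide_right_mono mult_right_mono mult_left_mono mult_mono) auto
        finally show ?thesis by (simp add: power2_eq_square mult_ac)
      qed
      also have "(U1 * U2 * U3 * U4) powr (3/4) * ((32 * Z / h) * (A / h) * (32 * Z / h / A) * ?Y) powr (1/2) \<le> 184 * (Z * (p * q)\<^sup>2) / (real h)\<^sup>2"
      proof -
        have "U1 * U2 * U3 * U4 = (p * p) * (q * q)" by (simp add: p2 q2)
        also have "\<dots> = (p * q) powr 2" using pq by (simp add: powr_numeral power2_eq_square)
        finally have e1: "(U1 * U2 * U3 * U4) powr (3/4) = (p * q) powr (3/2)" by (simp add: powr_powr)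
        \<comment> \<open>The factor 33792 = 32 * 32 * 33 is rounded up to the square of 184, which
          allows the root to be taken.\<close>
        have "(32 * Z / h) * (A / h) * (32 * Z / h / A) * ?Y = 33792 * (Z\<^sup>2 * (p * q)) / (real h)\<^sup>2 / (real h)\<^sup>2"
          using Apos by (simp add: power2_eq_square)
        also have "\<dots> \<le> 184\<^sup>2 * (Z\<^sup>2 * (p * q)) / (real h)\<^sup>2 / (real h)\<^sup>2"
          using pq by (intro divide_right_mono mult_right_mono) auto
        also have "\<dots> = (184 * Z / (real h)\<^sup>2)\<^sup>2 * (p * q)" by (simp add: power2_eq_square)
        finally have "((32 * Z / h) * (A / h) * (32 * Z / h / A) * ?Y) powr (1/2) \<le> ((184 * Z / (real h)\<^sup>2)\<^sup>2 * (p * q)) powr (1/2)"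
          using pos pq Apos h by (intro powr_mono2) auto
        also have "\<dots> = (184 * Z / (real h)\<^sup>2) * (p * q) powr (1/2)"
          using pos pq h by (simp add: powr_mult powr_half_sqrt)
        finally have "(U1 * U2 * U3 * U4) powr (3/4) * ((32 * Z / h) * (A / h) * (32 * Z / h / A) * ?Y) powr (1/2)
           \<le> (p * q) powr (3/2) * ((184 * Z / (real h)\<^sup>2) * (p * q) powr (1/2))"
          unfolding e1 by (rule mult_left_mono) simp
        also have "\<dots> = (184 * Z / (real h)\<^sup>2) * ((p * q) powr (3/2) * (p * q) powr (1/2))" by simp
        also have "(p * q) powr (3/2) * (p * q) powr (1/2) = (p * q) powr 2" by (simp only: powr_add[symmetric]) simp
        also have "\<dots> = (p * q)\<^sup>2" using pq by (simp add: powr_numeral)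
        finally show ?thesis by simp
      qed
      finally show ?thesis by (simp add: add_divide_distrib[symmetric] algebra_simps)
    qed
    \<comment> \<open>In the degenerate case u1 u2 and u3 u4 are plus or minus squares of b and a,
      and by coprimality every u_i is plus or minus a square. This leaves about sqrt U_i choices for
      each, and a and b are determined up to sign.\<close>
    have c2: "real (card W2) \<le> 4096 * (Z * (p * q)) / h"
    proof -
      let ?Sq = "\<lambda>U. {u \<in> nz_ints U. \<exists>s. \<bar>u\<bar> = s\<^sup>2}"
      let ?e = "\<lambda>(u1::int, u2::int, u3::int, u4::int, a::int, b::int, z'::int). (u1, u2, u3, u4, a > 0, b > 0, z')"
      have W2f: "u1 \<in> ?Sq U1 \<and> u2 \<in> ?Sq U2 \<and> u3 \<in> ?Sq U3 \<and> u4 \<in> ?Sq U4 \<and> \<bar>u1 * u2\<bar> = b\<^sup>2 \<and> \<bar>u3 * u4\<bar> = a\<^sup>2 \<and> z' \<in> nz_ints (32 * Z / h) \<and> a \<noteq> 0 \<and> b \<noteq> 0"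
        if w2: "(u1, u2, u3, u4, a, b, z') \<in> W2" for u1 u2 u3 u4 a b z'
      proof -
        have w: "(u1, u2, u3, u4, a, b, z') \<in> W (int h)" "u1 * u2 * a\<^sup>2 = u3 * u4 * b\<^sup>2" using w2 by (auto simp: W2_def)
        obtain z r where t: "(u1, u2, u3, u4, z, r) \<in> ?T" "coprime a b" "a \<noteq> 0" "b \<noteq> 0" "z' > 0" "z' \<le> 32 * Z / h" using Wfacts[OF w(1)] by blast
        have T: "u1 \<in> nz_ints U1" "u2 \<in> nz_ints U2" "u3 \<in> nz_ints U3" "u4 \<in> nz_ints U4" "coprime (u1 * u2) (u3 * u4)" "coprime u1 u2" "coprime u3 u4"
          using t(1) by (simp_all add: root_tuples_def)
        have sq: "\<bar>u1 * u2\<bar> = b\<^sup>2" "\<bar>u3 * u4\<bar> = a\<^sup>2" using coprime_square_eq_int[OF T(5) t(2) w(2)] by simp_all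
        show ?thesis using coprime_mult_square_int[OF T(6) sq(1)] coprime_mult_square_int[OF T(7) sq(2)] T sq t
          by (simp add: nz_ints_def)
      qed
      have inj: "inj_on ?e W2"
      proof (rule inj_onI)
        fix x y assume xy: "x \<in> W2" "y \<in> W2" "?e x = ?e y"
        obtain u1 u2 u3 u4 a b z' where x: "x = (u1, u2, u3, u4, a, b, z')" by (cases x) auto
        obtain a' b' where y: "y = (u1, u2, u3, u4, a', b', z')" using xy(3) x by (cases y) auto
        have s: "a > 0 \<longleftrightarrow> a' > 0" "b > 0 \<longleftrightarrow> b' > 0" using xy(3) x y by auto
        have "a\<^sup>2 = a'\<^sup>2" "b\<^sup>2 = b'\<^sup>2" "a \<noteq> 0" "a' \<noteq> 0" "b \<noteq> 0" "b' \<noteq> 0" using W2f[of u1 u2 u3 u4 a b z'] W2f[of u1 u2 u3 u4 a' b' z'] xy(1,2) x y by auto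
        then have "a = a'" "b = b'" using s by (auto simp: power2_eq_iff)
        then show "x = y" using x y by simp
      qed
      have "card W2 = card (?e ` W2)" using inj by (simp add: card_image)
      also have "\<dots> \<le> card (?Sq U1 \<times> ?Sq U2 \<times> ?Sq U3 \<times> ?Sq U4 \<times> (UNIV::bool set) \<times> (UNIV::bool set) \<times> nz_ints (32 * Z / h))"
      proof (rule card_mono)
        show "?e ` W2 \<subseteq> ?Sq U1 \<times> ?Sq U2 \<times> ?Sq U3 \<times> ?Sq U4 \<times> (UNIV::bool set) \<times> (UNIV::bool set) \<times> nz_ints (32 * Z / h)"
        proof
          fix x assume "x \<in> ?e ` W2"
          then obtain w where w: "w \<in> W2" "x = ?e w" by blast
          obtain u1 u2 u3 u4 a b z' where we: "w = (u1, u2, u3, u4, a, b, z')" by (cases w) auto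
          show "x \<in> ?Sq U1 \<times> ?Sq U2 \<times> ?Sq U3 \<times> ?Sq U4 \<times> (UNIV::bool set) \<times> (UNIV::bool set) \<times> nz_ints (32 * Z / h)"
            using W2f[of u1 u2 u3 u4 a b z'] w unfolding we by simp
        qed
      qed (simp add: finite_cartesian_product)
      finally have "real (card W2) \<le> real (card (?Sq U1 \<times> ?Sq U2 \<times> ?Sq U3 \<times> ?Sq U4 \<times> (UNIV::bool set) \<times> (UNIV::bool set) \<times> nz_ints (32 * Z / h)))" unfolding of_nat_le_iff .
      also have "\<dots> \<le> (2 * sqrt U1) * ((2 * sqrt U2) * ((2 * sqrt U3) * ((2 * sqrt U4) * (2 * (2 * (2 * (32 * Z / h)))))))"
        by (intro card_Times_le card_nz_ints_le card_square_ints_le) (use pos h in \<open>simp_all add: less_imp_le\<close>)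
      also have "\<dots> = 4096 * (Z * ((sqrt U1 * sqrt U2) * (sqrt U3 * sqrt U4))) / h" by simp
      also have "\<dots> = 4096 * (Z * (p * q)) / h" by (simp add: p_def q_def real_sqrt_mult)
      finally show ?thesis .
    qed
    have "W (int h) = W1 \<union> W2" by (auto simp: W1_def W2_def)
    then have "card (W (int h)) \<le> card W1 + card W2" by (simp add: card_Un_le)
    then have cW: "real (card (W (int h))) \<le> 13870080 * (Z * (p * q)\<^sup>2) / (real h)\<^sup>2 + 4096 * (Z * (p * q)) / h"
      using c1 c2 by linarith
    \<comment> \<open>In the term with h^(-2) the divisor function is replaced by 2 sqrt h, and the
      sum over h still converges. In the term with 1 / h it must be kept and produces the square of
      the harmonic number.\<close>
    have tau: "2 * real (card (dvs (int h))) \<le> 4 * sqrt h" using card_dvs_le_sqrt[of "int h"] h by simp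
    have "2 * real (card (dvs (int h))) * real (card (W (int h))) \<le> 2 * real (card (dvs (int h))) * (13870080 * (Z * (p * q)\<^sup>2) / (real h)\<^sup>2 + 4096 * (Z * (p * q)) / h)"
      using cW by (intro mult_left_mono) auto
    also have "\<dots> = 2 * real (card (dvs (int h))) * (13870080 * (Z * (p * q)\<^sup>2) / (real h)\<^sup>2) + 8192 * (Z * (p * q)) * (real (card (dvs (int h))) / h)"
      by (simp add: algebra_simps)
    also have "2 * real (card (dvs (int h))) * (13870080 * (Z * (p * q)\<^sup>2) / (real h)\<^sup>2) \<le> 4 * sqrt h * (13870080 * (Z * (p * q)\<^sup>2) / (real h)\<^sup>2)"
      using tau pos by (intro mult_right_mono) auto
    also have "\<dots> = 55480320 * (Z * (p * q)\<^sup>2) * (sqrt h / (real h)\<^sup>2)" by simp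
    also have "sqrt h / (real h)\<^sup>2 = real h powr (-(3/2))"
      using h powr_diff[of "real h" "1/2" 2] by (simp add: powr_half_sqrt powr_numeral)
    finally show "2 * real (card (dvs (int h))) * real (card (W (int h)))
        \<le> 55480320 * (Z * (p * q)\<^sup>2) * real h powr (-(3/2)) + 8192 * (Z * (p * q)) * (real (card (dvs (int h))) / real h)" by simp
  qed
  also have "\<dots> = 55480320 * (Z * (p * q)\<^sup>2) * (\<Sum>h=1..n. real h powr (-(3/2))) + 8192 * (Z * (p * q)) * (\<Sum>h=1..n. real (card (dvs (int h))) / real h)"
    by (simp only: sum.distrib sum_distrib_left)
  also have "\<dots> \<le> 55480320 * (Z * (p * q)\<^sup>2) * 3 + 8192 * (Z * (p * q)) * (harm n)\<^sup>2"
    using pos pq by (intro add_mono mult_left_mono sum_powr_three_halves_le sum_card_dvs_div_le) auto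
  also have "(p * q)\<^sup>2 = U1 * U2 * U3 * U4" using p2 q2 by (simp add: power2_eq_square mult_ac)
  also have "p * q = sqrt (U1 * U2 * U3 * U4)" by (simp add: p_def q_def real_sqrt_mult)
  finally show ?thesis by (simp add: n_def)
qed

lemma card_root_tuples_large:
  fixes U1 U2 U3 U4 Z U V1 V2 V3 :: real
    and f :: "int \<times> int \<times> int \<times> int \<times> int \<times> int \<Rightarrow> int \<times> int \<times> int \<times> int \<times> int"
    and g :: "int \<times> int \<times> int \<times> int \<times> int \<times> int \<Rightarrow> int"
  assumes pos: "0 < Z" "0 \<le> V1" "0 \<le> V2" "0 \<le> V3" "Z \<le> U"
    and f: "\<And>t. t \<in> root_tuples U1 U2 U3 U4 Z \<Longrightarrow> f t \<in> nz_ints V1 \<times> nz_ints V2 \<times> nz_ints V3 \<times> nz_ints (32 * Z) \<times> nz_ints (32 * Z)"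
    and inj: "\<And>s t. f s = f t \<Longrightarrow> g s = g t \<Longrightarrow> s = t"
    and g: "\<And>t. t \<in> root_tuples U1 U2 U3 U4 Z \<Longrightarrow> \<bar>real_of_int (g t)\<bar> \<le> U"
    and dvd: "\<And>s t. s \<in> root_tuples U1 U2 U3 U4 Z \<Longrightarrow> t \<in> root_tuples U1 U2 U3 U4 Z \<Longrightarrow> f s = f t \<Longrightarrow>
         fst (snd (snd (snd (f s)))) dvd g s - g t \<and> Z \<le> real_of_int (fst (snd (snd (snd (f s)))))"
  shows "real (card (root_tuples U1 U2 U3 U4 Z)) \<le> 131072 * (Z * (U * V1 * V2 * V3))"
proof -
  let ?T = "root_tuples U1 U2 U3 U4 Z"
  let ?N = "nz_ints V1 \<times> nz_ints V2 \<times> nz_ints V3 \<times> nz_ints (32 * Z) \<times> nz_ints (32 * Z)"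
  have cN: "real (card ?N) \<le> (2 * V1) * ((2 * V2) * ((2 * V3) * ((2 * (32 * Z)) * (2 * (32 * Z)))))"
    by (intro card_Times_le card_nz_ints_le) (use pos in auto)
  have "real (card ?T) \<le> ((2 * V1) * ((2 * V2) * ((2 * V3) * ((2 * (32 * Z)) * (2 * (32 * Z)))))) * (4 * U / Z)"
  proof (rule card_le_mult_fibres[OF finite_root_tuples _ _ cN])
    show "f ` ?T \<subseteq> ?N" using f by blast
    show "0 \<le> 4 * U / Z" using pos by simp
    fix a assume "a \<in> ?N"
    let ?B = "{t \<in> ?T. f t = a}"
    define z where "z = fst (snd (snd (snd a)))"
    show "real (card ?B) \<le> 4 * U / Z"
    proof (cases "?B = {}")
      case True
      show ?thesis unfolding True using pos by simp
    next
      case False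
      then obtain s where s: "s \<in> ?T" "f s = a" by blast
      have Zz: "Z \<le> z" using dvd[OF s(1) s(1) refl] s(2) by (simp add: z_def)
      then have zr: "real_of_int z > 0" using pos by linarith
      then have z: "z > 0" by simp
      have "inj_on g ?B" using inj by (auto simp: inj_on_def)
      then have "card ?B = card (g ` ?B)" by (simp add: card_image)
      moreover have "real (card (g ` ?B)) \<le> 2 * U / z + 2"
      proof (rule card_residue_class_le(2)[OF z])
        show "0 \<le> U" using pos by simp
        fix u assume "u \<in> g ` ?B"
        then obtain s where s: "s \<in> ?T" "f s = a" "u = g s" by blast
        then show "\<bar>real_of_int u\<bar> \<le> U" using g by simp
        fix v assume "v \<in> g ` ?B"
        then obtain t where t: "t \<in> ?T" "f t = a" "v = g t" by blast
        have "f s = f t" using s t by simp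
        then show "z dvd u - v" using dvd[OF s(1) t(1)] s t by (simp add: z_def)
      qed
      moreover have "2 * U / z \<le> 2 * U / Z" using Zz pos by (intro divide_left_mono) auto
      moreover have "2 \<le> 2 * U / Z" using pos by (simp add: le_divide_eq)
      ultimately show ?thesis by simp
    qed
  qed simp
  also have "\<dots> = 131072 * (Z * (U * V1 * V2 * V3))" using pos by simp
  finally show ?thesis .
qed

text \<open>Since U2 \<le> U1 and U4 \<le> U3, the case left over by
  \<open>card_root_tuples_core\<close> has a long u1 or u3. The congruence then fixes u1 modulo z
  because r^2 u2 is invertible, and u3 because u4 is.\<close>

lemma card_root_tuples_ordered:
  fixes U1 U2 U3 U4 Z :: real
  assumes U: "1 \<le> U2" "U2 \<le> U1" "1 \<le> U4" "U4 \<le> U3" and Z: "0 < Z"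
  shows "real (card (root_tuples U1 U2 U3 U4 Z)) \<le>
     166440960 * (Z * (U1 * U2 * U3 * U4)) + 8192 * (Z * sqrt (U1 * U2 * U3 * U4)) * (harm (nat \<lfloor>32 * Z\<rfloor>))\<^sup>2"
proof -
  let ?T = "root_tuples U1 U2 U3 U4 Z"
  have R0: "0 \<le> 8192 * (Z * sqrt (U1 * U2 * U3 * U4)) * (harm (nat \<lfloor>32 * Z\<rfloor>))\<^sup>2" using U Z by simp
  have P0: "0 \<le> Z * (U1 * U2 * U3 * U4)" using U Z by simp
  consider "U1 < Z \<and> U3 < Z" | "Z \<le> U1" | "Z \<le> U3" by linarith
  then show ?thesis
  proof cases
    case 1
    then show ?thesis using card_root_tuples_core[OF U] by simp
  next
    case 2
    \<comment> \<open>The component r + 1 stands for r because \<open>nz_ints\<close> omits 0; r < z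
      keeps it within 32 Z.\<close>
    let ?f = "\<lambda>(u1::int, u2::int, u3::int, u4::int, z::int, r::int). (u2, u3, u4, z, r + 1)"
    let ?g = "\<lambda>(u1::int, u2::int, u3::int, u4::int, z::int, r::int). u1"
    have "real (card ?T) \<le> 131072 * (Z * (U1 * U2 * U3 * U4))"
    proof (rule card_root_tuples_large[where f = ?f and g = ?g])
      fix t assume t: "t \<in> ?T"
      obtain u1 u2 u3 u4 z r where te: "t = (u1, u2, u3, u4, z, r)" by (cases t) auto
      have T: "u2 \<in> nz_ints U2" "u3 \<in> nz_ints U3" "u4 \<in> nz_ints U4" "Z \<le> z" "z \<le> 32 * Z" "0 \<le> r" "r < z" "\<bar>real_of_int u1\<bar> \<le> U1"
        using t by (simp_all add: te root_tuples_def nz_ints_def)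
      have "real_of_int r + 1 \<le> 32 * Z" using T(5,7) by linarith
      then show "?f t \<in> nz_ints U2 \<times> nz_ints U3 \<times> nz_ints U4 \<times> nz_ints (32 * Z) \<times> nz_ints (32 * Z)"
        using T by (simp add: te nz_ints_def)
      show "\<bar>real_of_int (?g t)\<bar> \<le> U1" using T by (simp add: te)
      fix s assume s: "s \<in> ?T" "?f s = ?f t"
      obtain v1 where se: "s = (v1, u2, u3, u4, z, r)" using s(2) te by (cases s) auto
      have d: "z dvd r\<^sup>2 * (u1 * u2) - u3 * u4" "z dvd r\<^sup>2 * (v1 * u2) - u3 * u4" "coprime z (u1 * u2 * (u3 * u4))"
        using t s(1) by (simp_all add: te se root_tuples_def)
      have c: "coprime r z" using root_tuples_coprime_root t te by blast
      have "z dvd (r\<^sup>2 * (v1 * u2) - u3 * u4) - (r\<^sup>2 * (u1 * u2) - u3 * u4)" using d(2,1) by (rule dvd_diff)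
      also have "\<dots> = (v1 - u1) * (r\<^sup>2 * u2)" by (simp add: algebra_simps)
      finally have "z dvd (v1 - u1) * (r\<^sup>2 * u2)" .
      moreover have "coprime z (r\<^sup>2 * u2)" using c d(3) by (simp add: coprime_commute)
      ultimately have "z dvd v1 - u1" using coprime_dvd_mult_left_iff by blast
      then show "fst (snd (snd (snd (?f s)))) dvd ?g s - ?g t \<and> Z \<le> real_of_int (fst (snd (snd (snd (?f s)))))"
        using T(4) by (simp add: se te)
    qed (use U Z 2 in auto)
    then show ?thesis using R0 P0 by linarith
  next
    case 3
    let ?f = "\<lambda>(u1::int, u2::int, u3::int, u4::int, z::int, r::int). (u1, u2, u4, z, r + 1)"
    let ?g = "\<lambda>(u1::int, u2::int, u3::int, u4::int, z::int, r::int). u3"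
    have "real (card ?T) \<le> 131072 * (Z * (U3 * U1 * U2 * U4))"
    proof (rule card_root_tuples_large[where f = ?f and g = ?g])
      fix t assume t: "t \<in> ?T"
      obtain u1 u2 u3 u4 z r where te: "t = (u1, u2, u3, u4, z, r)" by (cases t) auto
      have T: "u1 \<in> nz_ints U1" "u2 \<in> nz_ints U2" "u4 \<in> nz_ints U4" "Z \<le> z" "z \<le> 32 * Z" "0 \<le> r" "r < z" "\<bar>real_of_int u3\<bar> \<le> U3"
        using t by (simp_all add: te root_tuples_def nz_ints_def)
      have "real_of_int r + 1 \<le> 32 * Z" using T(5,7) by linarith
      then show "?f t \<in> nz_ints U1 \<times> nz_ints U2 \<times> nz_ints U4 \<times> nz_ints (32 * Z) \<times> nz_ints (32 * Z)"
        using T by (simp add: te nz_ints_def)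
      show "\<bar>real_of_int (?g t)\<bar> \<le> U3" using T by (simp add: te)
      fix s assume s: "s \<in> ?T" "?f s = ?f t"
      obtain v3 where se: "s = (u1, u2, v3, u4, z, r)" using s(2) te by (cases s) auto
      have d: "z dvd r\<^sup>2 * (u1 * u2) - u3 * u4" "z dvd r\<^sup>2 * (u1 * u2) - v3 * u4" "coprime z (u1 * u2 * (u3 * u4))"
        using t s(1) by (simp_all add: te se root_tuples_def)
      have "z dvd (r\<^sup>2 * (u1 * u2) - u3 * u4) - (r\<^sup>2 * (u1 * u2) - v3 * u4)" using d(1,2) by (rule dvd_diff)
      also have "\<dots> = (v3 - u3) * u4" by (simp add: algebra_simps)
      finally have "z dvd (v3 - u3) * u4" .
      moreover have "coprime z u4" using d(3) by simp
      ultimately have "z dvd v3 - u3" using coprime_dvd_mult_left_iff by blast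
      then show "fst (snd (snd (snd (?f s)))) dvd ?g s - ?g t \<and> Z \<le> real_of_int (fst (snd (snd (snd (?f s)))))"
        using T(4) by (simp add: se te)
    qed (use U Z 3 in auto)
    then have "real (card ?T) \<le> 131072 * (Z * (U1 * U2 * U3 * U4))" by (simp add: mult_ac)
    then show ?thesis using R0 P0 by linarith
  qed
qed

lemma card_root_tuples_swap12: "card (root_tuples U1 U2 U3 U4 Z) = card (root_tuples U2 U1 U3 U4 Z)"
proof -
  let ?h = "\<lambda>(u1::int, u2::int, u3::int, u4::int, z::int, r::int). (u2, u1, u3, u4, z, r)"
  have "root_tuples U2 U1 U3 U4 Z = ?h ` root_tuples U1 U2 U3 U4 Z"
  proof (intro equalityI subsetI)
    fix t assume t: "t \<in> root_tuples U2 U1 U3 U4 Z"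
    then have "?h t \<in> root_tuples U1 U2 U3 U4 Z" by (auto simp: root_tuples_def coprime_commute mult.commute)
    moreover have "t = ?h (?h t)" by (cases t) auto
    ultimately show "t \<in> ?h ` root_tuples U1 U2 U3 U4 Z" by blast
  qed (auto simp: root_tuples_def coprime_commute mult.commute)
  moreover have "inj_on ?h (root_tuples U1 U2 U3 U4 Z)" by (auto simp: inj_on_def)
  ultimately show ?thesis by (simp add: card_image)
qed

lemma card_root_tuples_swap34: "card (root_tuples U1 U2 U3 U4 Z) = card (root_tuples U1 U2 U4 U3 Z)"
proof -
  let ?h = "\<lambda>(u1::int, u2::int, u3::int, u4::int, z::int, r::int). (u1, u2, u4, u3, z, r)"
  have "root_tuples U1 U2 U4 U3 Z = ?h ` root_tuples U1 U2 U3 U4 Z"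
  proof (intro equalityI subsetI)
    fix t assume t: "t \<in> root_tuples U1 U2 U4 U3 Z"
    then have "?h t \<in> root_tuples U1 U2 U3 U4 Z" by (auto simp: root_tuples_def coprime_commute mult.commute)
    moreover have "t = ?h (?h t)" by (cases t) auto
    ultimately show "t \<in> ?h ` root_tuples U1 U2 U3 U4 Z" by blast
  qed (auto simp: root_tuples_def coprime_commute mult.commute)
  moreover have "inj_on ?h (root_tuples U1 U2 U3 U4 Z)" by (auto simp: inj_on_def)
  ultimately show ?thesis by (simp add: card_image)
qed

lemma card_root_tuples_le:
  fixes U1 U2 U3 U4 Z :: real
  assumes U: "1 \<le> U1" "1 \<le> U2" "1 \<le> U3" "1 \<le> U4" and Z: "0 < Z"
  shows "real (card (root_tuples U1 U2 U3 U4 Z)) \<le>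
     166440960 * (Z * (U1 * U2 * U3 * U4)) + 8192 * (Z * sqrt (U1 * U2 * U3 * U4)) * (harm (nat \<lfloor>32 * Z\<rfloor>))\<^sup>2"
proof -
  define M where "M = (\<lambda>P. 166440960 * (Z * P) + 8192 * (Z * sqrt P) * (harm (nat \<lfloor>32 * Z\<rfloor>))\<^sup>2)"
  have 1: "real (card (root_tuples U1 U2 U3 U4 Z)) \<le> M (U1 * U2 * U3 * U4)"
    if "1 \<le> U1" "1 \<le> U2" "1 \<le> U4" "U4 \<le> U3" for U1 U2 U3 U4
  proof (cases "U2 \<le> U1")
    case True
    then show ?thesis unfolding M_def using that Z by (intro card_root_tuples_ordered) auto
  next
    case False
    then have "real (card (root_tuples U2 U1 U3 U4 Z)) \<le> M (U2 * U1 * U3 * U4)"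
      unfolding M_def using that Z by (intro card_root_tuples_ordered) auto
    then show ?thesis by (simp add: card_root_tuples_swap12[of U1] mult.commute[of U1])
  qed
  show ?thesis
  proof (cases "U4 \<le> U3")
    case True
    then show ?thesis using 1[of U1 U2 U4 U3] U by (simp add: M_def)
  next
    case False
    then have "real (card (root_tuples U1 U2 U4 U3 Z)) \<le> M (U1 * U2 * U4 * U3)" using 1[of U1 U2 U3 U4] U by simp
    moreover have "U1 * U2 * U4 * U3 = U1 * U2 * U3 * U4" by simp
    ultimately show ?thesis by (simp only: M_def card_root_tuples_swap34[of U1 U2 U3 U4])
  qed
qed

section \<open>Torsor variables and a single pair of indices\<close>

text \<open>With \<open>w\<^sub>i = u\<^sub>i * (product of the d\<^sub>i\<^sub>j)\<close>, the numbers \<open>d\<^sub>i\<^sub>j\<close> are the gcds of the coordinates of a primitive point \<open>w\<close> of the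
  plane \<open>w\<^sub>1 + w\<^sub>2 + w\<^sub>3 + w\<^sub>4 = 0\<close>.\<close>

definition torsor :: "int \<Rightarrow> int \<Rightarrow> int \<Rightarrow> int \<Rightarrow> int \<Rightarrow> int \<Rightarrow> int \<Rightarrow> int \<Rightarrow> int \<Rightarrow> int \<Rightarrow> bool" where
  "torsor u1 u2 u3 u4 d12 d13 d14 d23 d24 d34 \<longleftrightarrow>
     (u1 \<noteq> 0 \<and> u2 \<noteq> 0 \<and> u3 \<noteq> 0 \<and> u4 \<noteq> 0) \<and>
     (d12 > 0 \<and> d13 > 0 \<and> d14 > 0 \<and> d23 > 0 \<and> d24 > 0 \<and> d34 > 0) \<and>
     (coprime u1 u2 \<and> coprime u1 u3 \<and> coprime u1 u4 \<and> coprime u2 u3 \<and> coprime u2 u4 \<and> coprime u3 u4) \<and>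
     (coprime d12 d13 \<and> coprime d12 d14 \<and> coprime d12 d23 \<and> coprime d12 d24 \<and> coprime d12 d34 \<and>
      coprime d13 d14 \<and> coprime d13 d23 \<and> coprime d13 d24 \<and> coprime d13 d34 \<and>
      coprime d14 d23 \<and> coprime d14 d24 \<and> coprime d14 d34 \<and>
      coprime d23 d24 \<and> coprime d23 d34 \<and> coprime d24 d34) \<and>
     (coprime u1 d23 \<and> coprime u1 d24 \<and> coprime u1 d34 \<and> coprime u2 d13 \<and> coprime u2 d14 \<and> coprime u2 d34 \<and>
      coprime u3 d12 \<and> coprime u3 d14 \<and> coprime u3 d24 \<and> coprime u4 d12 \<and> coprime u4 d13 \<and> coprime u4 d23) \<and>
     d12 * d13 * d14 * u1 + d12 * d23 * d24 * u2 + d13 * d23 * d34 * u3 + d14 * d24 * d34 * u4 = 0 \<and>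
     d12 * d13 * d14 * u1 + d12 * d23 * d24 * u2 \<noteq> 0 \<and>
     d12 * d13 * d14 * u1 + d13 * d23 * d34 * u3 \<noteq> 0 \<and>
     d12 * d13 * d14 * u1 + d14 * d24 * d34 * u4 \<noteq> 0"

lemma torsor_swap_23:
  assumes "torsor u1 u2 u3 u4 d12 d13 d14 d23 d24 d34"
  shows "torsor u1 u3 u2 u4 d13 d12 d14 d23 d34 d24"
proof -
  have e: "d13 * d12 * d14 * u1 = d12 * d13 * d14 * u1" "d14 * d34 * d24 * u4 = d14 * d24 * d34 * u4" by simp_all
  have s: "d12 * d13 * d14 * u1 + d12 * d23 * d24 * u2 + d13 * d23 * d34 * u3 + d14 * d24 * d34 * u4 = 0"
     "d12 * d13 * d14 * u1 + d12 * d23 * d24 * u2 \<noteq> 0" "d12 * d13 * d14 * u1 + d13 * d23 * d34 * u3 \<noteq> 0"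
     "d12 * d13 * d14 * u1 + d14 * d24 * d34 * u4 \<noteq> 0" using assms unfolding torsor_def by blast+
  have "d13 * d12 * d14 * u1 + d13 * d23 * d34 * u3 + d12 * d23 * d24 * u2 + d14 * d34 * d24 * u4 = 0"
    "d13 * d12 * d14 * u1 + d13 * d23 * d34 * u3 \<noteq> 0" "d13 * d12 * d14 * u1 + d12 * d23 * d24 * u2 \<noteq> 0"
    "d13 * d12 * d14 * u1 + d14 * d34 * d24 * u4 \<noteq> 0" unfolding e using s by linarith+
  then show ?thesis using assms unfolding torsor_def by (simp only: coprime_commute simp_thms)
qed

text \<open>The relabelling of the indices by the permutation (1 3)(2 4).\<close>

lemma torsor_swap_halves:
  assumes "torsor u1 u2 u3 u4 d12 d13 d14 d23 d24 d34"
  shows "torsor u3 u4 u1 u2 d34 d13 d23 d14 d24 d12"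
proof -
  have e: "d34 * d13 * d23 * u3 = d13 * d23 * d34 * u3" "d34 * d14 * d24 * u4 = d14 * d24 * d34 * u4"
    "d13 * d14 * d12 * u1 = d12 * d13 * d14 * u1" "d23 * d24 * d12 * u2 = d12 * d23 * d24 * u2" by simp_all
  have s: "d12 * d13 * d14 * u1 + d12 * d23 * d24 * u2 + d13 * d23 * d34 * u3 + d14 * d24 * d34 * u4 = 0"
     "d12 * d13 * d14 * u1 + d12 * d23 * d24 * u2 \<noteq> 0" "d12 * d13 * d14 * u1 + d13 * d23 * d34 * u3 \<noteq> 0"
     "d12 * d13 * d14 * u1 + d14 * d24 * d34 * u4 \<noteq> 0" using assms unfolding torsor_def by blast+
  have "d34 * d13 * d23 * u3 + d34 * d14 * d24 * u4 + d13 * d14 * d12 * u1 + d23 * d24 * d12 * u2 = 0"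
    "d34 * d13 * d23 * u3 + d34 * d14 * d24 * u4 \<noteq> 0" "d34 * d13 * d23 * u3 + d13 * d14 * d12 * u1 \<noteq> 0"
    "d34 * d13 * d23 * u3 + d23 * d24 * d12 * u2 \<noteq> 0" unfolding e using s by linarith+
  then show ?thesis using assms unfolding torsor_def by (simp only: coprime_commute simp_thms)
qed

text \<open>The vanishing sum reads d12 A + d34 B = 0 with d12 and d34 coprime, so A = d34 z and B =
  - d12 z. These are the two expressions for z = (w1 + w2) / (d12 d34), which is nonzero because w1
  + w2 is.\<close>

lemma torsor_edge:
  assumes "torsor u1 u2 u3 u4 d12 d13 d14 d23 d24 d34"
  obtains z where "z \<noteq> 0" "d34 * z = d13 * d14 * u1 + d23 * d24 * u2" "d12 * z + d13 * d23 * u3 + d14 * d24 * u4 = 0"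
    "d12 * d34 * z = d12 * d13 * d14 * u1 + d12 * d23 * d24 * u2"
proof -
  define A where "A = d13 * d14 * u1 + d23 * d24 * u2"
  define B where "B = d13 * d23 * u3 + d14 * d24 * u4"
  have AB: "d12 * A + d34 * B = 0" using assms unfolding torsor_def A_def B_def by (simp add: algebra_simps)
  have c: "coprime d34 d12" "d34 > 0" "d12 > 0" using assms unfolding torsor_def by (simp_all add: coprime_commute)
  have "d12 * A = d34 * (- B)" using AB by simp
  then have "d34 dvd d12 * A" by simp
  then have "d34 dvd A" using c(1) coprime_dvd_mult_right_iff by blast
  then obtain z where z: "A = d34 * z" by blast
  have "d34 * (d12 * z + B) = 0" using AB z by (simp add: algebra_simps)
  then have 2: "d12 * z + B = 0" using c(2) by simp
  have "d12 * A \<noteq> 0" using assms unfolding torsor_def A_def by (simp add: algebra_simps)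
  then have "z \<noteq> 0" using z by auto
  moreover have "d12 * d34 * z = d12 * A" using z by simp
  ultimately show thesis using that[of z] z 2 unfolding A_def B_def by (simp add: algebra_simps)
qed

text \<open>Here Wi, Wj, Wl bound w1, w2, w4, and S bounds w1 + w2, up to factors 2. The numbers are
  what dyadic ranges leave: 40108032 = 32 * 1253376, and 2048 = 64 * 32 turns the size condition of
  \<open>card_edge\<close> into one on Wi^2.\<close>

lemma card_torsor_edge:
  fixes Om :: "(int \<times> int \<times> int \<times> int \<times> int \<times> int \<times> int \<times> int \<times> int \<times> int) set"
    and Wi Wj Wl S D12 D13 D14 D23 D24 D34 \<sigma> :: real
  assumes fin: "finite Om" and pos: "0 < Wi" "0 < Wj" "0 < Wl" "0 < S" "1 \<le> \<sigma>"
    and D: "1 \<le> D12" "1 \<le> D13" "1 \<le> D14" "1 \<le> D23" "1 \<le> D24" "1 \<le> D34"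
    and Om: "\<And>u1 u2 u3 u4 d12 d13 d14 d23 d24 d34. (u1, u2, u3, u4, d12, d13, d14, d23, d24, d34) \<in> Om \<Longrightarrow>
      torsor u1 u2 u3 u4 d12 d13 d14 d23 d24 d34 \<and>
      D12 \<le> d12 \<and> d12 < 2 * D12 \<and> D13 \<le> d13 \<and> d13 < 2 * D13 \<and> D14 \<le> d14 \<and> d14 < 2 * D14 \<and>
      D23 \<le> d23 \<and> d23 < 2 * D23 \<and> D24 \<le> d24 \<and> d24 < 2 * D24 \<and> D34 \<le> d34 \<and> d34 < 2 * D34 \<and>
      Wi \<le> \<bar>real_of_int (d12 * d13 * d14 * u1)\<bar> \<and> \<bar>real_of_int (d12 * d13 * d14 * u1)\<bar> < 2 * Wi \<and>
      \<bar>real_of_int (d12 * d23 * d24 * u2)\<bar> \<le> 2 * Wj \<and> \<bar>real_of_int (d14 * d24 * d34 * u4)\<bar> \<le> 2 * Wl \<and>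
      \<bar>real_of_int (d12 * d13 * d14 * u1 + d12 * d23 * d24 * u2)\<bar> \<le> 2 * S"
    and le: "Wi\<^sup>2 \<le> 2048 * \<sigma> ^ 3 * (S * Wj)"
  shows "real (card Om) \<le> 40108032 * \<sigma> * (S * Wj) * (1 / D12\<^sup>2 + 4 * Wl / (D12 * D13 * D14 * D23 * D24 * D34))"
proof -
  \<comment> \<open>The order of \<open>card_edge\<close>: p = d34, q = z, then x = (d13, d14, u1),
    y = (d23, d24, u2) and (f, s, t) = (d12, u3, u4).\<close>
  let ?h = "\<lambda>(u1::int, u2::int, u3::int, u4::int, d12::int, d13::int, d14::int, d23::int, d24::int, d34::int).
     (d34, (d13 * d14 * u1 + d23 * d24 * u2) div d34, d13, d14, u1, d23, d24, u2, d12, u3, u4)"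
  have Dp: "0 < D12" "0 < D13" "0 < D14" "0 < D23" "0 < D24" "0 < D34" using D by linarith+
  have "real (card (?h ` Om)) \<le> 1253376 * \<sigma> * (2 * D34) * (2 * S / (D12 * D34)) * ((2 * D23) * (2 * D24) * (2 * Wj / (D12 * D23 * D24)))
      * (1 + (2 * D12) * (2 * Wl / (D14 * D24 * D34)) / (D13 * D23))"
  \<comment> \<open>With each d in a dyadic range, the size of u1 lies between Wi / 8 and 2 Wi over
    D12 D13 D14; this explains the factor 16 in \<open>card_edge\<close>.\<close>
  proof (rule card_edge[where ?X1.0 = D13 and ?X2.0 = D14 and ?X3.0 = "Wi / (8 * (D12 * D13 * D14))"])
    show "finite (?h ` Om)" using fin by simp
    show "(D13 * D14 * (Wi / (8 * (D12 * D13 * D14))))\<^sup>2 \<le> \<sigma> ^ 3 * (2 * D34) * (2 * S / (D12 * D34)) * ((2 * D23) * (2 * D24) * (2 * Wj / (D12 * D23 * D24)))"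
    proof -
      have "(D13 * D14 * (Wi / (8 * (D12 * D13 * D14))))\<^sup>2 = Wi\<^sup>2 / (64 * D12\<^sup>2)" using Dp by (simp add: power2_eq_square)
      also have "\<dots> \<le> 2048 * \<sigma> ^ 3 * (S * Wj) / (64 * D12\<^sup>2)" using le by (intro divide_right_mono) auto
      also have "\<dots> = \<sigma> ^ 3 * (2 * D34) * (2 * S / (D12 * D34)) * ((2 * D23) * (2 * D24) * (2 * Wj / (D12 * D23 * D24)))"
        using Dp by (simp add: power2_eq_square)
      finally show ?thesis .
    qed
    fix p q x1 x2 x3 y1 y2 y3 f s t assume "(p, q, x1, x2, x3, y1, y2, y3, f, s, t) \<in> ?h ` Om"
    then have m: "(x3, y3, s, t, f, x1, x2, y1, y2, p) \<in> Om" and q: "q = (x1 * x2 * x3 + y1 * y2 * y3) div p" by auto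
    note b = Om[OF m]
    have tor: "torsor x3 y3 s t f x1 x2 y1 y2 p" using b by blast
    obtain z where z: "z \<noteq> 0" "p * z = x1 * x2 * x3 + y1 * y2 * y3" "f * z + x1 * y1 * s + x2 * y2 * t = 0"
       "f * p * z = f * x1 * x2 * x3 + f * y1 * y2 * y3" using torsor_edge[OF tor] by metis
    have dp: "real_of_int f > 0" "real_of_int x1 > 0" "real_of_int x2 > 0" "real_of_int y1 > 0" "real_of_int y2 > 0" "real_of_int p > 0"
       "x3 \<noteq> 0" "y3 \<noteq> 0" using tor unfolding torsor_def by simp_all
    have qz: "q = z" using q z(2)[symmetric] dp by simp
    have l: "D12 \<le> f" "D13 \<le> x1" "D14 \<le> x2" "D23 \<le> y1" "D24 \<le> y2" "D34 \<le> p" using b by blast+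
    have r: "f < 2 * D12" "x1 < 2 * D13" "x2 < 2 * D14" "y1 < 2 * D23" "y2 < 2 * D24" "p < 2 * D34" using b by blast+
    have w1: "Wi \<le> f * x1 * x2 * \<bar>real_of_int x3\<bar>" "f * x1 * x2 * \<bar>real_of_int x3\<bar> < 2 * Wi"
      using b dp by (simp_all add: abs_mult)
    have w2: "f * y1 * y2 * \<bar>real_of_int y3\<bar> \<le> 2 * Wj" and w4: "x2 * y2 * p * \<bar>real_of_int t\<bar> \<le> 2 * Wl"
      using b dp by (simp_all add: abs_mult)
    have "f * p * \<bar>real_of_int z\<bar> = \<bar>real_of_int (f * p * z)\<bar>" using dp by (simp add: abs_mult)
    also have "\<dots> \<le> 2 * S" unfolding z(4) using b by blast
    finally have wz: "f * p * \<bar>real_of_int z\<bar> \<le> 2 * S" .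
    have up: "x \<le> K / Q" if "Q * x \<le> K" "0 < Q" for x K Q :: real using that by (simp add: field_simps)
    have z_ub: "\<bar>real_of_int z\<bar> \<le> 2 * S / (D12 * D34)"
    proof (rule up)
      have "D12 * D34 * \<bar>real_of_int z\<bar> \<le> f * p * \<bar>real_of_int z\<bar>" using l Dp dp unfolding of_int_mult by (intro mult_right_mono mult_mono) auto
      then show "D12 * D34 * \<bar>real_of_int z\<bar> \<le> 2 * S" using wz by linarith
    qed (use Dp in simp)
    have y3_ub: "\<bar>real_of_int y3\<bar> \<le> 2 * Wj / (D12 * D23 * D24)"
    proof (rule up)
      have "D12 * D23 * D24 * \<bar>real_of_int y3\<bar> \<le> f * y1 * y2 * \<bar>real_of_int y3\<bar>" using l Dp dp unfolding of_int_mult by (intro mult_right_mono mult_mono) auto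
      then show "D12 * D23 * D24 * \<bar>real_of_int y3\<bar> \<le> 2 * Wj" using w2 by linarith
    qed (use Dp in simp)
    have t_ub: "\<bar>real_of_int t\<bar> \<le> 2 * Wl / (D14 * D24 * D34)"
    proof (rule up)
      have "D14 * D24 * D34 * \<bar>real_of_int t\<bar> \<le> x2 * y2 * p * \<bar>real_of_int t\<bar>" using l Dp dp unfolding of_int_mult by (intro mult_right_mono mult_mono) auto
      then show "D14 * D24 * D34 * \<bar>real_of_int t\<bar> \<le> 2 * Wl" using w4 by linarith
    qed (use Dp in simp)
    have x3_ub: "\<bar>real_of_int x3\<bar> \<le> 2 * Wi / (D12 * D13 * D14)"
    proof (rule up)
      have "D12 * D13 * D14 * \<bar>real_of_int x3\<bar> \<le> f * x1 * x2 * \<bar>real_of_int x3\<bar>" using l Dp dp unfolding of_int_mult by (intro mult_right_mono mult_mono) auto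
      then show "D12 * D13 * D14 * \<bar>real_of_int x3\<bar> \<le> 2 * Wi" using w1 by linarith
    qed (use Dp in simp)
    have x3_lb: "Wi / (8 * (D12 * D13 * D14)) \<le> \<bar>real_of_int x3\<bar>"
    proof -
      have "f * x1 * x2 * \<bar>real_of_int x3\<bar> \<le> (2 * D12) * (2 * D13) * (2 * D14) * \<bar>real_of_int x3\<bar>"
        using r dp Dp unfolding of_int_mult by (intro mult_right_mono mult_mono) auto
      then have "Wi \<le> (8 * (D12 * D13 * D14)) * \<bar>real_of_int x3\<bar>" using w1(1) by linarith
      then show ?thesis using Dp by (simp add: field_simps)
    qed
    have m_lb: "D13 * D23 \<le> \<bar>real_of_int (x1 * y1)\<bar>"
    proof -
      have "D13 * D23 \<le> real_of_int x1 * real_of_int y1" using l Dp dp by (intro mult_mono) auto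
      then show ?thesis using dp by (simp add: abs_mult)
    qed
    have c1: "coprime (x1 * x2 * x3) (y1 * y2 * y3)" "coprime (x1 * y1) (x2 * y2)" "coprime s t"
      using tor unfolding torsor_def by (simp_all add: coprime_commute)
    have nz: "p \<in> nz_ints (2 * D34)" "x1 \<in> nz_ints (16 * D13)" "x2 \<in> nz_ints (16 * D14)" "y1 \<in> nz_ints (2 * D23)" "y2 \<in> nz_ints (2 * D24)"
      using r dp Dp by (auto simp: nz_ints_def)
    have "16 * (Wi / (8 * (D12 * D13 * D14))) = 2 * Wi / (D12 * D13 * D14)" by simp
    then have nz2: "x3 \<in> nz_ints (16 * (Wi / (8 * (D12 * D13 * D14))))" "y3 \<in> nz_ints (2 * Wj / (D12 * D23 * D24))" "q \<in> nz_ints (2 * S / (D12 * D34))"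
      using x3_ub y3_ub z_ub dp z(1) qz by (simp_all add: nz_ints_def)
    have lb: "D13 \<le> \<bar>real_of_int x1\<bar>" "D14 \<le> \<bar>real_of_int x2\<bar>" "\<bar>real_of_int f\<bar> \<le> 2 * D12" using l r dp by linarith+
    show "p * q = x1 * x2 * x3 + y1 * y2 * y3 \<and> coprime (x1 * x2 * x3) (y1 * y2 * y3) \<and>
        f * q + x1 * y1 * s + x2 * y2 * t = 0 \<and> coprime (x1 * y1) (x2 * y2) \<and> coprime s t \<and>
        p \<in> nz_ints (2 * D34) \<and> q \<in> nz_ints (2 * S / (D12 * D34)) \<and> x1 \<in> nz_ints (16 * D13) \<and> x2 \<in> nz_ints (16 * D14) \<and>
        x3 \<in> nz_ints (16 * (Wi / (8 * (D12 * D13 * D14)))) \<and>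
        D13 \<le> \<bar>real_of_int x1\<bar> \<and> D14 \<le> \<bar>real_of_int x2\<bar> \<and> Wi / (8 * (D12 * D13 * D14)) \<le> \<bar>real_of_int x3\<bar> \<and>
        y1 \<in> nz_ints (2 * D23) \<and> y2 \<in> nz_ints (2 * D24) \<and> y3 \<in> nz_ints (2 * Wj / (D12 * D23 * D24)) \<and>
        \<bar>real_of_int f\<bar> \<le> 2 * D12 \<and> \<bar>real_of_int t\<bar> \<le> 2 * Wl / (D14 * D24 * D34) \<and> D13 * D23 \<le> \<bar>real_of_int (x1 * y1)\<bar>"
      using z(2,3) c1 nz nz2 lb x3_lb t_ub m_lb unfolding qz by blast
  qed (use pos Dp D in auto)
  also have "\<dots> = 40108032 * \<sigma> * (S * Wj) * (1 / D12\<^sup>2 + 4 * Wl / (D12 * D13 * D14 * D23 * D24 * D34))"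
    using Dp by (simp add: power2_eq_square) (simp add: field_simps)
  also have "card (?h ` Om) = card Om" by (rule card_image) (auto simp: inj_on_def)
  finally show ?thesis .
qed

section \<open>Dyadic boxes: bounds from a single pair of indices\<close>

text \<open>The coordinates of w are thought of as decreasing in absolute value. For the last one
  only an upper bound is kept, since its size is not a parameter of the box. The lower bound for w1
  + w4 makes the quotient z of the pair (1, 4) comparable to W / (d14 d23).\<close>

definition torsor_box :: "real \<Rightarrow> real \<Rightarrow> real \<Rightarrow> real \<Rightarrow> real \<Rightarrow> real \<Rightarrow> real \<Rightarrow> real \<Rightarrow> real \<Rightarrow>
    (int \<times> int \<times> int \<times> int \<times> int \<times> int \<times> int \<times> int \<times> int \<times> int) set" where
  "torsor_box W W2 V D12 D13 D14 D23 D24 D34 = {(u1, u2, u3, u4, d12, d13, d14, d23, d24, d34).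
      torsor u1 u2 u3 u4 d12 d13 d14 d23 d24 d34 \<and>
      (D12 \<le> real_of_int d12 \<and> real_of_int d12 < 2 * D12) \<and> (D13 \<le> real_of_int d13 \<and> real_of_int d13 < 2 * D13) \<and> (D14 \<le> real_of_int d14 \<and> real_of_int d14 < 2 * D14) \<and>
      (D23 \<le> real_of_int d23 \<and> real_of_int d23 < 2 * D23) \<and> (D24 \<le> real_of_int d24 \<and> real_of_int d24 < 2 * D24) \<and> (D34 \<le> real_of_int d34 \<and> real_of_int d34 < 2 * D34) \<and>
      (W \<le> \<bar>real_of_int (d12 * d13 * d14 * u1)\<bar> \<and> \<bar>real_of_int (d12 * d13 * d14 * u1)\<bar> < 2 * W) \<and>
      (W2 \<le> \<bar>real_of_int (d12 * d23 * d24 * u2)\<bar> \<and> \<bar>real_of_int (d12 * d23 * d24 * u2)\<bar> < 2 * W2) \<and>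
      (V \<le> \<bar>real_of_int (d13 * d23 * d34 * u3)\<bar> \<and> \<bar>real_of_int (d13 * d23 * d34 * u3)\<bar> < 2 * V) \<and>
      \<bar>real_of_int (d14 * d24 * d34 * u4)\<bar> \<le> 2 * V \<and>
      W / 2 \<le> \<bar>real_of_int (d12 * d13 * d14 * u1 + d14 * d24 * d34 * u4)\<bar>}"

lemma abs_int_factor_le:
  fixes x y :: int and K :: real
  assumes "x dvd y" "y \<noteq> 0" "\<bar>real_of_int y\<bar> \<le> K"
  shows "x \<in> nz_ints K"
proof -
  have "\<bar>x\<bar> \<le> \<bar>y\<bar>" by (rule dvd_imp_le_int[OF assms(2,1)])
  then have "\<bar>real_of_int x\<bar> \<le> \<bar>real_of_int y\<bar>" by linarith
  moreover have "x \<noteq> 0" using assms by auto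
  ultimately show ?thesis using assms(3) by (simp add: nz_ints_def)
qed

lemma finite_torsor_box [simp]: "finite (torsor_box W W2 V D12 D13 D14 D23 D24 D34)"
proof (rule finite_subset)
  let ?B = "torsor_box W W2 V D12 D13 D14 D23 D24 D34"
  define K where "K = 2 * \<bar>W\<bar> + 2 * \<bar>W2\<bar> + 2 * \<bar>V\<bar>"
  let ?N = "nz_ints K"
  show "?B \<subseteq> ?N \<times> ?N \<times> ?N \<times> ?N \<times> ?N \<times> ?N \<times> ?N \<times> ?N \<times> ?N \<times> ?N"
  proof
    fix t assume t: "t \<in> ?B"
    obtain u1 u2 u3 u4 d12 d13 d14 d23 d24 d34 where te: "t = (u1, u2, u3, u4, d12, d13, d14, d23, d24, d34)"
      by (metis prod.collapse)
    have b: "\<bar>real_of_int (d12 * d13 * d14 * u1)\<bar> < 2 * W" "\<bar>real_of_int (d12 * d23 * d24 * u2)\<bar> < 2 * W2"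
      "\<bar>real_of_int (d13 * d23 * d34 * u3)\<bar> < 2 * V" "\<bar>real_of_int (d14 * d24 * d34 * u4)\<bar> \<le> 2 * V"
      and tor: "torsor u1 u2 u3 u4 d12 d13 d14 d23 d24 d34"
      using t unfolding te torsor_box_def by blast+
    have K: "\<bar>real_of_int (d12 * d13 * d14 * u1)\<bar> \<le> K" "\<bar>real_of_int (d12 * d23 * d24 * u2)\<bar> \<le> K"
      "\<bar>real_of_int (d13 * d23 * d34 * u3)\<bar> \<le> K" "\<bar>real_of_int (d14 * d24 * d34 * u4)\<bar> \<le> K"
      using b unfolding K_def by linarith+
    have nz: "d12 * d13 * d14 * u1 \<noteq> 0" "d12 * d23 * d24 * u2 \<noteq> 0" "d13 * d23 * d34 * u3 \<noteq> 0" "d14 * d24 * d34 * u4 \<noteq> 0"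
      using tor unfolding torsor_def by simp_all
    have "u1 \<in> ?N" "u2 \<in> ?N" "u3 \<in> ?N" "u4 \<in> ?N" "d12 \<in> ?N" "d13 \<in> ?N" "d14 \<in> ?N" "d23 \<in> ?N" "d24 \<in> ?N" "d34 \<in> ?N"
      by (rule abs_int_factor_le[OF _ nz(1) K(1)], simp) (rule abs_int_factor_le[OF _ nz(2) K(2)], simp,
          rule abs_int_factor_le[OF _ nz(3) K(3)], simp, rule abs_int_factor_le[OF _ nz(4) K(4)], simp,
          rule abs_int_factor_le[OF _ nz(1) K(1)], simp, rule abs_int_factor_le[OF _ nz(1) K(1)], simp,
          rule abs_int_factor_le[OF _ nz(1) K(1)], simp, rule abs_int_factor_le[OF _ nz(2) K(2)], simp,
          rule abs_int_factor_le[OF _ nz(2) K(2)], simp, rule abs_int_factor_le[OF _ nz(3) K(3)], simp)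
    then show "t \<in> ?N \<times> ?N \<times> ?N \<times> ?N \<times> ?N \<times> ?N \<times> ?N \<times> ?N \<times> ?N \<times> ?N" unfolding te by blast
  qed
qed (intro finite_cartesian_product finite_nz_ints)

locale box_sizes =
  fixes W W2 V D12 D13 D14 D23 D24 D34 k :: real
  assumes k1: "1 \<le> k" and WV: "W = k ^ 9 * V" and V0: "0 < V" and W2: "W / 4 \<le> W2" "W2 \<le> W"
    and D: "1 \<le> D12" "1 \<le> D13" "1 \<le> D14" "1 \<le> D23" "1 \<le> D24" "1 \<le> D34"
begin

definition Pd where "Pd = D12 * D13 * D14 * D23 * D24 * D34"

abbreviation Box where "Box \<equiv> torsor_box W W2 V D12 D13 D14 D23 D24 D34"

lemma Dp: "0 < D12" "0 < D13" "0 < D14" "0 < D23" "0 < D24" "0 < D34" using D by linarith+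

lemma Pd0: "0 < Pd" unfolding Pd_def using Dp by simp

lemma kpow: "1 \<le> k ^ n" using k1 by simp

lemma V_le_W: "V \<le> W" unfolding WV using kpow[of 9] V0 by simp

lemma W0: "0 < W" "0 < W2" using V_le_W V0 W2 by linarith+

lemma BoxD:
  assumes "(u1, u2, u3, u4, d12, d13, d14, d23, d24, d34) \<in> Box"
  shows "torsor u1 u2 u3 u4 d12 d13 d14 d23 d24 d34"
    "D12 \<le> d12" "d12 < 2 * D12" "D13 \<le> d13" "d13 < 2 * D13" "D14 \<le> d14" "d14 < 2 * D14"
    "D23 \<le> d23" "d23 < 2 * D23" "D24 \<le> d24" "d24 < 2 * D24" "D34 \<le> d34" "d34 < 2 * D34"
    "W \<le> \<bar>real_of_int (d12 * d13 * d14 * u1)\<bar>" "\<bar>real_of_int (d12 * d13 * d14 * u1)\<bar> < 2 * W"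
    "W2 \<le> \<bar>real_of_int (d12 * d23 * d24 * u2)\<bar>" "\<bar>real_of_int (d12 * d23 * d24 * u2)\<bar> < 2 * W2"
    "V \<le> \<bar>real_of_int (d13 * d23 * d34 * u3)\<bar>" "\<bar>real_of_int (d13 * d23 * d34 * u3)\<bar> < 2 * V"
    "\<bar>real_of_int (d14 * d24 * d34 * u4)\<bar> \<le> 2 * V"
    "W / 2 \<le> \<bar>real_of_int (d12 * d13 * d14 * u1 + d14 * d24 * d34 * u4)\<bar>"
    "real_of_int (d12 * d13 * d14 * u1) + real_of_int (d12 * d23 * d24 * u2) + real_of_int (d13 * d23 * d34 * u3) + real_of_int (d14 * d24 * d34 * u4) = 0"
proof -
  note b = assms[unfolded torsor_box_def mem_Collect_eq prod.case]
  show "torsor u1 u2 u3 u4 d12 d13 d14 d23 d24 d34" using b by blast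
  then have "d12 * d13 * d14 * u1 + d12 * d23 * d24 * u2 + d13 * d23 * d34 * u3 + d14 * d24 * d34 * u4 = 0"
    unfolding torsor_def by blast
  then show "real_of_int (d12 * d13 * d14 * u1) + real_of_int (d12 * d23 * d24 * u2) + real_of_int (d13 * d23 * d34 * u3) + real_of_int (d14 * d24 * d34 * u4) = 0"
    by (metis of_int_0 of_int_add)
  show "D12 \<le> d12" "d12 < 2 * D12" "D13 \<le> d13" "d13 < 2 * D13" "D14 \<le> d14" "d14 < 2 * D14"
    "D23 \<le> d23" "d23 < 2 * D23" "D24 \<le> d24" "d24 < 2 * D24" "D34 \<le> d34" "d34 < 2 * D34"
    "W \<le> \<bar>real_of_int (d12 * d13 * d14 * u1)\<bar>" "\<bar>real_of_int (d12 * d13 * d14 * u1)\<bar> < 2 * W"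
    "W2 \<le> \<bar>real_of_int (d12 * d23 * d24 * u2)\<bar>" "\<bar>real_of_int (d12 * d23 * d24 * u2)\<bar> < 2 * W2"
    "V \<le> \<bar>real_of_int (d13 * d23 * d34 * u3)\<bar>" "\<bar>real_of_int (d13 * d23 * d34 * u3)\<bar> < 2 * V"
    "\<bar>real_of_int (d14 * d24 * d34 * u4)\<bar> \<le> 2 * V"
    "W / 2 \<le> \<bar>real_of_int (d12 * d13 * d14 * u1 + d14 * d24 * d34 * u4)\<bar>" using b by blast+
qed

text \<open>A pair is good when W D^2 \<ge> k^4 Pd. Then 1 / D^2 \<le> k^5 V / Pd, and this k^5
  together with the k^3 of the bounds for a single pair gives k^8.\<close>

lemma edge_final:
  assumes c: "c \<le> 40108032 * k ^ 3 * (2 * W * V * (1 / D\<^sup>2) + 8 * (W * V\<^sup>2 / Pd))" and good: "k ^ 4 * Pd \<le> W * D\<^sup>2" "0 < D"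
  shows "c \<le> 401080320 * k ^ 8 * (W * V\<^sup>2 / Pd)"
proof -
  have X0: "0 \<le> W * V\<^sup>2 / Pd" using W0 Pd0 by simp
  have kp: "0 < k ^ 4 * Pd" using k1 Pd0 by simp
  have "k ^ 4 * Pd / D\<^sup>2 \<le> W" using good by (simp add: pos_divide_le_eq)
  then have "1 / D\<^sup>2 \<le> W / (k ^ 4 * Pd)" unfolding pos_le_divide_eq[OF kp] by simp
  then have "2 * W * V * (1 / D\<^sup>2) \<le> 2 * W * V * (W / (k ^ 4 * Pd))" using W0 V0 by (intro mult_left_mono) auto
  also have "\<dots> = 2 * (W * V\<^sup>2 / Pd) * (k ^ 9 / k ^ 4)" unfolding WV using V0 k1 by (simp add: power2_eq_square mult_ac)
  also have "k ^ 9 / k ^ 4 = k ^ 5" using k1 by (simp add: power_diff[symmetric])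
  finally have 1: "2 * W * V * (1 / D\<^sup>2) \<le> 2 * (W * V\<^sup>2 / Pd) * k ^ 5" .
  have "8 * (W * V\<^sup>2 / Pd) * 1 \<le> 8 * (W * V\<^sup>2 / Pd) * k ^ 5" using X0 kpow[of 5] by (intro mult_left_mono) auto
  then have "2 * W * V * (1 / D\<^sup>2) + 8 * (W * V\<^sup>2 / Pd) \<le> 10 * (W * V\<^sup>2 / Pd) * k ^ 5" using 1 by linarith
  then have "40108032 * k ^ 3 * (2 * W * V * (1 / D\<^sup>2) + 8 * (W * V\<^sup>2 / Pd)) \<le> 40108032 * k ^ 3 * (10 * (W * V\<^sup>2 / Pd) * k ^ 5)"
    using k1 by (intro mult_left_mono) auto
  also have "\<dots> = 401080320 * (k ^ 3 * k ^ 5) * (W * V\<^sup>2 / Pd)" by simp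
  also have "k ^ 3 * k ^ 5 = k ^ 8" by (simp flip: power_add)
  finally show ?thesis using c by linarith
qed

lemma k3_cube: "(k ^ 3) ^ 3 = k ^ 9" by (simp flip: power_mult)

text \<open>By the vanishing sum w1 + w2 is only of size V, so S = 2 V. The choice \<sigma> = k^3 is
  dictated by W^2 \<le> 4 W W2 = 4 k^9 V W2.\<close>

lemma box_edge_12: "real (card Box) \<le> 40108032 * k ^ 3 * (2 * W * V * (1 / D12\<^sup>2) + 8 * (W * V\<^sup>2 / Pd))"
proof -
  have "real (card Box) \<le> 40108032 * k ^ 3 * ((2 * V) * W2) * (1 / D12\<^sup>2 + 4 * V / (D12 * D13 * D14 * D23 * D24 * D34))"
  proof (rule card_torsor_edge[OF finite_torsor_box W0(1,2) V0 _ kpow[of 3] D])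
    show "W\<^sup>2 \<le> 2048 * (k ^ 3) ^ 3 * (2 * V * W2)"
    proof -
      have "W * W \<le> W * (4 * W2)" using W2 W0 by (intro mult_left_mono) auto
      also have "\<dots> = 4 * (k ^ 9 * V * W2)" unfolding WV by simp
      also have "\<dots> \<le> 4096 * (k ^ 9 * V * W2)" using k1 V0 W0 by (intro mult_right_mono) auto
      finally show ?thesis unfolding k3_cube by (simp add: power2_eq_square)
    qed
    fix u1 u2 u3 u4 d12 d13 d14 d23 d24 d34 assume m: "(u1, u2, u3, u4, d12, d13, d14, d23, d24, d34) \<in> Box"
    note b = BoxD[OF m]
    have "\<bar>real_of_int (d12 * d13 * d14 * u1 + d12 * d23 * d24 * u2)\<bar> \<le> 2 * (2 * V)"
      using b(19,20,22) unfolding of_int_add by linarith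
    moreover have "\<bar>real_of_int (d12 * d23 * d24 * u2)\<bar> \<le> 2 * W2" using b(17) by linarith
    ultimately show "torsor u1 u2 u3 u4 d12 d13 d14 d23 d24 d34 \<and>
      D12 \<le> d12 \<and> d12 < 2 * D12 \<and> D13 \<le> d13 \<and> d13 < 2 * D13 \<and> D14 \<le> d14 \<and> d14 < 2 * D14 \<and>
      D23 \<le> d23 \<and> d23 < 2 * D23 \<and> D24 \<le> d24 \<and> d24 < 2 * D24 \<and> D34 \<le> d34 \<and> d34 < 2 * D34 \<and>
      W \<le> \<bar>real_of_int (d12 * d13 * d14 * u1)\<bar> \<and> \<bar>real_of_int (d12 * d13 * d14 * u1)\<bar> < 2 * W \<and>
      \<bar>real_of_int (d12 * d23 * d24 * u2)\<bar> \<le> 2 * W2 \<and> \<bar>real_of_int (d14 * d24 * d34 * u4)\<bar> \<le> 2 * V \<and>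
      \<bar>real_of_int (d12 * d13 * d14 * u1 + d12 * d23 * d24 * u2)\<bar> \<le> 2 * (2 * V)" using b(1-15,20) by blast
  qed (use V0 in simp)
  also have "\<dots> \<le> 40108032 * k ^ 3 * ((2 * V) * W) * (1 / D12\<^sup>2 + 4 * V / (D12 * D13 * D14 * D23 * D24 * D34))"
    using W2 V0 Dp k1 by (intro mult_right_mono mult_left_mono) auto
  also have "\<dots> = 40108032 * k ^ 3 * (2 * W * V * (1 / D12\<^sup>2) + 8 * (W * V\<^sup>2 / Pd))"
    unfolding Pd_def[symmetric] by (simp add: algebra_simps power2_eq_square)
  finally show ?thesis .
qed

text \<open>For the pair (3, 4) both coordinates and their sum are of size V, so \<sigma> = 1
  suffices. The result is weakened to the common shape of the four bounds.\<close>

lemma box_edge_34: "real (card Box) \<le> 40108032 * k ^ 3 * (2 * W * V * (1 / D34\<^sup>2) + 8 * (W * V\<^sup>2 / Pd))"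
proof -
  let ?h = "\<lambda>(u1::int, u2::int, u3::int, u4::int, d12::int, d13::int, d14::int, d23::int, d24::int, d34::int). (u3, u4, u1, u2, d34, d13, d23, d14, d24, d12)"
  have "real (card (?h ` Box)) \<le> 40108032 * 1 * ((2 * V) * V) * (1 / D34\<^sup>2 + 4 * W2 / (D34 * D13 * D23 * D14 * D24 * D12))"
  proof (rule card_torsor_edge[OF _ V0 V0 W0(2) _ _ D(6) D(2) D(4) D(3) D(5) D(1)])
    show "V\<^sup>2 \<le> 2048 * 1 ^ 3 * (2 * V * V)" using V0 by (simp add: power2_eq_square)
    fix u1 u2 u3 u4 d12 d13 d14 d23 d24 d34 assume "(u1, u2, u3, u4, d12, d13, d14, d23, d24, d34) \<in> ?h ` Box"
    then have m: "(u3, u4, u1, u2, d34, d13, d23, d14, d24, d12) \<in> Box" by auto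
    note b = BoxD[OF m]
    have c: "d13 * d14 * d12 * u1 = d12 * d13 * d14 * u1" "d23 * d24 * d12 * u2 = d12 * d23 * d24 * u2" "d34 * d14 * d24 * u4 = d14 * d24 * d34 * u4" by simp_all
    have "\<bar>real_of_int (d12 * d13 * d14 * u1 + d12 * d23 * d24 * u2)\<bar> \<le> 2 * (2 * V)"
      using b(19,20) unfolding of_int_add c by linarith
    moreover have "\<bar>real_of_int (d14 * d24 * d34 * u4)\<bar> \<le> 2 * W2" using b(17) unfolding c by linarith
    ultimately show "torsor u1 u2 u3 u4 d12 d13 d14 d23 d24 d34 \<and>
      D34 \<le> d12 \<and> d12 < 2 * D34 \<and> D13 \<le> d13 \<and> d13 < 2 * D13 \<and> D23 \<le> d14 \<and> d14 < 2 * D23 \<and>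
      D14 \<le> d23 \<and> d23 < 2 * D14 \<and> D24 \<le> d24 \<and> d24 < 2 * D24 \<and> D12 \<le> d34 \<and> d34 < 2 * D12 \<and>
      V \<le> \<bar>real_of_int (d12 * d13 * d14 * u1)\<bar> \<and> \<bar>real_of_int (d12 * d13 * d14 * u1)\<bar> < 2 * V \<and>
      \<bar>real_of_int (d12 * d23 * d24 * u2)\<bar> \<le> 2 * V \<and> \<bar>real_of_int (d14 * d24 * d34 * u4)\<bar> \<le> 2 * W2 \<and>
      \<bar>real_of_int (d12 * d13 * d14 * u1 + d12 * d23 * d24 * u2)\<bar> \<le> 2 * (2 * V)"
      using b(2-13) b(18-20)[unfolded c] torsor_swap_halves[OF b(1)] by blast
  qed (use V0 in simp_all)
  also have "card (?h ` Box) = card Box" by (rule card_image) (auto simp: inj_on_def)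
  also have "D34 * D13 * D23 * D14 * D24 * D12 = Pd" by (simp add: Pd_def)
  also have "40108032 * 1 * ((2 * V) * V) * (1 / D34\<^sup>2 + 4 * W2 / Pd) = 40108032 * 1 * (2 * V * V * (1 / D34\<^sup>2) + 8 * (W2 * V\<^sup>2 / Pd))"
    by (simp add: algebra_simps power2_eq_square)
  also have "\<dots> \<le> 40108032 * k ^ 3 * (2 * W * V * (1 / D34\<^sup>2) + 8 * (W * V\<^sup>2 / Pd))"
    using W2 V0 Dp k1 kpow[of 3] V_le_W Pd0 by (intro mult_mono add_mono mult_left_mono mult_right_mono divide_right_mono) auto
  finally show ?thesis .
qed

text \<open>Here the sum w1 + w3 may be of size W, so S = 2 W, and W^2 = k^9 W V again asks for
  \<sigma> = k^3. The bound for the pair (2, 4) is the same with w2 in place of w1.\<close>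

lemma box_edge_13: "real (card Box) \<le> 40108032 * k ^ 3 * (2 * W * V * (1 / D13\<^sup>2) + 8 * (W * V\<^sup>2 / Pd))"
proof -
  let ?h = "\<lambda>(u1::int, u2::int, u3::int, u4::int, d12::int, d13::int, d14::int, d23::int, d24::int, d34::int). (u1, u3, u2, u4, d13, d12, d14, d23, d34, d24)"
  have "real (card (?h ` Box)) \<le> 40108032 * k ^ 3 * ((2 * W) * V) * (1 / D13\<^sup>2 + 4 * V / (D13 * D12 * D14 * D23 * D34 * D24))"
  proof (rule card_torsor_edge[OF _ W0(1) V0 V0 _ kpow[of 3] D(2) D(1) D(3) D(4) D(6) D(5)])
    show "W\<^sup>2 \<le> 2048 * (k ^ 3) ^ 3 * (2 * W * V)" unfolding k3_cube using W0 V0 k1 by (simp add: WV power2_eq_square)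
    fix u1 u2 u3 u4 d12 d13 d14 d23 d24 d34 assume "(u1, u2, u3, u4, d12, d13, d14, d23, d24, d34) \<in> ?h ` Box"
    then have m: "(u1, u3, u2, u4, d13, d12, d14, d23, d34, d24) \<in> Box" by auto
    note b = BoxD[OF m]
    have c: "d13 * d12 * d14 * u1 = d12 * d13 * d14 * u1" "d14 * d34 * d24 * u4 = d14 * d24 * d34 * u4" by simp_all
    have "\<bar>real_of_int (d12 * d13 * d14 * u1 + d12 * d23 * d24 * u2)\<bar> \<le> 2 * (2 * W)"
      using b(15,19) V_le_W unfolding of_int_add c by linarith
    moreover have "\<bar>real_of_int (d12 * d23 * d24 * u2)\<bar> \<le> 2 * V" using b(19) by linarith
    ultimately show "torsor u1 u2 u3 u4 d12 d13 d14 d23 d24 d34 \<and>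
      D13 \<le> d12 \<and> d12 < 2 * D13 \<and> D12 \<le> d13 \<and> d13 < 2 * D12 \<and> D14 \<le> d14 \<and> d14 < 2 * D14 \<and>
      D23 \<le> d23 \<and> d23 < 2 * D23 \<and> D34 \<le> d24 \<and> d24 < 2 * D34 \<and> D24 \<le> d34 \<and> d34 < 2 * D24 \<and>
      W \<le> \<bar>real_of_int (d12 * d13 * d14 * u1)\<bar> \<and> \<bar>real_of_int (d12 * d13 * d14 * u1)\<bar> < 2 * W \<and>
      \<bar>real_of_int (d12 * d23 * d24 * u2)\<bar> \<le> 2 * V \<and> \<bar>real_of_int (d14 * d24 * d34 * u4)\<bar> \<le> 2 * V \<and>
      \<bar>real_of_int (d12 * d13 * d14 * u1 + d12 * d23 * d24 * u2)\<bar> \<le> 2 * (2 * W)"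
      using b(2-13) b(14,15,20)[unfolded c] torsor_swap_23[OF b(1)] by blast
  qed (use W0 in simp_all)
  also have "card (?h ` Box) = card Box" by (rule card_image) (auto simp: inj_on_def)
  also have "D13 * D12 * D14 * D23 * D34 * D24 = Pd" by (simp add: Pd_def)
  also have "40108032 * k ^ 3 * ((2 * W) * V) * (1 / D13\<^sup>2 + 4 * V / Pd) = 40108032 * k ^ 3 * (2 * W * V * (1 / D13\<^sup>2) + 8 * (W * V\<^sup>2 / Pd))"
    by (simp add: algebra_simps power2_eq_square)
  finally show ?thesis .
qed

lemma box_edge_24: "real (card Box) \<le> 40108032 * k ^ 3 * (2 * W * V * (1 / D24\<^sup>2) + 8 * (W * V\<^sup>2 / Pd))"
proof -
  let ?h = "\<lambda>(u1::int, u2::int, u3::int, u4::int, d12::int, d13::int, d14::int, d23::int, d24::int, d34::int). (u2, u4, u1, u3, d24, d12, d23, d14, d34, d13)"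
  have "real (card (?h ` Box)) \<le> 40108032 * k ^ 3 * ((2 * W) * V) * (1 / D24\<^sup>2 + 4 * V / (D24 * D12 * D23 * D14 * D34 * D13))"
  proof (rule card_torsor_edge[OF _ W0(2) V0 V0 _ kpow[of 3] D(5) D(1) D(4) D(3) D(6) D(2)])
    show "W2\<^sup>2 \<le> 2048 * (k ^ 3) ^ 3 * (2 * W * V)"
    proof -
      have "W2 * W2 \<le> W * W" using W2 W0 by (intro mult_mono) auto
      also have "\<dots> = k ^ 9 * (W * V)" by (simp add: WV)
      also have "\<dots> \<le> 4096 * (k ^ 9 * (W * V))" using k1 W0 V0 by simp
      finally show ?thesis unfolding k3_cube by (simp add: power2_eq_square)
    qed
    fix u1 u2 u3 u4 d12 d13 d14 d23 d24 d34 assume "(u1, u2, u3, u4, d12, d13, d14, d23, d24, d34) \<in> ?h ` Box"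
    then have m: "(u3, u1, u4, u2, d13, d34, d23, d14, d12, d24) \<in> Box" by auto
    note b = BoxD[OF m]
    have c: "d13 * d14 * d12 * u1 = d12 * d13 * d14 * u1" "d34 * d14 * d24 * u4 = d14 * d24 * d34 * u4" "d23 * d12 * d24 * u2 = d12 * d23 * d24 * u2"
      "d13 * d34 * d23 * u3 = d13 * d23 * d34 * u3" by simp_all
    have "\<bar>real_of_int (d12 * d13 * d14 * u1 + d12 * d23 * d24 * u2)\<bar> \<le> 2 * (2 * W)"
      using b(17,20) V_le_W W2 unfolding of_int_add c by linarith
    moreover have "\<bar>real_of_int (d14 * d24 * d34 * u4)\<bar> \<le> 2 * V" using b(19) unfolding c by linarith
    ultimately show "torsor u1 u2 u3 u4 d12 d13 d14 d23 d24 d34 \<and>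
      D24 \<le> d12 \<and> d12 < 2 * D24 \<and> D12 \<le> d13 \<and> d13 < 2 * D12 \<and> D23 \<le> d14 \<and> d14 < 2 * D23 \<and>
      D14 \<le> d23 \<and> d23 < 2 * D14 \<and> D34 \<le> d24 \<and> d24 < 2 * D34 \<and> D13 \<le> d34 \<and> d34 < 2 * D13 \<and>
      W2 \<le> \<bar>real_of_int (d12 * d13 * d14 * u1)\<bar> \<and> \<bar>real_of_int (d12 * d13 * d14 * u1)\<bar> < 2 * W2 \<and>
      \<bar>real_of_int (d12 * d23 * d24 * u2)\<bar> \<le> 2 * V \<and> \<bar>real_of_int (d14 * d24 * d34 * u4)\<bar> \<le> 2 * V \<and>
      \<bar>real_of_int (d12 * d13 * d14 * u1 + d12 * d23 * d24 * u2)\<bar> \<le> 2 * (2 * W)"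
      using b(2-13) b(16,17,20)[unfolded c] torsor_swap_halves[OF torsor_swap_23[OF b(1)]] by blast
  qed (use W0 in simp_all)
  also have "card (?h ` Box) = card Box" by (rule card_image) (auto simp: inj_on_def)
  also have "D24 * D12 * D23 * D14 * D34 * D13 = Pd" by (simp add: Pd_def)
  also have "40108032 * k ^ 3 * ((2 * W) * V) * (1 / D24\<^sup>2 + 4 * V / Pd) = 40108032 * k ^ 3 * (2 * W * V * (1 / D24\<^sup>2) + 8 * (W * V\<^sup>2 / Pd))"
    by (simp add: algebra_simps power2_eq_square)
  finally show ?thesis .
qed

end

section \<open>Dyadic boxes: bounds from roots modulo z\<close>

lemma torsor_swap_34:
  assumes "torsor u1 u2 u3 u4 d12 d13 d14 d23 d24 d34"
  shows "torsor u1 u2 u4 u3 d12 d14 d13 d24 d23 d34"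
proof -
  have e: "d12 * d14 * d13 * u1 = d12 * d13 * d14 * u1" "d12 * d24 * d23 * u2 = d12 * d23 * d24 * u2" by simp_all
  have s: "d12 * d13 * d14 * u1 + d12 * d23 * d24 * u2 + d13 * d23 * d34 * u3 + d14 * d24 * d34 * u4 = 0"
     "d12 * d13 * d14 * u1 + d12 * d23 * d24 * u2 \<noteq> 0" "d12 * d13 * d14 * u1 + d13 * d23 * d34 * u3 \<noteq> 0"
     "d12 * d13 * d14 * u1 + d14 * d24 * d34 * u4 \<noteq> 0" using assms unfolding torsor_def by blast+
  have "d12 * d14 * d13 * u1 + d12 * d24 * d23 * u2 + d14 * d24 * d34 * u4 + d13 * d23 * d34 * u3 = 0"
    "d12 * d14 * d13 * u1 + d12 * d24 * d23 * u2 \<noteq> 0" "d12 * d14 * d13 * u1 + d14 * d24 * d34 * u4 \<noteq> 0"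
    "d12 * d14 * d13 * u1 + d13 * d23 * d34 * u3 \<noteq> 0" unfolding e using s by linarith+
  then show ?thesis using assms unfolding torsor_def by (simp only: coprime_commute simp_thms)
qed

lemma coprime_of_sum:
  fixes c z m x y :: int
  assumes "c * z = x * m + y" "coprime m y"
  shows "coprime z m"
proof (rule coprimeI)
  fix g assume g: "g dvd z" "g dvd m"
  have "y = c * z - x * m" using assms(1) by simp
  then have "g dvd y" using g by simp
  then show "is_unit g" using assms(2) g(2) by (meson coprime_common_divisor)
qed

text \<open>Positive coprime pairs with vanishing cross product are equal; otherwise the cross
  product is a nonzero multiple of z, and \<open>card_slopes\<close> applies with m = Z.\<close>

lemma card_coprime_pairs_le:
  fixes P :: "(int \<times> int) set" and F G Z :: real and z :: int
  assumes fin: "finite P" and pos: "0 < F" "0 < G" "0 < Z" "Z \<le> z"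
    and P: "\<And>x y. (x, y) \<in> P \<Longrightarrow> 0 < x \<and> 0 < y \<and> coprime x y \<and> x \<le> F \<and> y \<le> G"
    and cr: "\<And>x y x' y'. (x, y) \<in> P \<Longrightarrow> (x', y') \<in> P \<Longrightarrow> z dvd x * y' - y * x'"
  shows "real (card P) \<le> 9 + 8 * F * G / Z"
proof (rule card_slopes[OF fin pos(1,2,3)])
  fix x y assume xy: "(x, y) \<in> P"
  note p = P[OF xy]
  show "\<bar>real_of_int x\<bar> \<le> F \<and> \<bar>real_of_int y\<bar> \<le> G" using p by simp
  fix x' y' assume xy': "(x', y') \<in> P"
  note p' = P[OF xy']
  show "((x', y') = (x, y) \<or> (x', y') = (- x, - y)) \<or> Z \<le> \<bar>real_of_int (x * y' - y * x')\<bar>"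
  proof (cases "x * y' - y * x' = 0")
    case True
    then have e: "x * y' = y * x'" by simp
    have "x dvd y * x'" "x' dvd x * y'" using e by (metis dvd_triv_left dvd_triv_right)+
    then have "x dvd x'" "x' dvd x" using p p' by (simp_all add: coprime_dvd_mult_right_iff coprime_dvd_mult_left_iff)
    then have "x = x'" using p p' by (simp add: zdvd_antisym_nonneg)
    then show ?thesis using e p by simp
  next
    case False
    have "\<bar>z\<bar> \<le> \<bar>x * y' - y * x'\<bar>" by (rule dvd_imp_le_int[OF False cr[OF xy xy']])
    then have "real_of_int z \<le> \<bar>real_of_int (x * y' - y * x')\<bar>" by linarith
    then show ?thesis using pos(4) by linarith
  qed
qed

context box_sizes
begin

text \<open>The ranges for z = (w1 + w4) / (d14 d23) and for the u_i that follow from the box; |z|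
  lies between \<open>bZ\<close> and 32 \<open>bZ\<close>.\<close>

definition bZ where "bZ = W / (8 * (D14 * D23))"
definition bU1 where "bU1 = 2 * W / (D12 * D13 * D14)"
definition bU2 where "bU2 = 2 * W2 / (D12 * D23 * D24)"
definition bU3 where "bU3 = 2 * V / (D13 * D23 * D34)"
definition bU4 where "bU4 = 2 * V / (D14 * D24 * D34)"

text \<open>The quotient x / y modulo z as a residue in [0, |z|); it exists whenever y is prime to
  z.\<close>

definition rt :: "int \<Rightarrow> int \<Rightarrow> int \<Rightarrow> int" where
  "rt x y z = (SOME r. 0 \<le> r \<and> r < \<bar>z\<bar> \<and> z dvd x - r * y)"

text \<open>The root is d12 / d34 modulo z, where z is the quotient of the pair (1, 4).\<close>

definition to_root where
  "to_root = (\<lambda>(u1::int, u2::int, u3::int, u4::int, d12::int, d13::int, d14::int, d23::int, d24::int, d34::int).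
     (u1, u2, u3, u4, \<bar>(d12 * d13 * u1 + d24 * d34 * u4) div d23\<bar>, rt d12 d34 ((d12 * d13 * u1 + d24 * d34 * u4) div d23)))"

lemma bZ0: "0 < bZ" using W0 Dp by (simp add: bZ_def)

text \<open>Put d12 = r d34 modulo z into the two expressions for z and cancel d34. This gives r u1
  d13 + u4 d24 = 0 and r u2 d24 + u3 d13 = 0 modulo z, and eliminating d13 and d24 yields r^2 u1 u2
  = u3 u4.\<close>

lemma to_root_facts:
  assumes m: "(u1, u2, u3, u4, d12, d13, d14, d23, d24, d34) \<in> Box"
  obtains z r where "to_root (u1, u2, u3, u4, d12, d13, d14, d23, d24, d34) = (u1, u2, u3, u4, \<bar>z\<bar>, r)"
    "(u1, u2, u3, u4, \<bar>z\<bar>, r) \<in> root_tuples bU1 bU2 bU3 bU4 bZ"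
    "d23 * z = d12 * d13 * u1 + d24 * d34 * u4" "d14 * z = - (d12 * d24 * u2 + d13 * d34 * u3)"
    "z dvd d12 - r * d34" "z dvd r * u1 * d13 + u4 * d24"
proof -
  note b = BoxD[OF m]
  \<comment> \<open>The relabelling brings the pair (1, 4) to the position for which
    \<open>torsor_edge\<close> is stated.\<close>
  have tor: "torsor u1 u4 u2 u3 d14 d12 d13 d24 d34 d23" using torsor_swap_23[OF torsor_swap_34[OF b(1)]] .
  obtain z where z: "z \<noteq> 0" "d23 * z = d12 * d13 * u1 + d24 * d34 * u4" "d14 * z + d12 * d24 * u2 + d13 * d34 * u3 = 0"
    "d14 * d23 * z = d14 * d12 * d13 * u1 + d14 * d24 * d34 * u4" using torsor_edge[OF tor] by metis
  note tb = b(1)[unfolded torsor_def]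
  have d0: "d12 > 0" "d13 > 0" "d14 > 0" "d23 > 0" "d24 > 0" "d34 > 0" using tb by blast+
  have zdiv: "(d12 * d13 * u1 + d24 * d34 * u4) div d23 = z" unfolding z(2)[symmetric] using d0 by simp
  have e2: "d14 * z = - (d12 * d24 * u2 + d13 * d34 * u3)" using z(3) by simp
  have cu1: "coprime z u1" by (rule coprime_of_sum[of d23 z "d12 * d13" u1 "d24 * d34 * u4"]) (use z(2) tb in \<open>simp_all add: coprime_commute\<close>)
  have cu4: "coprime z u4" by (rule coprime_of_sum[of d23 z "d24 * d34" u4 "d12 * d13 * u1"]) (use z(2) tb in \<open>simp_all add: coprime_commute\<close>)
  have cu2: "coprime z u2" by (rule coprime_of_sum[of d14 z "- (d12 * d24)" u2 "- (d13 * d34 * u3)"]) (use e2 tb in \<open>simp_all add: coprime_commute\<close>)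
  have cu3: "coprime z u3" by (rule coprime_of_sum[of d14 z "- (d13 * d34)" u3 "- (d12 * d24 * u2)"]) (use e2 tb in \<open>simp_all add: coprime_commute\<close>)
  have cd34: "coprime z d34" by (rule coprime_of_sum[of d23 z "d24 * u4" d34 "d12 * d13 * u1"]) (use z(2) tb in \<open>simp_all add: coprime_commute mult_ac\<close>)
  have cd13: "coprime z d13" by (rule coprime_of_sum[of d23 z "d12 * u1" d13 "d24 * d34 * u4"]) (use z(2) tb in \<open>simp_all add: coprime_commute mult_ac\<close>)
  have cd24: "coprime z d24" by (rule coprime_of_sum[of d23 z "d34 * u4" d24 "d12 * d13 * u1"]) (use z(2) tb in \<open>simp_all add: coprime_commute mult_ac\<close>)
  obtain x y where xy: "x * d34 + y * z = 1" using bezout_int[of d34 z] cd34 by (metis coprime_commute coprime_imp_gcd_eq_1)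
  have "\<exists>r. 0 \<le> r \<and> r < \<bar>z\<bar> \<and> z dvd d12 - r * d34"
  proof (intro exI conjI)
    let ?r = "(d12 * x) mod \<bar>z\<bar>"
    show "0 \<le> ?r" "?r < \<bar>z\<bar>" using z(1) by simp_all
    have "\<bar>z\<bar> dvd d12 * x - ?r" by simp
    then have "z dvd d12 * x - ?r" by (simp only: abs_dvd_iff)
    then have "z dvd (d12 * x - ?r) * d34 + d12 * y * z" by simp
    also have "(d12 * x - ?r) * d34 + d12 * y * z = d12 * (x * d34 + y * z) - ?r * d34" by (simp add: algebra_simps)
    finally show "z dvd d12 - ?r * d34" unfolding xy by simp
  qed
  then have r: "0 \<le> rt d12 d34 z \<and> rt d12 d34 z < \<bar>z\<bar> \<and> z dvd d12 - rt d12 d34 z * d34"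
    unfolding rt_def by (rule someI_ex)
  define r where "r = rt d12 d34 z"
  have r: "0 \<le> r" "r < \<bar>z\<bar>" "z dvd d12 - r * d34" using r unfolding r_def by blast+
  have "z dvd (d12 - r * d34) * (d13 * u1)" using r(3) by simp
  then have "z dvd d23 * z - (d12 - r * d34) * (d13 * u1)" by simp
  also have "d23 * z - (d12 - r * d34) * (d13 * u1) = d34 * (r * u1 * d13 + u4 * d24)" unfolding z(2) by (simp add: algebra_simps)
  finally have "z dvd d34 * (r * u1 * d13 + u4 * d24)" .
  then have 1: "z dvd r * u1 * d13 + u4 * d24" using cd34 coprime_dvd_mult_right_iff by blast
  have "z dvd (d12 - r * d34) * (d24 * u2)" using r(3) by simp
  then have "z dvd - (d14 * z) - (d12 - r * d34) * (d24 * u2)" by simp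
  also have "- (d14 * z) - (d12 - r * d34) * (d24 * u2) = d34 * (r * u2 * d24 + u3 * d13)" unfolding e2 by (simp add: algebra_simps)
  finally have "z dvd d34 * (r * u2 * d24 + u3 * d13)" .
  then have 2: "z dvd r * u2 * d24 + u3 * d13" using cd34 coprime_dvd_mult_right_iff by blast
  \<comment> \<open>The combination of the two congruences in which the terms with d24^2
    cancel.\<close>
  have "z dvd (r * u1 * d13 + u4 * d24) * (r * u2 * d24) - (u4 * d24) * (r * u2 * d24 + u3 * d13)" using 1 2 by simp
  also have "\<dots> = (d13 * d24) * (r\<^sup>2 * (u1 * u2) - u3 * u4)" by (simp add: algebra_simps power2_eq_square)
  finally have "z dvd (d13 * d24) * (r\<^sup>2 * (u1 * u2) - u3 * u4)" .
  moreover have "coprime z (d13 * d24)" using cd13 cd24 by simp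
  ultimately have root: "z dvd r\<^sup>2 * (u1 * u2) - u3 * u4" using coprime_dvd_mult_right_iff by blast
  note l = b(2,4,6,8,10,12)
  have dr: "real_of_int d12 > 0" "real_of_int d13 > 0" "real_of_int d14 > 0" "real_of_int d23 > 0" "real_of_int d24 > 0" "real_of_int d34 > 0"
    using d0 by simp_all
  have "d14 * d23 * \<bar>real_of_int z\<bar> = \<bar>real_of_int (d14 * d23 * z)\<bar>" using dr by (simp add: abs_mult)
  also have "d14 * d23 * z = d12 * d13 * d14 * u1 + d14 * d24 * d34 * u4" unfolding z(4) by simp
  finally have wz: "d14 * d23 * \<bar>real_of_int z\<bar> = \<bar>real_of_int (d12 * d13 * d14 * u1 + d14 * d24 * d34 * u4)\<bar>" .
  have "W / 2 \<le> d14 * d23 * \<bar>real_of_int z\<bar>" unfolding wz using b(21) .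
  also have "\<dots> \<le> (2 * D14) * (2 * D23) * \<bar>real_of_int z\<bar>" using b(7,9) dr(3,4) Dp unfolding of_int_mult by (intro mult_right_mono mult_mono) auto
  finally have zl: "bZ \<le> \<bar>real_of_int z\<bar>" unfolding bZ_def using Dp by (simp add: field_simps)
  have "D14 * D23 * \<bar>real_of_int z\<bar> \<le> d14 * d23 * \<bar>real_of_int z\<bar>" using l dr Dp unfolding of_int_mult by (intro mult_right_mono mult_mono) auto
  also have "\<dots> \<le> 4 * W" unfolding wz of_int_add using b(15,20) V_le_W by linarith
  finally have zu: "\<bar>real_of_int z\<bar> \<le> 32 * bZ" unfolding bZ_def using Dp by (simp add: field_simps)
  have up: "x \<le> K / Q" if "Q * x \<le> K" "0 < Q" for x K Q :: real using that by (simp add: field_simps)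
  have "D12 * D13 * D14 * \<bar>real_of_int u1\<bar> \<le> d12 * d13 * d14 * \<bar>real_of_int u1\<bar>" using l dr Dp unfolding of_int_mult by (intro mult_right_mono mult_mono) auto
  also have "\<dots> \<le> 2 * W" using b(15) dr by (simp add: abs_mult)
  finally have u1: "\<bar>real_of_int u1\<bar> \<le> bU1" unfolding bU1_def using Dp by (intro up) auto
  have "D12 * D23 * D24 * \<bar>real_of_int u2\<bar> \<le> d12 * d23 * d24 * \<bar>real_of_int u2\<bar>" using l dr Dp unfolding of_int_mult by (intro mult_right_mono mult_mono) auto
  also have "\<dots> \<le> 2 * W2" using b(17) dr by (simp add: abs_mult)
  finally have u2: "\<bar>real_of_int u2\<bar> \<le> bU2" unfolding bU2_def using Dp by (intro up) auto
  have "D13 * D23 * D34 * \<bar>real_of_int u3\<bar> \<le> d13 * d23 * d34 * \<bar>real_of_int u3\<bar>" using l dr Dp unfolding of_int_mult by (intro mult_right_mono mult_mono) auto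
  also have "\<dots> \<le> 2 * V" using b(19) dr by (simp add: abs_mult)
  finally have u3: "\<bar>real_of_int u3\<bar> \<le> bU3" unfolding bU3_def using Dp by (intro up) auto
  have "D14 * D24 * D34 * \<bar>real_of_int u4\<bar> \<le> d14 * d24 * d34 * \<bar>real_of_int u4\<bar>" using l dr Dp unfolding of_int_mult by (intro mult_right_mono mult_mono) auto
  also have "\<dots> \<le> 2 * V" using b(20) dr by (simp add: abs_mult)
  finally have u4: "\<bar>real_of_int u4\<bar> \<le> bU4" unfolding bU4_def using Dp by (intro up) auto
  have unz: "u1 \<noteq> 0" "u2 \<noteq> 0" "u3 \<noteq> 0" "u4 \<noteq> 0" using tb by blast+
  have nz: "u1 \<in> nz_ints bU1" "u2 \<in> nz_ints bU2" "u3 \<in> nz_ints bU3" "u4 \<in> nz_ints bU4"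
    using u1 u2 u3 u4 unz by (simp_all add: nz_ints_def)
  have ucop: "coprime u1 u2" "coprime u3 u4" "coprime u1 u3" "coprime u1 u4" "coprime u2 u3" "coprime u2 u4" using tb by blast+
  then have cop: "coprime u1 u2" "coprime u3 u4" "coprime (u1 * u2) (u3 * u4)" by simp_all
  have copz: "coprime \<bar>z\<bar> (u1 * u2 * (u3 * u4))" using cu1 cu2 cu3 cu4 by simp
  have mem: "(u1, u2, u3, u4, \<bar>z\<bar>, r) \<in> root_tuples bU1 bU2 bU3 bU4 bZ"
    unfolding root_tuples_def mem_Collect_eq prod.case using nz cop copz zl zu r(1,2) root by simp
  have "to_root (u1, u2, u3, u4, d12, d13, d14, d23, d24, d34) = (u1, u2, u3, u4, \<bar>z\<bar>, r)"
    by (simp add: to_root_def zdiv r_def)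
  then show thesis using that mem z(2) e2 r(3) 1 by blast
qed

text \<open>For a given root tuple, (d12, d34) and (d13, d24) are coprime pairs in lattices of
  determinant z0 and are counted independently. Nothing else remains free, because d14 and d23
  follow from z0.\<close>

lemma box_fibre:
  assumes a: "a \<in> root_tuples bU1 bU2 bU3 bU4 bZ"
  shows "real (card {t \<in> Box. to_root t = a}) \<le> (9 + 32 * (D12 * D34) / bZ) * (9 + 32 * (D13 * D24) / bZ)"
proof -
  let ?B = "{t \<in> Box. to_root t = a}"
  obtain u1 u2 u3 u4 z0 r where ae: "a = (u1, u2, u3, u4, z0, r)" by (cases a) auto
  have ar: "bZ \<le> z0" "coprime z0 (u1 * u2 * (u3 * u4))" using a unfolding ae root_tuples_def by simp_all
  have cr: "coprime r z0" using root_tuples_coprime_root a ae by blast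
  have "real_of_int z0 > 0" using ar(1) bZ0 by linarith
  then have z0: "z0 > 0" by simp
  have B: "\<exists>d12 d13 d14 d23 d24 d34. t = (u1, u2, u3, u4, d12, d13, d14, d23, d24, d34) \<and> t \<in> Box \<and>
     d23 * z0 = \<bar>d12 * d13 * u1 + d24 * d34 * u4\<bar> \<and> d14 * z0 = \<bar>d12 * d24 * u2 + d13 * d34 * u3\<bar> \<and>
     z0 dvd d12 - r * d34 \<and> z0 dvd r * u1 * d13 + u4 * d24" if t: "t \<in> ?B" for t
  proof -
    obtain v1 v2 v3 v4 d12 d13 d14 d23 d24 d34 where te: "t = (v1, v2, v3, v4, d12, d13, d14, d23, d24, d34)"
      by (metis prod.collapse)
    have m: "(v1, v2, v3, v4, d12, d13, d14, d23, d24, d34) \<in> Box" using t te by simp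
    obtain z s where zs: "to_root (v1, v2, v3, v4, d12, d13, d14, d23, d24, d34) = (v1, v2, v3, v4, \<bar>z\<bar>, s)"
      "d23 * z = d12 * d13 * v1 + d24 * d34 * v4" "d14 * z = - (d12 * d24 * v2 + d13 * d34 * v3)"
      "z dvd d12 - s * d34" "z dvd s * v1 * d13 + v4 * d24" using to_root_facts[OF m] by metis
    have e: "v1 = u1" "v2 = u2" "v3 = u3" "v4 = u4" "\<bar>z\<bar> = z0" "s = r" using t zs(1) unfolding te ae by auto
    have d0: "d14 > 0" "d23 > 0" using BoxD(1)[OF m] unfolding torsor_def by blast+
    have "d23 * z0 = \<bar>d23 * z\<bar>" "d14 * z0 = \<bar>d14 * z\<bar>" using d0 unfolding abs_mult e(5)[symmetric] by simp_all
    then have "d23 * z0 = \<bar>d12 * d13 * u1 + d24 * d34 * u4\<bar>" "d14 * z0 = \<bar>d12 * d24 * u2 + d13 * d34 * u3\<bar>"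
      unfolding zs(2,3) e(1-4) abs_minus_cancel by simp_all
    moreover have "z0 dvd d12 - r * d34" "z0 dvd r * u1 * d13 + u4 * d24"
      using zs(4,5) unfolding e(1-4) e(6) by (simp_all only: e(5)[symmetric] abs_dvd_iff)
    ultimately show ?thesis using te m e by blast
  qed
  let ?p = "\<lambda>(u1::int, u2::int, u3::int, u4::int, d12::int, d13::int, d14::int, d23::int, d24::int, d34::int). (d12, d34)"
  let ?q = "\<lambda>(u1::int, u2::int, u3::int, u4::int, d12::int, d13::int, d14::int, d23::int, d24::int, d34::int). (d13, d24)"
  have fin: "finite ?B" by simp
  \<comment> \<open>The two expressions for z, multiplied by d23 and d14, determine d23 and d14 from
    the other d and the u_i. Absolute values suffice because d14, d23 and z0 are positive.\<close>
  have inj: "inj_on (\<lambda>t. (?p t, ?q t)) ?B"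
  proof (rule inj_onI)
    fix s t assume st: "s \<in> ?B" "t \<in> ?B" "(?p s, ?q s) = (?p t, ?q t)"
    obtain d12 d13 d14 d23 d24 d34 where se: "s = (u1, u2, u3, u4, d12, d13, d14, d23, d24, d34)" 
      "d23 * z0 = \<bar>d12 * d13 * u1 + d24 * d34 * u4\<bar>" "d14 * z0 = \<bar>d12 * d24 * u2 + d13 * d34 * u3\<bar>" using B[OF st(1)] by blast
    obtain e12 e13 e14 e23 e24 e34 where te: "t = (u1, u2, u3, u4, e12, e13, e14, e23, e24, e34)" 
      "e23 * z0 = \<bar>e12 * e13 * u1 + e24 * e34 * u4\<bar>" "e14 * z0 = \<bar>e12 * e24 * u2 + e13 * e34 * u3\<bar>" using B[OF st(2)] by blast
    have eq: "e12 = d12" "e34 = d34" "e13 = d13" "e24 = d24" using st(3) unfolding se(1) te(1) by simp_all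
    have "d23 * z0 = e23 * z0" "d14 * z0 = e14 * z0" unfolding se(2,3) te(2,3) eq by simp_all
    then have "d23 = e23" "d14 = e14" using z0 by simp_all
    then show "s = t" unfolding se(1) te(1) eq by simp
  qed
  have cP: "real (card (?p ` ?B)) \<le> 9 + 8 * (2 * D12) * (2 * D34) / bZ"
  proof (rule card_coprime_pairs_le[OF _ _ _ bZ0 ar(1)])
    fix x y assume "(x, y) \<in> ?p ` ?B"
    then obtain t where t: "t \<in> ?B" "(x, y) = ?p t" by blast
    obtain d12 d13 d14 d23 d24 d34 where te: "t = (u1, u2, u3, u4, d12, d13, d14, d23, d24, d34)" "t \<in> Box" "z0 dvd d12 - r * d34"
      using B[OF t(1)] by blast
    have xy: "x = d12" "y = d34" using t(2) te(1) by simp_all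
    note b = BoxD[OF te(2)[unfolded te(1)]]
    show "0 < x \<and> 0 < y \<and> coprime x y \<and> x \<le> 2 * D12 \<and> y \<le> 2 * D34"
    proof -
      have "0 < d12" "0 < d34" "coprime d12 d34" using b(1) unfolding torsor_def by blast+
      then show ?thesis using b(3,13) unfolding xy by simp
    qed
    fix x' y' assume "(x', y') \<in> ?p ` ?B"
    then obtain t' where t': "t' \<in> ?B" "(x', y') = ?p t'" by blast
    obtain e12 e13 e14 e23 e24 e34 where te': "t' = (u1, u2, u3, u4, e12, e13, e14, e23, e24, e34)" "z0 dvd e12 - r * e34"
      using B[OF t'(1)] by blast
    have xy': "x' = e12" "y' = e34" using t'(2) te'(1) by simp_all
    have "z0 dvd (d12 - r * d34) * e34 - d34 * (e12 - r * e34)" using te(3) te'(2) by simp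
    also have "\<dots> = d12 * e34 - d34 * e12" by (simp add: algebra_simps)
    finally show "z0 dvd x * y' - y * x'" unfolding xy xy' .
  qed (use Dp fin in auto)
  have cQ: "real (card (?q ` ?B)) \<le> 9 + 8 * (2 * D13) * (2 * D24) / bZ"
  proof (rule card_coprime_pairs_le[OF _ _ _ bZ0 ar(1)])
    fix x y assume "(x, y) \<in> ?q ` ?B"
    then obtain t where t: "t \<in> ?B" "(x, y) = ?q t" by blast
    obtain d12 d13 d14 d23 d24 d34 where te: "t = (u1, u2, u3, u4, d12, d13, d14, d23, d24, d34)" "t \<in> Box" "z0 dvd r * u1 * d13 + u4 * d24"
      using B[OF t(1)] by blast
    have xy: "x = d13" "y = d24" using t(2) te(1) by simp_all
    note b = BoxD[OF te(2)[unfolded te(1)]]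
    show "0 < x \<and> 0 < y \<and> coprime x y \<and> x \<le> 2 * D13 \<and> y \<le> 2 * D24"
    proof -
      have "0 < d13" "0 < d24" "coprime d13 d24" using b(1) unfolding torsor_def by blast+
      then show ?thesis using b(5,11) unfolding xy by simp
    qed
    fix x' y' assume "(x', y') \<in> ?q ` ?B"
    then obtain t' where t': "t' \<in> ?B" "(x', y') = ?q t'" by blast
    obtain e12 e13 e14 e23 e24 e34 where te': "t' = (u1, u2, u3, u4, e12, e13, e14, e23, e24, e34)" "z0 dvd r * u1 * e13 + u4 * e24"
      using B[OF t'(1)] by blast
    have xy': "x' = e13" "y' = e24" using t'(2) te'(1) by simp_all
    have "z0 dvd (r * u1 * d13 + u4 * d24) * e24 - d24 * (r * u1 * e13 + u4 * e24)" using te(3) te'(2) by simp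
    also have "\<dots> = (r * u1) * (d13 * e24 - d24 * e13)" by (simp add: algebra_simps)
    finally have "z0 dvd (r * u1) * (d13 * e24 - d24 * e13)" .
    moreover have "coprime z0 (r * u1)" using cr ar(2) by (simp add: coprime_commute)
    ultimately have "z0 dvd d13 * e24 - d24 * e13" using coprime_dvd_mult_right_iff by blast
    then show "z0 dvd x * y' - y * x'" unfolding xy xy' .
  qed (use Dp fin in auto)
  have "card ?B = card ((\<lambda>t. (?p t, ?q t)) ` ?B)" using inj by (simp only: card_image)
  also have "\<dots> \<le> card (?p ` ?B \<times> ?q ` ?B)"
  proof (rule card_mono)
    show "finite (?p ` ?B \<times> ?q ` ?B)" using fin by simp
    show "(\<lambda>t. (?p t, ?q t)) ` ?B \<subseteq> ?p ` ?B \<times> ?q ` ?B" by (rule image_subsetI) (intro SigmaI imageI)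
  qed
  finally have "real (card ?B) \<le> real (card (?p ` ?B \<times> ?q ` ?B))" unfolding of_nat_le_iff .
  also have "\<dots> \<le> (9 + 8 * (2 * D12) * (2 * D34) / bZ) * (9 + 8 * (2 * D13) * (2 * D24) / bZ)"
    by (rule card_Times_le[OF cP cQ])
  finally show ?thesis by (simp add: mult_ac)
qed

text \<open>Up to a constant the square root of the product of the sizes of u1, u2, u3. It divides
  the squared logarithm in \<open>box_bad\<close>. The variable u4 is absent because the box gives
  no lower bound for w4.\<close>

definition bq where "bq = sqrt ((W / (D12 * D13 * D14)) * (W / (D12 * D23 * D24)) * (V / (D13 * D23 * D34)))"

lemma bq0: "0 < bq" unfolding bq_def using W0 V0 Dp by simp

lemma box_bad:
  assumes b1: "W \<le> k ^ 4 * (D12 * D34 * (D14 * D23))" and b2: "W \<le> k ^ 4 * (D13 * D24 * (D14 * D23))"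
  shows "real (card Box) \<le> 25000000000000 * k ^ 8 * (W * V\<^sup>2 / Pd) * (1 + (harm (nat \<lfloor>4 * W\<rfloor>))\<^sup>2 / bq)"
proof (cases "Box = {}")
  case True
  show ?thesis unfolding True using k1 W0 Pd0 bq0 by simp
next
  case False
  then obtain u1 u2 u3 u4 d12 d13 d14 d23 d24 d34 where m: "(u1, u2, u3, u4, d12, d13, d14, d23, d24, d34) \<in> Box"
    by (metis ex_in_conv prod.collapse)
  define H where "H = (harm (nat \<lfloor>4 * W\<rfloor>) :: real)"
  have H0: "0 \<le> H" by (simp add: H_def harm_nonneg)
  obtain z r where "(u1, u2, u3, u4, \<bar>z\<bar>, r) \<in> root_tuples bU1 bU2 bU3 bU4 bZ" using to_root_facts[OF m] by metis
  then have "u1 \<in> nz_ints bU1" "u2 \<in> nz_ints bU2" "u3 \<in> nz_ints bU3" "u4 \<in> nz_ints bU4" by (simp_all add: root_tuples_def)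
  moreover have "1 \<le> U" if "u \<in> nz_ints U" for u U
  proof -
    have "1 \<le> \<bar>u\<bar>" "\<bar>real_of_int u\<bar> \<le> U" using that by (auto simp: nz_ints_def)
    then show ?thesis by linarith
  qed
  ultimately have U: "1 \<le> bU1" "1 \<le> bU2" "1 \<le> bU3" "1 \<le> bU4" by blast+
  define Pi where "Pi = bU1 * bU2 * bU3 * bU4"
  have PiE: "Pi = 16 * (W * W2 * V\<^sup>2) / Pd\<^sup>2"
    unfolding Pi_def bU1_def bU2_def bU3_def bU4_def Pd_def using Dp by (simp add: power2_eq_square field_simps)
  have Pi0: "0 < Pi" unfolding PiE using W0 V0 Pd0 by simp
  \<comment> \<open>The box contains a point, so the range of u4 has length at least 1 and may be
    inserted; W \<le> 4 W2 compares the factor of u2.\<close>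
  have qPi: "bq \<le> sqrt Pi"
  proof -
    have "(W / (D12 * D13 * D14)) * (W / (D12 * D23 * D24)) * (V / (D13 * D23 * D34)) \<le> (2 * W / (D12 * D13 * D14)) * (4 * W2 / (D12 * D23 * D24)) * (V / (D13 * D23 * D34))"
      using W0 W2 V0 Dp by (intro mult_mono divide_right_mono) auto
    also have "\<dots> = bU1 * bU2 * bU3 * 1" by (simp add: bU1_def bU2_def bU3_def)
    also have "\<dots> \<le> Pi" unfolding Pi_def using U by (intro mult_left_mono) auto
    finally show ?thesis unfolding bq_def by simp
  qed
  have cR: "real (card (root_tuples bU1 bU2 bU3 bU4 bZ)) \<le> 166440960 * (bZ * Pi) * (1 + H\<^sup>2 / bq)"
  proof -
    have "bZ \<le> W / (8 * 1)" unfolding bZ_def using D W0 mult_mono[of 1 D14 1 D23] by (intro divide_left_mono mult_left_mono) auto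
    then have "nat \<lfloor>32 * bZ\<rfloor> \<le> nat \<lfloor>4 * W\<rfloor>" by (intro nat_mono floor_mono) linarith
    then have "(harm (nat \<lfloor>32 * bZ\<rfloor>))\<^sup>2 \<le> H\<^sup>2" unfolding H_def by (intro power_mono harm_mono harm_nonneg)
    moreover have "sqrt Pi * bq \<le> sqrt Pi * sqrt Pi" using qPi Pi0 by (intro mult_left_mono) auto
    then have "sqrt Pi \<le> Pi / bq" using bq0 Pi0 by (simp add: field_simps)
    ultimately have "8192 * (bZ * sqrt Pi) * (harm (nat \<lfloor>32 * bZ\<rfloor>))\<^sup>2 \<le> 166440960 * (bZ * (Pi / bq)) * H\<^sup>2"
      using bZ0 Pi0 bq0 by (intro mult_mono) auto
    moreover have "real (card (root_tuples bU1 bU2 bU3 bU4 bZ)) \<le> 166440960 * (bZ * Pi) + 8192 * (bZ * sqrt Pi) * (harm (nat \<lfloor>32 * bZ\<rfloor>))\<^sup>2"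
      unfolding Pi_def by (rule card_root_tuples_le[OF U bZ0])
    ultimately have "real (card (root_tuples bU1 bU2 bU3 bU4 bZ)) \<le> 166440960 * (bZ * Pi) + 166440960 * (bZ * (Pi / bq)) * H\<^sup>2" by linarith
    also have "\<dots> = 166440960 * (bZ * Pi) * (1 + H\<^sup>2 / bq)" by (simp add: algebra_simps)
    finally show ?thesis .
  qed
  \<comment> \<open>The hypothesis on x gives 8 \<open>bZ\<close> \<le> k^4 x, so 9 is at most 9/8
    of k^4 x / \<open>bZ\<close>; and 9/8 + 32 \<le> 34.\<close>
  have fac: "9 + 32 * x / bZ \<le> 34 * k ^ 4 * (x / bZ)" if x: "W \<le> k ^ 4 * (x * (D14 * D23))" "0 < x" for x
  proof -
    have "8 * bZ = W / (D14 * D23)" by (simp add: bZ_def)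
    also have "\<dots> \<le> k ^ 4 * x" using x Dp by (simp add: field_simps)
    finally have "8 \<le> k ^ 4 * x / bZ" using bZ0 by (simp add: field_simps)
    then have "8 \<le> k ^ 4 * (x / bZ)" by simp
    moreover have "x / bZ \<le> k ^ 4 * (x / bZ)" using kpow[of 4] x bZ0 mult_right_mono[of 1 "k ^ 4" "x / bZ"] by simp
    ultimately have "9 + 32 * (x / bZ) \<le> 9 / 8 * (k ^ 4 * (x / bZ)) + 32 * (k ^ 4 * (x / bZ))" by linarith
    also have "\<dots> \<le> 34 * (k ^ 4 * (x / bZ))"
    proof -
      have "0 \<le> k ^ 4 * (x / bZ)" using x bZ0 k1 by simp
      then show ?thesis by linarith
    qed
    finally show ?thesis by (simp add: mult_ac)
  qed
  have "real (card Box) \<le> (166440960 * (bZ * Pi) * (1 + H\<^sup>2 / bq)) * ((9 + 32 * (D12 * D34) / bZ) * (9 + 32 * (D13 * D24) / bZ))"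
  proof (rule card_le_mult_fibres[OF finite_torsor_box _ finite_root_tuples cR, where f = to_root])
    show "to_root ` Box \<subseteq> root_tuples bU1 bU2 bU3 bU4 bZ"
    proof
      fix x assume "x \<in> to_root ` Box"
      then obtain t where t: "t \<in> Box" "x = to_root t" by blast
      obtain u1 u2 u3 u4 d12 d13 d14 d23 d24 d34 where te: "t = (u1, u2, u3, u4, d12, d13, d14, d23, d24, d34)" by (metis prod.collapse)
      show "x \<in> root_tuples bU1 bU2 bU3 bU4 bZ" using to_root_facts[OF t(1)[unfolded te]] t(2) unfolding te by metis
    qed
    show "0 \<le> (9 + 32 * (D12 * D34) / bZ) * (9 + 32 * (D13 * D24) / bZ)" using bZ0 Dp by simp
  qed (rule box_fibre)
  also have "\<dots> \<le> (166440960 * (bZ * Pi) * (1 + H\<^sup>2 / bq)) * ((34 * k ^ 4 * (D12 * D34 / bZ)) * (34 * k ^ 4 * (D13 * D24 / bZ)))"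
    using fac[of "D12 * D34"] fac[of "D13 * D24"] b1 b2 Dp bZ0 Pi0 bq0 k1
    by (intro mult_left_mono mult_mono) auto
  also have "\<dots> = 166440960 * 1156 * (k ^ 4 * k ^ 4) * (Pi * ((D12 * D34) * (D13 * D24) / bZ)) * (1 + H\<^sup>2 / bq)"
    using bZ0 by simp
  also have "k ^ 4 * k ^ 4 = k ^ 8" by (simp flip: power_add)
  also have "Pi * ((D12 * D34) * (D13 * D24) / bZ) = 128 * (W2 * V\<^sup>2 / Pd)"
  proof -
    have "(D12 * D34) * (D13 * D24) / bZ = 8 * Pd / W" unfolding bZ_def Pd_def by (simp add: mult_ac)
    then show ?thesis unfolding PiE using Pd0 W0 by (simp add: power2_eq_square)
  qed
  also have "166440960 * 1156 * k ^ 8 * (128 * (W2 * V\<^sup>2 / Pd)) * (1 + H\<^sup>2 / bq) \<le> 166440960 * 1156 * k ^ 8 * (128 * (W * V\<^sup>2 / Pd)) * (1 + H\<^sup>2 / bq)"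
    using W2 W0 Pd0 bq0 k1 by (intro mult_right_mono mult_left_mono divide_right_mono) auto
  also have "\<dots> = 24627935969280 * (k ^ 8 * (W * V\<^sup>2 / Pd) * (1 + H\<^sup>2 / bq))" by simp
  also have "\<dots> \<le> 25000000000000 * (k ^ 8 * (W * V\<^sup>2 / Pd) * (1 + H\<^sup>2 / bq))"
    using W0 Pd0 bq0 k1 by (intro mult_right_mono) auto
  finally show ?thesis by (simp add: H_def)
qed

text \<open>Either one of the pairs (1, 2), (3, 4), (1, 3), (2, 4) is good and
  \<open>edge_final\<close> applies, or all four inequalities fail. Multiplying the failures for
  complementary pairs gives W D12 D34 \<le> k^4 Pd and W D13 D24 \<le> k^4 Pd, which after
  cancellation are the hypotheses of \<open>box_bad\<close>.\<close>

lemma box_bound: "real (card Box) \<le> 25000000000000 * k ^ 8 * (W * V\<^sup>2 / Pd) * (1 + (harm (nat \<lfloor>4 * W\<rfloor>))\<^sup>2 / bq)"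
proof -
  define X where "X = W * V\<^sup>2 / Pd"
  have X0: "0 \<le> X" unfolding X_def using W0 Pd0 by simp
  have good: ?thesis if "real (card Box) \<le> 401080320 * k ^ 8 * X"
  proof -
    have "401080320 * k ^ 8 * X \<le> 25000000000000 * k ^ 8 * X" using X0 k1 by (intro mult_right_mono) auto
    also have "\<dots> * 1 \<le> 25000000000000 * k ^ 8 * X * (1 + (harm (nat \<lfloor>4 * W\<rfloor>))\<^sup>2 / bq)"
      using X0 k1 bq0 by (intro mult_left_mono) auto
    finally show ?thesis using that unfolding X_def by simp
  qed
  show ?thesis
  proof (cases "k ^ 4 * Pd \<le> W * D12\<^sup>2 \<or> k ^ 4 * Pd \<le> W * D34\<^sup>2 \<or> k ^ 4 * Pd \<le> W * D13\<^sup>2 \<or> k ^ 4 * Pd \<le> W * D24\<^sup>2")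
    case True
    then show ?thesis
      using edge_final[OF box_edge_12] edge_final[OF box_edge_34] edge_final[OF box_edge_13] edge_final[OF box_edge_24] Dp good
      unfolding X_def by blast
  next
    case False
    then have lt: "W * D12\<^sup>2 \<le> k ^ 4 * Pd" "W * D34\<^sup>2 \<le> k ^ 4 * Pd" "W * D13\<^sup>2 \<le> k ^ 4 * Pd" "W * D24\<^sup>2 \<le> k ^ 4 * Pd" by linarith+
    \<comment> \<open>The inequality 2 x y \<le> x^2 + y^2 passes from two squares to the mixed
      product.\<close>
    have am: "W * (x * y) \<le> K" if "W * x\<^sup>2 \<le> K" "W * y\<^sup>2 \<le> K" for x y K
    proof -
      have "0 \<le> W * (x - y)\<^sup>2" using W0 by simp
      then have "2 * (W * (x * y)) \<le> W * x\<^sup>2 + W * y\<^sup>2" by (simp add: power2_eq_square algebra_simps)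
      then show ?thesis using that by linarith
    qed
    have "W * (D12 * D34) \<le> k ^ 4 * Pd" "W * (D13 * D24) \<le> k ^ 4 * Pd" using am lt by blast+
    then have "(D12 * D34) * W \<le> (D12 * D34) * (k ^ 4 * (D13 * D24 * (D14 * D23)))" "(D13 * D24) * W \<le> (D13 * D24) * (k ^ 4 * (D12 * D34 * (D14 * D23)))"
      unfolding Pd_def by (simp_all add: mult_ac)
    then have "W \<le> k ^ 4 * (D13 * D24 * (D14 * D23))" "W \<le> k ^ 4 * (D12 * D34 * (D14 * D23))"
      using Dp by (simp_all only: mult_le_cancel_left_pos mult_pos_pos)
    then show ?thesis by (intro box_bad)
  qed
qed

end

section \<open>From the surface to the plane\<close>

definition gprod :: "int \<Rightarrow> int \<Rightarrow> int \<Rightarrow> int \<Rightarrow> int" where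
  "gprod a b c d = gcd a b * gcd a c * gcd a d * gcd b c * gcd b d * gcd c d"

text \<open>The coordinates of \<open>w\<close> are proportional to the inverses of those of a point of the surface; \<open>\<bar>a * b * c * d\<bar> / gprod\<close>
  is their least common multiple.\<close>

definition plane_points :: "real \<Rightarrow> (int \<times> int \<times> int \<times> int) set" where
  "plane_points B = {(a, b, c, d). a + b + c + d = 0 \<and>
     (a \<noteq> 0 \<and> b \<noteq> 0 \<and> c \<noteq> 0 \<and> d \<noteq> 0) \<and>
     (a + b \<noteq> 0 \<and> a + c \<noteq> 0 \<and> a + d \<noteq> 0 \<and> b + c \<noteq> 0 \<and> b + d \<noteq> 0 \<and> c + d \<noteq> 0) \<and>
     gcd a (gcd b (gcd c d)) = 1 \<and>
     (\<forall>x\<in>{a, b, c, d}. \<bar>real_of_int (a * b * c * d)\<bar> \<le> B * real_of_int (gprod a b c d) * \<bar>real_of_int x\<bar> \<and> \<bar>real_of_int x\<bar> \<le> B ^ 3)}"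

lemma gcd_mult_dvd_int:
  fixes a b c :: int
  shows "gcd (a * b) c dvd gcd a c * gcd b c"
proof -
  obtain x y where xy: "gcd (a * b) c = x * y" "x dvd a" "y dvd b" using division_decomp[of "gcd (a * b) c" a b] by auto
  have "x dvd c" "y dvd c" using xy(1) by (metis dvd_trans dvd_triv_left dvd_triv_right gcd_dvd2)+
  then show ?thesis unfolding xy(1) using xy by (intro mult_dvd_mono) auto
qed

text \<open>Up to sign a b is lcm a b times gcd a b, and the lcm divides c s.\<close>

lemma mult_dvd_mult_gcd:
  fixes a b c s t :: int
  assumes "a dvd c * s" "b dvd c" "gcd a b dvd t"
  shows "a * b dvd c * (s * t)"
proof -
  have "lcm a b dvd c * s" using assms by simp
  then have "lcm a b * gcd a b dvd c * s * t" using assms(3) by (rule mult_dvd_mono)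
  moreover have "\<bar>a * b\<bar> = lcm a b * gcd a b" by (metis abs_mult mult.commute prod_gcd_lcm_int)
  ultimately have "\<bar>a * b\<bar> dvd c * s * t" by simp
  then show ?thesis by (simp add: mult.assoc)
qed

text \<open>One factor is added at a time. Each costs its gcd with the product so far, and that gcd
  divides the product of the pairwise gcds.\<close>

lemma prod4_dvd_gprod:
  fixes a b c d m :: int
  assumes "a dvd m" "b dvd m" "c dvd m" "d dvd m"
  shows "a * b * c * d dvd m * gprod a b c d"
proof -
  have "a * b dvd m * (1 * gcd a b)" by (rule mult_dvd_mult_gcd) (use assms in auto)
  then have "a * b * c dvd m * ((1 * gcd a b) * (gcd a c * gcd b c))"
    by (rule mult_dvd_mult_gcd) (use assms gcd_mult_dvd_int in auto)
  then have "a * b * c * d dvd m * (((1 * gcd a b) * (gcd a c * gcd b c)) * ((gcd a d * gcd b d) * gcd c d))"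
  proof (rule mult_dvd_mult_gcd)
    show "gcd (a * b * c) d dvd gcd a d * gcd b d * gcd c d"
      using gcd_mult_dvd_int[of "a * b" c d] gcd_mult_dvd_int[of a b d] by (meson dvd_trans dvd_refl mult_dvd_mono)
  qed (use assms in auto)
  then show ?thesis by (simp add: gprod_def mult_ac)
qed

lemma finite_plane_points [simp]: "finite (plane_points B)"
proof (rule finite_subset)
  let ?N = "nz_ints (B ^ 3)"
  show "plane_points B \<subseteq> ?N \<times> ?N \<times> ?N \<times> ?N" by (auto simp: plane_points_def nz_ints_def)
qed simp

lemma UNIV_4_eq: "(UNIV :: 4 set) = {1, 2, 3, 4}"
proof (rule UNIV_eq_I)
  fix x :: 4
  show "x \<in> {1, 2, 3, 4}" using exhaust_4[of x] by (simp only: insert_iff) blast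
qed

lemma gcd4_mult_int:
  fixes n p q r s :: int
  shows "gcd (n * p) (gcd (n * q) (gcd (n * r) (n * s))) = \<bar>n\<bar> * gcd p (gcd q (gcd r s))"
proof -
  have *: "gcd (n * x) (\<bar>n\<bar> * y) = \<bar>n\<bar> * gcd x y" for x y
  proof (cases "0 \<le> n")
    case True
    then show ?thesis using gcd_mult_distrib_int[of n x y] by simp
  next
    case False
    then show ?thesis using gcd_mult_distrib_int[of "- n" x y] by simp
  qed
  have "gcd (n * r) (n * s) = \<bar>n\<bar> * gcd r s" by (simp only: gcd_mult_distrib_int)
  then show ?thesis by (simp only: *)
qed

text \<open>If one coordinate vanishes, the cubic equation makes a second one vanish, and the point
  lies on a line X_i = X_j = 0. The equation also reads x3 x4 (x1 + x2) + x1 x2 (x3 + x4) = 0, so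
  one pair sum vanishes only together with the complementary one, and the other three lines exclude
  this.\<close>

lemma counted_pointsD:
  assumes "x \<in> counted_points B"
  shows "x$1 \<noteq> 0" "x$2 \<noteq> 0" "x$3 \<noteq> 0" "x$4 \<noteq> 0"
    "x$2 * x$3 * x$4 + x$1 * x$3 * x$4 + x$1 * x$2 * x$4 + x$1 * x$2 * x$3 = 0"
    "gcd (x$1) (gcd (x$2) (gcd (x$3) (x$4))) = 1"
    "\<bar>real_of_int (x$i)\<bar> \<le> B"
    "x$1 + x$2 \<noteq> 0" "x$1 + x$3 \<noteq> 0" "x$1 + x$4 \<noteq> 0" "x$2 + x$3 \<noteq> 0" "x$2 + x$4 \<noteq> 0" "x$3 + x$4 \<noteq> 0"
proof -
  have U: "in_U x" and M: "real_of_int (MAX i. \<bar>x$i\<bar>) \<le> B" and G: "(GCD i. x$i) = 1" using assms by (simp_all add: counted_points_def)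
  have eq: "x$2 * x$3 * x$4 + x$1 * x$3 * x$4 + x$1 * x$2 * x$4 + x$1 * x$2 * x$3 = 0" using U by (simp add: in_U_def cayley_cubic_def)
  then show "x$2 * x$3 * x$4 + x$1 * x$3 * x$4 + x$1 * x$2 * x$4 + x$1 * x$2 * x$3 = 0" .
  have L: "\<not> (x$1 = 0 \<and> x$2 = 0)" "\<not> (x$1 = 0 \<and> x$3 = 0)" "\<not> (x$1 = 0 \<and> x$4 = 0)" "\<not> (x$2 = 0 \<and> x$3 = 0)"
     "\<not> (x$2 = 0 \<and> x$4 = 0)" "\<not> (x$3 = 0 \<and> x$4 = 0)"
     "\<not> (x$1 + x$2 = 0 \<and> x$3 + x$4 = 0)" "\<not> (x$1 + x$3 = 0 \<and> x$2 + x$4 = 0)" "\<not> (x$1 + x$4 = 0 \<and> x$2 + x$3 = 0)"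
    using U by (simp_all add: in_U_def cayley_lines_def coord_line_def pair_line_def)
  show nz: "x$1 \<noteq> 0" "x$2 \<noteq> 0" "x$3 \<noteq> 0" "x$4 \<noteq> 0" using eq L by auto
  have f12: "x$3 * x$4 * (x$1 + x$2) + x$1 * x$2 * (x$3 + x$4) = 0" using eq by (simp add: algebra_simps)
  have f13: "x$2 * x$4 * (x$1 + x$3) + x$1 * x$3 * (x$2 + x$4) = 0" using eq by (simp add: algebra_simps)
  have f14: "x$2 * x$3 * (x$1 + x$4) + x$1 * x$4 * (x$2 + x$3) = 0" using eq by (simp add: algebra_simps)
  have "x$1 + x$2 = 0 \<longleftrightarrow> x$3 + x$4 = 0" using f12 nz by (metis add.left_neutral add.right_neutral mult_eq_0_iff mult_zero_right)
  then show "x$1 + x$2 \<noteq> 0" "x$3 + x$4 \<noteq> 0" using L(7) by blast+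
  have "x$1 + x$3 = 0 \<longleftrightarrow> x$2 + x$4 = 0" using f13 nz by (metis add.left_neutral add.right_neutral mult_eq_0_iff mult_zero_right)
  then show "x$1 + x$3 \<noteq> 0" "x$2 + x$4 \<noteq> 0" using L(8) by blast+
  have "x$1 + x$4 = 0 \<longleftrightarrow> x$2 + x$3 = 0" using f14 nz by (metis add.left_neutral add.right_neutral mult_eq_0_iff mult_zero_right)
  then show "x$1 + x$4 \<noteq> 0" "x$2 + x$3 \<noteq> 0" using L(9) by blast+
  show "gcd (x$1) (gcd (x$2) (gcd (x$3) (x$4))) = 1" using G unfolding UNIV_4_eq by simp
  have "\<bar>x$i\<bar> \<le> (MAX i. \<bar>x$i\<bar>)" by (rule Max_ge) auto
  then show "\<bar>real_of_int (x$i)\<bar> \<le> B" using M by linarith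
qed

definition triple_gcd :: "int \<Rightarrow> int \<Rightarrow> int \<Rightarrow> int \<Rightarrow> int" where
  "triple_gcd a b c d = gcd (b * c * d) (gcd (a * c * d) (gcd (a * b * d) (a * b * c)))"

text \<open>The primitive integer vector proportional to the inverses of the coordinates, written
  without denominators.\<close>

definition to_plane :: "int ^ 4 \<Rightarrow> int \<times> int \<times> int \<times> int" where
  "to_plane x = (let g = triple_gcd (x$1) (x$2) (x$3) (x$4) in
     ((x$2 * x$3 * x$4) div g, (x$1 * x$3 * x$4) div g, (x$1 * x$2 * x$4) div g, (x$1 * x$2 * x$3) div g))"

text \<open>The products of the w_i with the corresponding x_i have a common value m, which is a
  common multiple of the w_i. Hence |a b c d| \<le> |m| \<open>gprod\<close>, and the height enters
  through |m| \<le> B |w_i| for each i.\<close>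

lemma to_plane_facts:
  assumes x: "x \<in> counted_points B"
  obtains a b c d m where "to_plane x = (a, b, c, d)" "a * x$1 = m" "b * x$2 = m" "c * x$3 = m" "d * x$4 = m" "m \<noteq> 0"
    "(a, b, c, d) \<in> plane_points B" "m * triple_gcd (x$1) (x$2) (x$3) (x$4) = x$1 * x$2 * x$3 * x$4"
proof -
  note p = counted_pointsD[OF x]
  define g where "g = triple_gcd (x$1) (x$2) (x$3) (x$4)"
  have g0: "g > 0" using p(1-4) by (simp add: g_def triple_gcd_def)
  have gd: "g dvd x$2 * x$3 * x$4" "g dvd x$1 * x$3 * x$4" "g dvd x$1 * x$2 * x$4" "g dvd x$1 * x$2 * x$3"
    unfolding g_def triple_gcd_def by (meson gcd_dvd1 gcd_dvd2 dvd_trans)+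
  then obtain a b c d where w: "x$2 * x$3 * x$4 = g * a" "x$1 * x$3 * x$4 = g * b" "x$1 * x$2 * x$4 = g * c" "x$1 * x$2 * x$3 = g * d"
    by (meson dvdE)
  have T: "to_plane x = (a, b, c, d)" unfolding to_plane_def Let_def g_def[symmetric] w using g0 by simp
  have "g = gcd (g * a) (gcd (g * b) (gcd (g * c) (g * d)))" using g_def unfolding triple_gcd_def w by simp
  also have "\<dots> = g * gcd a (gcd b (gcd c d))" using g0 by (simp add: gcd_mult_left)
  finally have prim: "gcd a (gcd b (gcd c d)) = 1" using g0 by simp
  have "g * (a + b + c + d) = 0" using p(5) unfolding w distrib_left by simp
  then have sum0: "a + b + c + d = 0" using g0 by simp
  define m where "m = a * x$1"
  have E: "g * (a * x$1) = x$1 * x$2 * x$3 * x$4" "g * (b * x$2) = x$1 * x$2 * x$3 * x$4" "g * (c * x$3) = x$1 * x$2 * x$3 * x$4"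
    "g * (d * x$4) = x$1 * x$2 * x$3 * x$4"
    unfolding mult.assoc[symmetric] w[symmetric] by simp_all
  have m: "a * x$1 = m" "b * x$2 = m" "c * x$3 = m" "d * x$4 = m"
    using E g0 unfolding m_def by (metis mult_cancel_left less_irrefl)+
  have m0: "m \<noteq> 0" using E(1) p(1-4) unfolding m(1) by auto
  have nz: "a \<noteq> 0" "b \<noteq> 0" "c \<noteq> 0" "d \<noteq> 0" using m m0 by auto
  have "g * (a + b) = x$3 * x$4 * (x$1 + x$2)" "g * (a + c) = x$2 * x$4 * (x$1 + x$3)" "g * (a + d) = x$2 * x$3 * (x$1 + x$4)"
    "g * (b + c) = x$1 * x$4 * (x$2 + x$3)" "g * (b + d) = x$1 * x$3 * (x$2 + x$4)" "g * (c + d) = x$1 * x$2 * (x$3 + x$4)"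
    unfolding distrib_left w[symmetric] by (simp_all add: algebra_simps)
  then have ps: "a + b \<noteq> 0" "a + c \<noteq> 0" "a + d \<noteq> 0" "b + c \<noteq> 0" "b + d \<noteq> 0" "c + d \<noteq> 0"
    using p(1-4,8-13) by (metis mult_eq_0_iff)+
  have dv: "a dvd m" "b dvd m" "c dvd m" "d dvd m" using m by (metis dvd_triv_left)+
  have G0: "gprod a b c d > 0" unfolding gprod_def using nz by simp
  have "\<bar>a * b * c * d\<bar> \<le> \<bar>m * gprod a b c d\<bar>" by (rule dvd_imp_le_int) (use prod4_dvd_gprod[OF dv] m0 G0 in auto)
  then have le: "\<bar>real_of_int (a * b * c * d)\<bar> \<le> \<bar>real_of_int m\<bar> * real_of_int (gprod a b c d)"
    using G0 by (simp only: abs_mult abs_of_pos of_int_mult[symmetric] of_int_abs[symmetric] of_int_le_iff)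
  have H: "\<bar>real_of_int (a * b * c * d)\<bar> \<le> B * real_of_int (gprod a b c d) * \<bar>real_of_int y\<bar>" if y: "y * x$i = m" for y i
  proof -
    have "\<bar>real_of_int m\<bar> = \<bar>real_of_int y\<bar> * \<bar>real_of_int (x$i)\<bar>" unfolding y[symmetric] by (simp add: abs_mult)
    also have "\<dots> \<le> \<bar>real_of_int y\<bar> * B" using p(7) by (intro mult_left_mono) auto
    finally have "\<bar>real_of_int m\<bar> * real_of_int (gprod a b c d) \<le> \<bar>real_of_int y\<bar> * B * real_of_int (gprod a b c d)"
      using G0 by (intro mult_right_mono) auto
    then show ?thesis using le by (simp add: mult_ac)
  qed
  have B3: "\<bar>real_of_int y\<bar> \<le> B ^ 3" if y: "x$i * x$j * x$k = g * y" for y i j k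
  proof -
    have "\<bar>real_of_int y\<bar> \<le> \<bar>real_of_int (g * y)\<bar>"
      using g0 mult_right_mono[of 1 "real_of_int g" "\<bar>real_of_int y\<bar>"] by (simp add: abs_mult)
    also have "\<dots> = \<bar>real_of_int (x$i)\<bar> * \<bar>real_of_int (x$j)\<bar> * \<bar>real_of_int (x$k)\<bar>" unfolding y[symmetric] by (simp add: abs_mult)
    also have "\<dots> \<le> B * B * B" using p(7)[of i] p(7)[of j] p(7)[of k] by (intro mult_mono mult_nonneg_nonneg) auto
    finally show ?thesis by (simp add: power3_eq_cube)
  qed
  have "(a, b, c, d) \<in> plane_points B"
    unfolding plane_points_def mem_Collect_eq prod.case
    using sum0 nz ps prim H[OF m(1)] H[OF m(2)] H[OF m(3)] H[OF m(4)] B3[OF w(1)] B3[OF w(2)] B3[OF w(3)] B3[OF w(4)] by blast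
  moreover have "m * triple_gcd (x$1) (x$2) (x$3) (x$4) = x$1 * x$2 * x$3 * x$4" using E(1) unfolding m g_def by (simp add: mult.commute)
  ultimately show thesis using that T m m0 by blast
qed

text \<open>Points x and y with the same image satisfy n x = m y and, being primitive, agree up to
  sign. Opposite points are told apart because the map is odd: m times the triple gcd is x1 x2 x3
  x4, which is unchanged under x to -x, so m = n and the sign is fixed.\<close>

lemma N_le_card_plane_points: "N B \<le> card (plane_points B)"
proof -
  have "inj_on to_plane (counted_points B)"
  proof (rule inj_onI)
    fix x y assume xy: "x \<in> counted_points B" "y \<in> counted_points B" "to_plane x = to_plane y"
    obtain a b c d m where ax: "to_plane x = (a, b, c, d)" "a * x$1 = m" "b * x$2 = m" "c * x$3 = m" "d * x$4 = m" "m \<noteq> 0"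
      "m * triple_gcd (x$1) (x$2) (x$3) (x$4) = x$1 * x$2 * x$3 * x$4" using to_plane_facts[OF xy(1)] by metis
    obtain a' b' c' d' n where ay: "to_plane y = (a', b', c', d')" "a' * y$1 = n" "b' * y$2 = n" "c' * y$3 = n" "d' * y$4 = n" "n \<noteq> 0"
      "n * triple_gcd (y$1) (y$2) (y$3) (y$4) = y$1 * y$2 * y$3 * y$4" using to_plane_facts[OF xy(2)] by metis
    have e: "a' = a" "b' = b" "c' = c" "d' = d" using ax(1) ay(1) xy(3) by simp_all
    have nz: "a \<noteq> 0" "b \<noteq> 0" "c \<noteq> 0" "d \<noteq> 0" using ax by auto
    have gen: "n * p = m * q" if "v * p = m" "v * q = n" "v \<noteq> 0" for v p q :: int
    proof -
      have "v * (n * p) = n * m" "v * (m * q) = m * n" using that(1,2) by (metis mult.left_commute)+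
      then have "v * (n * p) = v * (m * q)" by (simp only: mult.commute)
      then show ?thesis using that(3) by simp
    qed
    have pr: "n * x$1 = m * y$1" "n * x$2 = m * y$2" "n * x$3 = m * y$3" "n * x$4 = m * y$4"
      using gen[OF ax(2) ay(2)[unfolded e] nz(1)] gen[OF ax(3) ay(3)[unfolded e] nz(2)] gen[OF ax(4) ay(4)[unfolded e] nz(3)]
        gen[OF ax(5) ay(5)[unfolded e] nz(4)] by blast+
    have "gcd (n * x$1) (gcd (n * x$2) (gcd (n * x$3) (n * x$4))) = \<bar>n\<bar> * gcd (x$1) (gcd (x$2) (gcd (x$3) (x$4)))"
      by (rule gcd4_mult_int)
    moreover have "gcd (m * y$1) (gcd (m * y$2) (gcd (m * y$3) (m * y$4))) = \<bar>m\<bar> * gcd (y$1) (gcd (y$2) (gcd (y$3) (y$4)))"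
      by (rule gcd4_mult_int)
    ultimately have "\<bar>n\<bar> = \<bar>m\<bar>" unfolding pr counted_pointsD(6)[OF xy(1)] counted_pointsD(6)[OF xy(2)] by simp
    then consider "n = m" | "n = - m" by (auto simp: abs_eq_iff)
    then show "x = y"
    proof cases
      case 1
      then have "x$1 = y$1" "x$2 = y$2" "x$3 = y$3" "x$4 = y$4" using pr ax(6) by simp_all
      then show ?thesis by (simp add: vec_eq_iff forall_4)
    next
      case 2
      have neg: "p = - q" if "n * p = m * q" for p q
      proof -
        have "m * (p + q) = 0" using that unfolding 2 by (simp add: algebra_simps)
        then show ?thesis using ax(6) by simp
      qed
      have s: "x$1 = - y$1" "x$2 = - y$2" "x$3 = - y$3" "x$4 = - y$4" using neg pr by blast+
      have t: "triple_gcd (x$1) (x$2) (x$3) (x$4) = triple_gcd (y$1) (y$2) (y$3) (y$4)" unfolding s triple_gcd_def by simp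
      have "x$1 * x$2 * x$3 * x$4 = y$1 * y$2 * y$3 * y$4" unfolding s by simp
      then have "m * triple_gcd (x$1) (x$2) (x$3) (x$4) = n * triple_gcd (y$1) (y$2) (y$3) (y$4)" unfolding ax(7) ay(7) .
      then have "m * triple_gcd (x$1) (x$2) (x$3) (x$4) = n * triple_gcd (x$1) (x$2) (x$3) (x$4)" unfolding t .
      moreover have "triple_gcd (x$1) (x$2) (x$3) (x$4) \<noteq> 0" using ax(7) counted_pointsD(1-4)[OF xy(1)] by auto
      ultimately have "m = n" by simp
      then show ?thesis using 2 ax(6) by simp
    qed
  qed
  moreover have "to_plane ` counted_points B \<subseteq> plane_points B"
  proof
    fix w assume "w \<in> to_plane ` counted_points B"
    then obtain x where x: "x \<in> counted_points B" "w = to_plane x" by blast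
    show "w \<in> plane_points B" using to_plane_facts[OF x(1)] x(2) by metis
  qed
  ultimately show ?thesis unfolding N_def using card_inj_on_le finite_plane_points by blast
qed

definition sorted_points :: "real \<Rightarrow> (int \<times> int \<times> int \<times> int) set" where
  "sorted_points B = {(a, b, c, d) \<in> plane_points B. \<bar>b\<bar> \<le> \<bar>a\<bar> \<and> \<bar>c\<bar> \<le> \<bar>b\<bar> \<and> \<bar>d\<bar> \<le> \<bar>c\<bar>}"

lemma plane_points_swap12: "(a, b, c, d) \<in> plane_points B \<Longrightarrow> (b, a, c, d) \<in> plane_points B"
  unfolding plane_points_def gprod_def by (simp add: ac_simps) 

lemma plane_points_swap23: "(a, b, c, d) \<in> plane_points B \<Longrightarrow> (a, c, b, d) \<in> plane_points B"
  unfolding plane_points_def gprod_def by (simp add: ac_simps)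

lemma plane_points_swap34: "(a, b, c, d) \<in> plane_points B \<Longrightarrow> (a, b, d, c) \<in> plane_points B"
  unfolding plane_points_def gprod_def by (simp add: ac_simps)

text \<open>24 = 4 * 3 * 2 counts the successive choices of the largest coordinate, of the next and
  of the last two. Transpositions suffice.\<close>

lemma card_plane_points_le: "card (plane_points B) \<le> 24 * card (sorted_points B)"
proof -
  let ?P = "plane_points B"
  define P1 where "P1 = {(a, b, c, d) \<in> ?P. \<bar>b\<bar> \<le> \<bar>a\<bar> \<and> \<bar>c\<bar> \<le> \<bar>a\<bar> \<and> \<bar>d\<bar> \<le> \<bar>a\<bar>}"
  define P2 where "P2 = {(a, b, c, d) \<in> P1. \<bar>c\<bar> \<le> \<bar>b\<bar> \<and> \<bar>d\<bar> \<le> \<bar>b\<bar>}"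
  let ?s12 = "\<lambda>(a::int, b::int, c::int, d::int). (b, a, c, d)" and ?s13 = "\<lambda>(a::int, b::int, c::int, d::int). (c, b, a, d)"
    and ?s14 = "\<lambda>(a::int, b::int, c::int, d::int). (d, b, c, a)" and ?s23 = "\<lambda>(a::int, b::int, c::int, d::int). (a, c, b, d)"
    and ?s24 = "\<lambda>(a::int, b::int, c::int, d::int). (a, d, c, b)" and ?s34 = "\<lambda>(a::int, b::int, c::int, d::int). (a, b, d, c)"
  have sw: "(b, a, c, d) \<in> ?P" "(c, b, a, d) \<in> ?P" "(d, b, c, a) \<in> ?P" "(a, c, b, d) \<in> ?P" "(a, d, c, b) \<in> ?P" "(a, b, d, c) \<in> ?P"
    if "(a, b, c, d) \<in> ?P" for a b c d
    using that plane_points_swap12 plane_points_swap23 plane_points_swap34 by meson+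
  have fin: "finite P1" "finite P2" "finite (sorted_points B)"
    unfolding P1_def P2_def sorted_points_def by (auto intro: finite_subset[OF _ finite_plane_points[of B]])
  have "?P \<subseteq> P1 \<union> ?s12 ` P1 \<union> ?s13 ` P1 \<union> ?s14 ` P1"
  proof
    fix w assume w: "w \<in> ?P"
    obtain a b c d where we: "w = (a, b, c, d)" by (cases w)
    note s = sw[OF w[unfolded we]]
    consider "\<bar>b\<bar> \<le> \<bar>a\<bar> \<and> \<bar>c\<bar> \<le> \<bar>a\<bar> \<and> \<bar>d\<bar> \<le> \<bar>a\<bar>" | "\<bar>a\<bar> \<le> \<bar>b\<bar> \<and> \<bar>c\<bar> \<le> \<bar>b\<bar> \<and> \<bar>d\<bar> \<le> \<bar>b\<bar>"
      | "\<bar>b\<bar> \<le> \<bar>c\<bar> \<and> \<bar>a\<bar> \<le> \<bar>c\<bar> \<and> \<bar>d\<bar> \<le> \<bar>c\<bar>" | "\<bar>b\<bar> \<le> \<bar>d\<bar> \<and> \<bar>c\<bar> \<le> \<bar>d\<bar> \<and> \<bar>a\<bar> \<le> \<bar>d\<bar>" by linarith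
    then show "w \<in> P1 \<union> ?s12 ` P1 \<union> ?s13 ` P1 \<union> ?s14 ` P1"
    proof cases
      case 1
      then have "w \<in> P1" using w unfolding we P1_def by simp
      then show ?thesis by blast
    next
      case 2
      then have "(b, a, c, d) \<in> P1" using s(1) unfolding P1_def by simp
      then have "?s12 (b, a, c, d) \<in> ?s12 ` P1" by (rule imageI)
      then show ?thesis unfolding we by simp
    next
      case 3
      then have "(c, b, a, d) \<in> P1" using s(2) unfolding P1_def by simp
      then have "?s13 (c, b, a, d) \<in> ?s13 ` P1" by (rule imageI)
      then show ?thesis unfolding we by simp
    next
      case 4
      then have "(d, b, c, a) \<in> P1" using s(3) unfolding P1_def by simp
      then have "?s14 (d, b, c, a) \<in> ?s14 ` P1" by (rule imageI)
      then show ?thesis unfolding we by simp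
    qed
  qed
  then have "card ?P \<le> card (P1 \<union> ?s12 ` P1 \<union> ?s13 ` P1 \<union> ?s14 ` P1)" by (rule card_mono[rotated]) (use fin in auto)
  also have "\<dots> \<le> card P1 + card (?s12 ` P1) + card (?s13 ` P1) + card (?s14 ` P1)"
    by (intro order_trans[OF card_Un_le] add_right_mono order_refl)
  also have "\<dots> \<le> 4 * card P1"
    using card_image_le[OF fin(1), of ?s12] card_image_le[OF fin(1), of ?s13] card_image_le[OF fin(1), of ?s14] by linarith
  finally have 1: "card ?P \<le> 4 * card P1" .
  have "P1 \<subseteq> P2 \<union> ?s23 ` P2 \<union> ?s24 ` P2"
  proof
    fix w assume w: "w \<in> P1"
    obtain a b c d where we: "w = (a, b, c, d)" by (cases w)
    have m: "(a, b, c, d) \<in> ?P" "\<bar>b\<bar> \<le> \<bar>a\<bar>" "\<bar>c\<bar> \<le> \<bar>a\<bar>" "\<bar>d\<bar> \<le> \<bar>a\<bar>" using w unfolding we P1_def by simp_all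
    note s = sw[OF m(1)]
    consider "\<bar>c\<bar> \<le> \<bar>b\<bar> \<and> \<bar>d\<bar> \<le> \<bar>b\<bar>" | "\<bar>b\<bar> \<le> \<bar>c\<bar> \<and> \<bar>d\<bar> \<le> \<bar>c\<bar>" | "\<bar>c\<bar> \<le> \<bar>d\<bar> \<and> \<bar>b\<bar> \<le> \<bar>d\<bar>" by linarith
    then show "w \<in> P2 \<union> ?s23 ` P2 \<union> ?s24 ` P2"
    proof cases
      case 1
      then have "w \<in> P2" using m unfolding we P1_def P2_def by simp
      then show ?thesis by blast
    next
      case 2
      then have "(a, c, b, d) \<in> P2" using s(4) m unfolding P1_def P2_def by simp
      then have "?s23 (a, c, b, d) \<in> ?s23 ` P2" by (rule imageI)
      then show ?thesis unfolding we by simp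
    next
      case 3
      then have "(a, d, c, b) \<in> P2" using s(5) m unfolding P1_def P2_def by simp
      then have "?s24 (a, d, c, b) \<in> ?s24 ` P2" by (rule imageI)
      then show ?thesis unfolding we by simp
    qed
  qed
  then have "card P1 \<le> card (P2 \<union> ?s23 ` P2 \<union> ?s24 ` P2)" by (rule card_mono[rotated]) (use fin in auto)
  also have "\<dots> \<le> card P2 + card (?s23 ` P2) + card (?s24 ` P2)"
    by (intro order_trans[OF card_Un_le] add_right_mono order_refl)
  also have "\<dots> \<le> 3 * card P2"
    using card_image_le[OF fin(2), of ?s23] card_image_le[OF fin(2), of ?s24] by linarith
  finally have 2: "card P1 \<le> 3 * card P2" .
  let ?S = "sorted_points B"
  have "P2 \<subseteq> ?S \<union> ?s34 ` ?S"
  proof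
    fix w assume w: "w \<in> P2"
    obtain a b c d where we: "w = (a, b, c, d)" by (cases w)
    have m: "(a, b, c, d) \<in> ?P" "\<bar>b\<bar> \<le> \<bar>a\<bar>" "\<bar>c\<bar> \<le> \<bar>b\<bar>" "\<bar>d\<bar> \<le> \<bar>b\<bar>" using w unfolding we P1_def P2_def by simp_all
    note s = sw[OF m(1)]
    consider "\<bar>d\<bar> \<le> \<bar>c\<bar>" | "\<bar>c\<bar> \<le> \<bar>d\<bar>" by linarith
    then show "w \<in> ?S \<union> ?s34 ` ?S"
    proof cases
      case 1
      then have "w \<in> ?S" using m unfolding we sorted_points_def by simp
      then show ?thesis by blast
    next
      case 2
      then have "(a, b, d, c) \<in> ?S" using s(6) m unfolding sorted_points_def by simp
      then have "?s34 (a, b, d, c) \<in> ?s34 ` ?S" by (rule imageI)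
      then show ?thesis unfolding we by simp
    qed
  qed
  then have "card P2 \<le> card (?S \<union> ?s34 ` ?S)" by (rule card_mono[rotated]) (use fin in auto)
  also have "\<dots> \<le> card ?S + card (?s34 ` ?S)" by (rule card_Un_le)
  also have "\<dots> \<le> 2 * card ?S" using card_image_le[OF fin(3), of ?s34] by linarith
  finally show ?thesis using 1 2 by linarith
qed

lemma coprime_if_three:
  fixes a b c p q :: int
  assumes "\<And>g. g dvd a \<Longrightarrow> g dvd b \<Longrightarrow> g dvd c \<Longrightarrow> is_unit g"
    and "\<And>g. g dvd p \<Longrightarrow> g dvd q \<Longrightarrow> g dvd a \<and> g dvd b \<and> g dvd c"
  shows "coprime p q"
  by (rule coprimeI) (use assms in blast)

text \<open>A common divisor of three coordinates divides the fourth, since the sum vanishes, and is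
  a unit. Any two different pairwise gcds together involve at least three coordinates, so they are
  coprime; the same argument gives the coprimality of u_i with the gcds not involving i.\<close>

lemma plane_point_torsor:
  fixes a b c d :: int
  assumes sum0: "a + b + c + d = 0" and nz: "a \<noteq> 0" "b \<noteq> 0" "c \<noteq> 0" "d \<noteq> 0"
    and ps: "a + b \<noteq> 0" "a + c \<noteq> 0" "a + d \<noteq> 0" and prim: "gcd a (gcd b (gcd c d)) = 1"
  obtains u1 u2 u3 u4 where
    "torsor u1 u2 u3 u4 (gcd a b) (gcd a c) (gcd a d) (gcd b c) (gcd b d) (gcd c d)"
    "a = gcd a b * gcd a c * gcd a d * u1" "b = gcd a b * gcd b c * gcd b d * u2"
    "c = gcd a c * gcd b c * gcd c d * u3" "d = gcd a d * gcd b d * gcd c d * u4"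
proof -
  have four: "is_unit g" if "g dvd a" "g dvd b" "g dvd c" "g dvd d" for g
  proof -
    have "g dvd gcd a (gcd b (gcd c d))" using that by simp
    then show ?thesis using prim by simp
  qed
  have abc: "is_unit g" if "g dvd a" "g dvd b" "g dvd c" for g
  proof (rule four[OF that])
    have "d = - (a + b + c)" using sum0 by simp
    then show "g dvd d" using that by simp
  qed
  have abd: "is_unit g" if "g dvd a" "g dvd b" "g dvd d" for g
  proof (rule four[OF that(1,2) _ that(3)])
    have "c = - (a + b + d)" using sum0 by simp
    then show "g dvd c" using that by simp
  qed
  have acd: "is_unit g" if "g dvd a" "g dvd c" "g dvd d" for g
  proof (rule four[OF that(1) _ that(2,3)])
    have "b = - (a + c + d)" using sum0 by simp
    then show "g dvd b" using that by simp
  qed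
  have bcd: "is_unit g" if "g dvd b" "g dvd c" "g dvd d" for g
  proof (rule four[OF _ that])
    have "a = - (b + c + d)" using sum0 by simp
    then show "g dvd a" using that by simp
  qed
  have cd1: "coprime (gcd a b) (gcd a c)" by (rule coprime_if_three[OF abc]) auto
  have cd2: "coprime (gcd a b) (gcd a d)" by (rule coprime_if_three[OF abd]) auto
  have cd3: "coprime (gcd a b) (gcd b c)" by (rule coprime_if_three[OF abc]) auto
  have cd4: "coprime (gcd a b) (gcd b d)" by (rule coprime_if_three[OF abd]) auto
  have cd5: "coprime (gcd a b) (gcd c d)" by (rule coprime_if_three[OF abc]) auto
  have cd6: "coprime (gcd a c) (gcd a d)" by (rule coprime_if_three[OF acd]) auto
  have cd7: "coprime (gcd a c) (gcd b c)" by (rule coprime_if_three[OF abc]) auto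
  have cd8: "coprime (gcd a c) (gcd b d)" by (rule coprime_if_three[OF abc]) auto
  have cd9: "coprime (gcd a c) (gcd c d)" by (rule coprime_if_three[OF acd]) auto
  have cd10: "coprime (gcd a d) (gcd b c)" by (rule coprime_if_three[OF abc]) auto
  have cd11: "coprime (gcd a d) (gcd b d)" by (rule coprime_if_three[OF abd]) auto
  have cd12: "coprime (gcd a d) (gcd c d)" by (rule coprime_if_three[OF acd]) auto
  have cd13: "coprime (gcd b c) (gcd b d)" by (rule coprime_if_three[OF bcd]) auto
  have cd14: "coprime (gcd b c) (gcd c d)" by (rule coprime_if_three[OF bcd]) auto
  have cd15: "coprime (gcd b d) (gcd c d)" by (rule coprime_if_three[OF bcd]) auto
  have three: "x * y * z dvd w" if "x dvd w" "y dvd w" "z dvd w" "coprime x y" "coprime x z" "coprime y z" for x y z w :: int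
    using that by (intro divides_mult) simp_all
  have "gcd a b * gcd a c * gcd a d dvd a" by (rule three) (use cd1 cd2 cd6 in simp_all)
  then obtain u1 where u1: "a = gcd a b * gcd a c * gcd a d * u1" by (rule dvdE)
  have "gcd a b * gcd b c * gcd b d dvd b" by (rule three) (use cd3 cd4 cd13 in simp_all)
  then obtain u2 where u2: "b = gcd a b * gcd b c * gcd b d * u2" by (rule dvdE)
  have "gcd a c * gcd b c * gcd c d dvd c" by (rule three) (use cd7 cd9 cd14 in simp_all)
  then obtain u3 where u3: "c = gcd a c * gcd b c * gcd c d * u3" by (rule dvdE)
  have "gcd a d * gcd b d * gcd c d dvd d" by (rule three) (use cd11 cd12 cd15 in simp_all)
  then obtain u4 where u4: "d = gcd a d * gcd b d * gcd c d * u4" by (rule dvdE)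
  have ua: "u1 dvd a" "u2 dvd b" "u3 dvd c" "u4 dvd d" by (metis u1 dvd_triv_right, metis u2 dvd_triv_right, metis u3 dvd_triv_right, metis u4 dvd_triv_right)
  have un: "u1 \<noteq> 0" "u2 \<noteq> 0" "u3 \<noteq> 0" "u4 \<noteq> 0" using nz u1 u2 u3 u4 by (metis mult_zero_right)+
  \<comment> \<open>After division by their gcd, x and y are coprime, and u and v are factors of the
    cofactors. The disjunctions only record the position of the gcd in the product.\<close>
  have pair: "coprime u v" if "x = gcd x y * s * t * u \<or> x = s * gcd x y * t * u \<or> x = s * t * gcd x y * u"
      "y = gcd x y * s' * t' * v \<or> y = s' * gcd x y * t' * v \<or> y = s' * t' * gcd x y * v" "x \<noteq> 0" for x y s t u s' t' v :: int
  proof -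
    have g: "gcd x y > 0" using that(3) by simp
    have "x = gcd x y * (s * t * u)" "y = gcd x y * (s' * t' * v)" using that(1,2) by (metis mult.assoc mult.commute mult.left_commute)+
    then have "coprime (s * t * u) (s' * t' * v)" using g by (metis gcd_coprime less_irrefl nonzero_mult_div_cancel_left div_gcd_coprime that(3))
    then show ?thesis by simp
  qed
  have cu: "coprime u1 u2" "coprime u1 u3" "coprime u1 u4" "coprime u2 u3" "coprime u2 u4" "coprime u3 u4"
    by (rule pair[OF disjI1[OF u1] disjI1[OF u2] nz(1)],
        rule pair[OF disjI2[OF disjI1[OF u1]] disjI1[OF u3] nz(1)],
        rule pair[OF disjI2[OF disjI2[OF u1]] disjI1[OF u4] nz(1)],
        rule pair[OF disjI2[OF disjI1[OF u2]] disjI2[OF disjI1[OF u3]] nz(2)],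
        rule pair[OF disjI2[OF disjI2[OF u2]] disjI2[OF disjI1[OF u4]] nz(2)],
        rule pair[OF disjI2[OF disjI2[OF u3]] disjI2[OF disjI2[OF u4]] nz(3)])
  have x1: "coprime u1 (gcd b c)" by (rule coprime_if_three[OF abc]) (use ua in \<open>auto intro: dvd_trans\<close>)
  have x2: "coprime u1 (gcd b d)" by (rule coprime_if_three[OF abd]) (use ua in \<open>auto intro: dvd_trans\<close>)
  have x3: "coprime u1 (gcd c d)" by (rule coprime_if_three[OF acd]) (use ua in \<open>auto intro: dvd_trans\<close>)
  have x4: "coprime u2 (gcd a c)" by (rule coprime_if_three[OF abc]) (use ua in \<open>auto intro: dvd_trans\<close>)
  have x5: "coprime u2 (gcd a d)" by (rule coprime_if_three[OF abd]) (use ua in \<open>auto intro: dvd_trans\<close>)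
  have x6: "coprime u2 (gcd c d)" by (rule coprime_if_three[OF bcd]) (use ua in \<open>auto intro: dvd_trans\<close>)
  have x7: "coprime u3 (gcd a b)" by (rule coprime_if_three[OF abc]) (use ua in \<open>auto intro: dvd_trans\<close>)
  have x8: "coprime u3 (gcd a d)" by (rule coprime_if_three[OF acd]) (use ua in \<open>auto intro: dvd_trans\<close>)
  have x9: "coprime u3 (gcd b d)" by (rule coprime_if_three[OF bcd]) (use ua in \<open>auto intro: dvd_trans\<close>)
  have x10: "coprime u4 (gcd a b)" by (rule coprime_if_three[OF abd]) (use ua in \<open>auto intro: dvd_trans\<close>)
  have x11: "coprime u4 (gcd a c)" by (rule coprime_if_three[OF acd]) (use ua in \<open>auto intro: dvd_trans\<close>)
  have x12: "coprime u4 (gcd b c)" by (rule coprime_if_three[OF bcd]) (use ua in \<open>auto intro: dvd_trans\<close>)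
  have gp: "gcd a b > 0" "gcd a c > 0" "gcd a d > 0" "gcd b c > 0" "gcd b d > 0" "gcd c d > 0" using nz by simp_all
  have "torsor u1 u2 u3 u4 (gcd a b) (gcd a c) (gcd a d) (gcd b c) (gcd b d) (gcd c d)"
    unfolding torsor_def u1[symmetric] u2[symmetric] u3[symmetric] u4[symmetric]
    using un gp cu cd1 cd2 cd3 cd4 cd5 cd6 cd7 cd8 cd9 cd10 cd11 cd12 cd13 cd14 cd15
      x1 x2 x3 x4 x5 x6 x7 x8 x9 x10 x11 x12 sum0 ps by blast
  then show thesis using that u1 u2 u3 u4 by blast
qed

text \<open>For the second inequality suppose that d cancels more than half of a. Then b + c is too
  small for b and c to have equal signs, and with opposite signs the ordering forces a + b = 0 or a
  + c = 0. It supplies the lower bound for w1 + w4 in \<open>torsor_box\<close>.\<close>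

lemma sorted_sum_zero:
  fixes a b c d :: int
  assumes "a + b + c + d = 0" "\<bar>b\<bar> \<le> \<bar>a\<bar>" "\<bar>c\<bar> \<le> \<bar>b\<bar>" "\<bar>d\<bar> \<le> \<bar>c\<bar>" "a + b \<noteq> 0" "a + c \<noteq> 0"
  shows "\<bar>a\<bar> \<le> 3 * \<bar>b\<bar>" "\<bar>a\<bar> \<le> 2 * \<bar>a + d\<bar>"
  using assms by (smt (verit))+

section \<open>Dyadic decomposition and the upper bound\<close>

definition dy :: "int \<Rightarrow> nat" where
  "dy x = nat \<lfloor>log 2 (real_of_int \<bar>x\<bar>)\<rfloor>"

lemma dy:
  assumes "x \<noteq> 0"
  shows "2 ^ dy x \<le> \<bar>real_of_int x\<bar>" "\<bar>real_of_int x\<bar> < 2 * 2 ^ dy x"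
proof -
  have x1: "1 \<le> \<bar>real_of_int x\<bar>" using assms by linarith
  then have l0: "0 \<le> log 2 \<bar>real_of_int x\<bar>" by simp
  have e: "real (dy x) = of_int \<lfloor>log 2 \<bar>real_of_int x\<bar>\<rfloor>" using l0 by (simp add: dy_def)
  have "(2::real) ^ dy x = 2 powr (real (dy x))" by (simp add: powr_realpow)
  also have "\<dots> \<le> 2 powr (log 2 \<bar>real_of_int x\<bar>)" unfolding e by (intro powr_mono) auto
  also have "\<dots> = \<bar>real_of_int x\<bar>" using x1 by simp
  finally show "2 ^ dy x \<le> \<bar>real_of_int x\<bar>" .
  have "\<bar>real_of_int x\<bar> = 2 powr (log 2 \<bar>real_of_int x\<bar>)" using x1 by simp
  also have "\<dots> < 2 powr (real (dy x) + 1)" unfolding e by (intro powr_less_mono) linarith+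
  also have "\<dots> = 2 * 2 ^ dy x" by (simp add: powr_add powr_realpow)
  finally show "\<bar>real_of_int x\<bar> < 2 * 2 ^ dy x" .
qed

lemma dy_le:
  assumes "x \<noteq> 0" "\<bar>real_of_int x\<bar> < 2 * 2 ^ n"
  shows "dy x \<le> n"
proof -
  have "(2::real) ^ dy x < 2 ^ (n + 1)" using dy(1)[OF assms(1)] assms(2) by simp
  then show ?thesis using power_less_imp_less_exp[of "2::real" "dy x" "n + 1"] by simp
qed

lemma geometric_sum_le:
  fixes q :: real
  assumes "0 \<le> q" "q < 1"
  shows "(\<Sum>i\<le>n. q ^ i) \<le> 1 / (1 - q)"
proof -
  have "(\<Sum>i\<le>n. q ^ i) = (1 - q ^ Suc n) / (1 - q)" using assms by (subst sum_gp0) auto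
  also have "\<dots> \<le> 1 / (1 - q)" using assms by (intro divide_right_mono) auto
  finally show ?thesis .
qed

lemma sum_reindex_le:
  fixes h :: "'b \<Rightarrow> real"
  assumes "finite T" "inj_on \<phi> I" "\<phi> ` I \<subseteq> T" "\<And>t. t \<in> T \<Longrightarrow> 0 \<le> h t"
  shows "(\<Sum>s\<in>I. h (\<phi> s)) \<le> (\<Sum>t\<in>T. h t)"
proof -
  have "(\<Sum>s\<in>I. h (\<phi> s)) = (\<Sum>t\<in>\<phi> ` I. h t)" using assms(2) by (simp add: sum.reindex)
  also have "\<dots> \<le> (\<Sum>t\<in>T. h t)" using assms by (intro sum_mono2) auto
  finally show ?thesis .
qed

lemma harm_le_1_plus_ln:
  assumes "n > 0"
  shows "harm n \<le> 1 + ln (real n)"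
proof -
  obtain m where m: "n = Suc m" using assms by (cases n) auto
  have "harm (Suc m) - ln (real (Suc m)) \<le> harm (Suc 0) - ln (real (Suc 0))"
    using decseq_harm_diff_ln unfolding decseq_def by blast
  then show ?thesis unfolding m by (simp add: harm_Suc harm_expand(1))
qed

definition box_index :: "int \<times> int \<times> int \<times> int \<Rightarrow> nat \<times> nat \<times> nat \<times> nat \<times> nat \<times> nat \<times> nat \<times> nat \<times> nat" where
  "box_index = (\<lambda>(a, b, c, d). (dy a, dy b, dy c, dy (gcd a b), dy (gcd a c), dy (gcd a d), dy (gcd b c), dy (gcd b d), dy (gcd c d)))"

text \<open>The two largest coordinates differ by a factor of at most 3, so k2 is within 2 of k. In
  the height condition 256 = 4 * 64: the 4 replaces |a| by |b|, and 64 comes from rounding six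
  gcds.\<close>

lemma box_index_facts:
  assumes w: "(a, b, c, d) \<in> sorted_points B" and B: "1 \<le> B" and n: "B ^ 3 < 2 * 2 ^ n"
    and ix: "box_index (a, b, c, d) = (k, k2, l, e12, e13, e14, e23, e24, e34)"
  obtains u1 u2 u3 u4 where
    "(u1, u2, u3, u4, gcd a b, gcd a c, gcd a d, gcd b c, gcd b d, gcd c d) \<in>
       torsor_box (2 ^ k) (2 ^ k2) (2 ^ l) (2 ^ e12) (2 ^ e13) (2 ^ e14) (2 ^ e23) (2 ^ e24) (2 ^ e34)"
    "a = gcd a b * gcd a c * gcd a d * u1" "b = gcd a b * gcd b c * gcd b d * u2"
    "c = gcd a c * gcd b c * gcd c d * u3" "d = gcd a d * gcd b d * gcd c d * u4"
    "k \<le> n" "l \<le> k" "k2 \<le> k" "k \<le> k2 + 2" "e12 + e13 + e14 \<le> k" "e12 + e23 + e24 \<le> k" "e13 + e23 + e34 \<le> l"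
    "2 ^ (2 * k + l) \<le> 256 * B * 2 ^ (e12 + e13 + e14 + e23 + e24 + e34)"
proof -
  have p: "a + b + c + d = 0" "a \<noteq> 0" "b \<noteq> 0" "c \<noteq> 0" "d \<noteq> 0" "a + b \<noteq> 0" "a + c \<noteq> 0" "a + d \<noteq> 0" "gcd a (gcd b (gcd c d)) = 1"
    "\<bar>real_of_int (a * b * c * d)\<bar> \<le> B * real_of_int (gprod a b c d) * \<bar>real_of_int d\<bar>" "\<bar>real_of_int a\<bar> \<le> B ^ 3"
    "\<bar>b\<bar> \<le> \<bar>a\<bar>" "\<bar>c\<bar> \<le> \<bar>b\<bar>" "\<bar>d\<bar> \<le> \<bar>c\<bar>"
    using w unfolding sorted_points_def plane_points_def mem_Collect_eq prod.case by blast+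
  obtain u1 u2 u3 u4 where t: "torsor u1 u2 u3 u4 (gcd a b) (gcd a c) (gcd a d) (gcd b c) (gcd b d) (gcd c d)"
    "a = gcd a b * gcd a c * gcd a d * u1" "b = gcd a b * gcd b c * gcd b d * u2"
    "c = gcd a c * gcd b c * gcd c d * u3" "d = gcd a d * gcd b d * gcd c d * u4"
    using plane_point_torsor[OF p(1-9)] by metis
  have ie: "dy a = k" "dy b = k2" "dy c = l" "dy (gcd a b) = e12" "dy (gcd a c) = e13" "dy (gcd a d) = e14" "dy (gcd b c) = e23"
    "dy (gcd b d) = e24" "dy (gcd c d) = e34" using ix unfolding box_index_def by simp_all
  have g0: "gcd a b > 0" "gcd a c > 0" "gcd a d > 0" "gcd b c > 0" "gcd b d > 0" "gcd c d > 0" using p(2-5) by simp_all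
  have A: "2 ^ k \<le> \<bar>real_of_int a\<bar>" "\<bar>real_of_int a\<bar> < 2 * 2 ^ k" using dy[OF p(2)] unfolding ie by simp_all
  have Bb: "2 ^ k2 \<le> \<bar>real_of_int b\<bar>" "\<bar>real_of_int b\<bar> < 2 * 2 ^ k2" using dy[OF p(3)] unfolding ie by simp_all
  have C: "2 ^ l \<le> \<bar>real_of_int c\<bar>" "\<bar>real_of_int c\<bar> < 2 * 2 ^ l" using dy[OF p(4)] unfolding ie by simp_all
  have gd: "2 ^ dy g \<le> real_of_int g \<and> real_of_int g < 2 * 2 ^ dy g" if "g > 0" for g using dy[of g] that by simp
  have G: "2 ^ e12 \<le> real_of_int (gcd a b) \<and> real_of_int (gcd a b) < 2 * 2 ^ e12" "2 ^ e13 \<le> real_of_int (gcd a c) \<and> real_of_int (gcd a c) < 2 * 2 ^ e13"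
    "2 ^ e14 \<le> real_of_int (gcd a d) \<and> real_of_int (gcd a d) < 2 * 2 ^ e14" "2 ^ e23 \<le> real_of_int (gcd b c) \<and> real_of_int (gcd b c) < 2 * 2 ^ e23"
    "2 ^ e24 \<le> real_of_int (gcd b d) \<and> real_of_int (gcd b d) < 2 * 2 ^ e24" "2 ^ e34 \<le> real_of_int (gcd c d) \<and> real_of_int (gcd c d) < 2 * 2 ^ e34"
    using gd[OF g0(1)] gd[OF g0(2)] gd[OF g0(3)] gd[OF g0(4)] gd[OF g0(5)] gd[OF g0(6)] unfolding ie by blast+
  have s: "\<bar>a\<bar> \<le> 3 * \<bar>b\<bar>" "\<bar>a\<bar> \<le> 2 * \<bar>a + d\<bar>" using sorted_sum_zero[OF p(1,12,13,14,6,7)] by blast+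
  have dc: "\<bar>real_of_int d\<bar> \<le> 2 * 2 ^ l" using p(14) C(2) by linarith
  have "real_of_int \<bar>a\<bar> \<le> real_of_int (2 * \<bar>a + d\<bar>)" using s(2) by (simp only: of_int_le_iff)
  then have ad: "2 ^ k / 2 \<le> \<bar>real_of_int (a + d)\<bar>" using A(1) by simp
  have box: "(u1, u2, u3, u4, gcd a b, gcd a c, gcd a d, gcd b c, gcd b d, gcd c d) \<in>
       torsor_box (2 ^ k) (2 ^ k2) (2 ^ l) (2 ^ e12) (2 ^ e13) (2 ^ e14) (2 ^ e23) (2 ^ e24) (2 ^ e34)"
    unfolding torsor_box_def mem_Collect_eq prod.case t(2-5)[symmetric] using t(1) G A Bb C dc ad by blast
  have kn: "k \<le> n" using dy_le[OF p(2), of n] p(11) n unfolding ie by linarith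
  have "\<bar>real_of_int c\<bar> < 2 * 2 ^ k" using p(12,13) A(2) by linarith
  then have lk: "l \<le> k" using dy_le[OF p(4), of k] unfolding ie by simp
  have "\<bar>real_of_int b\<bar> < 2 * 2 ^ k" using p(12) A(2) by linarith
  then have k2k: "k2 \<le> k" using dy_le[OF p(3), of k] unfolding ie by simp
  have "\<bar>real_of_int a\<bar> < 2 * 2 ^ (k2 + 2)" using s(1) Bb(2) unfolding power_add by simp
  then have kk2: "k \<le> k2 + 2" using dy_le[OF p(2), of "k2 + 2"] unfolding ie by simp
  \<comment> \<open>A nonzero w is at least the product of its three gcds; since the exponents are
    integers, the strict bound by 2^(m + 1) yields m without loss.\<close>
  have ex: "x + y + z \<le> m" if "w = p * q * r * u" "w \<noteq> 0" "2 ^ x \<le> real_of_int p" "2 ^ y \<le> real_of_int q" "2 ^ z \<le> real_of_int r" "\<bar>real_of_int w\<bar> < 2 * 2 ^ m"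
    for w p q r u :: int and x y z m :: nat
  proof -
    have u: "1 \<le> \<bar>real_of_int u\<bar>" using that(1,2) by (cases "u = 0") auto
    have pos: "0 \<le> real_of_int p" "0 \<le> real_of_int q" "0 \<le> real_of_int r"
      using that(3-5) by (meson order_trans zero_le_power zero_le_numeral)+
    have "(2::real) ^ (x + y + z) = 2 ^ x * 2 ^ y * 2 ^ z * 1" by (simp add: power_add)
    also have "\<dots> \<le> real_of_int p * real_of_int q * real_of_int r * \<bar>real_of_int u\<bar>"
      using that(3-5) u pos by (intro mult_mono mult_nonneg_nonneg) simp_all
    also have "\<dots> \<le> \<bar>real_of_int w\<bar>" unfolding that(1) of_int_mult abs_mult using pos by simp
    also have "\<dots> < 2 ^ (m + 1)" using that(6) by simp
    finally show ?thesis using power_less_imp_less_exp[of "2::real" "x + y + z" "m + 1"] by simp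
  qed
  have e1: "e12 + e13 + e14 \<le> k" by (rule ex[OF t(2) p(2) _ _ _ A(2)]) (use G in blast)+
  have "e12 + e23 + e24 \<le> k2" by (rule ex[OF t(3) p(3) _ _ _ Bb(2)]) (use G in blast)+
  then have e2: "e12 + e23 + e24 \<le> k" using k2k by simp
  have e3: "e13 + e23 + e34 \<le> l" by (rule ex[OF t(4) p(4) _ _ _ C(2)]) (use G in blast)+
  have d0: "\<bar>real_of_int d\<bar> > 0" using p(5) by simp
  have "(\<bar>real_of_int a\<bar> * \<bar>real_of_int b\<bar> * \<bar>real_of_int c\<bar>) * \<bar>real_of_int d\<bar> \<le> (B * real_of_int (gprod a b c d)) * \<bar>real_of_int d\<bar>"
    using p(10) by (simp add: abs_mult)
  then have abc: "\<bar>real_of_int a\<bar> * \<bar>real_of_int b\<bar> * \<bar>real_of_int c\<bar> \<le> B * real_of_int (gprod a b c d)" using d0 by (rule mult_right_le_imp_le)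
  have gp: "real_of_int (gprod a b c d) \<le> 64 * 2 ^ (e12 + e13 + e14 + e23 + e24 + e34)"
  proof -
    have "real_of_int (gprod a b c d) \<le> (2 * 2 ^ e12) * (2 * 2 ^ e13) * (2 * 2 ^ e14) * (2 * 2 ^ e23) * (2 * 2 ^ e24) * (2 * 2 ^ e34)"
      unfolding gprod_def of_int_mult using G g0 by (intro mult_mono) (auto intro!: mult_nonneg_nonneg)
    also have "\<dots> = 64 * 2 ^ (e12 + e13 + e14 + e23 + e24 + e34)" by (simp add: power_add)
    finally show ?thesis .
  qed
  have "(2::real) ^ (2 * k + l) = 2 ^ k * 2 ^ k * 2 ^ l" by (simp add: power_add mult_2)
  also have "\<dots> \<le> \<bar>real_of_int a\<bar> * (4 * \<bar>real_of_int b\<bar>) * \<bar>real_of_int c\<bar>"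
  proof (intro mult_mono)
    show "(2::real) ^ k \<le> 4 * \<bar>real_of_int b\<bar>" using A(1) s(1) by linarith
  qed (use A C in auto)
  also have "\<dots> \<le> 4 * (B * (64 * 2 ^ (e12 + e13 + e14 + e23 + e24 + e34)))"
  proof -
    have "B * real_of_int (gprod a b c d) \<le> B * (64 * 2 ^ (e12 + e13 + e14 + e23 + e24 + e34))" using gp B by (intro mult_left_mono) auto
    then show ?thesis using abc by simp
  qed
  finally have "2 ^ (2 * k + l) \<le> 256 * B * 2 ^ (e12 + e13 + e14 + e23 + e24 + e34)" by simp
  then show thesis using that[OF box t(2-5) kn lk k2k kk2 e1 e2 e3] by blast
qed

lemma prod_cases9:
  obtains a b c d e f g h i where "s = (a, b, c, d, e, f, g, h, i)"
  by (rule that[of "fst s" "fst (snd s)" "fst (snd (snd s))" "fst (snd (snd (snd s)))" "fst (snd (snd (snd (snd s))))"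
    "fst (snd (snd (snd (snd (snd s)))))" "fst (snd (snd (snd (snd (snd (snd s))))))" "fst (snd (snd (snd (snd (snd (snd (snd s)))))))"
    "snd (snd (snd (snd (snd (snd (snd (snd s)))))))"]) simp

lemma nat_diff_left_cancel:
  fixes a b c :: nat
  assumes "a - b = a - c" "b \<le> a" "c \<le> a"
  shows "b = c"
  using assms by linarith

lemma sum_Times3:
  fixes f g h :: "_ \<Rightarrow> real"
  shows "(\<Sum>(i, j, c)\<in>A \<times> B \<times> C. f i * (g j * h c)) = sum f A * (sum g B * sum h C)"
proof -
  have "(\<Sum>(i, j, c)\<in>A \<times> B \<times> C. f i * (g j * h c)) = (\<Sum>i\<in>A. \<Sum>j\<in>B. \<Sum>c\<in>C. f i * (g j * h c))"
    by (simp only: sum.cartesian_product)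
  also have "\<dots> = sum f A * (sum g B * sum h C)"
    by (simp only: sum_distrib_left[symmetric] sum_distrib_right[symmetric])
  finally show ?thesis .
qed

lemma sum_Times6:
  fixes f g h s t u :: "_ \<Rightarrow> real"
  shows "(\<Sum>(i, j, x, y, z, c)\<in>A \<times> B \<times> C \<times> D \<times> E \<times> F. f i * (g j * (h x * (s y * (t z * u c)))))
     = sum f A * (sum g B * (sum h C * (sum s D * (sum t E * sum u F))))"
proof -
  have "(\<Sum>(i, j, x, y, z, c)\<in>A \<times> B \<times> C \<times> D \<times> E \<times> F. f i * (g j * (h x * (s y * (t z * u c)))))
     = (\<Sum>i\<in>A. \<Sum>j\<in>B. \<Sum>x\<in>C. \<Sum>y\<in>D. \<Sum>z\<in>E. \<Sum>c\<in>F. f i * (g j * (h x * (s y * (t z * u c)))))"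
    by (simp only: sum.cartesian_product)
  also have "\<dots> = sum f A * (sum g B * (sum h C * (sum s D * (sum t E * sum u F))))"
    by (simp only: sum_distrib_left[symmetric] sum_distrib_right[symmetric])
  finally show ?thesis .
qed

text \<open>The quantity 2^f is W^2 V / Pd, which the height controls. With \<kappa>^9 = 2^(k - l)
  the bound \<kappa>^8 W V^2 / Pd is 2^f / \<kappa>, a decay in k - l. The three differences in the
  last exponent are the dyadic sizes of u1, u2, u3.\<close>

lemma box_card_weight:
  fixes k k2 l e12 e13 e14 e23 e24 e34 n f :: nat
  assumes kn: "k \<le> n" and lk: "l \<le> k" and k2: "k2 \<le> k" "k \<le> k2 + 2"
    and e: "e12 + e13 + e14 \<le> k" "e12 + e23 + e24 \<le> k" "e13 + e23 + e34 \<le> l"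
    and f: "2 * k + l = f + (e12 + e13 + e14 + e23 + e24 + e34)"
  shows "real (card (torsor_box (2 ^ k) (2 ^ k2) (2 ^ l) (2 ^ e12) (2 ^ e13) (2 ^ e14) (2 ^ e23) (2 ^ e24) (2 ^ e34)))
     \<le> 25000000000000 * (2 ^ f * (1 / root 9 2) ^ (k - l) *
        (1 + (real n + 3)\<^sup>2 * (1 / sqrt 2) ^ ((k - (e12 + e13 + e14)) + (k - (e12 + e23 + e24)) + (l - (e13 + e23 + e34)))))"
proof -
  define \<rho> :: real where "\<rho> = root 9 2"
  have \<rho>: "\<rho> ^ 9 = 2" "0 < \<rho>" "1 \<le> \<rho>" by (simp_all add: \<rho>_def real_root_pow_pos2)
  define \<kappa> where "\<kappa> = \<rho> ^ (k - l)"
  have \<kappa>9: "\<kappa> ^ 9 = 2 ^ (k - l)" unfolding \<kappa>_def by (metis \<rho>(1) mult.commute power_mult)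
  have kl: "(2::real) ^ k = 2 ^ (k - l) * 2 ^ l" using lk by (simp flip: power_add)
  interpret box_sizes "2 ^ k" "2 ^ k2" "2 ^ l" "2 ^ e12" "2 ^ e13" "2 ^ e14" "2 ^ e23" "2 ^ e24" "2 ^ e34" \<kappa>
  proof
    show "1 \<le> \<kappa>" unfolding \<kappa>_def using \<rho>(3) by (rule one_le_power)
    show "(2::real) ^ k = \<kappa> ^ 9 * 2 ^ l" unfolding \<kappa>9 kl ..
    have "(2::real) ^ k \<le> 2 ^ (k2 + 2)" using k2 by (intro power_increasing) auto
    then show "(2::real) ^ k / 4 \<le> 2 ^ k2" by (simp add: power_add)
    show "(2::real) ^ k2 \<le> 2 ^ k" using k2 by (intro power_increasing) auto
  qed simp_all
  define n1 where "n1 = k - (e12 + e13 + e14)"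
  define n2 where "n2 = k - (e12 + e23 + e24)"
  define n3 where "n3 = l - (e13 + e23 + e34)"
  have sp: "(2::real) ^ m / (2 ^ x * 2 ^ y * 2 ^ z) = 2 ^ (m - (x + y + z))" if "x + y + z \<le> m" for m x y z :: nat
    using that by (simp add: power_diff power_add)
  have bq: "bq = sqrt 2 ^ (n1 + n2 + n3)"
    unfolding bq_def sp[OF e(1)] sp[OF e(2)] sp[OF e(3)] n1_def n2_def n3_def by (simp add: power_add real_sqrt_mult real_sqrt_power)
  have "(harm (nat \<lfloor>4 * (2::real) ^ k\<rfloor>) :: real) \<le> harm (2 ^ (n + 2))"
  proof (rule harm_mono)
    have "4 * (2::real) ^ k \<le> 4 * 2 ^ n" using kn by simp
    also have "4 * (2::real) ^ n = real_of_int (2 ^ (n + 2))" by simp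
    finally have "\<lfloor>4 * (2::real) ^ k\<rfloor> \<le> 2 ^ (n + 2)" by linarith
    then show "nat \<lfloor>4 * (2::real) ^ k\<rfloor> \<le> 2 ^ (n + 2)" by (simp add: nat_le_iff)
  qed
  also have "(harm (2 ^ (n + 2)) :: real) \<le> 1 + ln (real (2 ^ (n + 2)))" by (rule harm_le_1_plus_ln) simp
  also have "ln (real (2 ^ (n + 2))) = real (n + 2) * ln 2" by (simp only: of_nat_power of_nat_numeral ln_realpow zero_less_numeral)
  also have "real (n + 2) * ln 2 \<le> real (n + 2) * 1" using ln_2_less_1 by (intro mult_left_mono) auto
  finally have H: "(harm (nat \<lfloor>4 * (2::real) ^ k\<rfloor>) :: real) \<le> real n + 3" by simp
  have H2: "(harm (nat \<lfloor>4 * (2::real) ^ k\<rfloor>))\<^sup>2 \<le> (real n + 3)\<^sup>2" using H by (intro power_mono harm_nonneg)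
  have "(harm (nat \<lfloor>4 * (2::real) ^ k\<rfloor>))\<^sup>2 / bq \<le> (real n + 3)\<^sup>2 / bq" using H2 bq0 by (intro divide_right_mono) auto
  also have "\<dots> = (real n + 3)\<^sup>2 * (1 / sqrt 2) ^ (n1 + n2 + n3)" unfolding bq by (simp add: power_divide)
  finally have h: "(harm (nat \<lfloor>4 * (2::real) ^ k\<rfloor>))\<^sup>2 / bq \<le> (real n + 3)\<^sup>2 * (1 / sqrt 2) ^ (n1 + n2 + n3)" .
  \<comment> \<open>Here \<kappa>^8 = \<kappa>^9 / \<kappa> leaves exactly one factor 1 /
    \<kappa>.\<close>
  have F: "\<kappa> ^ 8 * (2 ^ k * (2 ^ l)\<^sup>2 / Pd) = 2 ^ f * (1 / \<rho>) ^ (k - l)"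
  proof -
    have "\<kappa> > 0" unfolding \<kappa>_def using \<rho> by simp
    then have "\<kappa> ^ 8 = \<kappa> ^ 9 / \<kappa>" by (simp add: eval_nat_numeral)
    also have "\<dots> = 2 ^ (k - l) * (1 / \<rho>) ^ (k - l)" unfolding \<kappa>9 by (simp add: \<kappa>_def power_divide)
    finally have "\<kappa> ^ 8 * (2 ^ k * (2 ^ l)\<^sup>2 / Pd) = (2 ^ (k - l) * 2 ^ l) * 2 ^ k * 2 ^ l / Pd * (1 / \<rho>) ^ (k - l)"
      by (simp add: power2_eq_square)
    also have "(2 ^ (k - l) * 2 ^ l) * (2::real) ^ k * 2 ^ l = 2 ^ (2 * k + l)" unfolding kl[symmetric] by (simp add: power_add mult_2)
    also have "\<dots> = 2 ^ f * Pd" unfolding f Pd_def by (simp add: power_add)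
    finally show ?thesis using Pd0 by simp
  qed
  have "real (card Box) \<le> 25000000000000 * (\<kappa> ^ 8 * (2 ^ k * (2 ^ l)\<^sup>2 / Pd)) * (1 + (harm (nat \<lfloor>4 * (2::real) ^ k\<rfloor>))\<^sup>2 / bq)"
    using box_bound by (simp add: mult.assoc)
  also have "\<dots> \<le> 25000000000000 * (2 ^ f * (1 / \<rho>) ^ (k - l)) * (1 + (real n + 3)\<^sup>2 * (1 / sqrt 2) ^ (n1 + n2 + n3))"
    unfolding F using h \<rho> by (intro mult_left_mono) auto
  finally show ?thesis unfolding n1_def n2_def n3_def \<rho>_def by (simp add: mult.assoc)
qed

lemma card_sorted_fibre_le:
  assumes B: "1 \<le> B" and n: "B ^ 3 < 2 * 2 ^ n"
  shows "card {w \<in> sorted_points B. box_index w = (k, k2, l, e12, e13, e14, e23, e24, e34)}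
     \<le> card (torsor_box (2 ^ k) (2 ^ k2) (2 ^ l) (2 ^ e12) (2 ^ e13) (2 ^ e14) (2 ^ e23) (2 ^ e24) (2 ^ e34))"
proof -
  let ?F = "{w \<in> sorted_points B. box_index w = (k, k2, l, e12, e13, e14, e23, e24, e34)}"
  let ?Bx = "torsor_box (2 ^ k) (2 ^ k2) (2 ^ l) (2 ^ e12) (2 ^ e13) (2 ^ e14) (2 ^ e23) (2 ^ e24) (2 ^ e34)"
  let ?r = "\<lambda>(u1::int, u2::int, u3::int, u4::int, d12::int, d13::int, d14::int, d23::int, d24::int, d34::int).
      (d12 * d13 * d14 * u1, d12 * d23 * d24 * u2, d13 * d23 * d34 * u3, d14 * d24 * d34 * u4)"
  have "?F \<subseteq> ?r ` ?Bx"
  proof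
    fix w assume w: "w \<in> ?F"
    obtain a b c d where we: "w = (a, b, c, d)" by (cases w)
    have m: "(a, b, c, d) \<in> sorted_points B" "box_index (a, b, c, d) = (k, k2, l, e12, e13, e14, e23, e24, e34)" using w we by simp_all
    obtain u1 u2 u3 u4 where t: "(u1, u2, u3, u4, gcd a b, gcd a c, gcd a d, gcd b c, gcd b d, gcd c d) \<in> ?Bx"
      "a = gcd a b * gcd a c * gcd a d * u1" "b = gcd a b * gcd b c * gcd b d * u2"
      "c = gcd a c * gcd b c * gcd c d * u3" "d = gcd a d * gcd b d * gcd c d * u4"
      using box_index_facts[OF m(1) B n m(2)] by metis
    have "w = ?r (u1, u2, u3, u4, gcd a b, gcd a c, gcd a d, gcd b c, gcd b d, gcd c d)"
      unfolding we prod.case t(2)[symmetric] t(3)[symmetric] t(4)[symmetric] t(5)[symmetric] ..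
    then show "w \<in> ?r ` ?Bx" using t(1) by (rule image_eqI)
  qed
  then have "card ?F \<le> card (?r ` ?Bx)" by (rule card_mono[rotated]) simp
  also have "\<dots> \<le> card ?Bx" by (rule card_image_le) simp
  finally show ?thesis .
qed

text \<open>The sums over f and over k - l are geometric and k - k2 takes three values, so the first
  part of the weight leaves the six exponents of the gcds free. In the part with two extra factors n
  + 3 the sizes of u1, u2, u3 give three more geometric sums, and only k, e12, e13 remain
  free.\<close>

lemma card_sorted_points_le:
  assumes B: "1 \<le> B" and n: "B ^ 3 < 2 * 2 ^ n"
  shows "real (card (sorted_points B)) \<le>
     25000000000000 * (256 * B) * 6 * (1 / (1 - 1 / root 9 2)) * (1 + (1 / (1 - 1 / sqrt 2)) ^ 3) * (real n + 3) ^ 6"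
proof -
  define I where "I = box_index ` sorted_points B"
  define \<beta> where "\<beta> = 1 / root 9 (2::real)"
  define \<gamma> where "\<gamma> = 1 / sqrt (2::real)"
  have \<beta>: "0 \<le> \<beta>" "\<beta> < 1" by (simp_all add: \<beta>_def)
  have \<gamma>: "0 \<le> \<gamma>" "\<gamma> < 1" by (simp_all add: \<gamma>_def)
  have fin: "finite (sorted_points B)" unfolding sorted_points_def by (auto intro: finite_subset[OF _ finite_plane_points[of B]])
  then have finI: "finite I" by (simp add: I_def)
  \<comment> \<open>The largest value that the height condition permits for f; summation by m - f
    turns 2^f into a geometric series.\<close>
  define m where "m = nat \<lfloor>log 2 (256 * B)\<rfloor>"
  have mle: "f \<le> m" if "2 ^ f \<le> 256 * B" for f :: nat
  proof -
    have "real f = log 2 (2 ^ f)" by simp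
    also have "\<dots> \<le> log 2 (256 * B)" using that B by (subst log_le_cancel_iff) auto
    finally show ?thesis unfolding m_def by (simp add: le_nat_floor)
  qed
  have m2: "2 ^ m \<le> 256 * B"
  proof -
    have "0 \<le> log 2 (256 * B)" using B by (subst zero_le_log_cancel_iff) auto
    then have "real m \<le> log 2 (256 * B)" unfolding m_def by simp
    then have "2 powr real m \<le> 2 powr (log 2 (256 * B))" by (intro powr_mono) auto
    then show ?thesis using B by (simp add: powr_realpow)
  qed
  define ff :: "nat \<times> nat \<times> nat \<times> nat \<times> nat \<times> nat \<times> nat \<times> nat \<times> nat \<Rightarrow> nat"
    where "ff = (\<lambda>(k, k2, l, e12, e13, e14, e23, e24, e34). 2 * k + l - (e12 + e13 + e14 + e23 + e24 + e34))"
  define n1 :: "nat \<times> nat \<times> nat \<times> nat \<times> nat \<times> nat \<times> nat \<times> nat \<times> nat \<Rightarrow> nat"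
    where "n1 = (\<lambda>(k, k2, l, e12, e13, e14, e23, e24, e34). k - (e12 + e13 + e14))"
  define n2 :: "nat \<times> nat \<times> nat \<times> nat \<times> nat \<times> nat \<times> nat \<times> nat \<times> nat \<Rightarrow> nat"
    where "n2 = (\<lambda>(k, k2, l, e12, e13, e14, e23, e24, e34). k - (e12 + e23 + e24))"
  define n3 :: "nat \<times> nat \<times> nat \<times> nat \<times> nat \<times> nat \<times> nat \<times> nat \<times> nat \<Rightarrow> nat"
    where "n3 = (\<lambda>(k, k2, l, e12, e13, e14, e23, e24, e34). l - (e13 + e23 + e34))"
  define jj :: "nat \<times> nat \<times> nat \<times> nat \<times> nat \<times> nat \<times> nat \<times> nat \<times> nat \<Rightarrow> nat"
    where "jj = (\<lambda>(k, k2, l, e12, e13, e14, e23, e24, e34). k - l)"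
  have If: "k \<le> n \<and> l \<le> k \<and> k2 \<le> k \<and> k \<le> k2 + 2 \<and> e12 + e13 + e14 \<le> k \<and> e12 + e23 + e24 \<le> k \<and> e13 + e23 + e34 \<le> l \<and>
     2 * k + l - (e12 + e13 + e14 + e23 + e24 + e34) \<le> m"
    if sI: "(k, k2, l, e12, e13, e14, e23, e24, e34) \<in> I" for k k2 l e12 e13 e14 e23 e24 e34
  proof -
    obtain x where x: "(k, k2, l, e12, e13, e14, e23, e24, e34) = box_index x" "x \<in> sorted_points B" using sI unfolding I_def by (rule imageE)
    obtain a b c d where xe: "x = (a, b, c, d)" by (metis prod_cases4)
    note w = x(2)[unfolded xe] x(1)[unfolded xe, symmetric]
    have h: "k \<le> n \<and> l \<le> k \<and> k2 \<le> k \<and> k \<le> k2 + 2 \<and> e12 + e13 + e14 \<le> k \<and> e12 + e23 + e24 \<le> k \<and> e13 + e23 + e34 \<le> l \<and>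
      2 ^ (2 * k + l) \<le> 256 * B * 2 ^ (e12 + e13 + e14 + e23 + e24 + e34)"
      by (rule box_index_facts[OF w(1) B n w(2)]) (intro conjI; assumption)
    then have h8: "2 ^ (2 * k + l) \<le> 256 * B * 2 ^ (e12 + e13 + e14 + e23 + e24 + e34)" by blast
    let ?s = "e12 + e13 + e14 + e23 + e24 + e34"
    have s: "?s \<le> 2 * k + l" using h by linarith
    then have "(2::real) ^ (2 * k + l - ?s) * 2 ^ ?s = 2 ^ (2 * k + l)" by (simp flip: power_add)
    then have "(2::real) ^ (2 * k + l - ?s) * 2 ^ ?s \<le> 256 * B * 2 ^ ?s" using h8 by simp
    then have "(2::real) ^ (2 * k + l - ?s) \<le> 256 * B" by (rule mult_right_le_imp_le) simp
    then show ?thesis using h mle by blast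
  qed
  have "real (card (sorted_points B)) \<le> (\<Sum>s\<in>I. 25000000000000 * (2 ^ ff s * \<beta> ^ jj s * (1 + (real n + 3)\<^sup>2 * \<gamma> ^ (n1 s + n2 s + n3 s))))"
  proof (rule card_le_sum_fibres[OF fin finI, where f = box_index])
    fix s assume s: "s \<in> I"
    obtain k k2 l e12 e13 e14 e23 e24 e34 where se: "s = (k, k2, l, e12, e13, e14, e23, e24, e34)" by (rule prod_cases9)
    note h = If[OF s[unfolded se]]
    have "real (card {w \<in> sorted_points B. box_index w = s}) \<le> real (card (torsor_box (2 ^ k) (2 ^ k2) (2 ^ l) (2 ^ e12) (2 ^ e13) (2 ^ e14) (2 ^ e23) (2 ^ e24) (2 ^ e34)))"
      unfolding se of_nat_le_iff by (rule card_sorted_fibre_le[OF B n])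
    also have "\<dots> \<le> 25000000000000 * (2 ^ ff s * (1 / root 9 2) ^ (k - l) *
        (1 + (real n + 3)\<^sup>2 * (1 / sqrt 2) ^ ((k - (e12 + e13 + e14)) + (k - (e12 + e23 + e24)) + (l - (e13 + e23 + e34)))))"
      by (rule box_card_weight) (use h in \<open>auto simp: ff_def se\<close>)
    finally show "real (card {w \<in> sorted_points B. box_index w = s}) \<le> 25000000000000 * (2 ^ ff s * \<beta> ^ jj s * (1 + (real n + 3)\<^sup>2 * \<gamma> ^ (n1 s + n2 s + n3 s)))"
      by (simp add: se jj_def n1_def n2_def n3_def \<beta>_def \<gamma>_def)
  qed (simp add: I_def)
  also have "\<dots> = (\<Sum>s\<in>I. 25000000000000 * 2 ^ m * ((1/2) ^ (m - ff s) * \<beta> ^ jj s) + 25000000000000 * 2 ^ m * (real n + 3)\<^sup>2 * ((1/2) ^ (m - ff s) * (\<beta> ^ jj s * (\<gamma> ^ n1 s * (\<gamma> ^ n2 s * \<gamma> ^ n3 s)))))"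
  proof (rule sum.cong[OF refl])
    fix s assume s: "s \<in> I"
    obtain k k2 l e12 e13 e14 e23 e24 e34 where se: "s = (k, k2, l, e12, e13, e14, e23, e24, e34)" by (rule prod_cases9)
    have "ff s \<le> m" using If[OF s[unfolded se]] unfolding se ff_def by simp
    then have "(2::real) ^ m * (1/2) ^ (m - ff s) = 2 ^ ff s" by (simp add: power_diff power_one_over)
    then have f2: "(2::real) ^ ff s = 2 ^ m * (1/2) ^ (m - ff s)" by simp
    show "25000000000000 * (2 ^ ff s * \<beta> ^ jj s * (1 + (real n + 3)\<^sup>2 * \<gamma> ^ (n1 s + n2 s + n3 s)))
      = 25000000000000 * 2 ^ m * ((1/2) ^ (m - ff s) * \<beta> ^ jj s) + 25000000000000 * 2 ^ m * (real n + 3)\<^sup>2 * ((1/2) ^ (m - ff s) * (\<beta> ^ jj s * (\<gamma> ^ n1 s * (\<gamma> ^ n2 s * \<gamma> ^ n3 s))))"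
      unfolding f2 by (simp add: algebra_simps power_add)
  qed
  also have "\<dots> = 25000000000000 * 2 ^ m * (\<Sum>s\<in>I. (1/2) ^ (m - ff s) * \<beta> ^ jj s)
      + 25000000000000 * 2 ^ m * (real n + 3)\<^sup>2 * (\<Sum>s\<in>I. (1/2) ^ (m - ff s) * (\<beta> ^ jj s * (\<gamma> ^ n1 s * (\<gamma> ^ n2 s * \<gamma> ^ n3 s))))"
    by (simp only: sum.distrib sum_distrib_left)
  also have "\<dots> \<le> 25000000000000 * 2 ^ m * (2 * (1 / (1 - \<beta>)) * (3 * (real n + 3) ^ 6))
      + 25000000000000 * 2 ^ m * (real n + 3)\<^sup>2 * (2 * (1 / (1 - \<beta>)) * (1 / (1 - \<gamma>)) ^ 3 * (3 * (real n + 3) ^ 4))"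
  proof (intro add_mono mult_left_mono)
    have half: "(\<Sum>i\<le>m. (1/2::real) ^ i) \<le> 2" using geometric_sum_le[of "1/2" m] by simp
    have b: "(\<Sum>i\<le>n. \<beta> ^ i) \<le> 1 / (1 - \<beta>)" by (rule geometric_sum_le[OF \<beta>])
    have g: "(\<Sum>i\<le>n. \<gamma> ^ i) \<le> 1 / (1 - \<gamma>)" by (rule geometric_sum_le[OF \<gamma>])
    have b0: "0 \<le> 1 / (1 - \<beta>)" "0 \<le> 1 / (1 - \<gamma>)" using \<beta> \<gamma> by simp_all
    \<comment> \<open>These data determine the index: the six exponents together with f give 2 k +
      l, and k - l then gives k and l.\<close>
    define p1 where "p1 = (\<lambda>s. case s of (k::nat, k2::nat, l::nat, e12::nat, e13::nat, e14::nat, e23::nat, e24::nat, e34::nat) \<Rightarrow>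
       (m - ff s, jj s, (k - k2, e12, e13, e14, e23, e24, e34)))"
    let ?C1 = "{..2::nat} \<times> {..n} \<times> {..n} \<times> {..n} \<times> {..n} \<times> {..n} \<times> {..n}"
    have "(\<Sum>s\<in>I. (1/2) ^ (m - ff s) * \<beta> ^ jj s) = (\<Sum>s\<in>I. (\<lambda>(i, j, c). (1/2) ^ i * (\<beta> ^ j * 1)) (p1 s))"
      by (intro sum.cong refl) (auto simp: p1_def)
    also have "\<dots> \<le> (\<Sum>t\<in>{..m} \<times> {..n} \<times> ?C1. (\<lambda>(i, j, c). (1/2) ^ i * (\<beta> ^ j * 1)) t)"
    proof (rule sum_reindex_le)
      show "finite ({..m} \<times> {..n} \<times> ?C1)" by simp
      show "inj_on p1 I"
      proof (rule inj_onI)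
        fix s t assume st: "s \<in> I" "t \<in> I" "p1 s = p1 t"
        obtain k k2 l e12 e13 e14 e23 e24 e34 where se: "s = (k, k2, l, e12, e13, e14, e23, e24, e34)" by (rule prod_cases9)
        obtain k' k2' l' e12' e13' e14' e23' e24' e34' where te: "t = (k', k2', l', e12', e13', e14', e23', e24', e34')" by (rule prod_cases9)
        note h = If[OF st(1)[unfolded se]] and h' = If[OF st(2)[unfolded te]]
        have E: "m - (2 * k + l - (e12 + e13 + e14 + e23 + e24 + e34)) = m - (2 * k' + l' - (e12' + e13' + e14' + e23' + e24' + e34')) \<and> k - l = k' - l' \<and>
          k - k2 = k' - k2' \<and> e12 = e12' \<and> e13 = e13' \<and> e14 = e14' \<and> e23 = e23' \<and> e24 = e24' \<and> e34 = e34'"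
          using st(3) unfolding p1_def se te ff_def jj_def prod.case prod.inject .
        note H = h[THEN conjunct1] h[THEN conjunct2, THEN conjunct1] h[THEN conjunct2, THEN conjunct2, THEN conjunct1] h[THEN conjunct2, THEN conjunct2, THEN conjunct2, THEN conjunct1] h[THEN conjunct2, THEN conjunct2, THEN conjunct2, THEN conjunct2, THEN conjunct1] h[THEN conjunct2, THEN conjunct2, THEN conjunct2, THEN conjunct2, THEN conjunct2, THEN conjunct1] h[THEN conjunct2, THEN conjunct2, THEN conjunct2, THEN conjunct2, THEN conjunct2, THEN conjunct2, THEN conjunct1] h[THEN conjunct2, THEN conjunct2, THEN conjunct2, THEN conjunct2, THEN conjunct2, THEN conjunct2, THEN conjunct2]
        note H' = h'[THEN conjunct1] h'[THEN conjunct2, THEN conjunct1] h'[THEN conjunct2, THEN conjunct2, THEN conjunct1] h'[THEN conjunct2, THEN conjunct2, THEN conjunct2, THEN conjunct1] h'[THEN conjunct2, THEN conjunct2, THEN conjunct2, THEN conjunct2, THEN conjunct1] h'[THEN conjunct2, THEN conjunct2, THEN conjunct2, THEN conjunct2, THEN conjunct2, THEN conjunct1] h'[THEN conjunct2, THEN conjunct2, THEN conjunct2, THEN conjunct2, THEN conjunct2, THEN conjunct2, THEN conjunct1] h'[THEN conjunct2, THEN conjunct2, THEN conjunct2, THEN conjunct2, THEN conjunct2, THEN conjunct2, THEN conjunct2]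
        note G = E[THEN conjunct1] E[THEN conjunct2, THEN conjunct1] E[THEN conjunct2, THEN conjunct2, THEN conjunct1] E[THEN conjunct2, THEN conjunct2, THEN conjunct2, THEN conjunct1] E[THEN conjunct2, THEN conjunct2, THEN conjunct2, THEN conjunct2, THEN conjunct1] E[THEN conjunct2, THEN conjunct2, THEN conjunct2, THEN conjunct2, THEN conjunct2, THEN conjunct1] E[THEN conjunct2, THEN conjunct2, THEN conjunct2, THEN conjunct2, THEN conjunct2, THEN conjunct2, THEN conjunct1] E[THEN conjunct2, THEN conjunct2, THEN conjunct2, THEN conjunct2, THEN conjunct2, THEN conjunct2, THEN conjunct2, THEN conjunct1] E[THEN conjunct2, THEN conjunct2, THEN conjunct2, THEN conjunct2, THEN conjunct2, THEN conjunct2, THEN conjunct2, THEN conjunct2]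
        have D: "2 * k + l - (e12 + e13 + e14 + e23 + e24 + e34) = 2 * k' + l' - (e12' + e13' + e14' + e23' + e24' + e34')" by (rule nat_diff_left_cancel[OF G(1) H(8) H'(8)])
        have "e12 + e13 + e14 + e23 + e24 + e34 \<le> 2 * k + l" "e12' + e13' + e14' + e23' + e24' + e34' \<le> 2 * k' + l'" "e12 + e13 + e14 + e23 + e24 + e34 = e12' + e13' + e14' + e23' + e24' + e34'"
          using H(5-7) H'(5-7) G(4-9) by linarith+
        then have F: "2 * k + l = 2 * k' + l'" using D by linarith
        have "k + l' = k' + l" using G(2) H(2) H'(2) by linarith
        then have kl: "k = k'" "l = l'" using F by linarith+
        have "k2 = k2'" using G(3) H(3) H'(3) kl(1) by linarith
        then show "s = t" unfolding se te kl G(4-9) by blast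
      qed
      show "p1 ` I \<subseteq> {..m} \<times> {..n} \<times> ?C1"
      proof
        fix y assume "y \<in> p1 ` I"
        then obtain s where s: "s \<in> I" "y = p1 s" by blast
        obtain k k2 l e12 e13 e14 e23 e24 e34 where se: "s = (k, k2, l, e12, e13, e14, e23, e24, e34)" by (rule prod_cases9)
        show "y \<in> {..m} \<times> {..n} \<times> ?C1" using If[OF s(1)[unfolded se]] unfolding s(2) p1_def se jj_def by (auto simp: le_diff_conv)
      qed
    qed (use \<beta> in auto)
    also have "\<dots> = (\<Sum>i\<le>m. (1/2::real) ^ i) * ((\<Sum>j\<le>n. \<beta> ^ j) * real (card ?C1))"
      by (subst sum_Times3[where h="\<lambda>_. 1"]) (simp only: sum_constant mult_1_right)
    also have "\<dots> \<le> 2 * ((1 / (1 - \<beta>)) * (3 * (real n + 3) ^ 6))"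
    proof (intro mult_mono half b)
      have "card ?C1 = 3 * Suc n ^ 6" by (simp add: card_cartesian_product power_numeral_reduce del: mult_Suc mult_Suc_right)
      then have "real (card ?C1) = 3 * (real n + 1) ^ 6" by (simp add: add.commute)
      also have "\<dots> \<le> 3 * (real n + 3) ^ 6" by (intro mult_left_mono power_mono) auto
      finally show "real (card ?C1) \<le> 3 * (real n + 3) ^ 6" .
    qed (use b0 \<beta> in \<open>auto intro!: sum_nonneg mult_nonneg_nonneg\<close>)
    finally show "(\<Sum>s\<in>I. (1/2) ^ (m - ff s) * \<beta> ^ jj s) \<le> 2 * (1 / (1 - \<beta>)) * (3 * (real n + 3) ^ 6)" by (simp only: mult.assoc)
    \<comment> \<open>Injective again: k gives l and k2, then n1 gives e14, n2 gives e23 + e24 and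
      n3 gives e23 + e34, while f gives e23 + e24 + e34; these three sums determine their
      terms.\<close>
    define p2 where "p2 = (\<lambda>s. case s of (k::nat, k2::nat, l::nat, e12::nat, e13::nat, e14::nat, e23::nat, e24::nat, e34::nat) \<Rightarrow>
       (m - ff s, jj s, n1 s, n2 s, n3 s, (k - k2, k, e12, e13)))"
    let ?C2 = "{..2::nat} \<times> {..n} \<times> {..n} \<times> {..n}"
    have "(\<Sum>s\<in>I. (1/2) ^ (m - ff s) * (\<beta> ^ jj s * (\<gamma> ^ n1 s * (\<gamma> ^ n2 s * \<gamma> ^ n3 s))))
        = (\<Sum>s\<in>I. (\<lambda>(i, j, x, y, z, c). (1/2) ^ i * (\<beta> ^ j * (\<gamma> ^ x * (\<gamma> ^ y * (\<gamma> ^ z * 1))))) (p2 s))"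
      by (intro sum.cong refl) (auto simp: p2_def)
    also have "\<dots> \<le> (\<Sum>t\<in>{..m} \<times> {..n} \<times> {..n} \<times> {..n} \<times> {..n} \<times> ?C2. (\<lambda>(i, j, x, y, z, c). (1/2) ^ i * (\<beta> ^ j * (\<gamma> ^ x * (\<gamma> ^ y * (\<gamma> ^ z * 1))))) t)"
    proof (rule sum_reindex_le)
      show "finite ({..m} \<times> {..n} \<times> {..n} \<times> {..n} \<times> {..n} \<times> ?C2)" by simp
      show "inj_on p2 I"
      proof (rule inj_onI)
        fix s t assume st: "s \<in> I" "t \<in> I" "p2 s = p2 t"
        obtain k k2 l e12 e13 e14 e23 e24 e34 where se: "s = (k, k2, l, e12, e13, e14, e23, e24, e34)" by (rule prod_cases9)
        obtain k' k2' l' e12' e13' e14' e23' e24' e34' where te: "t = (k', k2', l', e12', e13', e14', e23', e24', e34')" by (rule prod_cases9)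
        note h = If[OF st(1)[unfolded se]] and h' = If[OF st(2)[unfolded te]]
        have E: "m - (2 * k + l - (e12 + e13 + e14 + e23 + e24 + e34)) = m - (2 * k' + l' - (e12' + e13' + e14' + e23' + e24' + e34')) \<and> k - l = k' - l' \<and>
          k - (e12 + e13 + e14) = k' - (e12' + e13' + e14') \<and> k - (e12 + e23 + e24) = k' - (e12' + e23' + e24') \<and> l - (e13 + e23 + e34) = l' - (e13' + e23' + e34') \<and>
          k - k2 = k' - k2' \<and> k = k' \<and> e12 = e12' \<and> e13 = e13'"
          using st(3) unfolding p2_def se te ff_def jj_def n1_def n2_def n3_def prod.case prod.inject .
        note H = h[THEN conjunct1] h[THEN conjunct2, THEN conjunct1] h[THEN conjunct2, THEN conjunct2, THEN conjunct1] h[THEN conjunct2, THEN conjunct2, THEN conjunct2, THEN conjunct1] h[THEN conjunct2, THEN conjunct2, THEN conjunct2, THEN conjunct2, THEN conjunct1] h[THEN conjunct2, THEN conjunct2, THEN conjunct2, THEN conjunct2, THEN conjunct2, THEN conjunct1] h[THEN conjunct2, THEN conjunct2, THEN conjunct2, THEN conjunct2, THEN conjunct2, THEN conjunct2, THEN conjunct1] h[THEN conjunct2, THEN conjunct2, THEN conjunct2, THEN conjunct2, THEN conjunct2, THEN conjunct2, THEN conjunct2]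
        note H' = h'[THEN conjunct1] h'[THEN conjunct2, THEN conjunct1] h'[THEN conjunct2, THEN conjunct2, THEN conjunct1] h'[THEN conjunct2, THEN conjunct2, THEN conjunct2, THEN conjunct1] h'[THEN conjunct2, THEN conjunct2, THEN conjunct2, THEN conjunct2, THEN conjunct1] h'[THEN conjunct2, THEN conjunct2, THEN conjunct2, THEN conjunct2, THEN conjunct2, THEN conjunct1] h'[THEN conjunct2, THEN conjunct2, THEN conjunct2, THEN conjunct2, THEN conjunct2, THEN conjunct2, THEN conjunct1] h'[THEN conjunct2, THEN conjunct2, THEN conjunct2, THEN conjunct2, THEN conjunct2, THEN conjunct2, THEN conjunct2]
        note G = E[THEN conjunct1] E[THEN conjunct2, THEN conjunct1] E[THEN conjunct2, THEN conjunct2, THEN conjunct1] E[THEN conjunct2, THEN conjunct2, THEN conjunct2, THEN conjunct1] E[THEN conjunct2, THEN conjunct2, THEN conjunct2, THEN conjunct2, THEN conjunct1] E[THEN conjunct2, THEN conjunct2, THEN conjunct2, THEN conjunct2, THEN conjunct2, THEN conjunct1] E[THEN conjunct2, THEN conjunct2, THEN conjunct2, THEN conjunct2, THEN conjunct2, THEN conjunct2, THEN conjunct1] E[THEN conjunct2, THEN conjunct2, THEN conjunct2, THEN conjunct2, THEN conjunct2, THEN conjunct2, THEN conjunct2, THEN conjunct1] E[THEN conjunct2, THEN conjunct2, THEN conjunct2, THEN conjunct2, THEN conjunct2, THEN conjunct2, THEN conjunct2, THEN conjunct2]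
        have D: "2 * k + l - (e12 + e13 + e14 + e23 + e24 + e34) = 2 * k' + l' - (e12' + e13' + e14' + e23' + e24' + e34')" by (rule nat_diff_left_cancel[OF G(1) H(8) H'(8)])
        have l: "l = l'" using G(2,7) H(2) H'(2) by linarith
        have k2: "k2 = k2'" using G(6,7) H(3) H'(3) by linarith
        have a: "e12 + e13 + e14 = e12' + e13' + e14'" using G(3,7) H(5) H'(5) by linarith
        have b: "e12 + e23 + e24 = e12' + e23' + e24'" using G(4,7) H(6) H'(6) by linarith
        have c: "e13 + e23 + e34 = e13' + e23' + e34'" using G(5) l H(7) H'(7) by linarith
        have S: "e12 + e13 + e14 + e23 + e24 + e34 \<le> 2 * k + l" "e12' + e13' + e14' + e23' + e24' + e34' \<le> 2 * k' + l'" using H(5-7) H'(5-7) by linarith+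
        have d: "e12 + e13 + e14 + e23 + e24 + e34 = e12' + e13' + e14' + e23' + e24' + e34'" using D S l G(7) by linarith
        have "e14 = e14'" "e23 = e23'" "e24 = e24'" "e34 = e34'" using a b c d G(8,9) by linarith+
        then show "s = t" unfolding se te l k2 G(7-9) by blast
      qed
      show "p2 ` I \<subseteq> {..m} \<times> {..n} \<times> {..n} \<times> {..n} \<times> {..n} \<times> ?C2"
      proof
        fix y assume "y \<in> p2 ` I"
        then obtain s where s: "s \<in> I" "y = p2 s" by blast
        obtain k k2 l e12 e13 e14 e23 e24 e34 where se: "s = (k, k2, l, e12, e13, e14, e23, e24, e34)" by (rule prod_cases9)
        show "y \<in> {..m} \<times> {..n} \<times> {..n} \<times> {..n} \<times> {..n} \<times> ?C2" using If[OF s(1)[unfolded se]] unfolding s(2) p2_def se jj_def n1_def n2_def n3_def by (auto simp: le_diff_conv)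
      qed
    qed (use \<beta> \<gamma> in auto)
    also have "\<dots> = (\<Sum>i\<le>m. (1/2::real) ^ i) * ((\<Sum>j\<le>n. \<beta> ^ j) * ((\<Sum>x\<le>n. \<gamma> ^ x) * ((\<Sum>y\<le>n. \<gamma> ^ y) * ((\<Sum>z\<le>n. \<gamma> ^ z) * real (card ?C2)))))"
      by (subst sum_Times6[where u="\<lambda>_. 1"]) (simp only: sum_constant mult_1_right)
    also have "\<dots> \<le> 2 * ((1 / (1 - \<beta>)) * ((1 / (1 - \<gamma>)) * ((1 / (1 - \<gamma>)) * ((1 / (1 - \<gamma>)) * (3 * (real n + 3) ^ 4)))))"
    proof (intro mult_mono half b g)
      have "card ?C2 = 3 * Suc n ^ 3" by (simp add: card_cartesian_product power_numeral_reduce del: mult_Suc mult_Suc_right)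
      then have "real (card ?C2) = 3 * (real n + 1) ^ 3" by (simp add: add.commute)
      \<comment> \<open>Three free exponents are rounded up to a fourth power, so that with the two
        extra factors n + 3 both parts have exponent 6.\<close>
      also have "\<dots> \<le> 3 * (real n + 3) ^ 4"
      proof -
        have "(real n + 1) ^ 3 \<le> (real n + 3) ^ 3" by (intro power_mono) auto
        also have "\<dots> \<le> (real n + 3) ^ 4" by (intro power_increasing) auto
        finally show ?thesis by simp
      qed
      finally show "real (card ?C2) \<le> 3 * (real n + 3) ^ 4" .
    qed (use b0 \<beta> \<gamma> in \<open>auto intro!: sum_nonneg mult_nonneg_nonneg\<close>)
    also have "\<dots> = 2 * (1 / (1 - \<beta>)) * (1 / (1 - \<gamma>)) ^ 3 * (3 * (real n + 3) ^ 4)" by (simp only: power3_eq_cube mult_ac)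
    finally show "(\<Sum>s\<in>I. (1/2) ^ (m - ff s) * (\<beta> ^ jj s * (\<gamma> ^ n1 s * (\<gamma> ^ n2 s * \<gamma> ^ n3 s)))) \<le> 2 * (1 / (1 - \<beta>)) * (1 / (1 - \<gamma>)) ^ 3 * (3 * (real n + 3) ^ 4)" .
  qed auto
  also have "\<dots> = 25000000000000 * 2 ^ m * 6 * (1 / (1 - \<beta>)) * (1 + (1 / (1 - \<gamma>)) ^ 3) * (real n + 3) ^ 6"
  proof -
    have gen: "K * M * (2 * b * (3 * N ^ 6)) + K * M * N\<^sup>2 * (2 * b * g * (3 * N ^ 4)) = K * M * 6 * b * (1 + g) * N ^ 6" for K M N b g :: real
      by (simp add: algebra_simps power_add[symmetric] power2_eq_square eval_nat_numeral)
    show ?thesis by (rule gen)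
  qed
  also have "\<dots> \<le> 25000000000000 * (256 * B) * 6 * (1 / (1 - \<beta>)) * (1 + (1 / (1 - \<gamma>)) ^ 3) * (real n + 3) ^ 6"
    using m2 \<beta> \<gamma> by (intro mult_right_mono mult_left_mono) auto
  finally show ?thesis unfolding \<beta>_def \<gamma>_def .
qed

text \<open>The coordinates of w are at most B^3, so the dyadic exponents go up to about 3 log B /
  log 2. From B \<ge> 3 on, ln B \<ge> 1 absorbs the additive constant.\<close>

lemma N_upper_bound: "\<exists>c>0. \<forall>B\<ge>3. real (N B) \<le> c * B * (ln B) ^ 6"
proof -
  define K where "K = 25000000000000 * 256 * 6 * (1 / (1 - 1 / root 9 2)) * (1 + (1 / (1 - 1 / sqrt 2)) ^ 3 :: real)"
  have K0: "0 < K" unfolding K_def by (intro mult_pos_pos add_pos_nonneg) auto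
  have "real (N B) \<le> (24 * K * 12 ^ 6) * B * (ln B) ^ 6" if B: "3 \<le> B" for B
  proof -
    define n where "n = nat \<lfloor>log 2 (B ^ 3)\<rfloor>"
    have l0: "0 \<le> log 2 (B ^ 3)" using B by (subst zero_le_log_cancel_iff) auto
    have e: "real n = of_int \<lfloor>log 2 (B ^ 3)\<rfloor>" unfolding n_def using l0 by simp
    have "B ^ 3 = 2 powr (log 2 (B ^ 3))" using B by simp
    also have "\<dots> < 2 powr (real n + 1)" unfolding e by (intro powr_less_mono) linarith+
    also have "\<dots> = 2 * 2 ^ n" by (simp add: powr_add powr_realpow)
    finally have n: "B ^ 3 < 2 * 2 ^ n" .
    have lnB: "1 \<le> ln B"
    proof -
      have "exp 1 \<le> B" using exp_le B by linarith
      then show ?thesis using B by (subst ln_ge_iff) auto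
    qed
    have "real n \<le> log 2 (B ^ 3)" unfolding e by simp
    also have "\<dots> = 3 * (ln B / ln 2)" using B by (simp add: log_def ln_realpow)
    also have "\<dots> \<le> 3 * (ln B / (1/2))" using lnB ln2_ge_two_thirds by (intro mult_left_mono divide_left_mono) auto
    finally have nl: "real n + 3 \<le> 12 * ln B" using lnB by simp
    have sp: "real (card (sorted_points B)) \<le> K * B * (real n + 3) ^ 6"
      using card_sorted_points_le[OF _ n] B unfolding K_def by (simp add: mult_ac)
    have "real (N B) \<le> real (24 * card (sorted_points B))" using N_le_card_plane_points[of B] card_plane_points_le[of B] by (intro of_nat_mono) linarith
    also have "\<dots> \<le> 24 * (K * B * (real n + 3) ^ 6)"
      using sp by simp
    also have "\<dots> \<le> 24 * (K * B * (12 * ln B) ^ 6)" using nl K0 B by (intro mult_left_mono power_mono) auto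
    also have "\<dots> = (24 * K * 12 ^ 6) * B * (ln B) ^ 6" by (simp add: power_mult_distrib)
    finally show ?thesis .
  qed
  then show ?thesis using K0 by (intro exI[of _ "24 * K * 12 ^ 6"]) auto
qed

section \<open>From torsor variables back to points of the surface\<close>

lemma torsor_gcd:
  assumes "torsor u1 u2 u3 u4 d12 d13 d14 d23 d24 d34"
  shows "gcd (d12 * d13 * d14 * u1) (d12 * d23 * d24 * u2) = d12" "gcd (d12 * d13 * d14 * u1) (d13 * d23 * d34 * u3) = d13"
    "gcd (d12 * d13 * d14 * u1) (d14 * d24 * d34 * u4) = d14" "gcd (d12 * d23 * d24 * u2) (d13 * d23 * d34 * u3) = d23"
    "gcd (d12 * d23 * d24 * u2) (d14 * d24 * d34 * u4) = d24" "gcd (d13 * d23 * d34 * u3) (d14 * d24 * d34 * u4) = d34"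
proof -
  note t = assms[unfolded torsor_def]
  have gen: "gcd x y = d" if "x = d * p" "y = d * q" "coprime p q" "0 < d" for x y d p q :: int
    using that by (simp add: gcd_mult_left)
  have d0: "0 < d12" "0 < d13" "0 < d14" "0 < d23" "0 < d24" "0 < d34" using t by blast+
  show "gcd (d12 * d13 * d14 * u1) (d12 * d23 * d24 * u2) = d12"
    by (rule gen[of _ _ "d13 * d14 * u1" _ "d23 * d24 * u2"]) (use t d0 in \<open>simp_all add: coprime_commute\<close>)
  show "gcd (d12 * d13 * d14 * u1) (d13 * d23 * d34 * u3) = d13"
    by (rule gen[of _ _ "d12 * d14 * u1" _ "d23 * d34 * u3"]) (use t d0 in \<open>simp_all add: coprime_commute\<close>)
  show "gcd (d12 * d13 * d14 * u1) (d14 * d24 * d34 * u4) = d14"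
    by (rule gen[of _ _ "d12 * d13 * u1" _ "d24 * d34 * u4"]) (use t d0 in \<open>simp_all add: coprime_commute\<close>)
  show "gcd (d12 * d23 * d24 * u2) (d13 * d23 * d34 * u3) = d23"
    by (rule gen[of _ _ "d12 * d24 * u2" _ "d13 * d34 * u3"]) (use t d0 in \<open>simp_all add: coprime_commute\<close>)
  show "gcd (d12 * d23 * d24 * u2) (d14 * d24 * d34 * u4) = d24"
    by (rule gen[of _ _ "d12 * d23 * u2" _ "d14 * d34 * u4"]) (use t d0 in \<open>simp_all add: coprime_commute\<close>)
  show "gcd (d13 * d23 * d34 * u3) (d14 * d24 * d34 * u4) = d34"
    by (rule gen[of _ _ "d13 * d23 * u3" _ "d14 * d24 * u4"]) (use t d0 in \<open>simp_all add: coprime_commute\<close>)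
qed

lemma torsor_primitive:
  assumes "torsor u1 u2 u3 u4 d12 d13 d14 d23 d24 d34"
  shows "gcd (d12 * d13 * d14 * u1) (gcd (d12 * d23 * d24 * u2) (gcd (d13 * d23 * d34 * u3) (d14 * d24 * d34 * u4))) = 1"
proof -
  have "coprime d12 d34" using assms unfolding torsor_def by blast
  moreover have "gcd (d12 * d13 * d14 * u1) (gcd (d12 * d23 * d24 * u2) (gcd (d13 * d23 * d34 * u3) (d14 * d24 * d34 * u4))) = gcd d12 d34"
    unfolding torsor_gcd(6)[OF assms] gcd.assoc[symmetric] torsor_gcd(1)[OF assms] ..
  ultimately show ?thesis by simp
qed

text \<open>The i-th coordinate is the product of the three w_j with j \<noteq> i divided by the
  product of all six d; what remains are the u_j with j \<noteq> i and the d not involving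
  i.\<close>

definition torsor_point :: "int \<times> int \<times> int \<times> int \<times> int \<times> int \<times> int \<times> int \<times> int \<times> int \<Rightarrow> int ^ 4" where
  "torsor_point = (\<lambda>(u1, u2, u3, u4, d12, d13, d14, d23, d24, d34). (\<chi> i.
     if i = 1 then u2 * u3 * u4 * (d23 * d24 * d34)
     else if i = 2 then u1 * u3 * u4 * (d13 * d14 * d34)
     else if i = 3 then u1 * u2 * u4 * (d12 * d14 * d24)
     else u1 * u2 * u3 * (d12 * d13 * d23)))"

lemma four_distinct: "(2::4) \<noteq> 1" "(3::4) \<noteq> 1" "(3::4) \<noteq> 2" "(4::4) \<noteq> 1" "(4::4) \<noteq> 2" "(4::4) \<noteq> 3"
  by simp_all

lemma torsor_point_nth:
  "torsor_point (u1, u2, u3, u4, d12, d13, d14, d23, d24, d34) $ 1 = u2 * u3 * u4 * (d23 * d24 * d34)"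
  "torsor_point (u1, u2, u3, u4, d12, d13, d14, d23, d24, d34) $ 2 = u1 * u3 * u4 * (d13 * d14 * d34)"
  "torsor_point (u1, u2, u3, u4, d12, d13, d14, d23, d24, d34) $ 3 = u1 * u2 * u4 * (d12 * d14 * d24)"
  "torsor_point (u1, u2, u3, u4, d12, d13, d14, d23, d24, d34) $ 4 = u1 * u2 * u3 * (d12 * d13 * d23)"
  unfolding torsor_point_def prod.case vec_lambda_beta by (simp_all only: four_distinct if_True if_False simp_thms)

text \<open>A prime dividing all coordinates divides a variable in each of the four monomials. Two
  different variables can share a prime only if they are not in the list of coprimality conditions,
  and no admissible choice meets all four monomials.\<close>

lemma torsor_point_gcd:
  assumes "torsor u1 u2 u3 u4 d12 d13 d14 d23 d24 d34"
  shows "gcd (u2 * u3 * u4 * (d23 * d24 * d34)) (gcd (u1 * u3 * u4 * (d13 * d14 * d34)) (gcd (u1 * u2 * u4 * (d12 * d14 * d24)) (u1 * u2 * u3 * (d12 * d13 * d23)))) = 1"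
    (is "?g = 1")
proof (rule ccontr)
  assume n: "?g \<noteq> 1"
  note t = assms[unfolded torsor_def]
  have "u2 \<noteq> 0" "u3 \<noteq> 0" "u4 \<noteq> 0" "d23 > 0" "d24 > 0" "d34 > 0" using t by blast+
  then have "u2 * u3 * u4 * (d23 * d24 * d34) \<noteq> 0" by simp
  then have g0: "?g \<noteq> 0" by (simp only: gcd_eq_0_iff) blast
  have gen: "\<exists>p. prime p \<and> p dvd g" if "g \<noteq> 0" "g \<noteq> 1" "g \<ge> 0" for g :: int
  proof -
    have "\<not> is_unit g" using that by (simp add: zdvd1_eq)
    then show ?thesis using that(1) prime_divisorE by blast
  qed
  obtain p where p: "prime p" "p dvd ?g" using gen[OF g0 n gcd_ge_0_int] by blast
  have no: "\<not> (p dvd x \<and> p dvd y)" if "coprime x y" for x y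
    using that p(1) by (meson coprime_common_divisor not_prime_unit)
  have "p dvd u2 * u3 * u4 * (d23 * d24 * d34)" "p dvd u1 * u3 * u4 * (d13 * d14 * d34)" "p dvd u1 * u2 * u4 * (d12 * d14 * d24)"
    "p dvd u1 * u2 * u3 * (d12 * d13 * d23)" using p(2) by (meson dvd_trans gcd_dvd1 gcd_dvd2)+
  then have a: "p dvd u2 \<or> p dvd u3 \<or> p dvd u4 \<or> p dvd d23 \<or> p dvd d24 \<or> p dvd d34"
    and b: "p dvd u1 \<or> p dvd u3 \<or> p dvd u4 \<or> p dvd d13 \<or> p dvd d14 \<or> p dvd d34"
    and c: "p dvd u1 \<or> p dvd u2 \<or> p dvd u4 \<or> p dvd d12 \<or> p dvd d14 \<or> p dvd d24"
    and d: "p dvd u1 \<or> p dvd u2 \<or> p dvd u3 \<or> p dvd d12 \<or> p dvd d13 \<or> p dvd d23"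
    using p(1) by (simp_all add: prime_dvd_mult_iff)
  have "\<not> (p dvd u1 \<and> p dvd u2)" "\<not> (p dvd u1 \<and> p dvd u3)" "\<not> (p dvd u1 \<and> p dvd u4)" "\<not> (p dvd u2 \<and> p dvd u3)"
     "\<not> (p dvd u2 \<and> p dvd u4)" "\<not> (p dvd u3 \<and> p dvd u4)"
    "\<not> (p dvd d12 \<and> p dvd d23)" "\<not> (p dvd d12 \<and> p dvd d24)" "\<not> (p dvd d12 \<and> p dvd d34)"
    "\<not> (p dvd d13 \<and> p dvd d23)" "\<not> (p dvd d13 \<and> p dvd d24)" "\<not> (p dvd d13 \<and> p dvd d34)"
    "\<not> (p dvd d14 \<and> p dvd d23)" "\<not> (p dvd d14 \<and> p dvd d24)" "\<not> (p dvd d14 \<and> p dvd d34)"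
    "\<not> (p dvd d23 \<and> p dvd d24)" "\<not> (p dvd d23 \<and> p dvd d34)" "\<not> (p dvd d24 \<and> p dvd d34)"
    "\<not> (p dvd u1 \<and> p dvd d23)" "\<not> (p dvd u1 \<and> p dvd d24)" "\<not> (p dvd u1 \<and> p dvd d34)" "\<not> (p dvd u2 \<and> p dvd d13)" "\<not> (p dvd u2 \<and> p dvd d14)" "\<not> (p dvd u2 \<and> p dvd d34)"
    "\<not> (p dvd u3 \<and> p dvd d12)" "\<not> (p dvd u3 \<and> p dvd d14)" "\<not> (p dvd u3 \<and> p dvd d24)" "\<not> (p dvd u4 \<and> p dvd d12)" "\<not> (p dvd u4 \<and> p dvd d13)" "\<not> (p dvd u4 \<and> p dvd d23)"
    by ((rule no, use t in blast)+)
  then show False using a b c d by argo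
qed

lemma torsor_point_counted:
  assumes t: "torsor u1 u2 u3 u4 d12 d13 d14 d23 d24 d34" and
    h: "\<And>i. \<bar>real_of_int (torsor_point (u1, u2, u3, u4, d12, d13, d14, d23, d24, d34) $ i)\<bar> \<le> B"
  shows "torsor_point (u1, u2, u3, u4, d12, d13, d14, d23, d24, d34) \<in> counted_points B"
proof -
  note tt = t[unfolded torsor_def]
  define x where "x = torsor_point (u1, u2, u3, u4, d12, d13, d14, d23, d24, d34)"
  have x: "x $ 1 = u2 * u3 * u4 * (d23 * d24 * d34)" "x $ 2 = u1 * u3 * u4 * (d13 * d14 * d34)"
    "x $ 3 = u1 * u2 * u4 * (d12 * d14 * d24)" "x $ 4 = u1 * u2 * u3 * (d12 * d13 * d23)"
    unfolding x_def by (rule torsor_point_nth)+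
  have un: "u1 \<noteq> 0" "u2 \<noteq> 0" "u3 \<noteq> 0" "u4 \<noteq> 0" and dn: "d12 \<noteq> 0" "d13 \<noteq> 0" "d14 \<noteq> 0" "d23 \<noteq> 0" "d24 \<noteq> 0" "d34 \<noteq> 0"
    and w: "d12 * d13 * d14 * u1 + d12 * d23 * d24 * u2 + d13 * d23 * d34 * u3 + d14 * d24 * d34 * u4 = 0"
      "d12 * d13 * d14 * u1 + d12 * d23 * d24 * u2 \<noteq> 0" "d12 * d13 * d14 * u1 + d13 * d23 * d34 * u3 \<noteq> 0"
      "d12 * d13 * d14 * u1 + d14 * d24 * d34 * u4 \<noteq> 0"
    using tt by (blast, blast, blast, blast, auto)
  have xn: "x $ 1 \<noteq> 0" "x $ 2 \<noteq> 0" "x $ 3 \<noteq> 0" "x $ 4 \<noteq> 0" unfolding x using un dn by simp_all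
  \<comment> \<open>The product of the three coordinates other than the i-th is K w_i, which turns
    the cubic equation into the linear one.\<close>
  define K where "K = (u1 * u2 * u3 * u4)\<^sup>2 * (d12 * d13 * d14 * d23 * d24 * d34)"
  have "x $ 2 * x $ 3 * x $ 4 = K * (d12 * d13 * d14 * u1)" "x $ 1 * x $ 3 * x $ 4 = K * (d12 * d23 * d24 * u2)"
    "x $ 1 * x $ 2 * x $ 4 = K * (d13 * d23 * d34 * u3)" "x $ 1 * x $ 2 * x $ 3 = K * (d14 * d24 * d34 * u4)"
    unfolding x K_def by (simp_all add: power2_eq_square)
  then have "x $ 2 * x $ 3 * x $ 4 + x $ 1 * x $ 3 * x $ 4 + x $ 1 * x $ 2 * x $ 4 + x $ 1 * x $ 2 * x $ 3
     = K * (d12 * d13 * d14 * u1 + d12 * d23 * d24 * u2 + d13 * d23 * d34 * u3 + d14 * d24 * d34 * u4)" by (simp only: distrib_left)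
  then have cub: "x \<in> cayley_cubic" unfolding w(1) by (simp add: cayley_cubic_def)
  have "d12 * (x $ 1 + x $ 2) = (u3 * u4 * d34) * (d12 * d13 * d14 * u1 + d12 * d23 * d24 * u2)"
    "d13 * (x $ 1 + x $ 3) = (u2 * u4 * d24) * (d12 * d13 * d14 * u1 + d13 * d23 * d34 * u3)"
    "d14 * (x $ 1 + x $ 4) = (u2 * u3 * d23) * (d12 * d13 * d14 * u1 + d14 * d24 * d34 * u4)"
    unfolding x by (simp_all add: algebra_simps)
  then have ps: "x $ 1 + x $ 2 \<noteq> 0" "x $ 1 + x $ 3 \<noteq> 0" "x $ 1 + x $ 4 \<noteq> 0"
    using w(2-4) un dn by (metis mult_eq_0_iff)+
  have U: "in_U x" unfolding in_U_def using cub xn ps by (auto simp: cayley_lines_def coord_line_def pair_line_def)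
  have G: "(GCD i. x $ i) = 1" using torsor_point_gcd[OF t] unfolding UNIV_4_eq x[symmetric] by simp
  have "(MAX i. \<bar>x $ i\<bar>) \<in> range (\<lambda>i. \<bar>x $ i\<bar>)" by (rule Max_in) auto
  then obtain i where i: "(MAX i. \<bar>x $ i\<bar>) = \<bar>x $ i\<bar>" by blast
  have "real_of_int (MAX i. \<bar>x $ i\<bar>) \<le> B" unfolding i using h[of i] unfolding x_def by simp
  then show ?thesis unfolding counted_points_def x_def[symmetric] using U G by simp
qed

text \<open>The point determines w up to a factor, primitivity up to sign, and 0 < u1 fixes the
  sign. The d are then the gcds of the w_i and the u_i are the quotients.\<close>

lemma N_ge_card_torsor:
  assumes S: "\<And>u1 u2 u3 u4 d12 d13 d14 d23 d24 d34. (u1, u2, u3, u4, d12, d13, d14, d23, d24, d34) \<in> S \<Longrightarrow>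
      torsor u1 u2 u3 u4 d12 d13 d14 d23 d24 d34 \<and> 0 < u1 \<and>
      (\<forall>i. \<bar>real_of_int (torsor_point (u1, u2, u3, u4, d12, d13, d14, d23, d24, d34) $ i)\<bar> \<le> B)"
  shows "card S \<le> N B"
proof -
  have "inj_on torsor_point S"
  proof (rule inj_onI)
    fix s t assume st: "s \<in> S" "t \<in> S" "torsor_point s = torsor_point t"
    obtain u1 u2 u3 u4 d12 d13 d14 d23 d24 d34 where se: "s = (u1, u2, u3, u4, d12, d13, d14, d23, d24, d34)" by (metis prod.collapse)
    obtain v1 v2 v3 v4 e12 e13 e14 e23 e24 e34 where te: "t = (v1, v2, v3, v4, e12, e13, e14, e23, e24, e34)" by (metis prod.collapse)
    have ts: "torsor u1 u2 u3 u4 d12 d13 d14 d23 d24 d34" "0 < u1" using S st(1) unfolding se by blast+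
    have tt: "torsor v1 v2 v3 v4 e12 e13 e14 e23 e24 e34" "0 < v1" using S st(2) unfolding te by blast+
    define m where "m = u1 * u2 * u3 * u4 * (d12 * d13 * d14 * d23 * d24 * d34)"
    define n where "n = v1 * v2 * v3 * v4 * (e12 * e13 * e14 * e23 * e24 * e34)"
    define a b c d where "a = d12 * d13 * d14 * u1" and "b = d12 * d23 * d24 * u2" and "c = d13 * d23 * d34 * u3" and "d = d14 * d24 * d34 * u4"
    define a' b' c' d' where "a' = e12 * e13 * e14 * v1" and "b' = e12 * e23 * e24 * v2" and "c' = e13 * e23 * e34 * v3" and "d' = e14 * e24 * e34 * v4"
    define x where "x = torsor_point s"
    have p0: "0 < d12" "0 < d13" "0 < d14" "0 < d23" "0 < d24" "0 < d34" "u2 \<noteq> 0" "u3 \<noteq> 0" "u4 \<noteq> 0" using ts(1) unfolding torsor_def by blast+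
    have q0: "0 < e12" "0 < e13" "0 < e14" "0 < e23" "0 < e24" "0 < e34" "v2 \<noteq> 0" "v3 \<noteq> 0" "v4 \<noteq> 0" using tt(1) unfolding torsor_def by blast+
    have m: "a * x $ 1 = m" "b * x $ 2 = m" "c * x $ 3 = m" "d * x $ 4 = m"
      unfolding x_def se torsor_point_nth a_def b_def c_def d_def m_def by simp_all
    have n: "a' * x $ 1 = n" "b' * x $ 2 = n" "c' * x $ 3 = n" "d' * x $ 4 = n"
      unfolding x_def st(3) te torsor_point_nth a'_def b'_def c'_def d'_def n_def by simp_all
    have m0: "m \<noteq> 0" unfolding m_def using p0 ts(2) by simp
    have xn: "x $ 1 \<noteq> 0" "x $ 2 \<noteq> 0" "x $ 3 \<noteq> 0" "x $ 4 \<noteq> 0" using m m0 by auto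
    have gen: "n * p = m * q" if "p * v = m" "q * v = n" "v \<noteq> 0" for v p q :: int
    proof -
      have "(n * p) * v = n * m" "(m * q) * v = m * n" unfolding mult.assoc that(1,2) by simp_all
      then have "(n * p) * v = (m * q) * v" by (simp only: mult.commute)
      then show ?thesis using that(3) by simp
    qed
    have pr: "n * a = m * a'" "n * b = m * b'" "n * c = m * c'" "n * d = m * d'"
      using gen[OF m(1) n(1) xn(1)] gen[OF m(2) n(2) xn(2)] gen[OF m(3) n(3) xn(3)] gen[OF m(4) n(4) xn(4)] by blast+
    have g1: "gcd a (gcd b (gcd c d)) = 1" unfolding a_def b_def c_def d_def by (rule torsor_primitive[OF ts(1)])
    have g2: "gcd a' (gcd b' (gcd c' d')) = 1" unfolding a'_def b'_def c'_def d'_def by (rule torsor_primitive[OF tt(1)])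
    have "gcd (n * a) (gcd (n * b) (gcd (n * c) (n * d))) = \<bar>n\<bar>" unfolding gcd4_mult_int g1 by simp
    moreover have "gcd (m * a') (gcd (m * b') (gcd (m * c') (m * d'))) = \<bar>m\<bar>" unfolding gcd4_mult_int g2 by simp
    ultimately have nm: "\<bar>n\<bar> = \<bar>m\<bar>" unfolding pr by simp
    have a0: "0 < a" "0 < a'" unfolding a_def a'_def using p0 q0 ts(2) tt(2) by simp_all
    have "n = m"
    proof (rule ccontr)
      assume "n \<noteq> m"
      then have "n = - m" using nm by linarith
      then have "m * (a + a') = 0" using pr(1) by (simp add: algebra_simps)
      then show False using m0 a0 by simp
    qed
    then have w: "a = a'" "b = b'" "c = c'" "d = d'" using pr m0 by simp_all
    have de: "d12 = e12" "d13 = e13" "d14 = e14" "d23 = e23" "d24 = e24" "d34 = e34"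
      using torsor_gcd[OF ts(1)] torsor_gcd[OF tt(1)] w unfolding a_def b_def c_def d_def a'_def b'_def c'_def d'_def by simp_all
    have "u1 = v1" "u2 = v2" "u3 = v3" "u4 = v4"
      using w q0(1-6) unfolding a_def b_def c_def d_def a'_def b'_def c'_def d'_def de by simp_all
    then show "s = t" unfolding se te de by simp
  qed
  moreover have "torsor_point ` S \<subseteq> counted_points B"
  proof
    fix x assume "x \<in> torsor_point ` S"
    then obtain t where t: "t \<in> S" "x = torsor_point t" by blast
    obtain u1 u2 u3 u4 d12 d13 d14 d23 d24 d34 where te: "t = (u1, u2, u3, u4, d12, d13, d14, d23, d24, d34)" by (metis prod.collapse)
    show "x \<in> counted_points B" unfolding t(2) te by (rule torsor_point_counted) (use S[OF t(1)[unfolded te]] in blast)+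
  qed
  ultimately show ?thesis unfolding N_def using card_inj_on_le finite_counted_points by blast
qed

section \<open>Sieving the u for fixed d\<close>

text \<open>The slope is invertible modulo p, so each block of length p contains at most one
  solution.\<close>

lemma card_linear_congruence_le:
  fixes p \<alpha> \<beta> :: int
  assumes p: "prime p" "\<not> p dvd \<beta>"
  shows "real (card {t. t < K \<and> p dvd \<alpha> + \<beta> * int t}) \<le> real K / p + 1"
proof -
  let ?S = "{t. t < K \<and> p dvd \<alpha> + \<beta> * int t}"
  have p0: "p > 0" using p(1) prime_gt_0_int by blast
  have inj: "inj_on (\<lambda>t. t div nat p) ?S"
  proof (rule inj_onI)
    fix s t assume st: "s \<in> ?S" "t \<in> ?S" "s div nat p = t div nat p"
    have "p dvd (\<alpha> + \<beta> * int s) - (\<alpha> + \<beta> * int t)" using st by (intro dvd_diff) auto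
    also have "\<dots> = \<beta> * (int s - int t)" by (simp add: algebra_simps)
    finally have "p dvd int s - int t" using p prime_dvd_mult_iff by blast
    then have "int s mod p = int t mod p" by (simp add: mod_eq_dvd_iff)
    then have "s mod nat p = t mod nat p" using p0 by (metis int_nat_eq of_nat_eq_iff of_nat_mod less_imp_le)
    then show "s = t" using st(3) by (metis mult_div_mod_eq)
  qed
  have "(\<lambda>t. t div nat p) ` ?S \<subseteq> {..K div nat p}" by (auto intro: div_le_mono)
  then have "card ((\<lambda>t. t div nat p) ` ?S) \<le> card {..K div nat p}" by (intro card_mono) auto
  then have "card ?S \<le> K div nat p + 1" using inj by (simp add: card_image)
  then have "real (card ?S) \<le> real (K div nat p) + 1" by linarith
  also have "real (K div nat p) \<le> real K / real (nat p)" by (rule of_nat_div_le_of_nat)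
  finally show ?thesis using p0 by simp
qed

lemma card_triple_le:
  fixes k1 k2 k3 :: real and K1 K2 K3 :: nat
  assumes "real (card {a. a < K1 \<and> P1 a}) \<le> k1" "\<And>a. real (card {b. b < K2 \<and> P2 a b}) \<le> k2" "\<And>a b. real (card {c. c < K3 \<and> P3 a b c}) \<le> k3"
  shows "real (card {(a, b, c). (a < K1 \<and> b < K2 \<and> c < K3) \<and> P1 a \<and> P2 a b \<and> P3 a b c}) \<le> k1 * (k2 * k3)"
proof -
  have k: "0 \<le> k1" "0 \<le> k2" "0 \<le> k3" using assms of_nat_0_le_iff order_trans by blast+
  have eq: "{(a, b, c). (a < K1 \<and> b < K2 \<and> c < K3) \<and> P1 a \<and> P2 a b \<and> P3 a b c}
     = (SIGMA a:{a. a < K1 \<and> P1 a}. SIGMA b:{b. b < K2 \<and> P2 a b}. {c. c < K3 \<and> P3 a b c})" by auto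
  have "real (card {(a, b, c). (a < K1 \<and> b < K2 \<and> c < K3) \<and> P1 a \<and> P2 a b \<and> P3 a b c})
     = (\<Sum>a\<in>{a. a < K1 \<and> P1 a}. \<Sum>b\<in>{b. b < K2 \<and> P2 a b}. real (card {c. c < K3 \<and> P3 a b c}))"
    unfolding eq by (simp add: card_SigmaI)
  also have "\<dots> \<le> (\<Sum>a\<in>{a. a < K1 \<and> P1 a}. \<Sum>b\<in>{b. b < K2 \<and> P2 a b}. k3)" by (intro sum_mono assms(3))
  also have "\<dots> = (\<Sum>a\<in>{a. a < K1 \<and> P1 a}. real (card {b. b < K2 \<and> P2 a b}) * k3)" by simp
  also have "\<dots> \<le> (\<Sum>a\<in>{a. a < K1 \<and> P1 a}. k2 * k3)" using k by (intro sum_mono mult_right_mono assms(2))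
  also have "\<dots> = real (card {a. a < K1 \<and> P1 a}) * (k2 * k3)" by simp
  also have "\<dots> \<le> k1 * (k2 * k3)" using k by (intro mult_right_mono assms(1)) auto
  finally show ?thesis .
qed

text \<open>As \<open>M\<close> divides all \<open>d\<^sub>i\<^sub>j - 1\<close>, the residues \<open>1\<close>, \<open>1\<close> and \<open>- 1\<close> of the first three \<open>u\<^sub>i\<close> modulo \<open>M\<close> force
  the residue \<open>- 1\<close> on the fourth, so that all of them are prime to \<open>M\<close>.\<close>

locale torsor_family =
  fixes M d12 d13 d14 d23 d24 d34 :: int and K1 K2 K3 :: nat and r2 :: "int \<Rightarrow> int" and r3 :: "int \<Rightarrow> int \<Rightarrow> int"
  assumes M0: "0 < M" and dpos: "0 < d12" "0 < d13" "0 < d14" "0 < d23" "0 < d24" "0 < d34"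
    and dM: "M dvd d12 - 1" "M dvd d13 - 1" "M dvd d14 - 1" "M dvd d23 - 1" "M dvd d24 - 1" "M dvd d34 - 1"
    and dcop: "coprime d12 d13" "coprime d12 d14" "coprime d12 d23" "coprime d12 d24" "coprime d12 d34"
      "coprime d13 d14" "coprime d13 d23" "coprime d13 d24" "coprime d13 d34"
      "coprime d14 d23" "coprime d14 d24" "coprime d14 d34" "coprime d23 d24" "coprime d23 d34" "coprime d24 d34"
    and r2: "\<And>a. 1 \<le> r2 a \<and> r2 a \<le> M * d34 \<and> M dvd r2 a - 1 \<and> d34 dvd d13 * d14 * a + d23 * d24 * r2 a"
    and r3: "\<And>a b. 1 \<le> r3 a b \<and> r3 a b \<le> M * (d14 * d24) \<and> M dvd r3 a b + 1 \<and> d14 dvd d12 * d24 * b + d13 * d34 * r3 a b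
        \<and> d24 dvd d12 * d14 * a + d23 * d34 * r3 a b"
begin

text \<open>The u_i run through progressions modulo M, M d34 and M d14 d24. The starting points make
  d34, d14 and d24 divide the partial sums, so the fourth variable is integral. \<open>y12\<close>,
  \<open>y14\<close> and \<open>y24\<close> are, up to sign, the quotients of the pairs (1, 2), (1,
  4) and (2, 4).\<close>

definition v1 where "v1 t = 1 + M * int t"
definition v2 where "v2 s t = r2 (v1 s) + M * d34 * int t"
definition v3 where "v3 r s t = r3 (v1 r) (v2 r s) + M * d14 * d24 * int t"
definition y12 where "y12 s t = (d13 * d14 * v1 s + d23 * d24 * v2 s t) div d34"
definition y14 where "y14 r s t = (d12 * d24 * v2 r s + d13 * d34 * v3 r s t) div d14"
definition y24 where "y24 r s t = (d12 * d14 * v1 r + d23 * d34 * v3 r s t) div d24"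

text \<open>Each quotient is linear in its last parameter, with a slope that is a product of M and
  some d; divisibility by a prime thus becomes a linear congruence.\<close>

lemma y12_lin: "y12 s t = (d13 * d14 * v1 s + d23 * d24 * r2 (v1 s)) div d34 + (d23 * d24 * M) * int t"
  and y12: "d34 * y12 s t = d13 * d14 * v1 s + d23 * d24 * v2 s t"
proof -
  obtain k where k: "d13 * d14 * v1 s + d23 * d24 * r2 (v1 s) = d34 * k" using r2[of "v1 s"] by (meson dvdE)
  have e: "d13 * d14 * v1 s + d23 * d24 * v2 s t = d34 * (k + (d23 * d24 * M) * int t)"
    unfolding v2_def distrib_left k[symmetric] by (simp add: algebra_simps)
  show "y12 s t = (d13 * d14 * v1 s + d23 * d24 * r2 (v1 s)) div d34 + (d23 * d24 * M) * int t"
    unfolding y12_def e k using dpos by simp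
  show "d34 * y12 s t = d13 * d14 * v1 s + d23 * d24 * v2 s t" unfolding y12_def e using dpos by simp
qed

lemma y14_lin: "y14 r s t = (d12 * d24 * v2 r s + d13 * d34 * r3 (v1 r) (v2 r s)) div d14 + (d13 * d34 * M * d24) * int t"
  and y14: "d14 * y14 r s t = d12 * d24 * v2 r s + d13 * d34 * v3 r s t"
proof -
  obtain k where k: "d12 * d24 * v2 r s + d13 * d34 * r3 (v1 r) (v2 r s) = d14 * k" using r3[of "v1 r" "v2 r s"] by (meson dvdE)
  have e: "d12 * d24 * v2 r s + d13 * d34 * v3 r s t = d14 * (k + (d13 * d34 * M * d24) * int t)"
    unfolding v3_def distrib_left k[symmetric] by (simp add: algebra_simps)
  show "y14 r s t = (d12 * d24 * v2 r s + d13 * d34 * r3 (v1 r) (v2 r s)) div d14 + (d13 * d34 * M * d24) * int t"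
    unfolding y14_def e k using dpos by simp
  show "d14 * y14 r s t = d12 * d24 * v2 r s + d13 * d34 * v3 r s t" unfolding y14_def e using dpos by simp
qed

lemma y24_lin: "y24 r s t = (d12 * d14 * v1 r + d23 * d34 * r3 (v1 r) (v2 r s)) div d24 + (d23 * d34 * M * d14) * int t"
  and y24: "d24 * y24 r s t = d12 * d14 * v1 r + d23 * d34 * v3 r s t"
proof -
  obtain k where k: "d12 * d14 * v1 r + d23 * d34 * r3 (v1 r) (v2 r s) = d24 * k" using r3[of "v1 r" "v2 r s"] by (meson dvdE)
  have e: "d12 * d14 * v1 r + d23 * d34 * v3 r s t = d24 * (k + (d23 * d34 * M * d14) * int t)"
    unfolding v3_def distrib_left k[symmetric] by (simp add: algebra_simps)
  show "y24 r s t = (d12 * d14 * v1 r + d23 * d34 * r3 (v1 r) (v2 r s)) div d24 + (d23 * d34 * M * d14) * int t"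
    unfolding y24_def e k using dpos by simp
  show "d24 * y24 r s t = d12 * d14 * v1 r + d23 * d34 * v3 r s t" unfolding y24_def e using dpos by simp
qed

definition v4 where "v4 r s t = - (d12 * d13 * d14 * v1 r + d12 * d23 * d24 * v2 r s + d13 * d23 * d34 * v3 r s t) div (d14 * d24 * d34)"

lemma v_pos: "1 \<le> v1 t" "1 \<le> v2 s t" "1 \<le> v3 r s t"
  using M0 dpos r2[of "v1 s"] r3[of "v1 r" "v2 r s"] unfolding v1_def v2_def v3_def by (simp_all add: add_increasing2)

lemma v_less:
  "t < K \<Longrightarrow> v1 t \<le> M * int K" "t < K \<Longrightarrow> v2 s t \<le> M * d34 * int K" "t < K \<Longrightarrow> v3 r s t \<le> M * d14 * d24 * int K"
proof -
  have gen: "c + m * int t \<le> m * int K" if "t < K" "c \<le> m" "0 < m" for c m :: int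
  proof -
    have "c + m * int t \<le> m * (1 + int t)" using that by (simp add: algebra_simps)
    also have "\<dots> \<le> m * int K" using that by (intro mult_left_mono) auto
    finally show ?thesis .
  qed
  show "t < K \<Longrightarrow> v1 t \<le> M * int K" unfolding v1_def by (rule gen) (use M0 in auto)
  show "t < K \<Longrightarrow> v2 s t \<le> M * d34 * int K" unfolding v2_def by (rule gen) (use M0 dpos r2 in auto)
  show "t < K \<Longrightarrow> v3 r s t \<le> M * d14 * d24 * int K" unfolding v3_def by (rule gen) (use M0 dpos r3 in \<open>auto simp: mult.assoc\<close>)
qed

text \<open>Each of d34, d14, d24 divides the sum of the first three terms, seen by grouping two of
  them into the corresponding quotient. They are coprime, so the division in \<open>v4\<close> is
  exact.\<close>

lemma v_sum: "d12 * d13 * d14 * v1 r + d12 * d23 * d24 * v2 r s + d13 * d23 * d34 * v3 r s t + d14 * d24 * d34 * v4 r s t = 0"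
proof -
  let ?s = "d12 * d13 * d14 * v1 r + d12 * d23 * d24 * v2 r s + d13 * d23 * d34 * v3 r s t"
  have "?s = d12 * d34 * y12 r s + d13 * d23 * d34 * v3 r s t" using y12[of r s] by (simp add: algebra_simps)
  then have 1: "d34 dvd ?s" by simp
  have e2: "?s = d14 * (d12 * d13 * v1 r) + d23 * (d14 * y14 r s t)" unfolding y14 by (simp add: algebra_simps)
  have 2: "d14 dvd ?s" unfolding e2 by simp
  have e3: "?s = d24 * (d12 * d23 * v2 r s) + d13 * (d24 * y24 r s t)" unfolding y24 by (simp add: algebra_simps)
  have 3: "d24 dvd ?s" unfolding e3 by simp
  have "d14 * d24 * d34 dvd ?s" using 1 2 3 dcop by (intro divides_mult) simp_all
  then have "d14 * d24 * d34 dvd - ?s" by (simp only: dvd_minus_iff)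
  then have "d14 * d24 * d34 * v4 r s t = - ?s" unfolding v4_def by (simp only: dvd_mult_div_cancel)
  then show ?thesis by simp
qed

lemma v_rel:
  "d12 * y12 r s = - (d13 * d23 * v3 r s t + d14 * d24 * v4 r s t)"
  "d23 * y14 r s t = - (d12 * d13 * v1 r + d24 * d34 * v4 r s t)"
  "d13 * y24 r s t = - (d12 * d23 * v2 r s + d14 * d34 * v4 r s t)"
proof -
  have "d34 * (d12 * y12 r s + (d13 * d23 * v3 r s t + d14 * d24 * v4 r s t)) = d12 * (d34 * y12 r s) + d34 * (d13 * d23 * v3 r s t + d14 * d24 * v4 r s t)" by (simp add: algebra_simps)
  also have "\<dots> = d12 * d13 * d14 * v1 r + d12 * d23 * d24 * v2 r s + d13 * d23 * d34 * v3 r s t + d14 * d24 * d34 * v4 r s t" unfolding y12 by (simp add: algebra_simps)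
  also have "\<dots> = 0" by (rule v_sum)
  finally show "d12 * y12 r s = - (d13 * d23 * v3 r s t + d14 * d24 * v4 r s t)" using dpos by simp
  have "d14 * (d23 * y14 r s t + (d12 * d13 * v1 r + d24 * d34 * v4 r s t)) = d23 * (d14 * y14 r s t) + d14 * (d12 * d13 * v1 r + d24 * d34 * v4 r s t)" by (simp add: algebra_simps)
  also have "\<dots> = d12 * d13 * d14 * v1 r + d12 * d23 * d24 * v2 r s + d13 * d23 * d34 * v3 r s t + d14 * d24 * d34 * v4 r s t" unfolding y14 by (simp add: algebra_simps)
  also have "\<dots> = 0" by (rule v_sum)
  finally show "d23 * y14 r s t = - (d12 * d13 * v1 r + d24 * d34 * v4 r s t)" using dpos by simp
  have "d24 * (d13 * y24 r s t + (d12 * d23 * v2 r s + d14 * d34 * v4 r s t)) = d13 * (d24 * y24 r s t) + d24 * (d12 * d23 * v2 r s + d14 * d34 * v4 r s t)" by (simp add: algebra_simps)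
  also have "\<dots> = d12 * d13 * d14 * v1 r + d12 * d23 * d24 * v2 r s + d13 * d23 * d34 * v3 r s t + d14 * d24 * d34 * v4 r s t" unfolding y24 by (simp add: algebra_simps)
  also have "\<dots> = 0" by (rule v_sum)
  finally show "d13 * y24 r s t = - (d12 * d23 * v2 r s + d14 * d34 * v4 r s t)" using dpos by simp
qed

lemma v_mod: "M dvd v1 r - 1" "M dvd v2 r s - 1" "M dvd v3 r s t + 1"
proof -
  show "M dvd v1 r - 1" by (simp add: v1_def)
  have "M dvd (r2 (v1 r) - 1) + M * (d34 * int s)" using r2 by simp
  then show "M dvd v2 r s - 1" by (simp add: v2_def algebra_simps)
  have "M dvd (r3 (v1 r) (v2 r s) + 1) + M * (d14 * d24 * int t)" using r3 by simp
  then show "M dvd v3 r s t + 1" by (simp add: v3_def algebra_simps)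
qed

text \<open>By \<open>v_rel\<close> a prime dividing \<open>v1\<close> and \<open>v4\<close> divides \<open>d23 * y14\<close>, and so on: the last three clauses stand for
  the common divisors of \<open>v4\<close> with the others.\<close>

definition bad_at :: "int \<Rightarrow> nat \<Rightarrow> nat \<Rightarrow> nat \<Rightarrow> bool" where
  "bad_at p r s t \<longleftrightarrow>
     (\<not> p dvd d34 \<and> p dvd v1 r \<and> p dvd v2 r s) \<or>
     (\<not> p dvd d14 * d24 \<and> p dvd v1 r \<and> p dvd v3 r s t) \<or>
     (\<not> p dvd d34 * d14 * d24 \<and> p dvd v2 r s \<and> p dvd v3 r s t) \<or>
     (\<not> p dvd d13 * d34 * d24 \<and> p dvd v1 r \<and> p dvd y14 r s t) \<or>
     (\<not> p dvd d23 * d34 * d14 \<and> p dvd v2 r s \<and> p dvd y24 r s t) \<or>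
     (\<not> p dvd d23 * d24 * d14 \<and> p dvd v3 r s t \<and> p dvd y12 r s)"

text \<open>Six of the twelve coprimality conditions between the u and the d. The other six follow
  from these, from the absence of \<open>bad_at\<close> and from the relations for the
  quotients.\<close>

definition bad_gcd :: "int \<Rightarrow> nat \<Rightarrow> nat \<Rightarrow> nat \<Rightarrow> bool" where
  "bad_gcd p r s t \<longleftrightarrow> (p dvd d23 \<and> p dvd v1 r) \<or> (p dvd d24 \<and> p dvd v1 r) \<or> (p dvd d34 \<and> p dvd v1 r) \<or>
     (p dvd d13 \<and> p dvd v2 r s) \<or> (p dvd d14 \<and> p dvd v2 r s) \<or> (p dvd d12 \<and> p dvd v3 r s t)"

text \<open>Each relation has three terms, and a prime dividing two of them divides the third, whose
  factors are known to be prime to it. The primes exempted in the clauses of \<open>bad_at\<close>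
  divide some d and are excluded by \<open>bad_gcd\<close> or by such a relation.\<close>

lemma good_torsor:
  assumes good: "\<And>p. prime p \<Longrightarrow> \<not> bad_at p r s t \<and> \<not> bad_gcd p r s t"
  shows "torsor (v1 r) (v2 r s) (v3 r s t) (v4 r s t) d12 d13 d14 d23 d24 d34"
proof -
  define u1 where "u1 = v1 r"
  define u2 where "u2 = v2 r s"
  define u3 where "u3 = v3 r s t"
  define u4 where "u4 = v4 r s t"
  define z12 where "z12 = y12 r s"
  define z14 where "z14 = y14 r s t"
  define z24 where "z24 = y24 r s t"
  note ud = u1_def[symmetric] u2_def[symmetric] u3_def[symmetric] u4_def[symmetric] z12_def[symmetric] z14_def[symmetric] z24_def[symmetric]
  have E: "d34 * z12 = d13 * d14 * u1 + d23 * d24 * u2" "d14 * z14 = d12 * d24 * u2 + d13 * d34 * u3" "d24 * z24 = d12 * d14 * u1 + d23 * d34 * u3"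
    "d12 * z12 = - (d13 * d23 * u3 + d14 * d24 * u4)" "d23 * z14 = - (d12 * d13 * u1 + d24 * d34 * u4)" "d13 * z24 = - (d12 * d23 * u2 + d14 * d34 * u4)"
    using y12[of r s] y14[of r s t] y24[of r s t] v_rel(1)[of r s t] v_rel(2)[of r s t] v_rel(3)[of r s t] unfolding ud by blast+
  have clash: "coprime x y" if *: "\<And>p. prime p \<Longrightarrow> \<not> (p dvd y \<and> p dvd x)" "x \<noteq> 0" for x y :: int
  proof (rule ccontr)
    assume "\<not> coprime x y"
    then have n1: "gcd x y \<noteq> 1" by (simp add: coprime_iff_gcd_eq_1)
    have "gcd x y \<noteq> 0" using *(2) by simp
    moreover from this have "\<not> is_unit (gcd x y)" using n1 by (simp add: zdvd1_eq)
    ultimately obtain p where p: "prime p" "p dvd gcd x y" using prime_divisorE by blast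
    then show False using *(1)[OF p(1)] by (meson dvd_trans gcd_dvd1 gcd_dvd2)
  qed
  have facts: "\<not> (p dvd d23 \<and> p dvd u1)" "\<not> (p dvd d24 \<and> p dvd u1)" "\<not> (p dvd d34 \<and> p dvd u1)" "\<not> (p dvd d13 \<and> p dvd u2)"
      "\<not> (p dvd d14 \<and> p dvd u2)" "\<not> (p dvd d12 \<and> p dvd u3)"
      "p dvd u1 \<longrightarrow> p dvd u2 \<longrightarrow> p dvd d34" "p dvd u1 \<longrightarrow> p dvd u3 \<longrightarrow> p dvd d14 * d24" "p dvd u2 \<longrightarrow> p dvd u3 \<longrightarrow> p dvd d34 * d14 * d24"
      "p dvd u1 \<longrightarrow> p dvd z14 \<longrightarrow> p dvd d13 * d34 * d24" "p dvd u2 \<longrightarrow> p dvd z24 \<longrightarrow> p dvd d23 * d34 * d14" "p dvd u3 \<longrightarrow> p dvd z12 \<longrightarrow> p dvd d23 * d24 * d14"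
    if "prime p" for p
    using good[OF that] unfolding bad_at_def bad_gcd_def ud by blast+
  have one: "\<not> (p dvd a \<and> p dvd b)" if "prime p" "coprime a b" for p a b :: int
    using that by (meson coprime_common_divisor not_prime_unit)
  have dd: "\<not> (p dvd d12 \<and> p dvd d13)" "\<not> (p dvd d12 \<and> p dvd d14)" "\<not> (p dvd d12 \<and> p dvd d23)" "\<not> (p dvd d12 \<and> p dvd d24)" "\<not> (p dvd d12 \<and> p dvd d34)"
      "\<not> (p dvd d13 \<and> p dvd d14)" "\<not> (p dvd d13 \<and> p dvd d23)" "\<not> (p dvd d13 \<and> p dvd d24)" "\<not> (p dvd d13 \<and> p dvd d34)"
      "\<not> (p dvd d14 \<and> p dvd d23)" "\<not> (p dvd d14 \<and> p dvd d24)" "\<not> (p dvd d14 \<and> p dvd d34)" "\<not> (p dvd d23 \<and> p dvd d24)" "\<not> (p dvd d23 \<and> p dvd d34)" "\<not> (p dvd d24 \<and> p dvd d34)"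
    if "prime p" for p using one[OF that] dcop by blast+
  have pm: "p dvd a * b * c \<longleftrightarrow> p dvd a \<or> p dvd b \<or> p dvd c" "p dvd a * b \<longleftrightarrow> p dvd a \<or> p dvd b" if "prime p" for p a b c :: int
    using that by (simp_all add: prime_dvd_mult_iff)
  have split: "p dvd c" if "a = b + c" "p dvd a" "p dvd b" for a b c p :: int
    using that by (simp add: dvd_add_right_iff)
  \<comment> \<open>The six conditions missing from \<open>bad_gcd\<close>, each from the relation
    in which the given d and u remove two of the terms.\<close>
  have rel: "\<not> (p dvd d14 \<and> p dvd u3)" "\<not> (p dvd d24 \<and> p dvd u3)" "\<not> (p dvd d34 \<and> p dvd u2)" "\<not> (p dvd d12 \<and> p dvd u4)" "\<not> (p dvd d13 \<and> p dvd u4)" "\<not> (p dvd d23 \<and> p dvd u4)" if p: "prime p" for p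
  proof -
    note f = facts[OF p] and dd' = dd[OF p] and pm' = pm[OF p]
    show "\<not> (p dvd d14 \<and> p dvd u3)"
    proof
      assume a: "p dvd d14 \<and> p dvd u3"
      have "p dvd d12 * d24 * u2" by (rule split[OF trans[OF E(2) add.commute]]) (use a in simp_all)
      then show False using a f dd' unfolding pm' by argo
    qed
    show "\<not> (p dvd d24 \<and> p dvd u3)"
    proof
      assume a: "p dvd d24 \<and> p dvd u3"
      have "p dvd d12 * d14 * u1" by (rule split[OF trans[OF E(3) add.commute]]) (use a in simp_all)
      then show False using a f dd' unfolding pm' by argo
    qed
    show "\<not> (p dvd d34 \<and> p dvd u2)"
    proof
      assume a: "p dvd d34 \<and> p dvd u2"
      have "p dvd d13 * d14 * u1" by (rule split[OF trans[OF E(1) add.commute]]) (use a in simp_all)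
      then show False using a f dd' unfolding pm' by argo
    qed
    show "\<not> (p dvd d12 \<and> p dvd u4)"
    proof
      assume a: "p dvd d12 \<and> p dvd u4"
      have "- (d12 * z12) = d14 * d24 * u4 + d13 * d23 * u3" by (simp add: E(4))
      then have "p dvd d13 * d23 * u3" by (rule split) (use a in simp_all)
      then show False using a f dd' unfolding pm' by argo
    qed
    show "\<not> (p dvd d13 \<and> p dvd u4)"
    proof
      assume a: "p dvd d13 \<and> p dvd u4"
      have "- (d13 * z24) = d14 * d34 * u4 + d12 * d23 * u2" by (simp add: E(6))
      then have "p dvd d12 * d23 * u2" by (rule split) (use a in simp_all)
      then show False using a f dd' unfolding pm' by argo
    qed
    show "\<not> (p dvd d23 \<and> p dvd u4)"
    proof
      assume a: "p dvd d23 \<and> p dvd u4"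
      have "- (d23 * z14) = d24 * d34 * u4 + d12 * d13 * u1" by (simp add: E(5))
      then have "p dvd d12 * d13 * u1" by (rule split) (use a in simp_all)
      then show False using a f dd' unfolding pm' by argo
    qed
  qed
  \<comment> \<open>This translates a common prime of u4 and another u_i into one of a quotient,
    which \<open>bad_at\<close> excludes unless it divides the accompanying d or one of the exempted
    d.\<close>
  have zz: "p dvd u1 \<and> p dvd u4 \<longrightarrow> p dvd d23 * z14" "p dvd u2 \<and> p dvd u4 \<longrightarrow> p dvd d13 * z24" "p dvd u3 \<and> p dvd u4 \<longrightarrow> p dvd d12 * z12" for p
    unfolding E(4-6) by simp_all
  have zd: "\<not> (p dvd d13 \<and> p dvd z14)" "\<not> (p dvd d23 \<and> p dvd z24)" "\<not> (p dvd d23 \<and> p dvd z12)" if p: "prime p" for p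
  proof -
    note f = facts[OF p] and dd' = dd[OF p] and pm' = pm[OF p]
    show "\<not> (p dvd d13 \<and> p dvd z14)"
    proof
      assume a: "p dvd d13 \<and> p dvd z14"
      have "p dvd d12 * d24 * u2" by (rule split[OF trans[OF E(2) add.commute]]) (use a in simp_all)
      then show False using a f dd' unfolding pm' by argo
    qed
    show "\<not> (p dvd d23 \<and> p dvd z24)"
    proof
      assume a: "p dvd d23 \<and> p dvd z24"
      have "p dvd d12 * d14 * u1" by (rule split[OF trans[OF E(3) add.commute]]) (use a in simp_all)
      then show False using a f dd' unfolding pm' by argo
    qed
    show "\<not> (p dvd d23 \<and> p dvd z12)"
    proof
      assume a: "p dvd d23 \<and> p dvd z12"
      have "p dvd d13 * d14 * u1" by (rule split[OF trans[OF E(1) add.commute]]) (use a in simp_all)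
      then show False using a f dd' unfolding pm' by argo
    qed
  qed
  have un: "0 < u1" "0 < u2" "0 < u3" using v_pos[of r] v_pos(2)[of r s] v_pos(3)[of r s t] unfolding ud by linarith+
  have w: "0 < d12 * d13 * d14 * u1" "0 < d12 * d23 * d24 * u2" "0 < d13 * d23 * d34 * u3" using un dpos by simp_all
  have sum: "d12 * d13 * d14 * u1 + d12 * d23 * d24 * u2 + d13 * d23 * d34 * u3 + d14 * d24 * d34 * u4 = 0" using v_sum[of r s t] unfolding ud .
  have u4: "u4 \<noteq> 0" using sum w by auto
  have un0: "u1 \<noteq> 0" "u2 \<noteq> 0" "u3 \<noteq> 0" using un by simp_all
  have uu: "\<not> (p dvd u2 \<and> p dvd u1)" "\<not> (p dvd u3 \<and> p dvd u1)" "\<not> (p dvd u3 \<and> p dvd u2)" "\<not> (p dvd u4 \<and> p dvd u1)" "\<not> (p dvd u4 \<and> p dvd u2)" "\<not> (p dvd u4 \<and> p dvd u3)" if p: "prime p" for p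
    using facts[OF p] rel[OF p] zd[OF p] zz[of p] unfolding pm[OF p] by argo+
  note c = clash[OF uu(1) un0(1)] clash[OF uu(2) un0(1)] clash[OF uu(3) un0(2)] clash[OF uu(4) un0(1)] clash[OF uu(5) un0(2)] clash[OF uu(6) un0(3)]
  note x = clash[OF facts(1) un0(1)] clash[OF facts(2) un0(1)] clash[OF facts(3) un0(1)] clash[OF facts(4) un0(2)] clash[OF facts(5) un0(2)] clash[OF rel(3) un0(2)] clash[OF facts(6) un0(3)] clash[OF rel(1) un0(3)] clash[OF rel(2) un0(3)] clash[OF rel(4) u4] clash[OF rel(5) u4] clash[OF rel(6) u4]
  have ps: "d12 * d13 * d14 * u1 + d12 * d23 * d24 * u2 \<noteq> 0" "d12 * d13 * d14 * u1 + d13 * d23 * d34 * u3 \<noteq> 0"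
    "d12 * d13 * d14 * u1 + d14 * d24 * d34 * u4 \<noteq> 0" using w sum by linarith+
  show ?thesis unfolding ud torsor_def by (intro conjI un0 u4 dpos c dcop x sum ps)
qed

end

context torsor_family
begin

text \<open>The condition C does not depend on t; it is carried along because only under it the
  slope is prime to p. The term 1 / K absorbs the additive 1 of the congruence count.\<close>

lemma card_lin:
  fixes f :: "nat \<Rightarrow> int" and K :: real
  assumes p: "prime p" and f: "\<And>t. f t = \<alpha> + \<beta> * int t" and C: "C \<Longrightarrow> \<not> p dvd \<beta>" and K: "0 < K" "K \<le> real n"
  shows "real (card {t. t < n \<and> C \<and> p dvd f t}) \<le> real n * (1 / p + 1 / K)"
proof (cases C)
  case True
  have p0: "p > 0" using p prime_gt_0_int by blast
  have "real (card {t. t < n \<and> C \<and> p dvd f t}) \<le> real n / p + 1"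
    unfolding f using card_linear_congruence_le[OF p C[OF True], of n \<alpha>] True by simp
  also have "1 \<le> real n / K" using K by simp
  finally show ?thesis by (simp add: distrib_left)
next
  case False
  have "0 \<le> real n * (1 / p + 1 / K)" using K prime_gt_0_int[OF p] by simp
  then show ?thesis using False by simp
qed

lemma card_less: "real (card {t. t < (n::nat) \<and> True}) \<le> real n"
  by simp

lemma card_Un6_le:
  fixes b :: real
  assumes "real (card A1) \<le> b" "real (card A2) \<le> b" "real (card A3) \<le> b" "real (card A4) \<le> b" "real (card A5) \<le> b" "real (card A6) \<le> b"
  shows "real (card (A1 \<union> A2 \<union> A3 \<union> A4 \<union> A5 \<union> A6)) \<le> 6 * b"
proof -
  have "card (A1 \<union> A2 \<union> A3 \<union> A4 \<union> A5 \<union> A6) \<le> card A1 + card A2 + card A3 + card A4 + card A5 + card A6"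
    by (intro order_trans[OF card_Un_le] add_right_mono order_refl)
  then show ?thesis using assms by linarith
qed

definition Tt where "Tt = {(r, s, t). r < K1 \<and> s < K2 \<and> t < K3}"

lemma Tt_eq: "Tt = {..<K1} \<times> {..<K2} \<times> {..<K3}"
  by (auto simp: Tt_def)

lemma finite_Tt: "finite Tt" and card_Tt: "real (card Tt) = real K1 * real K2 * real K3"
  unfolding Tt_eq by (simp_all add: card_cartesian_product)

lemma card_Tt_disj6_le:
  fixes b :: real
  assumes "real (card {(r, s, t) \<in> Tt. Q1 r s t}) \<le> b" "real (card {(r, s, t) \<in> Tt. Q2 r s t}) \<le> b" "real (card {(r, s, t) \<in> Tt. Q3 r s t}) \<le> b"
    "real (card {(r, s, t) \<in> Tt. Q4 r s t}) \<le> b" "real (card {(r, s, t) \<in> Tt. Q5 r s t}) \<le> b" "real (card {(r, s, t) \<in> Tt. Q6 r s t}) \<le> b"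
  shows "real (card {(r, s, t) \<in> Tt. Q1 r s t \<or> Q2 r s t \<or> Q3 r s t \<or> Q4 r s t \<or> Q5 r s t \<or> Q6 r s t}) \<le> 6 * b"
proof -
  have "{(r, s, t) \<in> Tt. Q1 r s t \<or> Q2 r s t \<or> Q3 r s t \<or> Q4 r s t \<or> Q5 r s t \<or> Q6 r s t}
     = {(r, s, t) \<in> Tt. Q1 r s t} \<union> {(r, s, t) \<in> Tt. Q2 r s t} \<union> {(r, s, t) \<in> Tt. Q3 r s t} \<union> {(r, s, t) \<in> Tt. Q4 r s t}
       \<union> {(r, s, t) \<in> Tt. Q5 r s t} \<union> {(r, s, t) \<in> Tt. Q6 r s t}" by auto
  then show ?thesis using card_Un6_le[OF assms] by (simp only:)
qed

lemma card_Tt_le: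
  fixes k1 k2 k3 :: real
  assumes "real (card {a. a < K1 \<and> P1 a}) \<le> k1" "\<And>a. real (card {b. b < K2 \<and> P2 a b}) \<le> k2" "\<And>a b. real (card {c. c < K3 \<and> P3 a b c}) \<le> k3"
    and Q: "\<And>a b c. Q a b c \<Longrightarrow> P1 a \<and> P2 a b \<and> P3 a b c" and k: "k1 * (k2 * k3) = k"
  shows "real (card {(a, b, c) \<in> Tt. Q a b c}) \<le> k"
proof -
  have "{(a, b, c) \<in> Tt. Q a b c} \<subseteq> {(a, b, c). (a < K1 \<and> b < K2 \<and> c < K3) \<and> P1 a \<and> P2 a b \<and> P3 a b c}"
    unfolding Tt_def using Q by blast
  moreover have "finite {(a, b, c). (a < K1 \<and> b < K2 \<and> c < K3) \<and> P1 a \<and> P2 a b \<and> P3 a b c}"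
    by (rule finite_subset[OF _ finite_Tt]) (auto simp: Tt_def)
  ultimately have "card {(a, b, c) \<in> Tt. Q a b c} \<le> card {(a, b, c). (a < K1 \<and> b < K2 \<and> c < K3) \<and> P1 a \<and> P2 a b \<and> P3 a b c}"
    by (intro card_mono)
  moreover have "real (card {(a, b, c). (a < K1 \<and> b < K2 \<and> c < K3) \<and> P1 a \<and> P2 a b \<and> P3 a b c}) \<le> k"
    unfolding k[symmetric] by (rule card_triple_le[OF assms(1-3)])
  ultimately show ?thesis by linarith
qed

text \<open>Every clause imposes congruences on two different parameters, each with an invertible
  slope, so the density is a square. Its terms in 1 / p^2 can be summed over all primes.\<close>

lemma card_bad_at_le:
  fixes K :: real
  assumes p: "prime p" "\<not> p dvd M" and K: "0 < K" "K \<le> K1" "K \<le> K2" "K \<le> K3"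
  shows "real (card {(r, s, t) \<in> Tt. bad_at p r s t}) \<le> 6 * (real K1 * real K2 * real K3 * (1 / p + 1 / K)\<^sup>2)"
proof -
  let ?q = "1 / real_of_int p + 1 / K"
  have pm: "p dvd a * b \<longleftrightarrow> p dvd a \<or> p dvd b" for a b using p(1) by (simp add: prime_dvd_mult_iff)
  have l1: "real (card {t. t < K1 \<and> C \<and> p dvd v1 t}) \<le> real K1 * ?q" for C
    by (rule card_lin[OF p(1) v1_def _ K(1,2)]) (rule p(2))
  have l2: "real (card {t. t < K2 \<and> C \<and> p dvd v2 s t}) \<le> real K2 * ?q" if "C \<Longrightarrow> \<not> p dvd d34" for C s
    by (rule card_lin[OF p(1) v2_def _ K(1,3)]) (use that p(2) pm in blast)
  have l3: "real (card {t. t < K3 \<and> C \<and> p dvd v3 r s t}) \<le> real K3 * ?q" if "C \<Longrightarrow> \<not> p dvd d14 \<and> \<not> p dvd d24" for C r s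
    by (rule card_lin[OF p(1) v3_def _ K(1,4)]) (use that p(2) pm in blast)
  have ly12: "real (card {t. t < K2 \<and> C \<and> p dvd y12 s t}) \<le> real K2 * ?q" if "C \<Longrightarrow> \<not> p dvd d23 \<and> \<not> p dvd d24" for C s
    by (rule card_lin[OF p(1) y12_lin _ K(1,3)]) (use that p(2) pm in blast)
  have ly14: "real (card {t. t < K3 \<and> C \<and> p dvd y14 r s t}) \<le> real K3 * ?q" if "C \<Longrightarrow> \<not> p dvd d13 \<and> \<not> p dvd d34 \<and> \<not> p dvd d24" for C r s
    by (rule card_lin[OF p(1) y14_lin _ K(1,4)]) (use that p(2) pm in blast)
  have ly24: "real (card {t. t < K3 \<and> C \<and> p dvd y24 r s t}) \<le> real K3 * ?q" if "C \<Longrightarrow> \<not> p dvd d23 \<and> \<not> p dvd d34 \<and> \<not> p dvd d14" for C r s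
    by (rule card_lin[OF p(1) y24_lin _ K(1,4)]) (use that p(2) pm in blast)
  let ?k = "real K1 * real K2 * real K3 * ?q\<^sup>2"
  have a: "real (card {(r, s, t) \<in> Tt. \<not> p dvd d34 \<and> p dvd v1 r \<and> p dvd v2 r s}) \<le> ?k"
    by
    (rule card_Tt_le[where ?P1.0="\<lambda>a. True \<and> p dvd v1 a" and ?P2.0="\<lambda>a b. \<not> p dvd d34 \<and> p dvd v2 a b" and ?P3.0="\<lambda>a b c. True"], rule l1, rule l2, use pm in blast, rule card_less, blast, simp only: power2_eq_square mult_ac)
  have b: "real (card {(r, s, t) \<in> Tt. \<not> p dvd d14 * d24 \<and> p dvd v1 r \<and> p dvd v3 r s t}) \<le> ?k"
    by
    (rule card_Tt_le[where ?P1.0="\<lambda>a. True \<and> p dvd v1 a" and ?P2.0="\<lambda>a b. True" and ?P3.0="\<lambda>a b c. \<not> p dvd d14 * d24 \<and> p dvd v3 a b c"], rule l1, rule card_less, rule l3, use pm in blast, blast, simp only: power2_eq_square mult_ac)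
  have c: "real (card {(r, s, t) \<in> Tt. \<not> p dvd d34 * d14 * d24 \<and> p dvd v2 r s \<and> p dvd v3 r s t}) \<le> ?k"
    by
    (rule card_Tt_le[where ?P1.0="\<lambda>a. True" and ?P2.0="\<lambda>a b. \<not> p dvd d34 * d14 * d24 \<and> p dvd v2 a b" and ?P3.0="\<lambda>a b c. \<not> p dvd d34 * d14 * d24 \<and> p dvd v3 a b c"], rule card_less, rule l2, use pm in blast, rule l3, use pm in blast, blast, simp only: power2_eq_square mult_ac)
  have d: "real (card {(r, s, t) \<in> Tt. \<not> p dvd d13 * d34 * d24 \<and> p dvd v1 r \<and> p dvd y14 r s t}) \<le> ?k"
    by
    (rule card_Tt_le[where ?P1.0="\<lambda>a. True \<and> p dvd v1 a" and ?P2.0="\<lambda>a b. True" and ?P3.0="\<lambda>a b c. \<not> p dvd d13 * d34 * d24 \<and> p dvd y14 a b c"], rule l1, rule card_less, rule ly14, use pm in blast, blast, simp only: power2_eq_square mult_ac)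
  have e: "real (card {(r, s, t) \<in> Tt. \<not> p dvd d23 * d34 * d14 \<and> p dvd v2 r s \<and> p dvd y24 r s t}) \<le> ?k"
    by
    (rule card_Tt_le[where ?P1.0="\<lambda>a. True" and ?P2.0="\<lambda>a b. \<not> p dvd d23 * d34 * d14 \<and> p dvd v2 a b" and ?P3.0="\<lambda>a b c. \<not> p dvd d23 * d34 * d14 \<and> p dvd y24 a b c"], rule card_less, rule l2, use pm in blast, rule ly24, use pm in blast, blast, simp only: power2_eq_square mult_ac)
  have f: "real (card {(r, s, t) \<in> Tt. \<not> p dvd d23 * d24 * d14 \<and> p dvd v3 r s t \<and> p dvd y12 r s}) \<le> ?k"
    by
    (rule card_Tt_le[where ?P1.0="\<lambda>a. True" and ?P2.0="\<lambda>a b. \<not> p dvd d23 * d24 * d14 \<and> p dvd y12 a b" and ?P3.0="\<lambda>a b c. \<not> p dvd d23 * d24 * d14 \<and> p dvd v3 a b c"], rule card_less, rule ly12, use pm in blast, rule l3, use pm in blast, blast, simp only: power2_eq_square mult_ac)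
  show ?thesis unfolding bad_at_def by (rule card_Tt_disj6_le[OF a b c d e f])
qed

text \<open>Only one congruence is available here, but the event needs a prime dividing some d. The
  sum over the d is left as it stands in order to be averaged over the d later.\<close>

lemma card_bad_gcd_le:
  fixes K :: real
  assumes p: "prime p" "\<not> p dvd M" and K: "0 < K" "K \<le> K1" "K \<le> K2" "K \<le> K3"
  shows "real (card {(r, s, t) \<in> Tt. bad_gcd p r s t})
     \<le> real K1 * real K2 * real K3 * (\<Sum>d\<in>{d12, d13, d14, d23, d24, d34}. if p dvd d then 6 * (1 / p + 1 / K) else 0)"
proof -
  let ?q = "1 / real_of_int p + 1 / K"
  let ?D = "{d12, d13, d14, d23, d24, d34}"
  have q0: "0 \<le> ?q" using K prime_gt_0_int[OF p(1)] by simp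
  have pm: "p dvd a * b \<longleftrightarrow> p dvd a \<or> p dvd b" for a b using p(1) by (simp add: prime_dvd_mult_iff)
  have one: "\<not> (p dvd a \<and> p dvd b)" if "coprime a b" for a b :: int
    using that p(1) by (meson coprime_common_divisor not_prime_unit)
  show ?thesis
  proof (cases "\<exists>d\<in>?D. p dvd d")
    case False
    then have "{(r, s, t) \<in> Tt. bad_gcd p r s t} = {}" unfolding bad_gcd_def by blast
    then show ?thesis using q0 by (simp only: card.empty of_nat_0) (intro mult_nonneg_nonneg sum_nonneg, auto)
  next
    case True
    then obtain d where d: "d \<in> ?D" "p dvd d" by blast
    have l1: "real (card {t. t < K1 \<and> C \<and> p dvd v1 t}) \<le> real K1 * ?q" for C
      by (rule card_lin[OF p(1) v1_def _ K(1,2)]) (rule p(2))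
    have l2: "real (card {t. t < K2 \<and> C \<and> p dvd v2 s t}) \<le> real K2 * ?q" if "C \<Longrightarrow> \<not> p dvd d34" for C s
      by (rule card_lin[OF p(1) v2_def _ K(1,3)]) (use that p(2) pm in blast)
    have l3: "real (card {t. t < K3 \<and> C \<and> p dvd v3 r s t}) \<le> real K3 * ?q" if "C \<Longrightarrow> \<not> p dvd d14 \<and> \<not> p dvd d24" for C r s
      by (rule card_lin[OF p(1) v3_def _ K(1,4)]) (use that p(2) pm in blast)
    let ?k = "real K1 * real K2 * real K3 * ?q"
    have n1: "p dvd d13 \<Longrightarrow> \<not> p dvd d34" "p dvd d14 \<Longrightarrow> \<not> p dvd d34" "p dvd d12 \<Longrightarrow> \<not> p dvd d14 \<and> \<not> p dvd d24"
      using one dcop by blast+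
    have A1: "real (card {(r, s, t) \<in> Tt. p dvd e \<and> p dvd v1 r}) \<le> ?k" for e
      by (rule card_Tt_le[where ?P1.0="\<lambda>a. p dvd e \<and> p dvd v1 a" and ?P2.0="\<lambda>a b. True" and ?P3.0="\<lambda>a b c. True"], rule l1, rule card_less, rule card_less, blast, simp only: mult_ac)
    have A2: "real (card {(r, s, t) \<in> Tt. p dvd e \<and> p dvd v2 r s}) \<le> ?k" if e: "p dvd e \<Longrightarrow> \<not> p dvd d34" for e
      by (rule card_Tt_le[where ?P1.0="\<lambda>a. True" and ?P2.0="\<lambda>a b. p dvd e \<and> p dvd v2 a b" and ?P3.0="\<lambda>a b c. True"], rule card_less, rule l2, erule e, rule card_less, blast, simp only: mult_ac)
    have A3: "real (card {(r, s, t) \<in> Tt. p dvd e \<and> p dvd v3 r s t}) \<le> ?k" if e: "p dvd e \<Longrightarrow> \<not> p dvd d14 \<and> \<not> p dvd d24" for e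
      by (rule card_Tt_le[where ?P1.0="\<lambda>a. True" and ?P2.0="\<lambda>a b. True" and ?P3.0="\<lambda>a b c. p dvd e \<and> p dvd v3 a b c"], rule card_less, rule card_less, rule l3, erule e, blast, simp only: mult_ac)
    have "real (card {(r, s, t) \<in> Tt. bad_gcd p r s t}) \<le> 6 * ?k"
      unfolding bad_gcd_def by (rule card_Tt_disj6_le[OF A1 A1 A1 A2[OF n1(1)] A2[OF n1(2)] A3[OF n1(3)]])
    also have "6 * ?k = real K1 * real K2 * real K3 * (6 * ?q)" by simp
    also have "6 * ?q \<le> (\<Sum>d\<in>?D. if p dvd d then 6 * ?q else 0)"
      using member_le_sum[OF d(1), of "\<lambda>d. if p dvd d then 6 * ?q else 0"] d(2) q0 by simp
    finally show ?thesis by (simp add: mult_left_mono)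
  qed
qed

text \<open>A union bound over the primes in \<open>Pr\<close>. Every bad event makes p divide one
  of \<open>v1\<close>, \<open>v2\<close>, \<open>v3\<close>. These are at most Q, and are 1 or -1
  modulo M, so no prime outside \<open>Pr\<close> can occur.\<close>

lemma card_good_ge:
  fixes K :: real and Q :: int
  assumes K: "0 < K" "K \<le> K1" "K \<le> K2" "K \<le> K3"
    and Q: "M * int K1 \<le> Q" "M * d34 * int K2 \<le> Q" "M * d14 * d24 * int K3 \<le> Q"
    and Pr: "Pr = {p. prime p \<and> p \<le> Q \<and> \<not> p dvd M}"
  shows "real K1 * real K2 * real K3 * (1 - 6 * (\<Sum>p\<in>Pr. (1 / p + 1 / K)\<^sup>2)
      - (\<Sum>p\<in>Pr. \<Sum>d\<in>{d12, d13, d14, d23, d24, d34}. if p dvd d then 6 * (1 / p + 1 / K) else 0))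
    \<le> real (card {(r, s, t) \<in> Tt. \<forall>p. prime p \<longrightarrow> \<not> bad_at p r s t \<and> \<not> bad_gcd p r s t})"
proof -
  let ?G = "{(r, s, t) \<in> Tt. \<forall>p. prime p \<longrightarrow> \<not> bad_at p r s t \<and> \<not> bad_gcd p r s t}"
  let ?k = "real K1 * real K2 * real K3"
  have fPr: "finite Pr"
  proof (rule finite_subset)
    show "Pr \<subseteq> {0..Q}" unfolding Pr using prime_ge_0_int by auto
  qed simp
  have PrI: "p \<in> Pr" if b: "(r, s, t) \<in> Tt" "prime p" "bad_at p r s t \<or> bad_gcd p r s t" for p r s t
  proof -
    have rst: "r < K1" "s < K2" "t < K3" using b(1) by (simp_all add: Tt_def)
    have "p dvd v1 r \<or> p dvd v2 r s \<or> p dvd v3 r s t" using b(3) unfolding bad_at_def bad_gcd_def by blast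
    then show ?thesis
    proof (elim disjE)
      assume d: "p dvd v1 r"
      have "p \<le> v1 r" using d v_pos(1)[of r] by (intro zdvd_imp_le) auto
      moreover have "\<not> p dvd M"
      proof
        assume "p dvd M"
        then have "p dvd v1 r - 1" using v_mod(1) dvd_trans by blast
        then have "p dvd v1 r - (v1 r - 1)" using d by (rule dvd_diff[rotated])
        then show False using b(2) by (simp add: not_prime_unit)
      qed
      ultimately show ?thesis unfolding Pr using b(2) v_less(1)[OF rst(1)] Q(1) by simp
    next
      assume d: "p dvd v2 r s"
      have "p \<le> v2 r s" using d v_pos(2)[of r s] by (intro zdvd_imp_le) auto
      moreover have "\<not> p dvd M"
      proof
        assume "p dvd M"
        then have "p dvd v2 r s - 1" using v_mod(2) dvd_trans by blast
        then have "p dvd v2 r s - (v2 r s - 1)" using d by (rule dvd_diff[rotated])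
        then show False using b(2) by (simp add: not_prime_unit)
      qed
      ultimately show ?thesis unfolding Pr using b(2) v_less(2)[OF rst(2), of r] Q(2) by simp
    next
      assume d: "p dvd v3 r s t"
      have "p \<le> v3 r s t" using d v_pos(3)[of r s t] by (intro zdvd_imp_le) auto
      moreover have "\<not> p dvd M"
      proof
        assume "p dvd M"
        then have "p dvd v3 r s t + 1" using v_mod(3) dvd_trans by blast
        then have "p dvd (v3 r s t + 1) - v3 r s t" using d by (rule dvd_diff)
        then show False using b(2) by (simp add: not_prime_unit)
      qed
      ultimately show ?thesis unfolding Pr using b(2) v_less(3)[OF rst(3), of r s] Q(3) by simp
    qed
  qed
  have finB: "finite {(r, s, t) \<in> Tt. B r s t}" for B by (rule finite_subset[OF _ finite_Tt]) auto
  have "Tt \<subseteq> ?G \<union> ((\<Union>p\<in>Pr. {(r, s, t) \<in> Tt. bad_at p r s t}) \<union> (\<Union>p\<in>Pr. {(r, s, t) \<in> Tt. bad_gcd p r s t}))"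
  proof
    fix x assume x: "x \<in> Tt"
    obtain r s t where e: "x = (r, s, t)" by (metis prod_cases3)
    show "x \<in> ?G \<union> ((\<Union>p\<in>Pr. {(r, s, t) \<in> Tt. bad_at p r s t}) \<union> (\<Union>p\<in>Pr. {(r, s, t) \<in> Tt. bad_gcd p r s t}))"
      using PrI[of r s t] x unfolding e by auto
  qed
  then have "card Tt \<le> card (?G \<union> ((\<Union>p\<in>Pr. {(r, s, t) \<in> Tt. bad_at p r s t}) \<union> (\<Union>p\<in>Pr. {(r, s, t) \<in> Tt. bad_gcd p r s t})))"
    by (rule card_mono[rotated]) (intro finite_UnI finite_UN_I fPr finB)
  also have "\<dots> \<le> card ?G + (card (\<Union>p\<in>Pr. {(r, s, t) \<in> Tt. bad_at p r s t}) + card (\<Union>p\<in>Pr. {(r, s, t) \<in> Tt. bad_gcd p r s t}))"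
    by (intro order_trans[OF card_Un_le] add_left_mono card_Un_le)
  also have "\<dots> \<le> card ?G + ((\<Sum>p\<in>Pr. card {(r, s, t) \<in> Tt. bad_at p r s t}) + (\<Sum>p\<in>Pr. card {(r, s, t) \<in> Tt. bad_gcd p r s t}))"
    by (intro add_left_mono add_mono card_UN_le fPr)
  finally have "real (card Tt) \<le> real (card ?G) + ((\<Sum>p\<in>Pr. real (card {(r, s, t) \<in> Tt. bad_at p r s t})) + (\<Sum>p\<in>Pr. real (card {(r, s, t) \<in> Tt. bad_gcd p r s t})))"
    unfolding of_nat_sum[symmetric] of_nat_add[symmetric] of_nat_le_iff .
  also have "\<dots> \<le> real (card ?G) + ((\<Sum>p\<in>Pr. 6 * (?k * (1 / p + 1 / K)\<^sup>2)) + (\<Sum>p\<in>Pr. ?k * (\<Sum>d\<in>{d12, d13, d14, d23, d24, d34}. if p dvd d then 6 * (1 / p + 1 / K) else 0)))"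
    by (intro add_left_mono add_mono sum_mono card_bad_at_le card_bad_gcd_le K) (simp_all add: Pr)
  also have "\<dots> = real (card ?G) + ?k * (6 * (\<Sum>p\<in>Pr. (1 / p + 1 / K)\<^sup>2) + (\<Sum>p\<in>Pr. \<Sum>d\<in>{d12, d13, d14, d23, d24, d34}. if p dvd d then 6 * (1 / p + 1 / K) else 0))"
    by (simp only: sum_distrib_left distrib_left mult_ac)
  finally show ?thesis unfolding card_Tt by (simp add: algebra_simps)
qed

end

section \<open>Existence of the progressions and the height of their points\<close>

lemma crt_linear:
  fixes m n \<alpha> \<beta> \<alpha>' \<beta>' :: int
  assumes c: "coprime m n" "coprime \<beta> m" "coprime \<beta>' n" and pos: "0 < m" "0 < n"
  shows "\<exists>x. 1 \<le> x \<and> x \<le> m * n \<and> m dvd \<alpha> + \<beta> * x \<and> n dvd \<alpha>' + \<beta>' * x"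
proof -
  have inv: "\<exists>i. k dvd a + b * (- a * i)" if bk: "coprime b k" for a b k :: int
  proof -
    obtain i where "[b * i = 1] (mod k)" using cong_solve_coprime_int[OF bk] by blast
    then have "k dvd b * i - 1" by (simp add: cong_iff_dvd_diff)
    then have "k dvd - a * (b * i - 1)" by (rule dvd_mult)
    then show ?thesis by (intro exI[of _ i]) (simp add: algebra_simps)
  qed
  have upd: "k dvd a + b * y" if "k dvd a + b * x" "k dvd y - x" for k a b x y :: int
  proof -
    have e: "a + b * y = (a + b * x) + b * (y - x)" by (simp add: algebra_simps)
    show ?thesis unfolding e by (rule dvd_add[OF that(1) dvd_mult[OF that(2)]])
  qed
  obtain i where i: "m dvd \<alpha> + \<beta> * (- \<alpha> * i)" using inv[OF c(2)] by blast
  obtain j where j: "n dvd \<alpha>' + \<beta>' * (- \<alpha>' * j)" using inv[OF c(3)] by blast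
  obtain x where x: "[x = - \<alpha> * i] (mod m)" "[x = - \<alpha>' * j] (mod n)" using binary_chinese_remainder_int[OF c(1)] by blast
  \<comment> \<open>The shift by 1 places the representative in {1..m n} instead of {0..<m
    n}.\<close>
  define y where "y = (x - 1) mod (m * n) + 1"
  have "(x - 1) mod (m * n) = (x - 1) - (m * n) * ((x - 1) div (m * n))" by (rule minus_mult_div_eq_mod[symmetric])
  then have yx: "y - x = m * n * (- ((x - 1) div (m * n)))" unfolding y_def by simp
  have "m dvd y - x" "n dvd y - x" unfolding yx by (simp_all add: mult.assoc)
  moreover have "m dvd x - - \<alpha> * i" "n dvd x - - \<alpha>' * j" using x by (simp_all add: cong_iff_dvd_diff)
  ultimately have "m dvd \<alpha> + \<beta> * y" "n dvd \<alpha>' + \<beta>' * y" using upd i j by blast+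
  moreover have "1 \<le> y" "y \<le> m * n" unfolding y_def using pos by (simp_all add: zless_add1_eq[symmetric] add1_zle_eq)
  ultimately show ?thesis by blast
qed

lemma coprime_if_dvd_minus_1:
  fixes M d :: int
  assumes "M dvd d - 1"
  shows "coprime M d"
proof (rule coprimeI)
  fix c assume c: "c dvd M" "c dvd d"
  have "c dvd d - (d - 1)" by (rule dvd_diff[OF c(2) dvd_trans[OF c(1) assms]])
  then show "is_unit c" by simp
qed

text \<open>The slopes are invertible since the d are pairwise coprime and 1 modulo M. For r3 three
  moduli are needed, so the congruences modulo d14 and d24 are solved first and then combined with
  the one modulo M.\<close>

lemma torsor_family_exists:
  fixes M d12 d13 d14 d23 d24 d34 :: int
  assumes M0: "0 < M" and dpos: "0 < d12" "0 < d13" "0 < d14" "0 < d23" "0 < d24" "0 < d34"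
    and dM: "M dvd d12 - 1" "M dvd d13 - 1" "M dvd d14 - 1" "M dvd d23 - 1" "M dvd d24 - 1" "M dvd d34 - 1"
    and dcop: "coprime d12 d13" "coprime d12 d14" "coprime d12 d23" "coprime d12 d24" "coprime d12 d34"
      "coprime d13 d14" "coprime d13 d23" "coprime d13 d24" "coprime d13 d34"
      "coprime d14 d23" "coprime d14 d24" "coprime d14 d34" "coprime d23 d24" "coprime d23 d34" "coprime d24 d34"
  shows "\<exists>r2 r3. torsor_family M d12 d13 d14 d23 d24 d34 r2 r3"
proof -
  have cM: "coprime M d14" "coprime M d24" "coprime M d34" using dM coprime_if_dvd_minus_1 by blast+
  have "\<exists>x. 1 \<le> x \<and> x \<le> M * d34 \<and> M dvd x - 1 \<and> d34 dvd d13 * d14 * a + d23 * d24 * x" for a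
  proof -
    have "coprime (d23 * d24) d34" using dcop by simp
    \<comment> \<open>With \<alpha> = 1 and \<beta> = -1 the first congruence is M dvd 1 -
      x.\<close>
    from crt_linear[OF cM(3) _ this M0 dpos(6), of 1 "- 1" "d13 * d14 * a"] show ?thesis by simp
  qed
  then obtain r2 where r2: "\<And>a. 1 \<le> r2 a \<and> r2 a \<le> M * d34 \<and> M dvd r2 a - 1 \<and> d34 dvd d13 * d14 * a + d23 * d24 * r2 a"
    by metis
  have "\<exists>x. 1 \<le> x \<and> x \<le> M * (d14 * d24) \<and> M dvd x + 1 \<and> d14 dvd d12 * d24 * b + d13 * d34 * x
        \<and> d24 dvd d12 * d14 * a + d23 * d34 * x" for a b
  proof -
    have "coprime (d13 * d34) d14" "coprime (d23 * d34) d24" using dcop by (simp_all add: coprime_commute)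
    from crt_linear[OF dcop(11) this dpos(3,5)] obtain z where z: "d14 dvd d12 * d24 * b + d13 * d34 * z" "d24 dvd d12 * d14 * a + d23 * d34 * z"
      by blast
    have "coprime M (d14 * d24)" using cM by simp
    from crt_linear[OF this, of 1 1 1 "- z"] M0 dpos obtain x where x: "1 \<le> x" "x \<le> M * (d14 * d24)" "M dvd 1 + 1 * x" "d14 * d24 dvd - z + 1 * x"
      by auto
    have xz: "d14 dvd x - z" "d24 dvd x - z" using x(4) by (auto intro: dvd_mult_left dvd_mult_right)
    have "d14 dvd (d12 * d24 * b + d13 * d34 * z) + d13 * d34 * (x - z)" "d24 dvd (d12 * d14 * a + d23 * d34 * z) + d23 * d34 * (x - z)"
      by (intro dvd_add dvd_mult z xz)+
    then show ?thesis using x by (intro exI[of _ x]) (simp add: algebra_simps)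
  qed
  note ex = this
  define r3 where "r3 a b = (SOME x. 1 \<le> x \<and> x \<le> M * (d14 * d24) \<and> M dvd x + 1 \<and> d14 dvd d12 * d24 * b + d13 * d34 * x
        \<and> d24 dvd d12 * d14 * a + d23 * d34 * x)" for a b
  have "1 \<le> r3 a b \<and> r3 a b \<le> M * (d14 * d24) \<and> M dvd r3 a b + 1 \<and> d14 dvd d12 * d24 * b + d13 * d34 * r3 a b
        \<and> d24 dvd d12 * d14 * a + d23 * d34 * r3 a b" for a b
    unfolding r3_def by (rule someI_ex) (rule ex)
  then have "torsor_family M d12 d13 d14 d23 d24 d34 r2 r3" by (intro torsor_family.intro assms r2)
  then show ?thesis by blast
qed

lemma abs_le_of_abs_mult3_le:
  fixes W a b c x P B :: real
  assumes "\<bar>a\<bar> \<le> W" "\<bar>b\<bar> \<le> W" "\<bar>c\<bar> \<le> W" and e: "a * b * c = x * P" and P: "0 < P" and "W ^ 3 \<le> B * P"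
  shows "\<bar>x\<bar> \<le> B"
proof -
  have "\<bar>x\<bar> * P = \<bar>a * b * c\<bar>" unfolding e using P by (simp add: abs_mult)
  also have "\<dots> = \<bar>a\<bar> * \<bar>b\<bar> * \<bar>c\<bar>" by (simp add: abs_mult)
  also have "\<dots> \<le> W * W * W" using assms by (intro mult_mono) auto
  also have "\<dots> \<le> B * P" using assms by (simp add: power3_eq_cube)
  finally show ?thesis using P by simp
qed

context torsor_family
begin

text \<open>The lengths of the progressions keep w1, w2, w3 below W / 3, hence |w4| \<le> W. A
  coordinate of the point times the product of the d is a product of three w_i, so it is bounded by
  W^3 and the height by B.\<close>

lemma card_torsor_ge:
  fixes B W K :: real and Q :: int
  assumes W: "3 * (real_of_int (d12 * d13 * d14) * (M * K1)) \<le> W" "3 * (real_of_int (d12 * d23 * d24) * (M * d34 * K2)) \<le> W"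
      "3 * (real_of_int (d13 * d23 * d34) * (M * d14 * d24 * K3)) \<le> W"
    and BW: "W ^ 3 \<le> B * real_of_int (d12 * d13 * d14 * d23 * d24 * d34)"
    and K: "0 < K" "K \<le> K1" "K \<le> K2" "K \<le> K3"
    and Q: "M * int K1 \<le> Q" "M * d34 * int K2 \<le> Q" "M * d14 * d24 * int K3 \<le> Q"
    and Pr: "Pr = {p. prime p \<and> p \<le> Q \<and> \<not> p dvd M}"
  shows "\<exists>S. finite S \<and> (\<forall>(u1, u2, u3, u4)\<in>S. torsor u1 u2 u3 u4 d12 d13 d14 d23 d24 d34 \<and> 0 < u1 \<and>
      (\<forall>i. \<bar>real_of_int (torsor_point (u1, u2, u3, u4, d12, d13, d14, d23, d24, d34) $ i)\<bar> \<le> B)) \<and>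
    real K1 * real K2 * real K3 * (1 - 6 * (\<Sum>p\<in>Pr. (1 / p + 1 / K)\<^sup>2)
      - (\<Sum>p\<in>Pr. \<Sum>d\<in>{d12, d13, d14, d23, d24, d34}. if p dvd d then 6 * (1 / p + 1 / K) else 0)) \<le> real (card S)"
proof -
  let ?G = "{(r, s, t) \<in> Tt. \<forall>p. prime p \<longrightarrow> \<not> bad_at p r s t \<and> \<not> bad_gcd p r s t}"
  let ?f = "\<lambda>(r, s, t). (v1 r, v2 r s, v3 r s t, v4 r s t)"
  have fin: "finite ?G" by (rule finite_subset[OF _ finite_Tt]) auto
  have inj: "inj_on ?f ?G"
  proof (rule inj_onI)
    fix a b assume "a \<in> ?G" "b \<in> ?G" and e: "?f a = ?f b"
    obtain r s t r' s' t' where ab: "a = (r, s, t)" "b = (r', s', t')" by (metis prod_cases3)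
    have r: "r = r'" using e M0 by (simp add: ab v1_def)
    have s: "s = s'" using e M0 dpos by (simp add: ab v2_def r)
    show "a = b" using e M0 dpos by (simp add: ab v3_def r s)
  qed
  have "torsor u1 u2 u3 u4 d12 d13 d14 d23 d24 d34 \<and> 0 < u1 \<and>
      (\<forall>i. \<bar>real_of_int (torsor_point (u1, u2, u3, u4, d12, d13, d14, d23, d24, d34) $ i)\<bar> \<le> B)"
    if u: "(u1, u2, u3, u4) \<in> ?f ` ?G" for u1 u2 u3 u4
  proof -
    obtain r s t where rst: "(r, s, t) \<in> Tt" and good: "\<And>p. prime p \<Longrightarrow> \<not> bad_at p r s t \<and> \<not> bad_gcd p r s t"
      and ud: "u1 = v1 r" "u2 = v2 r s" "u3 = v3 r s t" "u4 = v4 r s t" using u by auto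
    have lt: "r < K1" "s < K2" "t < K3" using rst by (simp_all add: Tt_def)
    have up: "0 < u1" "0 < u2" "0 < u3" using v_pos(1)[of r] v_pos(2)[of r s] v_pos(3)[of r s t] unfolding ud by linarith+
    define w1 where "w1 = real_of_int (d12 * d13 * d14 * u1)"
    define w2 where "w2 = real_of_int (d12 * d23 * d24 * u2)"
    define w3 where "w3 = real_of_int (d13 * d23 * d34 * u3)"
    define w4 where "w4 = real_of_int (d14 * d24 * d34 * u4)"
    have wp: "0 < w1" "0 < w2" "0 < w3" unfolding w1_def w2_def w3_def of_int_0_less_iff using up dpos by simp_all
    have u1: "real_of_int u1 \<le> real_of_int (M * int K1)" using v_less(1)[OF lt(1)] unfolding ud by (simp only: of_int_le_iff)
    have u2: "real_of_int u2 \<le> real_of_int (M * d34 * int K2)" using v_less(2)[OF lt(2)] unfolding ud by (simp only: of_int_le_iff)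
    have u3: "real_of_int u3 \<le> real_of_int (M * d14 * d24 * int K3)" using v_less(3)[OF lt(3)] unfolding ud by (simp only: of_int_le_iff)
    have "w1 = real_of_int (d12 * d13 * d14) * u1" by (simp add: w1_def)
    also have "\<dots> \<le> real_of_int (d12 * d13 * d14) * real_of_int (M * int K1)" using u1 dpos by (intro mult_left_mono) auto
    finally have w1: "3 * w1 \<le> W" using W(1) by simp
    have "w2 = real_of_int (d12 * d23 * d24) * u2" by (simp add: w2_def)
    also have "\<dots> \<le> real_of_int (d12 * d23 * d24) * real_of_int (M * d34 * int K2)" using u2 dpos by (intro mult_left_mono) auto
    finally have w2: "3 * w2 \<le> W" using W(2) by simp
    have "w3 = real_of_int (d13 * d23 * d34) * u3" by (simp add: w3_def)
    also have "\<dots> \<le> real_of_int (d13 * d23 * d34) * real_of_int (M * d14 * d24 * int K3)" using u3 dpos by (intro mult_left_mono) auto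
    finally have w3: "3 * w3 \<le> W" using W(3) by simp
    have "w1 + w2 + w3 + w4 = real_of_int (d12 * d13 * d14 * u1 + d12 * d23 * d24 * u2 + d13 * d23 * d34 * u3 + d14 * d24 * d34 * u4)"
      unfolding w1_def w2_def w3_def w4_def by (simp only: of_int_add)
    also have "\<dots> = 0" unfolding ud v_sum by simp
    finally have sum: "w1 + w2 + w3 + w4 = 0" .
    have a: "\<bar>w1\<bar> \<le> W" "\<bar>w2\<bar> \<le> W" "\<bar>w3\<bar> \<le> W" "\<bar>w4\<bar> \<le> W" using w1 w2 w3 wp sum by linarith+
    define P where "P = real_of_int (d12 * d13 * d14 * d23 * d24 * d34)"
    have P0: "0 < P" unfolding P_def of_int_0_less_iff using dpos by simp
    define x where "x = torsor_point (u1, u2, u3, u4, d12, d13, d14, d23, d24, d34)"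
    have x: "x $ 1 = u2 * u3 * u4 * (d23 * d24 * d34)" "x $ 2 = u1 * u3 * u4 * (d13 * d14 * d34)"
      "x $ 3 = u1 * u2 * u4 * (d12 * d14 * d24)" "x $ 4 = u1 * u2 * u3 * (d12 * d13 * d23)"
      unfolding x_def by (rule torsor_point_nth)+
    have e: "w2 * w3 * w4 = real_of_int (x $ 1) * P" "w1 * w3 * w4 = real_of_int (x $ 2) * P"
      "w1 * w2 * w4 = real_of_int (x $ 3) * P" "w1 * w2 * w3 = real_of_int (x $ 4) * P"
      unfolding x w1_def w2_def w3_def w4_def P_def of_int_mult by (simp_all only: mult_ac)
    have "\<bar>real_of_int (x $ 1)\<bar> \<le> B" "\<bar>real_of_int (x $ 2)\<bar> \<le> B" "\<bar>real_of_int (x $ 3)\<bar> \<le> B" "\<bar>real_of_int (x $ 4)\<bar> \<le> B"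
      using abs_le_of_abs_mult3_le[OF a(2,3,4) e(1) P0] abs_le_of_abs_mult3_le[OF a(1,3,4) e(2) P0]
        abs_le_of_abs_mult3_le[OF a(1,2,4) e(3) P0] abs_le_of_abs_mult3_le[OF a(1,2,3) e(4) P0] BW unfolding P_def by blast+
    then have "\<forall>i. \<bar>real_of_int (x $ i)\<bar> \<le> B" unfolding forall_4 by blast
    moreover have "torsor u1 u2 u3 u4 d12 d13 d14 d23 d24 d34" unfolding ud by (rule good_torsor[OF good])
    ultimately show ?thesis using up(1) unfolding x_def by blast
  qed
  moreover have "real K1 * real K2 * real K3 * (1 - 6 * (\<Sum>p\<in>Pr. (1 / p + 1 / K)\<^sup>2)
      - (\<Sum>p\<in>Pr. \<Sum>d\<in>{d12, d13, d14, d23, d24, d34}. if p dvd d then 6 * (1 / p + 1 / K) else 0)) \<le> real (card (?f ` ?G))"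
    unfolding card_image[OF inj] by (rule card_good_ge[OF K Q Pr])
  ultimately show ?thesis using fin by (intro exI[of _ "?f ` ?G"]) blast
qed

end

section \<open>Density of good u for fixed d\<close>

lemma sum_inverse_squares_le:
  fixes P :: "int set"
  assumes "finite P" and P: "\<And>p. p \<in> P \<Longrightarrow> int m < p" and m: "0 < m"
  shows "(\<Sum>p\<in>P. 1 / (real_of_int p)\<^sup>2) \<le> 1 / real m"
proof -
  have tele: "(\<Sum>k<n. 1 / (real (m + 1 + k))\<^sup>2) \<le> 1 / real m - 1 / real (m + n)" for n
  proof (induction n)
    case (Suc n)
    have "1 / (real (m + 1 + n))\<^sup>2 \<le> 1 / (real (m + n) * real (m + Suc n))"
      using m by (intro divide_left_mono) (auto simp: power2_eq_square intro!: mult_mono)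
    also have "\<dots> = 1 / real (m + n) - 1 / real (m + Suc n)" using m by (simp add: field_simps)
    finally show ?case using Suc by simp
  qed simp
  obtain n where n: "\<And>p. p \<in> P \<Longrightarrow> p < int n"
  proof -
    have "p < int (nat (Max (insert 0 P)) + 1)" if "p \<in> P" for p
    proof -
      have "p \<le> Max (insert 0 P)" using assms(1) that by (intro Max_ge) auto
      then show ?thesis by linarith
    qed
    then show ?thesis using that by blast
  qed
  have inj: "inj_on (\<lambda>k. int (m + 1 + k)) {..<n}" by (auto intro: inj_onI)
  have "P \<subseteq> (\<lambda>k. int (m + 1 + k)) ` {..<n}"
  proof
    fix p assume p: "p \<in> P"
    have "p = int (m + 1 + nat (p - int m - 1))" "nat (p - int m - 1) < n" using P[OF p] n[OF p] by auto
    then show "p \<in> (\<lambda>k. int (m + 1 + k)) ` {..<n}" by blast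
  qed
  then have "(\<Sum>p\<in>P. 1 / (real_of_int p)\<^sup>2) \<le> (\<Sum>p\<in>(\<lambda>k. int (m + 1 + k)) ` {..<n}. 1 / (real_of_int p)\<^sup>2)"
    by (intro sum_mono2) auto
  also have "\<dots> = (\<Sum>k<n. 1 / (real (m + 1 + k))\<^sup>2)" unfolding sum.reindex[OF inj] by simp
  also have "\<dots> \<le> 1 / real m - 1 / real (m + n)" by (rule tele)
  also have "\<dots> \<le> 1 / real m" by simp
  finally show ?thesis .
qed

lemma prime_gt_if_not_dvd_fact:
  fixes p :: int
  assumes "prime p" "\<not> p dvd fact m"
  shows "int m < p"
proof (rule ccontr)
  assume "\<not> int m < p"
  then have "nat p dvd fact m" using prime_ge_2_int[OF assms(1)] by (intro dvd_fact) auto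
  then have "int (nat p) dvd int (fact m)" by (simp only: int_dvd_int_iff)
  then show False using assms prime_ge_2_int[OF assms(1)] by simp
qed

text \<open>Half of the density is lost at most, apart from a sum depending on the d: the inverse
  squares of primes cost 6 * 2 / 48 = 1/4, and all terms with K cost another 1/4 by
  \<open>small\<close>. What remains is 6 / p for each prime p dividing a d_i, and such p are at
  most Y.\<close>

lemma sieve_density_ge:
  fixes d :: "nat \<Rightarrow> int" and Q :: int and K Y :: real
  assumes Pr: "Pr = {p. prime p \<and> p \<le> Q \<and> \<not> p dvd fact m}" and m: "48 \<le> m" and K: "0 < K" and Q: "0 \<le> Q"
    and small: "12 * (Q / K\<^sup>2) + 36 * (Y / K) \<le> 1 / 4" and d: "\<And>i. i < 6 \<Longrightarrow> 1 \<le> d i \<and> d i \<le> Y"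
    and PY: "PY = {p::int. prime p \<and> int m < p \<and> p \<le> Y}"
  shows "1 / 2 - (\<Sum>p\<in>PY. \<Sum>i<6. if p dvd d i then 6 / real_of_int p else 0)
    \<le> 1 - 6 * (\<Sum>p\<in>Pr. (1 / p + 1 / K)\<^sup>2) - (\<Sum>p\<in>Pr. \<Sum>e\<in>d ` {..<6}. if p dvd e then 6 * (1 / p + 1 / K) else 0)"
proof -
  have PrQ: "Pr \<subseteq> {1..Q}"
  proof
    fix p assume "p \<in> Pr"
    then show "p \<in> {1..Q}" using prime_gt_0_int[of p] unfolding Pr by simp
  qed
  then have fPr: "finite Pr" by (rule finite_subset) simp
  have gt: "int m < p" if "p \<in> Pr" for p using that prime_gt_if_not_dvd_fact unfolding Pr by blast
  have p0: "0 < p" if "p \<in> Pr" for p using gt[OF that] by simp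
  have "PY \<subseteq> {0..\<lfloor>Y\<rfloor>}" unfolding PY by (auto simp: le_floor_iff)
  then have fPY: "finite PY" by (rule finite_subset) simp
  have "card Pr \<le> card {1..Q}" by (rule card_mono[OF _ PrQ]) simp
  then have cPr: "real (card Pr) \<le> real_of_int Q" using Q by simp
  have sq: "(1 / real_of_int p + 1 / K)\<^sup>2 \<le> 2 * (1 / (real_of_int p)\<^sup>2) + 2 / K\<^sup>2" for p
    using sum_squares_bound[of "1 / real_of_int p" "1 / K"] by (simp add: power2_sum power_divide)
  have "(\<Sum>p\<in>Pr. (1 / real_of_int p + 1 / K)\<^sup>2) \<le> (\<Sum>p\<in>Pr. 2 * (1 / (real_of_int p)\<^sup>2) + 2 / K\<^sup>2)" by (intro sum_mono sq)
  also have "\<dots> = 2 * (\<Sum>p\<in>Pr. 1 / (real_of_int p)\<^sup>2) + card Pr * (2 / K\<^sup>2)" by (simp add: sum.distrib sum_distrib_left)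
  also have "\<dots> \<le> 2 * (1 / real m) + Q * (2 / K\<^sup>2)"
    using sum_inverse_squares_le[OF fPr gt] m cPr by (intro add_mono mult_left_mono mult_right_mono) auto
  also have "2 * (1 / real m) \<le> 2 * (1 / 48)" using m by (intro mult_left_mono divide_left_mono) auto
  finally have A: "6 * (\<Sum>p\<in>Pr. (1 / real_of_int p + 1 / K)\<^sup>2) \<le> 1 / 4 + 12 * (Q / K\<^sup>2)" by simp
  have "(\<Sum>p\<in>Pr. \<Sum>e\<in>d ` {..<6}. if p dvd e then 6 * (1 / real_of_int p + 1 / K) else 0)
      \<le> (\<Sum>p\<in>Pr. \<Sum>i<6. if p dvd d i then 6 * (1 / real_of_int p + 1 / K) else 0)"
  proof (intro sum_mono)
    fix p assume "p \<in> Pr"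
    then show "(\<Sum>e\<in>d ` {..<6}. if p dvd e then 6 * (1 / real_of_int p + 1 / K) else 0)
      \<le> (\<Sum>i<6. if p dvd d i then 6 * (1 / real_of_int p + 1 / K) else 0)"
      using sum_image_le[of "{..<6}" "\<lambda>e. if p dvd e then 6 * (1 / real_of_int p + 1 / K) else 0" d] p0[of p] K by (simp add: o_def)
  qed
  also have "\<dots> = (\<Sum>p\<in>Pr. (\<Sum>i<6. if p dvd d i then 6 / real_of_int p else 0) + (\<Sum>i<6. if p dvd d i then 6 / K else 0))"
    unfolding sum.distrib[symmetric] by (intro sum.cong refl) simp
  also have "\<dots> = (\<Sum>p\<in>Pr. \<Sum>i<6. if p dvd d i then 6 / real_of_int p else 0) + (\<Sum>p\<in>Pr. \<Sum>i<6. if p dvd d i then 6 / K else 0)"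
    by (rule sum.distrib)
  also have "(\<Sum>p\<in>Pr. \<Sum>i<6. if p dvd d i then 6 / real_of_int p else 0) \<le> (\<Sum>p\<in>PY. \<Sum>i<6. if p dvd d i then 6 / real_of_int p else 0)"
  proof -
    have z: "(\<Sum>i<6. if p dvd d i then 6 / real_of_int p else 0) = 0" if p: "p \<in> Pr - PY" for p
    proof -
      have "\<not> p dvd d i" if "i < 6" for i
      proof
        assume "p dvd d i"
        then have "p \<le> d i" using d[OF that] by (intro zdvd_imp_le) auto
        then have "real_of_int p \<le> Y" using d[OF that] by linarith
        then show False using p gt[of p] unfolding Pr PY by blast
      qed
      then show ?thesis by simp
    qed
    have "(\<Sum>p\<in>Pr. \<Sum>i<6. if p dvd d i then 6 / real_of_int p else 0) = (\<Sum>p\<in>Pr \<inter> PY. \<Sum>i<6. if p dvd d i then 6 / real_of_int p else 0)"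
      by (rule sum.mono_neutral_right[OF fPr]) (use z in blast)+
    also have "\<dots> \<le> (\<Sum>p\<in>PY. \<Sum>i<6. if p dvd d i then 6 / real_of_int p else 0)"
      using fPY by (intro sum_mono2 sum_nonneg) (auto simp: PY)
    finally show ?thesis .
  qed
  \<comment> \<open>Each d_i has at most Y prime divisors, and 36 = 6 * 6.\<close>
  also have "(\<Sum>p\<in>Pr. \<Sum>i<6. if p dvd d i then 6 / K else 0) \<le> 36 * (Y / K)"
  proof -
    have "(\<Sum>p\<in>Pr. \<Sum>i<6. if p dvd d i then 6 / K else 0) = (\<Sum>i<6. \<Sum>p\<in>Pr. if p dvd d i then 6 / K else 0)" by (rule sum.swap)
    also have "\<dots> \<le> (\<Sum>i<(6::nat). Y * (6 / K))"
    proof (rule sum_mono)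
      fix i :: nat assume "i \<in> {..<6}"
      then have di: "1 \<le> d i" "d i \<le> Y" using d by auto
      have "{p \<in> Pr. p dvd d i} \<subseteq> {1..d i}"
      proof
        fix p assume "p \<in> {p \<in> Pr. p dvd d i}"
        then show "p \<in> {1..d i}" using p0[of p] di zdvd_imp_le[of p "d i"] by simp
      qed
      then have "card {p \<in> Pr. p dvd d i} \<le> card {1..d i}" by (rule card_mono[rotated]) simp
      then have c: "real (card {p \<in> Pr. p dvd d i}) \<le> Y" using di by simp
      have "(\<Sum>p\<in>Pr. if p dvd d i then 6 / K else 0) = (\<Sum>p\<in>{p \<in> Pr. p dvd d i}. 6 / K)"
        by (rule sum.inter_filter[OF fPr, symmetric])
      also have "\<dots> = card {p \<in> Pr. p dvd d i} * (6 / K)" by simp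
      also have "\<dots> \<le> Y * (6 / K)" using c K by (intro mult_right_mono) auto
      finally show "(\<Sum>p\<in>Pr. if p dvd d i then 6 / K else 0) \<le> Y * (6 / K)" .
    qed
    also have "\<dots> = 36 * (Y / K)" by simp
    finally show ?thesis .
  qed
  finally have "(\<Sum>p\<in>Pr. \<Sum>e\<in>d ` {..<6}. if p dvd e then 6 * (1 / real_of_int p + 1 / K) else 0)
     \<le> (\<Sum>p\<in>PY. \<Sum>i<6. if p dvd d i then 6 / real_of_int p else 0) + 36 * (Y / K)" by simp
  then show ?thesis using A small by linarith
qed

text \<open>The values d 0, ..., d 5 stand for d12, d13, d14, d23, d24, d34. Since all d are at most
  Y and B = Y^60, the progressions are so long that the rounding errors of the sieve are
  negligible.\<close>

lemma card_torsor_lower: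
  fixes d :: "nat \<Rightarrow> int" and B Y :: real
  assumes m: "48 \<le> m" and Y: "(fact m)\<^sup>2 \<le> Y" and B: "B = Y ^ 60"
    and d: "\<And>i. i < 6 \<Longrightarrow> 1 \<le> d i \<and> d i \<le> Y" and dM: "\<And>i. i < 6 \<Longrightarrow> fact m dvd d i - 1"
    and dcop: "\<And>i j. i < 6 \<Longrightarrow> j < i \<Longrightarrow> coprime (d j) (d i)"
    and PY: "PY = {p::int. prime p \<and> int m < p \<and> p \<le> Y}"
  shows "\<exists>S. finite S \<and> (\<forall>(u1, u2, u3, u4)\<in>S. torsor u1 u2 u3 u4 (d 0) (d 1) (d 2) (d 3) (d 4) (d 5) \<and> 0 < u1 \<and>
      (\<forall>i. \<bar>real_of_int (torsor_point (u1, u2, u3, u4, d 0, d 1, d 2, d 3, d 4, d 5) $ i)\<bar> \<le> B)) \<and>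
    B / (216 * (fact m) ^ 3) * (\<Prod>i<6. 1 / real_of_int (d i)) * (1 / 2 - (\<Sum>p\<in>PY. \<Sum>i<6. if p dvd d i then 6 / real_of_int p else 0)) \<le> real (card S)"
proof -
  define M :: int where "M = fact m"
  define R :: real where "R = fact m"
  have RM: "real_of_int M = R" unfolding M_def R_def by simp
  have "(48::real) \<le> fact 48" by (simp add: fact_numeral)
  also have "\<dots> \<le> fact m" using m by (rule fact_mono)
  finally have R48: "48 \<le> R" unfolding R_def .
  have M0: "0 < M" unfolding M_def by simp
  have YR: "R\<^sup>2 \<le> Y" using Y unfolding R_def .
  have "R \<le> R\<^sup>2" using R48 by (simp add: power2_eq_square)
  then have RY: "R \<le> Y" using YR by linarith
  have "48 * 48 \<le> R * R" using R48 by (intro mult_mono) auto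
  then have Y48: "96 \<le> Y" using YR by (simp add: power2_eq_square)
  have Y1: "1 \<le> Y" using Y48 by simp
  obtain r2 r3 where fam: "torsor_family M (d 0) (d 1) (d 2) (d 3) (d 4) (d 5) r2 r3"
  proof -
    have dp: "0 < d i" if "i < 6" for i using d[OF that] by simp
    have "\<exists>r2 r3. torsor_family M (d 0) (d 1) (d 2) (d 3) (d 4) (d 5) r2 r3"
      by (rule torsor_family_exists[OF M0]; (rule dp | rule dM[folded M_def] | rule dcop); simp)
    then show ?thesis using that by blast
  qed
  define e where "e i = real_of_int (d i)" for i
  have e: "1 \<le> e i" "e i \<le> Y" if "i < 6" for i using d[OF that] by (simp_all add: e_def)
  have e': "1 \<le> e 0" "1 \<le> e 1" "1 \<le> e 2" "1 \<le> e 3" "1 \<le> e 4" "1 \<le> e 5" "e 0 \<le> Y" "e 1 \<le> Y" "e 2 \<le> Y" "e 3 \<le> Y" "e 4 \<le> Y" "e 5 \<le> Y"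
    by (simp_all add: e)
  have ep: "0 < e 0" "0 < e 1" "0 < e 2" "0 < e 3" "0 < e 4" "0 < e 5" using e' by linarith+
  define P where "P = e 0 * e 1 * e 2 * e 3 * e 4 * e 5"
  have P0: "0 < P" unfolding P_def using ep by simp
  have P1: "1 \<le> P"
  proof -
    have "1 * 1 * 1 * 1 * 1 * (1::real) \<le> P" unfolding P_def using e' by (intro mult_mono) auto
    then show ?thesis by simp
  qed
  have B0: "0 < B" unfolding B using Y1 by simp
  \<comment> \<open>The largest size of the w_i compatible with height B, since each coordinate is a
    product of three w_i over P.\<close>
  define W where "W = root 3 (B * P)"
  have W3: "W ^ 3 = B * P" unfolding W_def using B0 P0 by (intro real_root_pow_pos2) auto
  have W20: "Y ^ 20 \<le> W"
  proof -
    have "(Y ^ 20) ^ 3 = B" unfolding B by (simp flip: power_mult)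
    also have "\<dots> \<le> W ^ 3" unfolding W3 using B0 P1 by simp
    finally show ?thesis unfolding W_def using power_mono_iff[of "Y ^ 20" "root 3 (B * P)" 3] B0 P0 Y1 by simp
  qed
  have W0: "0 < W" using W20 Y1 by (smt (verit) zero_less_power)
  \<comment> \<open>A lower bound for all three lengths: each q is at most Y^5, and rounding down
    costs at most half.\<close>
  define K where "K = W / (6 * R * Y ^ 5)"
  have Y5: "0 < Y ^ 5" "0 < R" using Y1 R48 by simp_all
  have K_big: "8 * R * Y ^ 6 \<le> K"
  proof -
    have "8 * R * Y ^ 6 * (6 * R * Y ^ 5) = (48 * R * R) * Y ^ 11" by (simp add: power_numeral_reduce)
    also have "\<dots> \<le> (Y * Y * Y) * Y ^ 11" using Y48 RY R48 by (intro mult_mono) auto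
    also have "\<dots> = Y ^ 14" by (simp add: power_numeral_reduce)
    also have "\<dots> \<le> Y ^ 20" using Y1 by (intro power_increasing) auto
    also have "\<dots> \<le> W" by (rule W20)
    finally show ?thesis unfolding K_def using Y5 by (simp add: pos_le_divide_eq)
  qed
  have Y6: "1 \<le> Y ^ 6" using Y1 by simp
  have "8 * R * 1 \<le> 8 * R * Y ^ 6" using Y6 R48 by (intro mult_left_mono) auto
  then have K1: "1 \<le> K" using K_big R48 by linarith
  then have K0: "0 < K" by simp
  \<comment> \<open>The real length of a progression that keeps the corresponding w_i at most W / 3;
    q collects the coefficient of u_i in w_i and the part of the modulus outside M.\<close>
  define X where "X q = W / (3 * R * q)" for q
  have X2K: "2 * K \<le> X q" if "0 < q" "q \<le> Y ^ 5" for q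
  proof -
    have "2 * K = W / (3 * R * Y ^ 5)" unfolding K_def by simp
    also have "\<dots> \<le> W / (3 * R * q)" using that W0 Y5 by (intro divide_left_mono mult_left_mono) auto
    finally show ?thesis unfolding X_def .
  qed
  \<comment> \<open>Every d occurs in exactly two of the three products, so q1 q2 q3 = P^2, and the
    number of triples is about W^3 / P^2 = B / P up to the powers of 3 and R.\<close>
  define q1 where "q1 = e 0 * e 1 * e 2"
  define q2 where "q2 = e 0 * e 3 * e 4 * e 5"
  define q3 where "q3 = e 1 * e 3 * e 5 * e 2 * e 4"
  have q0: "0 < q1" "0 < q2" "0 < q3" unfolding q1_def q2_def q3_def using ep by simp_all
  have "q1 \<le> Y * Y * Y" "q2 \<le> Y * Y * Y * Y" "q3 \<le> Y * Y * Y * Y * Y"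
    unfolding q1_def q2_def q3_def using e' Y1 by (intro mult_mono mult_nonneg_nonneg; simp)+
  then have q: "q1 \<le> Y ^ 3" "q2 \<le> Y ^ 4" "q3 \<le> Y ^ 5" by (simp_all add: power_numeral_reduce mult_ac)
  moreover have "Y ^ 3 \<le> Y ^ 5" "Y ^ 4 \<le> Y ^ 5" using Y1 by (intro power_increasing; simp)+
  ultimately have q5: "q1 \<le> Y ^ 5" "q2 \<le> Y ^ 5" "q3 \<le> Y ^ 5" by linarith+
  define k where "k q = nat \<lfloor>X q\<rfloor>" for q
  have k: "real (k q) \<le> X q" "K \<le> real (k q)" "X q / 2 \<le> real (k q)" if "0 < q" "q \<le> Y ^ 5" for q
  proof -
    have x: "2 * K \<le> X q" by (rule X2K[OF that])
    then have e: "real (k q) = of_int \<lfloor>X q\<rfloor>" unfolding k_def using K1 by simp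
    show "real (k q) \<le> X q" unfolding e by simp
    have "X q - 1 < real (k q)" unfolding e by linarith
    then show "K \<le> real (k q)" "X q / 2 \<le> real (k q)" using x K1 by linarith+
  qed
  have Xq: "3 * (q * (R * X q)) = W" if "0 < q" for q unfolding X_def using that Y5 by (simp add: field_simps)
  have kW: "3 * (q * (R * real (k q))) \<le> W" if "0 < q" "q \<le> Y ^ 5" for q
  proof -
    have "3 * (q * (R * real (k q))) \<le> 3 * (q * (R * X q))" using k(1)[OF that] that Y5 by (intro mult_left_mono) auto
    then show ?thesis using Xq that by simp
  qed
  have kQ: "c * (R * real (k q)) \<le> W" if "0 < q" "q \<le> Y ^ 5" "c \<le> q" for c q
  proof -
    have "c * (R * real (k q)) \<le> q * (R * real (k q))" using that Y5 by (intro mult_right_mono) auto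
    also have "\<dots> \<le> 3 * (q * (R * real (k q)))" using that Y5 by simp
    finally show ?thesis using kW[OF that(1,2)] by linarith
  qed
  \<comment> \<open>The values of \<open>v1\<close>, \<open>v2\<close>, \<open>v3\<close> do not
    exceed W, so no larger prime has to be sieved.\<close>
  define Q where "Q = \<lfloor>W\<rfloor>"
  have Q0: "0 \<le> Q" unfolding Q_def using W0 by simp
  have QW: "real_of_int Q \<le> W" unfolding Q_def by simp
  have c: "1 \<le> q1" "e 5 \<le> q2" "e 2 * e 4 \<le> q3"
  proof -
    have "1 * 1 * 1 \<le> q1" unfolding q1_def using e' by (intro mult_mono) auto
    then show "1 \<le> q1" by simp
    have "1 * 1 * 1 * e 5 \<le> q2" unfolding q2_def using e' by (intro mult_mono mult_nonneg_nonneg; simp)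
    then show "e 5 \<le> q2" by simp
    have "1 * 1 * 1 * e 2 * e 4 \<le> q3" unfolding q3_def using e' by (intro mult_mono mult_nonneg_nonneg; simp)
    then show "e 2 * e 4 \<le> q3" by simp
  qed
  have Q1: "M * int (k q1) \<le> Q" unfolding Q_def le_floor_iff using kQ[OF q0(1) q5(1) c(1)] by (simp add: RM)
  have Q2: "M * d 5 * int (k q2) \<le> Q" unfolding Q_def le_floor_iff using kQ[OF q0(2) q5(2) c(2)] by (simp add: RM e_def mult_ac)
  have Q3: "M * d 2 * d 4 * int (k q3) \<le> Q" unfolding Q_def le_floor_iff using kQ[OF q0(3) q5(3) c(3)] by (simp add: RM e_def mult_ac)
  have W1: "3 * (real_of_int (d 0 * d 1 * d 2) * (M * k q1)) \<le> W"
    using kW[OF q0(1) q5(1)] by (simp add: RM e_def q1_def)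
  have W2: "3 * (real_of_int (d 0 * d 3 * d 4) * (M * d 5 * k q2)) \<le> W"
    using kW[OF q0(2) q5(2)] unfolding q2_def of_int_mult RM e_def by (simp only: mult_ac)
  have W3': "3 * (real_of_int (d 1 * d 3 * d 5) * (M * d 2 * d 4 * k q3)) \<le> W"
    using kW[OF q0(3) q5(3)] unfolding q3_def of_int_mult RM e_def by (simp only: mult_ac)
  have W4: "W ^ 3 \<le> B * real_of_int (d 0 * d 1 * d 2 * d 3 * d 4 * d 5)" unfolding W3 P_def e_def by simp
  define Pr where "Pr = {p. prime p \<and> p \<le> Q \<and> \<not> p dvd M}"
  have imd: "{d 0, d 1, d 2, d 3, d 4, d 5} = d ` {..<6}" by (auto simp: numeral_eq_Suc lessThan_Suc)
  define br where "br = 1 - 6 * (\<Sum>p\<in>Pr. (1 / p + 1 / K)\<^sup>2) - (\<Sum>p\<in>Pr. \<Sum>e\<in>d ` {..<6}. if p dvd e then 6 * (1 / p + 1 / K) else 0)"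
  define \<beta> where "\<beta> = 1 / 2 - (\<Sum>p\<in>PY. \<Sum>i<6. if p dvd d i then 6 / real_of_int p else 0)"
  have small: "12 * (Q / K\<^sup>2) + 36 * (Y / K) \<le> 1 / 4"
  proof -
    have "Q / K\<^sup>2 \<le> W / K\<^sup>2" using QW by (intro divide_right_mono) auto
    also have "\<dots> = (W / K) / K" by (simp add: power2_eq_square)
    also have "W / K = 6 * R * Y ^ 5" unfolding K_def using W0 Y5 by simp
    also have "6 * R * Y ^ 5 / K \<le> 6 * R * Y ^ 5 / (8 * R * Y ^ 6)" using K_big Y5 Y6 K0 by (intro divide_left_mono) auto
    also have "\<dots> = 3 / 4 / Y" using Y1 Y5 by (simp add: field_simps power_numeral_reduce)
    also have "\<dots> \<le> 3 / 4 / 96" using Y48 by (intro divide_left_mono) auto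
    finally have 1: "Q / K\<^sup>2 \<le> 1 / 128" by simp
    have "Y / K \<le> Y / (8 * R * Y ^ 6)" using K_big Y5 Y6 K0 Y1 by (intro divide_left_mono) auto
    also have "\<dots> = 1 / (8 * R * Y ^ 5)" using Y1 Y5 by (simp add: field_simps power_numeral_reduce)
    also have "\<dots> \<le> 1 / (8 * 48 * 1)"
    proof -
      have "1 \<le> Y ^ 5" using Y1 by simp
      then have "8 * 48 * 1 \<le> 8 * R * Y ^ 5" using R48 by (intro mult_mono) auto
      then show ?thesis by (intro divide_left_mono) auto
    qed
    finally have 2: "Y / K \<le> 1 / 384" by simp
    show ?thesis using 1 2 by linarith
  qed
  have br: "\<beta> \<le> br" unfolding br_def \<beta>_def
    by (rule sieve_density_ge[OF Pr_def[unfolded M_def] m K0 Q0 small d PY])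
  obtain S where S: "finite S" "\<forall>(u1, u2, u3, u4)\<in>S. torsor u1 u2 u3 u4 (d 0) (d 1) (d 2) (d 3) (d 4) (d 5) \<and> 0 < u1 \<and>
      (\<forall>i. \<bar>real_of_int (torsor_point (u1, u2, u3, u4, d 0, d 1, d 2, d 3, d 4, d 5) $ i)\<bar> \<le> B)"
    "real (k q1) * real (k q2) * real (k q3) * br \<le> real (card S)"
    using torsor_family.card_torsor_ge[OF fam W1 W2 W3' W4 K0 k(2)[OF q0(1) q5(1)] k(2)[OF q0(2) q5(2)] k(2)[OF q0(3) q5(3)] Q1 Q2 Q3 Pr_def]
    unfolding imd br_def by blast
  have "B / (216 * R ^ 3) * (\<Prod>i<6. 1 / e i) * \<beta> \<le> real (card S)"
  proof (cases "\<beta> \<le> 0")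
    \<comment> \<open>For a negative bracket the left side is not positive, and nothing has to be
      counted.\<close>
    case True
    have "0 \<le> 1 / e i" if "i < 6" for i using e(1)[OF that] by simp
    then have "0 \<le> (\<Prod>i<6. 1 / e i)" by (intro prod_nonneg) auto
    moreover have "0 \<le> B / (216 * R ^ 3)" using B0 Y5 by simp
    ultimately have "0 \<le> B / (216 * R ^ 3) * (\<Prod>i<6. 1 / e i)" by (rule mult_nonneg_nonneg[rotated])
    then have "B / (216 * R ^ 3) * (\<Prod>i<6. 1 / e i) * \<beta> \<le> 0" using True by (rule mult_nonneg_nonpos)
    then show ?thesis using of_nat_0_le_iff[of "card S"] by linarith
  next
    case False
    have "(\<Prod>i<6. 1 / e i) = 1 / P" unfolding P_def by (simp add: numeral_eq_Suc lessThan_Suc mult_ac)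
    then have "B / (216 * R ^ 3) * (\<Prod>i<6. 1 / e i) = (B * P) / (216 * R ^ 3 * P\<^sup>2)" using P0 by (simp add: power2_eq_square)
    also have "P\<^sup>2 = q1 * q2 * q3" unfolding P_def q1_def q2_def q3_def by (simp add: power2_eq_square mult_ac)
    also have "(B * P) / (216 * R ^ 3 * (q1 * q2 * q3)) = (X q1 / 2) * (X q2 / 2) * (X q3 / 2)"
      unfolding W3[symmetric] X_def by (simp add: power3_eq_cube mult_ac)
    also have "\<dots> \<le> real (k q1) * real (k q2) * real (k q3)"
      using k(3)[OF q0(1) q5(1)] k(3)[OF q0(2) q5(2)] k(3)[OF q0(3) q5(3)] X2K[OF q0(1) q5(1)] X2K[OF q0(2) q5(2)] X2K[OF q0(3) q5(3)] K0
      by (intro mult_mono mult_nonneg_nonneg) auto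
    finally have A: "B / (216 * R ^ 3) * (\<Prod>i<6. 1 / e i) \<le> real (k q1) * real (k q2) * real (k q3)" .
    have "B / (216 * R ^ 3) * (\<Prod>i<6. 1 / e i) * \<beta> \<le> real (k q1) * real (k q2) * real (k q3) * br"
      by (rule mult_mono[OF A br]) (use False in auto)
    then show ?thesis using S(3) by linarith
  qed
  then show ?thesis using S(1,2) unfolding \<beta>_def R_def e_def by blast
qed

section \<open>Averaging over d and the lower bound\<close>

text \<open>For d = p n in D the cofactor n lies in a fixed class modulo M, in general not that of
  1. Moving it down to the nearest integer that is 1 modulo M keeps it positive, only increases its
  inverse and stays injective; so the factor 1 / p is obtained without a constant.\<close>

lemma sum_inverse_dvd_le:
  fixes M p :: int and Y :: real
  assumes D: "D = {d::int. 1 \<le> d \<and> d \<le> Y \<and> M dvd d - 1}" and M: "0 < M" and p: "prime p" "\<not> p dvd M"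
  shows "(\<Sum>d\<in>D. if p dvd d then 1 / real_of_int d else 0) \<le> (\<Sum>d\<in>D. 1 / real_of_int d) * (1 / p)"
proof -
  have p0: "0 < p" using p(1) by (rule prime_gt_0_int)
  have "D \<subseteq> {1..\<lfloor>Y\<rfloor>}" unfolding D by (auto simp: le_floor_iff)
  then have fD: "finite D" by (rule finite_subset) simp
  define D' where "D' = {d \<in> D. p dvd d}"
  define \<phi> where "\<phi> d = d div p - (d div p - 1) mod M" for d
  have m1: "1 \<le> d div p" "d = p * (d div p)" if "d \<in> D'" for d
  proof -
    show e: "d = p * (d div p)" using that unfolding D'_def by simp
    have "0 < d" using that unfolding D'_def D by simp
    then have "0 < p * (d div p)" using e by simp
    then show "1 \<le> d div p" using p0 by (simp add: zero_less_mult_iff)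
  qed
  have \<phi>: "1 \<le> \<phi> d" "\<phi> d \<le> d div p" "M dvd \<phi> d - 1" if "d \<in> D'" for d
  proof -
    have "(d div p - 1) mod M \<le> d div p - 1" using m1[OF that] by (intro zmod_le_nonneg_dividend) simp
    then show "1 \<le> \<phi> d" unfolding \<phi>_def by simp
    show "\<phi> d \<le> d div p" unfolding \<phi>_def using M by simp
    have e: "\<phi> d - 1 = (d div p - 1) - (d div p - 1) mod M" unfolding \<phi>_def by simp
    show "M dvd \<phi> d - 1" unfolding e by (rule dvd_minus_mod)
  qed
  have inj: "inj_on \<phi> D'"
  proof (rule inj_onI)
    fix c d assume cd: "c \<in> D'" "d \<in> D'" "\<phi> c = \<phi> d"
    have "M dvd (c - 1) - (d - 1)" using cd unfolding D'_def D by (intro dvd_diff[of M "c - 1" "d - 1"]) auto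
    also have "(c - 1) - (d - 1) = p * (c div p - d div p)" using m1(2)[OF cd(1)] m1(2)[OF cd(2)] by (simp add: right_diff_distrib)
    finally have "M dvd p * (c div p - d div p)" .
    moreover have "coprime M p" using prime_imp_coprime[OF p] by (simp add: coprime_commute)
    ultimately have "M dvd c div p - d div p" by (simp add: coprime_dvd_mult_right_iff)
    then have "M dvd (c div p - 1) - (d div p - 1)" by simp
    then have "(c div p - 1) mod M = (d div p - 1) mod M" by (simp only: mod_eq_dvd_iff)
    then have "c div p = d div p" using cd(3) unfolding \<phi>_def by simp
    then show "c = d" using m1(2)[OF cd(1)] m1(2)[OF cd(2)] by simp
  qed
  have im: "\<phi> ` D' \<subseteq> D"
  proof
    fix x assume "x \<in> \<phi> ` D'"
    then obtain d where d: "d \<in> D'" "x = \<phi> d" by blast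
    have "1 * (d div p) \<le> p * (d div p)" using p0 m1(1)[OF d(1)] by (intro mult_right_mono) auto
    then have "\<phi> d \<le> d" using \<phi>(2)[OF d(1)] m1(2)[OF d(1)] by simp
    moreover have "d \<le> Y" using d(1) unfolding D'_def D by simp
    ultimately have "\<phi> d \<le> Y" by linarith
    then show "x \<in> D" unfolding D d(2) using \<phi>[OF d(1)] by simp
  qed
  have "(\<Sum>d\<in>D. if p dvd d then 1 / real_of_int d else 0) = (\<Sum>d\<in>D'. 1 / real_of_int d)"
    unfolding D'_def by (rule sum.inter_filter[OF fD, symmetric])
  also have "\<dots> \<le> (\<Sum>d\<in>D'. 1 / real_of_int (\<phi> d) * (1 / p))"
  proof (rule sum_mono)
    fix d assume d: "d \<in> D'"
    have "\<phi> d * p \<le> d" using mult_right_mono[OF \<phi>(2)[OF d], of p] p0 m1(2)[OF d] by (simp add: mult.commute)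
    then have "real_of_int (\<phi> d * p) \<le> d" by (simp only: of_int_le_iff)
    moreover have "0 < real_of_int (\<phi> d * p)" unfolding of_int_0_less_iff using \<phi>(1)[OF d] p0 by simp
    ultimately have "1 / real_of_int d \<le> 1 / real_of_int (\<phi> d * p)" by (intro divide_left_mono) auto
    then show "1 / real_of_int d \<le> 1 / real_of_int (\<phi> d) * (1 / p)" by simp
  qed
  also have "\<dots> = (\<Sum>d\<in>D'. 1 / real_of_int (\<phi> d)) * (1 / p)" by (rule sum_distrib_right[symmetric])
  also have "(\<Sum>d\<in>D'. 1 / real_of_int (\<phi> d)) = (\<Sum>x\<in>\<phi> ` D'. 1 / real_of_int x)" by (simp add: sum.reindex[OF inj])
  also have "\<dots> \<le> (\<Sum>x\<in>D. 1 / real_of_int x)" using fD im by (intro sum_mono2) (auto simp: D)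
  finally show ?thesis using p0 by (simp add: mult_right_mono divide_right_mono)
qed

text \<open>The weighted sum factors over the coordinates, and each coordinate in J contributes S /
  p instead of S.\<close>

lemma sum_PiE_prod_inverse_dvd_le:
  fixes D :: "int set" and p :: int and S :: real
  assumes fD: "finite D" and pos: "\<And>d. d \<in> D \<Longrightarrow> 0 < d" and p: "0 < p" and I: "finite I" "J \<subseteq> I"
    and S: "S = (\<Sum>d\<in>D. 1 / real_of_int d)" and h: "(\<Sum>d\<in>D. if p dvd d then 1 / real_of_int d else 0) \<le> S * (1 / p)"
  shows "(\<Sum>d\<in>PiE I (\<lambda>_. D). (\<Prod>i\<in>I. 1 / real_of_int (d i)) * (if \<forall>i\<in>J. p dvd d i then 1 else 0)) \<le> S ^ card I * (1 / p) ^ card J"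
proof -
  define g where "g i x = (if i \<in> J then (if p dvd x then 1 / real_of_int x else 0) else 1 / real_of_int x)" for i x
  have S0: "0 \<le> S" unfolding S using pos by (intro sum_nonneg) (simp add: less_imp_le)
  have "(\<Prod>i\<in>I. 1 / real_of_int (d i)) * (if \<forall>i\<in>J. p dvd d i then 1 else 0) = (\<Prod>i\<in>I. g i (d i))" for d
  proof (cases "\<forall>i\<in>J. p dvd d i")
    case True
    then show ?thesis by (auto simp: g_def intro!: prod.cong)
  next
    case False
    then obtain i where "i \<in> I" "g i (d i) = 0" using I unfolding g_def by auto
    then have "(\<Prod>i\<in>I. g i (d i)) = 0" using I by (intro prod_zero) auto
    then show ?thesis using False by (simp only: if_False mult_zero_right)
  qed
  then have "(\<Sum>d\<in>PiE I (\<lambda>_. D). (\<Prod>i\<in>I. 1 / real_of_int (d i)) * (if \<forall>i\<in>J. p dvd d i then 1 else 0)) = (\<Sum>d\<in>PiE I (\<lambda>_. D). \<Prod>i\<in>I. g i (d i))"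
    by (simp only:)
  also have "\<dots> = (\<Prod>i\<in>I. \<Sum>x\<in>D. g i x)" by (rule prod_sum_PiE[symmetric]) (use fD I in auto)
  also have "\<dots> \<le> (\<Prod>i\<in>I. S * (if i \<in> J then 1 / p else 1))"
  proof (rule prod_mono)
    fix i
    have "0 \<le> (\<Sum>x\<in>D. g i x)" unfolding g_def using pos by (intro sum_nonneg) (simp add: less_imp_le)
    moreover have "(\<Sum>x\<in>D. g i x) \<le> S * (if i \<in> J then 1 / p else 1)" unfolding g_def using h S by simp
    ultimately show "0 \<le> (\<Sum>x\<in>D. g i x) \<and> (\<Sum>x\<in>D. g i x) \<le> S * (if i \<in> J then 1 / p else 1)" ..
  qed
  also have "\<dots> = S ^ card I * (\<Prod>i\<in>I. if i \<in> J then 1 / p else 1)" by (simp add: prod.distrib)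
  also have "(\<Prod>i\<in>I. if i \<in> J then 1 / real_of_int p else 1) = (\<Prod>i\<in>I \<inter> J. 1 / real_of_int p)"
    by (rule prod.inter_restrict[OF I(1), symmetric])
  also have "I \<inter> J = J" using I by blast
  finally show ?thesis by simp
qed

text \<open>Compare 1 + M k \<le> M (k + 1) with the harmonic series of length Y / M. The condition
  M^2 \<le> Y makes this length at least sqrt Y, which costs only a factor 2 in the
  logarithm.\<close>

lemma sum_inverse_class_ge:
  fixes M :: int and Y :: real
  assumes D: "D = {d::int. 1 \<le> d \<and> d \<le> Y \<and> M dvd d - 1}" and M: "1 \<le> M" and Y: "real_of_int (M\<^sup>2) \<le> Y"
  shows "ln Y / (2 * M) \<le> (\<Sum>d\<in>D. 1 / real_of_int d)"
proof -
  have "D \<subseteq> {1..\<lfloor>Y\<rfloor>}" unfolding D by (auto simp: le_floor_iff)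
  then have fD: "finite D" by (rule finite_subset) simp
  define n where "n = nat \<lfloor>Y / M\<rfloor>"
  have M0: "0 < real_of_int M" using M by simp
  have Y0: "0 < Y" using Y M0 by (smt (verit) of_int_power zero_less_power)
  have nY: "real n \<le> Y / M" "Y / M \<le> real n + 1" unfolding n_def using Y0 M0 by (simp_all add: linear le_of_int_ceiling)
  have inj: "inj_on (\<lambda>k. 1 + M * int k) {..<n}" using M by (auto intro!: inj_onI)
  have im: "(\<lambda>k. 1 + M * int k) ` {..<n} \<subseteq> D"
  proof
    fix d assume "d \<in> (\<lambda>k. 1 + M * int k) ` {..<n}"
    then obtain k where k: "k < n" "d = 1 + M * int k" by blast
    have "1 + M * int k \<le> M * int n"
    proof -
      have "M * (int k + 1) \<le> M * int n" using k(1) M by (intro mult_left_mono) auto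
      then show ?thesis using M by (simp only: distrib_left mult_1_right)
    qed
    then have "real_of_int d \<le> real_of_int (M * int n)" unfolding k(2) by (simp only: of_int_le_iff)
    also have "\<dots> = real n * real_of_int M" by simp
    also have "\<dots> \<le> Y" using nY(1) unfolding pos_le_divide_eq[OF M0] .
    finally have "real_of_int d \<le> Y" .
    moreover have "1 \<le> d" "M dvd d - 1" unfolding k(2) using M by simp_all
    ultimately show "d \<in> D" unfolding D by blast
  qed
  have sq: "Y / M \<ge> sqrt Y"
  proof -
    have "real_of_int M \<le> sqrt Y" by (rule real_le_rsqrt) (use Y in simp)
    then have "sqrt Y * M \<le> sqrt Y * sqrt Y" using Y0 by (intro mult_left_mono) auto
    also have "\<dots> = Y" using Y0 by (intro real_sqrt_mult_self[THEN trans]) simp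
    finally show ?thesis unfolding pos_le_divide_eq[OF M0] .
  qed
  have "ln Y / 2 = ln (sqrt Y)" using Y0 by (simp add: ln_sqrt)
  also have "\<dots> \<le> ln (real n + 1)" using sq nY Y0 by (intro ln_mono) auto
  also have "\<dots> \<le> harm n" using ln_le_harm[of n] by (simp add: add.commute)
  also have "harm n = (\<Sum>k<n. 1 / real (Suc k))" unfolding harm_def by (simp add: sum.atLeast1_atMost_eq inverse_eq_divide)
  finally have "ln Y / 2 / M \<le> (\<Sum>k<n. 1 / real (Suc k)) / M" using M0 by (intro divide_right_mono) auto
  also have "\<dots> = (\<Sum>k<n. 1 / real (Suc k) / M)" by (rule sum_divide_distrib)
  also have "\<dots> \<le> (\<Sum>k<n. 1 / real_of_int (1 + M * int k))"
  proof (rule sum_mono)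
    fix k
    have "1 + M * int k \<le> int (Suc k) * M" using M by (simp add: algebra_simps)
    then have "real_of_int (1 + M * int k) \<le> real_of_int (int (Suc k) * M)" by (simp only: of_int_le_iff)
    then have le: "real_of_int (1 + M * int k) \<le> real (Suc k) * M" by (simp only: of_int_mult of_int_of_nat_eq)
    have "0 < 1 + M * int k" using M by (simp add: add_pos_nonneg)
    then have "0 < real_of_int (1 + M * int k)" by (simp only: of_int_0_less_iff)
    then have "1 / (real (Suc k) * M) \<le> 1 / real_of_int (1 + M * int k)" using le M0 by (intro divide_left_mono) auto
    then show "1 / real (Suc k) / M \<le> 1 / real_of_int (1 + M * int k)" by simp
  qed
  also have "\<dots> = (\<Sum>d\<in>(\<lambda>k. 1 + M * int k) ` {..<n}. 1 / real_of_int d)" by (simp only: sum.reindex[OF inj] o_def)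
  also have "\<dots> \<le> (\<Sum>d\<in>D. 1 / real_of_int d)" using fD im by (intro sum_mono2) (auto simp: D)
  finally show ?thesis by simp
qed

text \<open>The sum over all tuples, including those that are not pairwise coprime: for these the bracket is negative.\<close>

lemma sum_tuples_ge:
  fixes Y S :: real and M :: int
  assumes D: "D = {d::int. 1 \<le> d \<and> d \<le> Y \<and> M dvd d - 1}" and M: "M = fact m" and m: "204 \<le> m"
    and S: "S = (\<Sum>d\<in>D. 1 / real_of_int d)" and PY: "PY = {p::int. prime p \<and> int m < p \<and> p \<le> Y \<and> \<not> p dvd M}"
  shows "S ^ 6 / 4 \<le> (\<Sum>d\<in>PiE {..<6::nat} (\<lambda>_. D). (\<Prod>i<6. 1 / real_of_int (d i)) *
     (1 / 2 - (\<Sum>p\<in>PY. (\<Sum>i<6. if p dvd d i then 6 / real_of_int p else 0) + (\<Sum>i<6. \<Sum>j<i. if p dvd d i \<and> p dvd d j then 1 else 0))))"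
proof -
  let ?T = "PiE {..<6::nat} (\<lambda>_. D)"
  let ?w = "\<lambda>d. \<Prod>i<6. 1 / real_of_int (d i)"
  let ?c = "\<lambda>p J d. ?w d * (if \<forall>i\<in>J. p dvd d i then 1 else 0)"
  have M0: "0 < M" unfolding M by simp
  have "D \<subseteq> {1..\<lfloor>Y\<rfloor>}" unfolding D by (auto simp: le_floor_iff)
  then have fD: "finite D" by (rule finite_subset) simp
  have "PY \<subseteq> {0..\<lfloor>Y\<rfloor>}" unfolding PY using prime_ge_0_int by (auto simp: le_floor_iff)
  then have fPY: "finite PY" by (rule finite_subset) simp
  have p0: "0 < p" if "p \<in> PY" for p using that prime_gt_0_int unfolding PY by blast
  have S0: "0 \<le> S" unfolding S D by (intro sum_nonneg) simp
  have J: "(\<Sum>d\<in>?T. ?c p J d) \<le> S ^ 6 * (1 / p) ^ card J" if "p \<in> PY" "J \<subseteq> {..<6}" for p J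
  proof -
    have pp: "prime p" "\<not> p dvd M" using that(1) unfolding PY by blast+
    have "(\<Sum>d\<in>?T. ?c p J d) \<le> S ^ card {..<6::nat} * (1 / p) ^ card J"
      by (rule sum_PiE_prod_inverse_dvd_le[OF fD _ p0[OF that(1)] _ that(2) S])
        (use sum_inverse_dvd_le[OF D M0 pp] S in \<open>auto simp: D\<close>)
    then show ?thesis by simp
  qed
  have w: "(\<Sum>d\<in>?T. ?w d) = S ^ 6"
    using prod_sum_PiE[of "{..<6::nat}" "\<lambda>_. D" "\<lambda>_ x. 1 / real_of_int x"] fD S by simp
  \<comment> \<open>One factor 1 / p is in the summand and one comes from the divisibility; six
    coordinates with the weight 6 give 36.\<close>
  have one: "(\<Sum>d\<in>?T. ?w d * (\<Sum>i<6. if p dvd d i then 6 / real_of_int p else 0)) \<le> 36 * (S ^ 6 * (1 / p)\<^sup>2)" if p: "p \<in> PY" for p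
  proof -
    have "(\<Sum>d\<in>?T. ?w d * (\<Sum>i<6. if p dvd d i then 6 / real_of_int p else 0)) = (\<Sum>d\<in>?T. \<Sum>i<6. 6 / real_of_int p * ?c p {i} d)"
      unfolding sum_distrib_left by (intro sum.cong refl) simp
    also have "\<dots> = (\<Sum>i<6. 6 / real_of_int p * (\<Sum>d\<in>?T. ?c p {i} d))" by (subst sum.swap) (simp only: sum_distrib_left)
    also have "\<dots> \<le> (\<Sum>i<(6::nat). 6 / real_of_int p * (S ^ 6 * (1 / p) ^ card {i}))"
    proof (rule sum_mono)
      fix i :: nat assume "i \<in> {..<6}"
      then have "{i} \<subseteq> {..<6}" by simp
      then show "6 / real_of_int p * (\<Sum>d\<in>?T. ?c p {i} d) \<le> 6 / real_of_int p * (S ^ 6 * (1 / p) ^ card {i})"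
        using p0[OF p] by (intro mult_left_mono J[OF p]) auto
    qed
    also have "\<dots> = 36 * (S ^ 6 * (1 / p)\<^sup>2)" by (simp add: power2_eq_square)
    finally show ?thesis .
  qed
  \<comment> \<open>There are 15 pairs of coordinates, each with two divisibilities by p.\<close>
  have two: "(\<Sum>d\<in>?T. ?w d * (\<Sum>i<6. \<Sum>j<i. if p dvd d i \<and> p dvd d j then 1 else 0)) \<le> 15 * (S ^ 6 * (1 / p)\<^sup>2)" if p: "p \<in> PY" for p
  proof -
    have "(\<Sum>d\<in>?T. ?w d * (\<Sum>i<6. \<Sum>j<i. if p dvd d i \<and> p dvd d j then 1 else 0)) = (\<Sum>d\<in>?T. \<Sum>i<6. \<Sum>j<i. ?c p {i, j} d)"
      unfolding sum_distrib_left by (intro sum.cong refl) simp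
    also have "\<dots> = (\<Sum>i<6. \<Sum>d\<in>?T. \<Sum>j<i. ?c p {i, j} d)" by (rule sum.swap)
    also have "\<dots> = (\<Sum>i<6. \<Sum>j<i. \<Sum>d\<in>?T. ?c p {i, j} d)" by (intro sum.cong refl sum.swap)
    also have "\<dots> \<le> (\<Sum>i<(6::nat). \<Sum>j<i. S ^ 6 * (1 / p)\<^sup>2)"
    proof (intro sum_mono)
      fix i j :: nat assume "i \<in> {..<6}" "j \<in> {..<i}"
      then have "{i, j} \<subseteq> {..<6}" "card {i, j} = 2" by auto
      then show "(\<Sum>d\<in>?T. ?c p {i, j} d) \<le> S ^ 6 * (1 / p)\<^sup>2" using J[OF p, of "{i, j}"] by simp
    qed
    also have "\<dots> = 15 * (S ^ 6 * (1 / p)\<^sup>2)" by (simp add: numeral_eq_Suc lessThan_Suc)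
    finally show ?thesis .
  qed
  have "(\<Sum>d\<in>?T. ?w d * (\<Sum>p\<in>PY. (\<Sum>i<6. if p dvd d i then 6 / real_of_int p else 0) + (\<Sum>i<6. \<Sum>j<i. if p dvd d i \<and> p dvd d j then 1 else 0)))
     = (\<Sum>p\<in>PY. (\<Sum>d\<in>?T. ?w d * (\<Sum>i<6. if p dvd d i then 6 / real_of_int p else 0)) + (\<Sum>d\<in>?T. ?w d * (\<Sum>i<6. \<Sum>j<i. if p dvd d i \<and> p dvd d j then 1 else 0)))"
    (is "?E = _")
    unfolding sum_distrib_left distrib_left sum.distrib[symmetric] by (subst sum.swap) (rule refl)
  also have "\<dots> \<le> (\<Sum>p\<in>PY. 36 * (S ^ 6 * (1 / p)\<^sup>2) + 15 * (S ^ 6 * (1 / p)\<^sup>2))"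
    by (intro sum_mono add_mono one two)
  also have "\<dots> = (\<Sum>p\<in>PY. 51 * S ^ 6 * (1 / (real_of_int p)\<^sup>2))" by (intro sum.cong refl) (simp add: power_divide)
  also have "\<dots> = 51 * S ^ 6 * (\<Sum>p\<in>PY. 1 / (real_of_int p)\<^sup>2)" by (rule sum_distrib_left[symmetric])
  \<comment> \<open>51 = 36 + 15, and m \<ge> 204 = 4 * 51 makes the loss at most a quarter of
    S^6.\<close>
  also have "\<dots> \<le> 51 * S ^ 6 * (1 / 204)"
  proof (rule mult_left_mono)
    have "(\<Sum>p\<in>PY. 1 / (real_of_int p)\<^sup>2) \<le> 1 / real m" by (rule sum_inverse_squares_le[OF fPY]) (use m in \<open>auto simp: PY\<close>)
    also have "\<dots> \<le> 1 / 204" using m by (intro divide_left_mono) auto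
    finally show "(\<Sum>p\<in>PY. 1 / (real_of_int p)\<^sup>2) \<le> 1 / 204" .
  qed (use S0 in simp)
  finally have E: "?E \<le> S ^ 6 / 4" by simp
  have "(\<Sum>d\<in>?T. ?w d * (1 / 2 - (\<Sum>p\<in>PY. (\<Sum>i<6. if p dvd d i then 6 / real_of_int p else 0) + (\<Sum>i<6. \<Sum>j<i. if p dvd d i \<and> p dvd d j then 1 else 0))))
     = (\<Sum>d\<in>?T. ?w d) * (1 / 2) - ?E" unfolding right_diff_distrib sum_subtractf sum_distrib_right by (rule refl)
  then show ?thesis using E unfolding w by linarith
qed

text \<open>The six logarithms are the six factors S, the sums of 1 / d_i over the d_i up to Y =
  B^(1/60) that are 1 modulo M. From ln B = 60 ln Y comes S \<ge> ln B / (120 R).\<close>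

lemma N_lower_bound: "\<exists>c>0. \<forall>\<^sub>F B in at_top. c * B * (ln B) ^ 6 \<le> real (N B)"
proof -
  obtain m :: nat where m: "204 \<le> m" by blast
  define M :: int where "M = fact m"
  define R :: real where "R = fact m"
  have RM: "real_of_int M = R" unfolding M_def R_def by simp
  have R1: "1 \<le> R" unfolding R_def by (rule fact_ge_1)
  then have M1: "1 \<le> M" using RM by (metis of_int_1_le_iff)
  have main: "1 / (216 * R ^ 3) * (1 / (120 * R)) ^ 6 / 4 * B * (ln B) ^ 6 \<le> real (N B)" if B: "(R\<^sup>2) ^ 60 \<le> B" for B
  proof -
    define Y where "Y = root 60 B"
    have B0: "0 < B"
    proof -
      have "0 < (R\<^sup>2) ^ 60" using R1 by simp
      then show ?thesis using B by linarith
    qed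
    have YB: "Y ^ 60 = B" unfolding Y_def using B0 by (intro real_root_pow_pos2) auto
    have "root 60 ((R\<^sup>2) ^ 60) \<le> Y" unfolding Y_def using B by (intro real_root_le_mono) auto
    moreover have "root 60 ((R\<^sup>2) ^ 60) = R\<^sup>2" by (rule real_root_power_cancel) auto
    ultimately have YR: "R\<^sup>2 \<le> Y" by (simp only:)
    have Y1: "1 \<le> Y" using YR R1 by (smt (verit) one_le_power)
    have lnB: "ln B = 60 * ln Y" unfolding YB[symmetric] using Y1 by (simp add: ln_realpow)
    define D where "D = {d::int. 1 \<le> d \<and> d \<le> Y \<and> M dvd d - 1}"
    define S where "S = (\<Sum>d\<in>D. 1 / real_of_int d)"
    define PY where "PY = {p::int. prime p \<and> int m < p \<and> p \<le> Y}"
    have "\<not> p dvd M" if "p \<in> PY" for p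
    proof
      assume "p dvd M"
      then have "int (nat p) dvd int (fact m)" using that prime_ge_0_int[of p] unfolding M_def PY_def by simp
      then have "nat p dvd fact m" by (simp only: int_dvd_int_iff)
      moreover have "prime (nat p)" using that prime_int_nat_transfer[of p] unfolding PY_def by blast
      ultimately have "nat p \<le> m" by (simp add: prime_dvd_fact_iff)
      moreover have "int m < p" using that unfolding PY_def by blast
      ultimately show False by linarith
    qed
    then have PY: "PY = {p::int. prime p \<and> int m < p \<and> p \<le> Y \<and> \<not> p dvd M}" unfolding PY_def by blast
    have "D \<subseteq> {1..\<lfloor>Y\<rfloor>}" unfolding D_def by (auto simp: le_floor_iff)
    then have fD: "finite D" by (rule finite_subset) simp
    have "PY \<subseteq> {0..\<lfloor>Y\<rfloor>}" unfolding PY_def using prime_ge_0_int by (auto simp: le_floor_iff)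
    then have fPY: "finite PY" by (rule finite_subset) simp
    have "real_of_int (M\<^sup>2) \<le> Y" using YR by (simp add: RM)
    from sum_inverse_class_ge[OF D_def M1 this] have "ln Y / (2 * R) \<le> S" unfolding S_def by (simp add: RM)
    then have SB: "1 / (120 * R) * ln B \<le> S" unfolding lnB by simp
    define T where "T = PiE {..<6::nat} (\<lambda>_. D)"
    define C where "C = {d \<in> T. \<forall>i<6. \<forall>j<i. coprime (d j) (d i)}"
    define w where "w d = (\<Prod>i<6. 1 / real_of_int (d i))" for d :: "nat \<Rightarrow> int"
    \<comment> \<open>The bracket of \<open>card_torsor_lower\<close>. The sum \<open>\<tau>\<close>
      below adds a penalty for coordinates sharing a prime, so that the average can be taken over
      all tuples.\<close>
    define \<beta> where "\<beta> d = 1 / 2 - (\<Sum>p\<in>PY. \<Sum>i<6. if p dvd d i then 6 / real_of_int p else 0)" for d :: "nat \<Rightarrow> int"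
    define \<tau> :: "(nat \<Rightarrow> int) \<Rightarrow> real" where "\<tau> d = (\<Sum>p\<in>PY. \<Sum>i<6. \<Sum>j<i. if p dvd d i \<and> p dvd d j then 1 else 0)" for d
    define k where "k = B / (216 * R ^ 3)"
    have k0: "0 \<le> k" unfolding k_def using B0 R1 by simp
    have fT: "finite T" unfolding T_def using fD by (intro finite_PiE) auto
    then have fC: "finite C" unfolding C_def by simp
    have Td: "1 \<le> d i" "d i \<le> Y" "M dvd d i - 1" if "d \<in> T" "i < 6" for d i
      using PiE_mem[of d "{..<6}" "\<lambda>_. D" i] that unfolding T_def D_def by simp_all
    have w0: "0 \<le> w d" if "d \<in> T" for d
    proof -
      have "0 \<le> 1 / real_of_int (d i)" if "i < 6" for i using Td(1)[OF \<open>d \<in> T\<close> that] by simp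
      then show ?thesis unfolding w_def by (intro prod_nonneg) auto
    qed
    have \<tau>0: "0 \<le> \<tau> d" for d unfolding \<tau>_def by (intro sum_nonneg) simp
    have \<beta>half: "\<beta> d \<le> 1 / 2" for d
    proof -
      have "0 \<le> (\<Sum>p\<in>PY. \<Sum>i<6. if p dvd d i then 6 / real_of_int p else 0)" unfolding PY_def by (intro sum_nonneg) auto
      then show ?thesis unfolding \<beta>_def by simp
    qed
    \<comment> \<open>A prime shared by two d is prime to M = m!, because the d are 1 modulo M;
      hence it exceeds m and is counted in \<open>\<tau>\<close>.\<close>
    have \<tau>1: "1 \<le> \<tau> d" if d: "d \<in> T - C" for d
    proof -
      obtain i j where ij: "i < 6" "j < i" "\<not> coprime (d j) (d i)" using d unfolding C_def by blast
      have dT: "d \<in> T" using d by simp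
      have di: "1 \<le> d i" "d i \<le> Y" using Td[OF dT ij(1)] by auto
      have "gcd (d j) (d i) \<noteq> 1" using ij(3) by (simp add: coprime_iff_gcd_eq_1)
      moreover have g0: "gcd (d j) (d i) \<noteq> 0" using di by simp
      ultimately have "\<not> is_unit (gcd (d j) (d i))" by (simp add: zdvd1_eq)
      then obtain p where p: "prime p" "p dvd gcd (d j) (d i)" using prime_divisorE g0 by blast
      have pd: "p dvd d i" "p dvd d j" using p(2) by (meson dvd_trans gcd_dvd1 gcd_dvd2)+
      have "\<not> p dvd M"
      proof
        assume "p dvd M"
        then have "p dvd d i - 1" using Td(3)[OF dT ij(1)] dvd_trans by blast
        then have "p dvd d i - (d i - 1)" using pd(1) by (rule dvd_diff[rotated])
        then show False using p(1) by (simp add: not_prime_unit)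
      qed
      then have "int m < p" using prime_gt_if_not_dvd_fact[OF p(1)] unfolding M_def by blast
      moreover have "p \<le> d i" using pd di by (intro zdvd_imp_le) auto
      then have "p \<le> Y" using di by linarith
      ultimately have pPY: "p \<in> PY" unfolding PY_def using p(1) by blast
      have "1 = (if p dvd d i \<and> p dvd d j then 1 else (0::real))" using pd by simp
      also have "\<dots> \<le> (\<Sum>j<i. if p dvd d i \<and> p dvd d j then 1 else 0)" using ij by (intro member_le_sum) auto
      also have "\<dots> \<le> (\<Sum>i<6. \<Sum>j<i. if p dvd d i \<and> p dvd d j then 1 else 0)"
        using ij by (intro member_le_sum[of i _ "\<lambda>i. \<Sum>j<i. if p dvd d i \<and> p dvd d j then 1 else 0"] sum_nonneg) auto
      also have "\<dots> \<le> \<tau> d" unfolding \<tau>_def using pPY fPY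
        by (intro member_le_sum[of p _ "\<lambda>p. \<Sum>i<6. \<Sum>j<i. if p dvd d i \<and> p dvd d j then 1 else 0"] sum_nonneg) auto
      finally show ?thesis .
    qed
    define \<Phi> where "\<Phi> d S \<longleftrightarrow> finite S \<and> (\<forall>(u1, u2, u3, u4)\<in>S. torsor u1 u2 u3 u4 (d 0) (d 1) (d 2) (d 3) (d 4) (d 5) \<and> 0 < u1 \<and>
      (\<forall>i. \<bar>real_of_int (torsor_point (u1, u2, u3, u4, d 0, d 1, d 2, d 3, d 4, d 5) $ i)\<bar> \<le> B)) \<and> k * w d * \<beta> d \<le> real (card S)" for d and S :: "(int \<times> int \<times> int \<times> int) set"
    have ex: "\<exists>S. \<Phi> d S" if d: "d \<in> C" for d
    proof -
      have dT: "d \<in> T" using d unfolding C_def by simp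
      have 1: "1 \<le> d i \<and> d i \<le> Y" "fact m dvd d i - 1" if "i < 6" for i using Td[OF dT that] unfolding M_def by blast+
      have 2: "coprime (d j) (d i)" if "i < 6" "j < i" for i j using d that unfolding C_def by blast
      have m48: "48 \<le> m" and YR': "(fact m)\<^sup>2 \<le> Y" using m YR unfolding R_def by simp_all
      show ?thesis unfolding \<Phi>_def k_def w_def \<beta>_def R_def
        by (rule card_torsor_lower[OF m48 YR' YB[symmetric] 1 2 PY_def])
    qed
    \<comment> \<open>One set of u for each admissible d. The union over d is disjoint because the
      torsor tuple contains d, and this makes the counts add up.\<close>
    define F where "F d = (SOME S. \<Phi> d S)" for d
    have F\<Phi>: "\<Phi> d (F d)" if "d \<in> C" for d unfolding F_def by (rule someI_ex[OF ex[OF that]])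
    have F: "finite (F d)" "k * w d * \<beta> d \<le> real (card (F d))" if "d \<in> C" for d
      using F\<Phi>[OF that] unfolding \<Phi>_def by simp_all
    have F3: "torsor u1 u2 u3 u4 (d 0) (d 1) (d 2) (d 3) (d 4) (d 5) \<and> 0 < u1 \<and>
      (\<forall>i. \<bar>real_of_int (torsor_point (u1, u2, u3, u4, d 0, d 1, d 2, d 3, d 4, d 5) $ i)\<bar> \<le> B)"
      if "d \<in> C" and u: "(u1, u2, u3, u4) \<in> F d" for d u1 u2 u3 u4
    proof -
      have "\<forall>(u1, u2, u3, u4)\<in>F d. torsor u1 u2 u3 u4 (d 0) (d 1) (d 2) (d 3) (d 4) (d 5) \<and> 0 < u1 \<and>
      (\<forall>i. \<bar>real_of_int (torsor_point (u1, u2, u3, u4, d 0, d 1, d 2, d 3, d 4, d 5) $ i)\<bar> \<le> B)"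
        using F\<Phi>[OF \<open>d \<in> C\<close>] unfolding \<Phi>_def by (elim conjE)
      from bspec[OF this u] show ?thesis unfolding prod.case .
    qed
    define t where "t = (\<lambda>(d :: nat \<Rightarrow> int, u1 :: int, u2 :: int, u3 :: int, u4 :: int). (u1, u2, u3, u4, d 0, d 1, d 2, d 3, d 4, d 5))"
    have inj: "inj_on t (Sigma C F)"
    proof (rule inj_onI)
      fix a b assume ab: "a \<in> Sigma C F" "b \<in> Sigma C F" "t a = t b"
      obtain d u1 u2 u3 u4 d' u1' u2' u3' u4' where e: "a = (d, u1, u2, u3, u4)" "b = (d', u1', u2', u3', u4')" by (metis prod_cases5)
      have u: "u1 = u1'" "u2 = u2'" "u3 = u3'" "u4 = u4'" and dd: "d 0 = d' 0" "d 1 = d' 1" "d 2 = d' 2" "d 3 = d' 3" "d 4 = d' 4" "d 5 = d' 5"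
        using ab(3) unfolding e t_def by simp_all
      have T: "d \<in> T" "d' \<in> T" using ab(1,2) unfolding e C_def by auto
      have "d = d'"
      proof (rule PiE_ext[OF T[unfolded T_def]])
        fix i :: nat assume "i \<in> {..<6}"
        then have "i = 0 \<or> i = 1 \<or> i = 2 \<or> i = 3 \<or> i = 4 \<or> i = 5" by auto
        then show "d i = d' i" using dd by blast
      qed
      then show "a = b" using u unfolding e by simp
    qed
    have "card (t ` Sigma C F) \<le> N B"
    proof (rule N_ge_card_torsor)
      fix u1 u2 u3 u4 d12 d13 d14 d23 d24 d34
      assume "(u1, u2, u3, u4, d12, d13, d14, d23, d24, d34) \<in> t ` Sigma C F"
      then obtain d where d: "d \<in> C" "(u1, u2, u3, u4) \<in> F d" "d12 = d 0" "d13 = d 1" "d14 = d 2" "d23 = d 3" "d24 = d 4" "d34 = d 5"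
        unfolding t_def by auto
      show "torsor u1 u2 u3 u4 d12 d13 d14 d23 d24 d34 \<and> 0 < u1 \<and>
          (\<forall>i. \<bar>real_of_int (torsor_point (u1, u2, u3, u4, d12, d13, d14, d23, d24, d34) $ i)\<bar> \<le> B)"
        unfolding d(3-8) by (rule F3[OF d(1,2)])
    qed
    then have "card (Sigma C F) \<le> N B" using card_image[OF inj] by simp
    moreover have "card (Sigma C F) = (\<Sum>d\<in>C. card (F d))" by (rule card_SigmaI) (use fC F(1) in auto)
    ultimately have "(\<Sum>d\<in>C. card (F d)) \<le> N B" by simp
    then have "real (\<Sum>d\<in>C. card (F d)) \<le> real (N B)" by (simp only: of_nat_le_iff)
    then have NF: "(\<Sum>d\<in>C. real (card (F d))) \<le> real (N B)" by (simp only: of_nat_sum)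
    \<comment> \<open>Tuples outside C have \<open>\<beta>\<close> - \<open>\<tau>\<close> \<le> 1/2
      - 1 < 0, so dropping them only increases the sum.\<close>
    have "(\<Sum>d\<in>T. k * (w d * (\<beta> d - \<tau> d))) \<le> (\<Sum>d\<in>C. k * (w d * (\<beta> d - \<tau> d)))"
    proof -
      have "(\<Sum>d\<in>T. k * (w d * (\<beta> d - \<tau> d))) = (\<Sum>d\<in>T - C. k * (w d * (\<beta> d - \<tau> d))) + (\<Sum>d\<in>C. k * (w d * (\<beta> d - \<tau> d)))"
        by (rule sum.subset_diff[OF _ fT]) (auto simp: C_def)
      moreover have "(\<Sum>d\<in>T - C. k * (w d * (\<beta> d - \<tau> d))) \<le> 0"
      proof (rule sum_nonpos)
        fix d assume d: "d \<in> T - C"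
        have "\<beta> d - \<tau> d \<le> 0" using \<beta>half[of d] \<tau>1[OF d] by linarith
        then show "k * (w d * (\<beta> d - \<tau> d)) \<le> 0" using k0 w0 d by (intro mult_nonneg_nonpos) auto
      qed
      ultimately show ?thesis by linarith
    qed
    also have "\<dots> \<le> (\<Sum>d\<in>C. real (card (F d)))"
    proof (rule sum_mono)
      fix d assume d: "d \<in> C"
      have "k * (w d * (\<beta> d - \<tau> d)) \<le> k * (w d * \<beta> d)"
        using k0 w0[of d] d \<tau>0[of d] by (intro mult_left_mono) (auto simp: C_def)
      then show "k * (w d * (\<beta> d - \<tau> d)) \<le> real (card (F d))" using F(2)[OF d] by (simp add: mult.assoc)
    qed
    finally have "(\<Sum>d\<in>T. k * (w d * (\<beta> d - \<tau> d))) \<le> real (N B)" using NF by linarith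
    moreover have "(\<Sum>d\<in>T. k * (w d * (\<beta> d - \<tau> d))) = k * (\<Sum>d\<in>T. w d * (\<beta> d - \<tau> d))" by (rule sum_distrib_left[symmetric])
    moreover have "S ^ 6 / 4 \<le> (\<Sum>d\<in>T. w d * (\<beta> d - \<tau> d))"
      using sum_tuples_ge[OF D_def M_def m S_def PY] unfolding T_def w_def \<beta>_def \<tau>_def sum.distrib diff_diff_eq .
    ultimately have N1: "k * (S ^ 6 / 4) \<le> real (N B)" using mult_left_mono[OF _ k0] by (smt (verit))
    have "1 \<le> B" unfolding YB[symmetric] using Y1 by simp
    then have "(1 / (120 * R) * ln B) ^ 6 \<le> S ^ 6" using SB R1 by (intro power_mono) auto
    then have "k * ((1 / (120 * R) * ln B) ^ 6 / 4) \<le> k * (S ^ 6 / 4)" using k0 by (intro mult_left_mono divide_right_mono) auto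
    also note N1
    finally have "k * ((1 / (120 * R) * ln B) ^ 6 / 4) \<le> real (N B)" .
    moreover have "k * ((1 / (120 * R) * ln B) ^ 6 / 4) = 1 / (216 * R ^ 3) * (1 / (120 * R)) ^ 6 / 4 * B * (ln B) ^ 6"
      unfolding k_def power_mult_distrib by (simp only: mult_ac times_divide_eq_left times_divide_eq_right mult_1)
    ultimately show ?thesis by (rule ord_eq_le_trans[OF sym, rotated])
  qed
  have "\<forall>\<^sub>F B in at_top. 1 / (216 * R ^ 3) * (1 / (120 * R)) ^ 6 / 4 * B * (ln B) ^ 6 \<le> real (N B)"
    using eventually_ge_at_top[of "(R\<^sup>2) ^ 60"] by eventually_elim (rule main)
  moreover have "0 < 1 / (216 * R ^ 3) * (1 / (120 * R)) ^ 6 / 4" using R1 by simp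
  ultimately show ?thesis by blast
qed

theorem theorem1:
  "\<exists>c1>0. \<exists>c2>0. \<forall>\<^sub>F B :: real in at_top.
     c1 * B * (ln B) ^ 6 \<le> real (N B) \<and> real (N B) \<le> c2 * B * (ln B) ^ 6"
proof -
  obtain c2 where c2: "0 < c2" "\<forall>B\<ge>3. real (N B) \<le> c2 * B * (ln B) ^ 6" using N_upper_bound by blast
  obtain c1 where c1: "0 < c1" "\<forall>\<^sub>F B in at_top. c1 * B * (ln B) ^ 6 \<le> real (N B)" using N_lower_bound by blast
  have "\<forall>\<^sub>F B in at_top. c1 * B * (ln B) ^ 6 \<le> real (N B) \<and> real (N B) \<le> c2 * B * (ln B) ^ 6"
    using c1(2) eventually_ge_at_top[of 3] by eventually_elim (use c2(2) in blast)
  then show ?thesis using c1(1) c2(1) by blast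
qed

end
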